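(* Let $1 < p \leq 3$. For any $f \in (W^{1,1}(\mathbb R) \cap W^{1,p}(\mathbb R)) \setminus \{0\}$, there exist $\varepsilon_f > 0$ and constants $c_f, C_f > 0$ (independent of $\varepsilon$) such that, if $0 < \varepsilon < \varepsilon_f$, $u_0 = \varepsilon f$ and $u_1 = -\varepsilon f$, then the corresponding mild solution $$u \in C([0,T_0); W^{1,1}(\mathbb R) \cap W^{1,p}(\mathbb R)) \cap C^1((0,T_0); L^1(\mathbb R) \cap L^p(\mathbb R))$$ of the Cauchy problem $$\partial_t^2 u + \partial_t u - \partial_x^2 u = |u|^p, \qquad u(0) = u_0, \qquad \partial_t u(0) = u_1 \qquad (x \in \mathbb R)$$ exists uniquely, and its maximal existence time $T_0$ satisfies $$T_{1,p}(c_f \varepsilon^p) \leq T_0 \leq T_{1,p}(C_f \varepsilon^p).$$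
   Context: All functions are real-valued. $W^{1,q}(\mathbb R) = \{ g \in L^q(\mathbb R) : g' \in L^q(\mathbb R)\}$ is the usual Sobolev space. The function $T_{1,p}$ is defined for $\delta > 0$ by $$T_{1,p}(\delta) = \begin{cases} \delta^{-\frac{2(p-1)}{3-p}} & \text{if } 1 < p < 3, \\ \exp(\delta^{-2}) & \text{if } p = 3. \end{cases}$$ Linear propagator: for $t \geq 0$, $$S(t) g(x) = \frac12 \int_{-t}^{t} e^{-t/2} I_0\Big(\frac{\sqrt{t^2-y^2}}{2}\Big) g(x-y)\, dy,$$ where, for integers $\ell \ge 0$, $I_\ell(z) = \sum_{k=0}^\infty \frac{1}{k!(k+\ell)!} \left(\frac z2\right)^{2k+\ell}$ is the modified Bessel function of the first kind of order $\ell$. Its time derivative is $$\partial_t S(t) g(x) = e^{-t/2}\,\frac{g(x+t)+g(x-t)}{2} + \int_{-t}^{t} \frac{e^{-t/2}}{4}\Big( \frac{t}{\omega} I_1\big(\tfrac{\omega}{2}\big) - I_0\big(\tfrac{\omega}{2}\big)\Big) g(x-y)\, dy, \qquad \omega = \sqrt{t^2-y^2}.$$ Mild solution: a mild solution on $[0,T)$ is a function $u \in C([0,T); L^1(\mathbb R) \cap L^p(\mathbb R))$ satisfying, for $t \in [0,T)$, $$u(t,x) = S(t)(u_0+u_1)(x) + \partial_t S(t) u_0(x) + \int_0^t S(t-\tau) |u(\tau)|^p(x)\, d\tau.$$ The maximal existence time (lifespan) $T_0$ is the supremum of all $T > 0$ such that a mild solution exists on $[0,T)$ in the class $C([0,T);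 W^{1,1} \cap W^{1,p}) \cap C^1((0,T); L^1 \cap L^p)$. *)

theory Defs
  imports "HOL-Analysis.Analysis"
begin

text \<open>
  Elements of function spaces over the real line are Borel representatives
  \<open>real \<Rightarrow> real\<close> of Lebesgue classes. Every notion below depends on a function only through
  its class, and functions are identified when they agree almost everywhere. Curves in a function
  space are written \<open>u t x\<close>, with time first.
\<close>

definition Lq :: "real \<Rightarrow> (real \<Rightarrow> real) set" where
  "Lq q = {g. g \<in> borel_measurable lborel \<and> integrable lborel (\<lambda>x. \<bar>g x\<bar> powr q)}"

definition Lq_norm :: "real \<Rightarrow> (real \<Rightarrow> real) \<Rightarrow> real" where
  "Lq_norm q g = (LINT x|lborel. \<bar>g x\<bar> powr q) powr (1 / q)"

definition test_function :: "(real \<Rightarrow> real) \<Rightarrow> bool" where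
  "test_function \<phi> \<longleftrightarrow>
     (\<forall>n. ((deriv ^^ n) \<phi>) differentiable_on UNIV) \<and> compact (closure {x. \<phi> x \<noteq> 0})"

definition locally_integrable :: "(real \<Rightarrow> real) \<Rightarrow> bool" where
  "locally_integrable g \<longleftrightarrow> (\<forall>a b. set_integrable lborel {a..b} g)"

definition has_weak_deriv :: "(real \<Rightarrow> real) \<Rightarrow> (real \<Rightarrow> real) \<Rightarrow> bool" where
  "has_weak_deriv g h \<longleftrightarrow> locally_integrable g \<and> locally_integrable h \<and>
     (\<forall>\<phi>. test_function \<phi> \<longrightarrow>
        (LINT x|lborel. g x * deriv \<phi> x) = - (LINT x|lborel. h x * \<phi> x))"

text \<open>The weak derivative is unique almost everywhere, so the choice does not affect norms.\<close>

definition weak_deriv :: "(real \<Rightarrow> real) \<Rightarrow> real \<Rightarrow> real" where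
  "weak_deriv g = (SOME h. has_weak_deriv g h)"

definition W1 :: "real \<Rightarrow> (real \<Rightarrow> real) set" where
  "W1 q = {g \<in> Lq q. \<exists>h \<in> Lq q. has_weak_deriv g h}"

definition W1_norm :: "real \<Rightarrow> (real \<Rightarrow> real) \<Rightarrow> real" where
  "W1_norm q g = Lq_norm q g + Lq_norm q (weak_deriv g)"

definition L1_Lp_norm :: "real \<Rightarrow> (real \<Rightarrow> real) \<Rightarrow> real" where
  "L1_Lp_norm p g = Lq_norm 1 g + Lq_norm p g"

definition W11_W1p_norm :: "real \<Rightarrow> (real \<Rightarrow> real) \<Rightarrow> real" where
  "W11_W1p_norm p g = W1_norm 1 g + W1_norm p g"

text \<open>
  \<open>C0_curve J X N u\<close> and \<open>C1_curve J X N u\<close> say that \<open>u\<close> belongs to \<open>C(J; X)\<close> and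
  \<open>C\<^sup>1(J; X)\<close>, where the space \<open>X\<close> carries the norm \<open>N\<close>.
\<close>

definition C0_curve ::
  "real set \<Rightarrow> (real \<Rightarrow> real) set \<Rightarrow> ((real \<Rightarrow> real) \<Rightarrow> real) \<Rightarrow> (real \<Rightarrow> real \<Rightarrow> real) \<Rightarrow> bool" where
  "C0_curve J X N u \<longleftrightarrow> (\<forall>t\<in>J. u t \<in> X) \<and>
     (\<forall>t\<in>J. ((\<lambda>s. N (\<lambda>x. u s x - u t x)) \<longlongrightarrow> 0) (at t within J))"

definition C1_curve ::
  "real set \<Rightarrow> (real \<Rightarrow> real) set \<Rightarrow> ((real \<Rightarrow> real) \<Rightarrow> real) \<Rightarrow> (real \<Rightarrow> real \<Rightarrow> real) \<Rightarrow> bool" where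
  "C1_curve J X N u \<longleftrightarrow> (\<forall>t\<in>J. u t \<in> X) \<and>
     (\<exists>v. C0_curve J X N v \<and>
        (\<forall>t\<in>J. ((\<lambda>s. N (\<lambda>x. (u s x - u t x) / (s - t) - v t x)) \<longlongrightarrow> 0) (at t within J)))"

definition bessel_I :: "nat \<Rightarrow> real \<Rightarrow> real" where
  "bessel_I l z = (\<Sum>k. 1 / (fact k * fact (k + l)) * (z / 2) ^ (2 * k + l))"

definition propagator :: "real \<Rightarrow> (real \<Rightarrow> real) \<Rightarrow> real \<Rightarrow> real" where
  "propagator t g x =
     1 / 2 * (LINT y:{-t..t}|lborel. exp (- t / 2) * bessel_I 0 (sqrt (t\<^sup>2 - y\<^sup>2) / 2) * g (x - y))"

text \<open>The explicit time derivative of \<^const>\<open>propagator\<close>; it makes sense for almost every \<open>x\<close>.\<close>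

definition dt_propagator :: "real \<Rightarrow> (real \<Rightarrow> real) \<Rightarrow> real \<Rightarrow> real" where
  "dt_propagator t g x =
     exp (- t / 2) * ((g (x + t) + g (x - t)) / 2) +
     (LINT y:{-t..t}|lborel.
        (let \<omega> = sqrt (t\<^sup>2 - y\<^sup>2)
         in exp (- t / 2) / 4 * (t / \<omega> * bessel_I 1 (\<omega> / 2) - bessel_I 0 (\<omega> / 2)) * g (x - y)))"

text \<open>
  The end point \<open>T\<close> of a time interval may be infinite. For \<open>u\<close> in
  \<open>C([0,T); L\<^sup>1 \<inter> L\<^sup>p)\<close>, the integrand of the Duhamel term is a continuous function of
  \<open>\<tau>\<close> for every \<open>x\<close>, so the integral over \<open>\<tau>\<close> can be taken pointwise.
\<close>

definition mild_solution ::
  "real \<Rightarrow> (real \<Rightarrow> real) \<Rightarrow> (real \<Rightarrow> real) \<Rightarrow> ereal \<Rightarrow> (real \<Rightarrow> real \<Rightarrow> real) \<Rightarrow> bool" where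
  "mild_solution p u0 u1 T u \<longleftrightarrow>
     C0_curve {t. 0 \<le> t \<and> ereal t < T} (Lq 1 \<inter> Lq p) (L1_Lp_norm p) u \<and>
     (\<forall>t. 0 \<le> t \<and> ereal t < T \<longrightarrow>
        (AE x in lborel.
           u t x = propagator t (\<lambda>y. u0 y + u1 y) x + dt_propagator t u0 x
             + (LINT \<tau>:{0..t}|lborel. propagator (t - \<tau>) (\<lambda>y. \<bar>u \<tau> y\<bar> powr p) x)))"

definition regular_mild_solution ::
  "real \<Rightarrow> (real \<Rightarrow> real) \<Rightarrow> (real \<Rightarrow> real) \<Rightarrow> ereal \<Rightarrow> (real \<Rightarrow> real \<Rightarrow> real) \<Rightarrow> bool" where
  "regular_mild_solution p u0 u1 T u \<longleftrightarrow>
     mild_solution p u0 u1 T u \<and>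
     C0_curve {t. 0 \<le> t \<and> ereal t < T} (W1 1 \<inter> W1 p) (W11_W1p_norm p) u \<and>
     C1_curve {t. 0 < t \<and> ereal t < T} (Lq 1 \<inter> Lq p) (L1_Lp_norm p) u"

definition lifespan :: "real \<Rightarrow> (real \<Rightarrow> real) \<Rightarrow> (real \<Rightarrow> real) \<Rightarrow> ereal" where
  "lifespan p u0 u1 = Sup {T. 0 < T \<and> (\<exists>u. regular_mild_solution p u0 u1 T u)}"

text \<open>The function \<open>T\<^sub>1\<^sub>,\<^sub>p\<close>, meaningful for \<open>1 < p \<le> 3\<close> and \<open>\<delta> > 0\<close>.\<close>

definition T1 :: "real \<Rightarrow> real \<Rightarrow> real" where
  "T1 p \<delta> = (if p < 3 then \<delta> powr (- (2 * (p - 1) / (3 - p))) else exp (\<delta> powr (- 2)))"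

end

theory Submission
  imports Defs
begin

text \<open>
  Since \<open>u0 + u1 = 0\<close>, the linear part is \<open>\<partial>\<^sub>t S(t) u0\<close>, whose kernel has total mass \<open>O(1 / (1 + t))\<close>; the
  kernel of \<open>S(t)\<close> has mass at most \<open>1\<close>, supremum at most \<open>(1 + t)\<^sup>-\<^sup>1\<^sup>/\<^sup>2\<close> and second moment at most \<open>2 t\<close>.
  A function in \<open>W\<^sup>1\<^sup>,\<^sup>1\<close> has a continuous representative, so regular mild solutions are the same as bounded
  continuous solutions of the integral equation, which are unique by finite speed of propagation.

  Lower bound: on a time interval where \<open>\<epsilon>\<^sup>p\<^sup>(\<^sup>p\<^sup>-\<^sup>1\<^sup>) \<integral> (1 + \<tau>)\<^sup>-\<^sup>(\<^sup>p\<^sup>-\<^sup>1\<^sup>)\<^sup>/\<^sup>2 d\<tau>\<close> is small, the Picard iterates stay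
  within distance \<open>O(\<epsilon>\<^sup>p)\<close> of the linear part, in \<open>L\<^sup>1\<close> and, with decay \<open>(1 + t)\<^sup>-\<^sup>1\<^sup>/\<^sup>2\<close>, in the supremum norm.

  Upper bound: integrate the equation over the box \<open>\<bar>x\<bar> \<le> 4 \<surd>r\<close>, from which little of the mass of the
  kernel escapes before time \<open>r\<close>. With \<open>\<phi>(t)\<close> the integral of \<open>\<bar>u(t)\<bar>\<^sup>p\<close> over the box, Jensen's inequality
  gives \<open>(1/r) \<integral> (t - \<tau>) \<phi>(\<tau>) d\<tau> \<le> C (\<surd>r)\<^sup>(\<^sup>p\<^sup>-\<^sup>1\<^sup>)\<^sup>/\<^sup>p \<phi>(t)\<^sup>1\<^sup>/\<^sup>p + O(\<epsilon> / (1 + t))\<close>. Testing with \<open>((1 - t/r)\<^sup>m)''\<close>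
  and using Young's inequality caps \<open>\<integral> (1 - t/r)\<^sup>m \<phi>\<close> by \<open>C r\<^sup>-\<^sup>(\<^sup>3\<^sup>-\<^sup>p\<^sup>)\<^sup>/\<^sup>(\<^sup>2\<^sup>(\<^sup>p\<^sup>-\<^sup>1\<^sup>)\<^sup>)\<close> up to a small error,
  whereas this integral is at least \<open>c \<epsilon>\<^sup>p\<close> because the solution is close to the linear part on \<open>[0, 1]\<close>.
  For \<open>p = 3\<close> the cap does not decay; there the integral \<open>P(r)\<close> of \<open>\<phi>\<close> satisfies \<open>P(2 r) \<ge> P(r) + c P(r)\<^sup>3\<close>
  and reaches the cap after \<open>O(\<epsilon>\<^sup>-\<^sup>6)\<close> doublings.
\<close>

text \<open>Because u0 + u1 = 0, no mass of order \<epsilon> survives. The lasting mass is what the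
  source deposits during the first unit of time, of order \<epsilon>^p, and from then on the
  solution behaves like that of a heat equation with source |u|^p and initial mass \<epsilon>^p. The
  heat scaling (1 + t)^(-1/2) makes p = 3 critical, and the shift from \<epsilon> to \<epsilon>^p is
  why \<open>T1\<close> is evaluated at a multiple of \<epsilon>^p.

  Two obstacles shape the proof. Neither f nor u has a sign. Only the Duhamel term is nonnegative,
  so it alone is bounded below on the box, and the linear part is carried along as an error.
  Moreover the damped wave equation does not smooth: the travelling part \<open>wave\<close> is only
  as regular as f, and its time derivative exists only in norm. It is therefore split off, and the
  remainder is classically differentiable. The Bessel kernels are written as entire functions of t^2
  - y^2, which removes the square root at the light cone.\<close>

section \<open>Differentiation of integrals over moving intervals\<close>

lemma continuous_on_slice:
  assumes "continuous_on (A \<times> B) (\<lambda>(t, y). \<phi> t y)" "t \<in> A"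
  shows "continuous_on B (\<phi> t)"
proof -
  have "continuous_on B (\<lambda>y. (\<lambda>(t, y). \<phi> t y) (t, y))"
    by (rule continuous_on_compose2[OF assms(1)]) (use assms(2) in \<open>auto intro!: continuous_on_Pair\<close>)
  then show ?thesis by simp
qed

text \<open>This is the chain rule for \<open>H t a\<close>, the integral of \<open>\<phi> t\<close>
  up to \<open>a\<close>, along the curve \<open>(t, b t)\<close>. \<open>H\<close> is totally
  differentiable at the point because its partial derivative in \<open>a\<close> is the integrand,
  which is jointly continuous. The bound \<open>d\<close> leaves room for \<open>a\<close> to vary
  on both sides of \<open>b t0\<close>.\<close>

lemma leibniz_moving:
  fixes \<phi> \<phi>' :: "real \<Rightarrow> real \<Rightarrow> real"
  assumes U: "open U" "convex U" "t0 \<in> U"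
    and c0: "continuous_on (U \<times> {c..d}) (\<lambda>(t, y). \<phi> t y)"
    and c1: "continuous_on (U \<times> {c..d}) (\<lambda>(t, y). \<phi>' t y)"
    and d: "\<And>t y. t \<in> U \<Longrightarrow> y \<in> {c..d} \<Longrightarrow> ((\<lambda>t. \<phi> t y) has_real_derivative \<phi>' t y) (at t)"
    and b: "(b has_real_derivative b') (at t0)" "c < b t0" "b t0 < d"
  shows "((\<lambda>t. integral {c..b t} (\<phi> t)) has_real_derivative
           \<phi> t0 (b t0) * b' + integral {c..b t0} (\<phi>' t0)) (at t0)"
proof -
  let ?Y = "{c<..<d}"
  define H where "H = (\<lambda>t a. integral {c..a} (\<phi> t))"
  note c0' = continuous_on_slice[OF c0]
  have fx: "((\<lambda>t. H t (b t0)) has_derivative (*) (integral {c..b t0} (\<phi>' t0))) (at t0 within U)"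
    unfolding H_def has_field_derivative_def[symmetric] interval_cbox
  proof (rule leibniz_rule_field_derivative)
    fix t y assume "t \<in> U" "y \<in> cbox c (b t0)"
    then show "((\<lambda>t. \<phi> t y) has_real_derivative \<phi>' t y) (at t within U)"
      using d[of t y] b by (auto intro: has_field_derivative_at_within)
  next
    fix t assume "t \<in> U"
    then show "\<phi> t integrable_on cbox c (b t0)"
      using b by (intro integrable_continuous continuous_on_subset[OF c0']) auto
  next
    show "continuous_on (U \<times> cbox c (b t0)) (\<lambda>(t, y). \<phi>' t y)"
      using b by (intro continuous_on_subset[OF c1]) auto
  qed (use U in auto)
  have fy: "((\<lambda>a. H t a) has_derivative blinfun_apply (blinfun_mult_right (\<phi> t a))) (at a within ?Y)"
    if "t \<in> U" "a \<in> ?Y" for t a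
  proof -
    have "((\<lambda>a. integral {c..a} (\<phi> t)) has_real_derivative \<phi> t a) (at a within {c..d})"
      using that by (intro integral_has_real_derivative c0') auto
    then have "((\<lambda>a. integral {c..a} (\<phi> t)) has_real_derivative \<phi> t a) (at a within ?Y)"
      by (rule has_field_derivative_subset) auto
    then show ?thesis
      unfolding has_field_derivative_def H_def by (simp add: blinfun_mult_right.rep_eq)
  qed
  have cont: "continuous (at (t0, b t0) within U \<times> ?Y) (\<lambda>(t, a). blinfun_mult_right (\<phi> t a))"
  proof -
    have "continuous_on (U \<times> ?Y) (\<lambda>q. blinfun_mult_right ((\<lambda>(t, y). \<phi> t y) q))"
      by (intro bounded_linear.continuous_on[OF bounded_linear_blinfun_mult_right]
          continuous_on_subset[OF c0]) auto
    moreover have "(t0, b t0) \<in> U \<times> ?Y" using U b by auto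
    ultimately show ?thesis
      unfolding continuous_on_eq_continuous_within split_beta by blast
  qed
  have "((\<lambda>(t, a). H t a) has_derivative
      (\<lambda>(tx, ty). (*) (integral {c..b t0} (\<phi>' t0)) tx + blinfun_apply (blinfun_mult_right (\<phi> t0 (b t0))) ty))
      (at (t0, b t0) within U \<times> ?Y)"
    by (rule has_derivative_partialsI[OF fx fy cont]) (use b in auto)
  then have *: "((\<lambda>(t, a). H t a) has_derivative
      (\<lambda>(tx, ty). integral {c..b t0} (\<phi>' t0) * tx + \<phi> t0 (b t0) * ty)) (at (t0, b t0))"
    using U b by (subst (asm) at_within_open) (auto intro!: open_Times simp: blinfun_mult_right.rep_eq)
  have "((\<lambda>t. (t, b t)) has_derivative (\<lambda>h. (h, b' * h))) (at t0)"
    using b(1) unfolding has_field_derivative_def by (intro has_derivative_Pair) auto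
  from has_derivative_compose[OF this *] have "((\<lambda>t. H t (b t)) has_derivative
      (\<lambda>h. integral {c..b t0} (\<phi>' t0) * h + \<phi> t0 (b t0) * (b' * h))) (at t0)"
    by simp
  then show ?thesis
    unfolding has_field_derivative_def H_def
    by (rule has_derivative_eq_rhs) (auto simp: algebra_simps)
qed

text \<open>The integral over {-s..s}, rescaled to a fixed interval. In this form continuity in
  parameters is that of an integral over a compact set, and negative \<open>s\<close> give the odd
  extension, so differentiation in \<open>s\<close> has no special case at 0.\<close>

definition sym_integral :: "real \<Rightarrow> (real \<Rightarrow> real) \<Rightarrow> real" where
  "sym_integral s \<phi> = s * integral {-1..1} (\<lambda>z. \<phi> (s * z))"

lemma sym_integral_nonneg_eq:
  assumes "0 \<le> s" "continuous_on {-s..s} \<phi>"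
  shows "sym_integral s \<phi> = integral {-s..s} \<phi>"
proof (cases "s = 0")
  case False
  then have s: "0 < s" using assms by simp
  have "(\<phi> has_integral integral {-s..s} \<phi>) (cbox (-s) s)"
    using assms by (auto intro!: integrable_integral integrable_continuous_interval)
  from has_integral_affinity[OF this, of s 0] s
  have "((\<lambda>z. \<phi> (s * z)) has_integral (1 / s) * integral {-s..s} \<phi>) ((\<lambda>x. x / s) ` {-s..s})"
    by simp
  moreover have "(\<lambda>x. x / s) ` {-s..s} = {-1..1}"
    using s by (subst image_divide_atLeastAtMost) auto
  ultimately have "((\<lambda>z. \<phi> (s * z)) has_integral (1 / s) * integral {-s..s} \<phi>) {-1..1}" by simp
  then show ?thesis
    unfolding sym_integral_def using s by (simp add: integral_unique)
qed (simp add: sym_integral_def)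

text \<open>A base point -R below both end points turns the symmetric integral into two integrals
  with one moving end point each, for either sign of \<open>s\<close>. This is the form to which
  \<open>leibniz_moving\<close> applies.\<close>

lemma sym_integral_eq_diff:
  assumes "\<bar>s\<bar> < R" "continuous_on {-R..R} \<phi>"
  shows "sym_integral s \<phi> = integral {-R..s} \<phi> - integral {-R..-s} \<phi>"
proof (cases "0 \<le> s")
  case True
  have "\<phi> integrable_on {-R..s}"
    using assms True by (intro integrable_continuous_interval continuous_on_subset[OF assms(2)]) auto
  then have "integral {-R..-s} \<phi> + integral {-s..s} \<phi> = integral {-R..s} \<phi>"
    using assms True by (intro Henstock_Kurzweil_Integration.integral_combine) auto
  moreover have "sym_integral s \<phi> = integral {-s..s} \<phi>"
    using assms True by (intro sym_integral_nonneg_eq continuous_on_subset[OF assms(2)]) auto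
  ultimately show ?thesis by simp
next
  case False
  have "integral {-1..1} (\<lambda>z. \<phi> (s * z)) = integral {-1..1} (\<lambda>z. \<phi> (-s * z))"
    using Henstock_Kurzweil_Integration.integral_reflect_real[where a = "-1" and b = 1 and f = "\<lambda>z. \<phi> (s * z)"] by simp
  then have "sym_integral s \<phi> = - sym_integral (-s) \<phi>"
    unfolding sym_integral_def by simp
  moreover have "sym_integral (-s) \<phi> = integral {-(-s)..-s} \<phi>"
    using assms False by (intro sym_integral_nonneg_eq continuous_on_subset[OF assms(2)]) auto
  moreover have "\<phi> integrable_on {-R..-s}"
    using assms False by (intro integrable_continuous_interval continuous_on_subset[OF assms(2)]) auto
  then have "integral {-R..s} \<phi> + integral {s..-s} \<phi> = integral {-R..-s} \<phi>"
    using assms False by (intro Henstock_Kurzweil_Integration.integral_combine) auto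
  ultimately show ?thesis by simp
qed

lemma sym_integral_has_derivative:
  fixes \<phi> \<phi>' :: "real \<Rightarrow> real \<Rightarrow> real"
  assumes c0: "continuous_on UNIV (\<lambda>(t, y). \<phi> t y)"
    and c1: "continuous_on UNIV (\<lambda>(t, y). \<phi>' t y)"
    and d: "\<And>t y. ((\<lambda>t. \<phi> t y) has_real_derivative \<phi>' t y) (at t)"
  shows "((\<lambda>s. sym_integral s (\<phi> s)) has_real_derivative
           \<phi> s s + \<phi> s (-s) + sym_integral s (\<phi>' s)) (at s)"
proof -
  define R where "R = \<bar>s\<bar> + 1"
  have cont: "continuous_on A (\<phi> t)" "continuous_on A (\<phi>' t)" for t A
    using continuous_on_slice[of UNIV A \<phi> t] continuous_on_slice[of UNIV A \<phi>' t]
      continuous_on_subset[OF c0] continuous_on_subset[OF c1] by auto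
  have "((\<lambda>t. integral {-R..t} (\<phi> t) - integral {-R..-t} (\<phi> t)) has_real_derivative
      (\<phi> s s * 1 + integral {-R..s} (\<phi>' s)) - (\<phi> s (-s) * (-1) + integral {-R..-s} (\<phi>' s))) (at s)"
    by (intro DERIV_diff leibniz_moving[where U = UNIV and d = R and b = "\<lambda>t. t"]
        leibniz_moving[where U = UNIV and d = R and b = "\<lambda>t. - t"] continuous_on_subset[OF c0]
        continuous_on_subset[OF c1] d) (auto simp: R_def intro!: derivative_eq_intros)
  then have "((\<lambda>t. integral {-R..t} (\<phi> t) - integral {-R..-t} (\<phi> t)) has_real_derivative
      \<phi> s s + \<phi> s (-s) + sym_integral s (\<phi>' s)) (at s)"
    by (simp add: sym_integral_eq_diff[of s R] cont R_def algebra_simps)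
  moreover have "eventually (\<lambda>t. integral {-R..t} (\<phi> t) - integral {-R..-t} (\<phi> t) = sym_integral t (\<phi> t)) (nhds s)"
  proof -
    have "eventually (\<lambda>t. t \<in> {-R<..<R}) (nhds s)"
      by (rule eventually_nhds_in_open) (auto simp: R_def)
    then show ?thesis
      by eventually_elim (subst sym_integral_eq_diff[of _ R], auto simp: cont)
  qed
  ultimately show ?thesis
    by (subst (asm) DERIV_cong_ev[OF refl _ refl]) auto
qed

lemma sym_integral_ftc:
  assumes "\<And>y. (\<Phi> has_real_derivative \<phi> y) (at y)" "continuous_on UNIV \<phi>"
  shows "sym_integral t \<phi> = \<Phi> t - \<Phi> (-t)"
proof -
  define R where "R = \<bar>t\<bar> + 1"
  have "integral {-R..b} \<phi> = \<Phi> b - \<Phi> (-R)" if "-R \<le> b" for b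
    by (rule integral_unique, rule fundamental_theorem_of_calculus[OF that])
      (auto simp: has_real_derivative_iff_has_vector_derivative[symmetric]
        intro: has_field_derivative_at_within assms(1))
  from this[of t] this[of "-t"] show ?thesis
    by (subst sym_integral_eq_diff[of _ R])
      (auto simp: R_def intro: continuous_on_subset[OF assms(2)])
qed

lemma sym_integral_cmult [simp]:
  "sym_integral s (\<lambda>y. c * \<phi> y) = c * sym_integral s \<phi>"
  "sym_integral s (\<lambda>y. \<phi> y * c) = sym_integral s \<phi> * c"
  "sym_integral s (\<lambda>y. \<phi> y / c) = sym_integral s \<phi> / c"
  by (simp_all add: sym_integral_def)

lemma sym_integral_integrable:
  fixes s :: real and \<phi> :: "real \<Rightarrow> real"
  assumes "continuous_on {-\<bar>s\<bar>..\<bar>s\<bar>} \<phi>"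
  shows "(\<lambda>z. \<phi> (s * z)) integrable_on {-1..1}"
proof -
  have "\<bar>s * z\<bar> \<le> \<bar>s\<bar>" if "z \<in> {-1..1}" for z
  proof -
    have "\<bar>z\<bar> \<le> 1" using that by auto
    then show ?thesis by (simp add: abs_mult mult_left_le)
  qed
  then have "s * z \<in> {-\<bar>s\<bar>..\<bar>s\<bar>}" if "z \<in> {-1..1}" for z
    using that unfolding atLeastAtMost_iff by (meson abs_le_D1 abs_le_D2 minus_le_iff order_trans)
  then have "(\<lambda>z. s * z) ` {-1..1} \<subseteq> {-\<bar>s\<bar>..\<bar>s\<bar>}" by blast
  then have "continuous_on {-1..1} (\<lambda>z. \<phi> (s * z))"
    by (intro continuous_on_compose2[OF assms, where f = "\<lambda>z. s * z"]) (auto intro!: continuous_intros)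
  then show ?thesis by (rule integrable_continuous_real)
qed

lemma sym_integral_add:
  assumes "continuous_on {-\<bar>s\<bar>..\<bar>s\<bar>} \<phi>" "continuous_on {-\<bar>s\<bar>..\<bar>s\<bar>} \<psi>"
  shows "sym_integral s (\<lambda>y. \<phi> y + \<psi> y) = sym_integral s \<phi> + sym_integral s \<psi>"
    "sym_integral s (\<lambda>y. \<phi> y - \<psi> y) = sym_integral s \<phi> - sym_integral s \<psi>"
  using Henstock_Kurzweil_Integration.integral_add[OF assms[THEN sym_integral_integrable]]
    Henstock_Kurzweil_Integration.integral_diff[OF assms[THEN sym_integral_integrable]]
  by (simp_all add: sym_integral_def distrib_left right_diff_distrib)

lemma sym_integral_mono:
  assumes "0 \<le> s" "continuous_on {-s..s} \<phi>" "continuous_on {-s..s} \<psi>"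
    and "\<And>y. \<bar>y\<bar> \<le> s \<Longrightarrow> \<phi> y \<le> \<psi> y"
  shows "sym_integral s \<phi> \<le> sym_integral s \<psi>"
  unfolding sym_integral_def
proof (rule mult_left_mono[OF Henstock_Kurzweil_Integration.integral_le])
  fix z :: real assume "z \<in> {-1..1}"
  then have "\<bar>z\<bar> \<le> 1" by auto
  then have "\<bar>s * z\<bar> \<le> s" using assms(1) by (simp add: abs_mult mult_left_le)
  then show "\<phi> (s * z) \<le> \<psi> (s * z)" by (rule assms(4))
qed (use assms in \<open>auto intro!: sym_integral_integrable\<close>)

lemma sym_integral_abs_le:
  assumes "0 \<le> s" "continuous_on {-s..s} \<phi>"
  shows "\<bar>sym_integral s \<phi>\<bar> \<le> sym_integral s (\<lambda>y. \<bar>\<phi> y\<bar>)"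
proof -
  have "sym_integral s \<phi> \<le> sym_integral s (\<lambda>y. \<bar>\<phi> y\<bar>)"
    "sym_integral s (\<lambda>y. (- 1) * \<phi> y) \<le> sym_integral s (\<lambda>y. \<bar>\<phi> y\<bar>)"
    by (intro sym_integral_mono assms continuous_intros; simp)+
  then show ?thesis unfolding sym_integral_cmult by (simp add: abs_le_iff)
qed

lemma continuous_on_sym_integral:
  fixes \<phi> :: "'a::topological_space \<Rightarrow> real \<Rightarrow> real"
  assumes "continuous_on (A \<times> {-1..1}) (\<lambda>(q, z). \<phi> q (\<sigma> q * z))" "continuous_on A \<sigma>"
  shows "continuous_on A (\<lambda>q. sym_integral (\<sigma> q) (\<phi> q))"
  unfolding sym_integral_def
  using integral_continuous_on_param[of A "-1" 1 "\<lambda>q z. \<phi> q (\<sigma> q * z)"] assms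
  by (auto intro!: continuous_intros)

section \<open>The kernels\<close>

text \<open>For s \<ge> 0, \<open>J0 s\<close> is I_0(sqrt s / 2) and \<open>J1 s\<close> is
  I_1(sqrt s / 2) / sqrt s; see \<open>bessel_I_0\<close> and \<open>bessel_I_1\<close>. As power
  series in s = t^2 - y^2 both are entire. The factor 4 makes \<open>J1 / 4\<close> the derivative
  of \<open>J0\<close>, and \<open>J2\<close> is the derivative of \<open>J1\<close>.\<close>

definition bcoef :: "nat \<Rightarrow> real" where "bcoef n = 1 / (16 ^ n * (fact n)\<^sup>2)"
definition J0 :: "real \<Rightarrow> real" where "J0 s = (\<Sum>n. bcoef n * s ^ n)"
definition J1 :: "real \<Rightarrow> real" where "J1 s = (\<Sum>n. 4 * diffs bcoef n * s ^ n)"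
definition J2 :: "real \<Rightarrow> real" where "J2 s = (\<Sum>n. diffs (\<lambda>n. 4 * diffs bcoef n) n * s ^ n)"

lemma bcoef_Suc: "4 * diffs bcoef n = bcoef n / (4 * (1 + of_nat n))"
proof -
  have "4 * (S * (1 / (16 * a * (S * f)\<^sup>2))) = 1 / (a * f\<^sup>2) / (4 * S)"
    if "S \<noteq> 0" "f \<noteq> 0" "a \<noteq> 0" for S f a :: real
    using that by (simp add: field_simps power2_eq_square)
  from this[of "of_nat (Suc n)" "fact n" "16 ^ n"] show ?thesis
    unfolding bcoef_def diffs_def fact_Suc power_Suc by simp
qed

lemma bcoef_nonneg: "0 \<le> bcoef n" "0 \<le> diffs bcoef n"
  by (auto simp: bcoef_def diffs_def)

lemma bcoef_summable: "summable (\<lambda>n. bcoef n * s ^ n)"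
proof (rule summable_comparison_test')
  show "summable (\<lambda>n. inverse (fact n) * \<bar>s\<bar> ^ n)" by (rule summable_exp)
  fix n :: nat
  have "(1::real) * fact n \<le> 16 ^ n * (fact n)\<^sup>2"
    unfolding power2_eq_square mult.assoc[symmetric]
    by (intro mult_right_mono) (auto intro!: mult_ge1_I)
  then have "bcoef n \<le> inverse (fact n)"
    unfolding bcoef_def by (simp add: field_simps)
  moreover have "norm (bcoef n * s ^ n) = bcoef n * \<bar>s\<bar> ^ n"
    using bcoef_nonneg[of n] by (simp add: abs_mult power_abs)
  ultimately show "norm (bcoef n * s ^ n) \<le> inverse (fact n) * \<bar>s\<bar> ^ n"
    by (simp add: mult_right_mono)
qed

lemma J1_summable: "summable (\<lambda>n. 4 * diffs bcoef n * s ^ n)"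
  using summable_mult[OF termdiff_converges_all[OF bcoef_summable, of s], of 4]
  by (simp add: mult.assoc)

lemma J2_summable: "summable (\<lambda>n. diffs (\<lambda>n. 4 * diffs bcoef n) n * s ^ n)"
  by (rule termdiff_converges_all[OF J1_summable])

lemma DERIV_J0: "(J0 has_real_derivative J1 s / 4) (at s)"
proof -
  have "(J0 has_real_derivative (\<Sum>n. diffs bcoef n * s ^ n)) (at s)"
    unfolding J0_def by (rule termdiffs_strong_converges_everywhere[OF bcoef_summable])
  moreover have "J1 s = 4 * (\<Sum>n. diffs bcoef n * s ^ n)"
    unfolding J1_def using termdiff_converges_all[OF bcoef_summable, of s]
    by (subst suminf_mult[symmetric]) (auto simp: mult.assoc)
  ultimately show ?thesis by simp
qed

lemma DERIV_J1: "(J1 has_real_derivative J2 s) (at s)"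
  unfolding J1_def J2_def by (rule termdiffs_strong_converges_everywhere[OF J1_summable])

lemmas DERIV_J [derivative_intros] = DERIV_chain2[OF DERIV_J0] DERIV_chain2[OF DERIV_J1]

lemma DERIV_J2: "\<exists>c. (J2 has_real_derivative c) (at s)"
  unfolding J2_def using termdiffs_strong_converges_everywhere[OF J2_summable] by blast

lemma continuous_J [continuous_intros]:
  assumes "continuous_on A f"
  shows "continuous_on A (\<lambda>x. J0 (f x))" "continuous_on A (\<lambda>x. J1 (f x))" "continuous_on A (\<lambda>x. J2 (f x))"
proof -
  have "continuous_on UNIV J0" "continuous_on UNIV J1" "continuous_on UNIV J2"
    using DERIV_J0 DERIV_J1 DERIV_J2 by (meson DERIV_isCont continuous_at_imp_continuous_on)+
  then show "continuous_on A (\<lambda>x. J0 (f x))" "continuous_on A (\<lambda>x. J1 (f x))" "continuous_on A (\<lambda>x. J2 (f x))"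
    using assms by (auto intro: continuous_on_compose2)
qed

text \<open>The modified Bessel equation of order 0 in the variable s. On coefficients it is the
  recursion \<open>bcoef_Suc\<close>.\<close>

lemma J_ode: "J1 s + s * J2 s = J0 s / 4"
proof -
  let ?c = "\<lambda>n. 4 * diffs bcoef n"
  have "(\<lambda>n. ?c n * s ^ n) sums J1 s" "(\<lambda>n. diffs ?c n * s ^ n) sums J2 s"
    unfolding J1_def J2_def using J1_summable J2_summable by (auto intro: summable_sums)
  moreover have "(\<lambda>n. of_nat n * ?c n * s ^ n) sums (s * J2 s)"
  proof -
    have "(\<lambda>n. of_nat (Suc n) * ?c (Suc n) * s ^ Suc n) sums (s * J2 s)"
      using sums_mult[OF \<open>(\<lambda>n. diffs ?c n * s ^ n) sums J2 s\<close>, of s]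
      by (simp only: diffs_def[of ?c]) (simp add: ac_simps)
    then show ?thesis by (subst (asm) sums_Suc_iff) simp
  qed
  ultimately have "(\<lambda>n. ?c n * s ^ n + of_nat n * ?c n * s ^ n) sums (J1 s + s * J2 s)"
    by (intro sums_add)
  moreover have "?c n * s ^ n + of_nat n * ?c n * s ^ n = (bcoef n * s ^ n) / 4" for n
  proof -
    have "b / (4 * S) * c + (S - 1) * (b / (4 * S)) * c = b * c / 4" if "S \<noteq> 0" for b c S :: real
      using that by (simp add: field_simps)
    from this[of "1 + of_nat n"] show ?thesis unfolding bcoef_Suc by simp
  qed
  ultimately have "(\<lambda>n. (bcoef n * s ^ n) / 4) sums (J1 s + s * J2 s)" by simp
  moreover have "(\<lambda>n. (bcoef n * s ^ n) / 4) sums (J0 s / 4)"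
    unfolding J0_def by (intro sums_divide summable_sums bcoef_summable)
  ultimately show ?thesis by (rule sums_unique2)
qed

lemma J_at_0 [simp]: "J0 0 = 1" "J1 0 = 1 / 4"
  unfolding J0_def J1_def powser_zero by (simp_all add: bcoef_def diffs_def)

lemma J_mono: "0 \<le> s \<Longrightarrow> s \<le> s' \<Longrightarrow> J0 s \<le> J0 s'" "0 \<le> s \<Longrightarrow> s \<le> s' \<Longrightarrow> J1 s \<le> J1 s'"
  unfolding J0_def J1_def
  by (auto intro!: suminf_le bcoef_summable J1_summable mult_left_mono power_mono bcoef_nonneg)

lemma J_nonneg: "0 \<le> s \<Longrightarrow> 1 \<le> J0 s" "0 \<le> s \<Longrightarrow> 0 \<le> J1 s"
  using J_mono[of 0 s] by auto

lemma J1_le_J0: "0 \<le> s \<Longrightarrow> 4 * J1 s \<le> J0 s"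
  unfolding J0_def J1_def suminf_mult[OF J1_summable, symmetric]
proof (intro suminf_le summable_mult J1_summable bcoef_summable)
  fix n assume "0 \<le> s"
  have "4 * (4 * diffs bcoef n) \<le> bcoef n"
    unfolding bcoef_Suc using bcoef_nonneg[of n] by (simp add: field_simps)
  then show "4 * (4 * diffs bcoef n * s ^ n) \<le> bcoef n * s ^ n"
    using \<open>0 \<le> s\<close> by (subst mult.assoc[symmetric]) (intro mult_right_mono, auto)
qed

text \<open>With \<open>a\<^sub>n = (z/4)\<^sup>n / n!\<close> this is \<open>\<Sum>a\<^sub>n a\<^sub>n\<^sub>+\<^sub>1 \<le> \<Sum>a\<^sub>n\<^sup>2\<close>.\<close>

lemma z_J1_le_J0:
  assumes "0 \<le> z"
  shows "z * J1 (z\<^sup>2) \<le> J0 (z\<^sup>2)"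
proof -
  define a where "a n = (z / 4) ^ n / fact n" for n
  have a: "bcoef n * (z\<^sup>2) ^ n = (a n)\<^sup>2" for n
  proof -
    have "(16::real) ^ n = (4 ^ n)\<^sup>2"
      using power_mult[of "4::real" 2 n] power_mult[of "4::real" n 2] by (simp add: mult.commute)
    then show ?thesis
      unfolding bcoef_def a_def power_divide by (simp add: power_mult[symmetric] power_mult_distrib mult.commute)
  qed
  have J0s: "(\<lambda>n. (a n)\<^sup>2) sums J0 (z\<^sup>2)"
    using summable_sums[OF bcoef_summable, of "z\<^sup>2"] unfolding J0_def a .
  have J1s: "(\<lambda>n. a n * a (Suc n)) sums (z * J1 (z\<^sup>2))"
  proof -
    have "z * (4 * diffs bcoef n * (z\<^sup>2) ^ n) = a n * a (Suc n)" for n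
    proof -
      have "z * (4 * diffs bcoef n * (z\<^sup>2) ^ n) = (bcoef n * (z\<^sup>2) ^ n) * (z / (4 * (1 + of_nat n)))"
        unfolding bcoef_Suc by simp
      also have "\<dots> = a n * a (Suc n)"
        unfolding a by (simp add: a_def power2_eq_square algebra_simps)
      finally show ?thesis .
    qed
    then show ?thesis
      using sums_mult[OF summable_sums[OF J1_summable, of "z\<^sup>2"], of z] unfolding J1_def by simp
  qed
  have "(\<lambda>n. (a (Suc n))\<^sup>2) sums (J0 (z\<^sup>2) - (a 0)\<^sup>2)"
    using J0s by (subst sums_Suc_iff) simp
  then have "(\<lambda>n. ((a n)\<^sup>2 + (a (Suc n))\<^sup>2) / 2) sums ((J0 (z\<^sup>2) + (J0 (z\<^sup>2) - (a 0)\<^sup>2)) / 2)"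
    by (intro sums_divide sums_add J0s)
  then have "z * J1 (z\<^sup>2) \<le> (J0 (z\<^sup>2) + (J0 (z\<^sup>2) - (a 0)\<^sup>2)) / 2"
  proof (rule sums_le[OF _ J1s, rotated])
    fix n
    show "a n * a (Suc n) \<le> ((a n)\<^sup>2 + (a (Suc n))\<^sup>2) / 2"
      using sum_squares_bound[of "a n" "a (Suc n)"] by simp
  qed
  then show ?thesis by (simp add: a_def)
qed

text \<open>The function \<open>E\<close> is z times the difference of the two sides. It vanishes at
  0, and by \<open>J_ode\<close> its derivative is a sum of the nonnegative quantities of
  \<open>J1_le_J0\<close> and \<open>z_J1_le_J0\<close>. For large z this cancellation gains a
  factor of order 1 / z over \<open>J0\<close>, which is the source of the decay of the mass of
  \<open>k1\<close>.\<close>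

lemma J0_minus_z_J1_le:
  assumes "0 \<le> z"
  shows "J0 (z\<^sup>2) - z * J1 (z\<^sup>2) \<le> 4 * J1 (z\<^sup>2)"
proof -
  define E where "E z = 4 * z * J1 (z\<^sup>2) - z * J0 (z\<^sup>2) + z\<^sup>2 * J1 (z\<^sup>2)" for z
  have D: "(E has_real_derivative J0 (z\<^sup>2) - 4 * J1 (z\<^sup>2) + (z / 2) * (J0 (z\<^sup>2) - z * J1 (z\<^sup>2))) (at z)" for z
  proof -
    have D0: "(E has_real_derivative 4 * J1 (z\<^sup>2) + 4 * z * (J2 (z\<^sup>2) * (2 * z)) - (J0 (z\<^sup>2) + z * (J1 (z\<^sup>2) / 4 * (2 * z)))
       + (2 * z * J1 (z\<^sup>2) + z\<^sup>2 * (J2 (z\<^sup>2) * (2 * z)))) (at z)"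
      unfolding E_def
      by (auto intro!: derivative_eq_intros simp: power2_eq_square)
    have "z\<^sup>2 * J2 (z\<^sup>2) = J0 (z\<^sup>2) / 4 - J1 (z\<^sup>2)"
      using J_ode[of "z\<^sup>2"] by simp
    then have eq: "4 * J1 (z\<^sup>2) + 4 * z * (J2 (z\<^sup>2) * (2 * z)) - (J0 (z\<^sup>2) + z * (J1 (z\<^sup>2) / 4 * (2 * z)))
       + (2 * z * J1 (z\<^sup>2) + z\<^sup>2 * (J2 (z\<^sup>2) * (2 * z)))
       = J0 (z\<^sup>2) - 4 * J1 (z\<^sup>2) + (z / 2) * (J0 (z\<^sup>2) - z * J1 (z\<^sup>2))"
      by algebra
    show ?thesis by (rule DERIV_cong[OF D0 eq])
  qed
  have "E 0 \<le> E z"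
  proof (rule DERIV_nonneg_imp_nondecreasing[OF assms])
    fix x assume "0 \<le> x" "x \<le> z"
    then have "J0 (x\<^sup>2) - 4 * J1 (x\<^sup>2) + (x / 2) * (J0 (x\<^sup>2) - x * J1 (x\<^sup>2)) \<ge> 0"
      using z_J1_le_J0[of x] J1_le_J0[of "x\<^sup>2"] by (intro add_nonneg_nonneg mult_nonneg_nonneg) auto
    then show "\<exists>y. (E has_real_derivative y) (at x) \<and> 0 \<le> y" using D[of x] by blast
  qed
  then have "0 \<le> z * (4 * J1 (z\<^sup>2) - (J0 (z\<^sup>2) - z * J1 (z\<^sup>2)))"
    by (simp add: E_def algebra_simps power2_eq_square)
  then show ?thesis
    using assms by (cases "z = 0") (auto simp: zero_le_mult_iff)
qed

text \<open>Squared and cleared of denominators, this is (2n choose n) / 4^n \<le> 1 / sqrt (2n +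
  1). The induction step is (2n + 1) (2n + 3) \<le> (2n + 2)^2. The quotient on the left is the
  ratio of the n-th terms of \<open>J0 (t\<^sup>2)\<close> and of cosh (t / 2), so the decay (1 +
  t)^(-1/2) originates here.\<close>

lemma central_binomial_le: "(2 * real n + 1) * (fact (2 * n))\<^sup>2 \<le> (4 ^ n * (fact n)\<^sup>2 :: real)\<^sup>2"
proof (induction n)
  case (Suc n)
  let ?n = "real n"
  have f: "fact (2 * Suc n) = (2 * ?n + 2) * ((2 * ?n + 1) * fact (2 * n))"
    by (simp add: algebra_simps)
  have "(2 * real (Suc n) + 1) * (fact (2 * Suc n))\<^sup>2 =
      (2 * ?n + 3) * (2 * ?n + 2)\<^sup>2 * (2 * ?n + 1) * ((2 * ?n + 1) * (fact (2 * n))\<^sup>2)"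
  proof -
    have "(2 * (1 + N) + 1) * ((2 * N + 2) * ((2 * N + 1) * f))\<^sup>2 =
      (2 * N + 3) * (2 * N + 2)\<^sup>2 * (2 * N + 1) * ((2 * N + 1) * f\<^sup>2)" for N f :: real
      by (simp add: power2_eq_square algebra_simps)
    with f show ?thesis by (simp only: of_nat_Suc)
  qed
  also have "\<dots> \<le> (2 * ?n + 3) * (2 * ?n + 2)\<^sup>2 * (2 * ?n + 1) * (4 ^ n * (fact n)\<^sup>2)\<^sup>2"
    by (rule mult_left_mono[OF Suc.IH]) auto
  also have "\<dots> \<le> 16 * (?n + 1) ^ 4 * (4 ^ n * (fact n)\<^sup>2)\<^sup>2"
  proof (rule mult_right_mono)
    have "16 * (?n + 1) ^ 4 - (2 * ?n + 3) * (2 * ?n + 2)\<^sup>2 * (2 * ?n + 1) = 4 * (?n + 1)\<^sup>2" by algebra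
    then show "(2 * ?n + 3) * (2 * ?n + 2)\<^sup>2 * (2 * ?n + 1) \<le> 16 * (?n + 1) ^ 4"
      using zero_le_power2[of "?n + 1"] by linarith
  qed simp
  also have "\<dots> = (4 ^ Suc n * (fact (Suc n))\<^sup>2)\<^sup>2"
  proof -
    have "16 * (N + 1) ^ 4 * (a * f\<^sup>2)\<^sup>2 = (4 * a * ((1 + N) * f)\<^sup>2)\<^sup>2" for N a f :: real
      by algebra
    then show ?thesis by (simp only: of_nat_Suc fact_Suc power_Suc)
  qed
  finally show ?case .
qed simp

text \<open>The weight \<open>\<mu>\<close> comes from AM-GM applied to \<open>1 / sqrt (2 * n + 1)\<close>; it is optimised in \<open>t\<close> below.\<close>

lemma J0_le_cosh_sinh:
  assumes "0 < \<mu>" "0 < t"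
  shows "J0 (t\<^sup>2) \<le> (\<mu> * cosh (t / 2) + sinh (t / 2) / (\<mu> * (t / 2))) / 2"
proof -
  let ?z = "t / 2"
  define c where "c n = ?z ^ (2 * n) / fact (2 * n)" for n
  let ?e = "\<lambda>n. if even n then ?z ^ n /\<^sub>R fact n else 0"
  let ?o = "\<lambda>n. if even n then 0 else ?z ^ n /\<^sub>R fact n"
  have "(\<lambda>n. ?e (2 * n)) sums cosh ?z \<longleftrightarrow> ?e sums cosh ?z"
  proof (rule sums_mono_reindex)
    fix n :: nat assume "n \<notin> range (\<lambda>n. 2 * n)"
    then have "odd n" by (auto elim!: evenE)
    then show "?e n = 0" by simp
  qed (simp add: strict_mono_def)
  moreover have "?e (2 * n) = c n" for n
    by (simp only: c_def dvd_triv_left if_True real_scaleR_def divide_inverse_commute)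
  ultimately have C: "(\<lambda>n. c n) sums cosh ?z"
    using cosh_converges[of ?z] by simp
  have "(\<lambda>n. ?o (2 * n + 1)) sums sinh ?z \<longleftrightarrow> ?o sums sinh ?z"
  proof (rule sums_mono_reindex)
    fix n :: nat assume "n \<notin> range (\<lambda>n. 2 * n + 1)"
    then have "even n" by (metis oddE rangeI)
    then show "?o n = 0" by simp
  qed (simp add: strict_mono_def)
  moreover have "?o (2 * n + 1) = ?z ^ (2 * n + 1) / fact (2 * n + 1)" for n
    by (simp only: even_plus_one_iff dvd_triv_left not_True_eq_False if_False real_scaleR_def divide_inverse_commute)
  ultimately have "(\<lambda>n. ?z ^ (2 * n + 1) / fact (2 * n + 1)) sums sinh ?z"
    using sinh_converges[of ?z] by (simp only: )
  \<comment> \<open>Dividing the sinh series by t / 2 produces the terms of cosh with the weights 1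
    / (2n + 1).\<close>
  then have "(\<lambda>n. ?z ^ (2 * n + 1) / fact (2 * n + 1) / (\<mu> * ?z)) sums (sinh ?z / (\<mu> * ?z))"
    by (rule sums_divide)
  moreover have "?z ^ (2 * n + 1) / fact (2 * n + 1) / (\<mu> * ?z) = c n / (\<mu> * (2 * real n + 1))" for n
  proof -
    have "(Z * P) / (S * f) / (\<mu> * Z) = (P / f) / (\<mu> * S)" if "Z \<noteq> 0" for Z P S f :: real
      using that by (simp add: field_simps)
    from this[of ?z] show ?thesis using assms by (simp add: c_def)
  qed
  ultimately have S: "(\<lambda>n. c n / (\<mu> * (2 * real n + 1))) sums (sinh ?z / (\<mu> * ?z))" by simp
  have "(\<lambda>n. bcoef n * (t\<^sup>2) ^ n) sums J0 (t\<^sup>2)"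
    unfolding J0_def by (rule summable_sums[OF bcoef_summable])
  moreover have "(\<lambda>n. (\<mu> * c n + c n / (\<mu> * (2 * real n + 1))) / 2) sums
      ((\<mu> * cosh ?z + sinh ?z / (\<mu> * ?z)) / 2)"
    by (intro sums_divide sums_add sums_mult C S)
  ultimately show ?thesis
  proof (rule sums_le[rotated])
    fix n
    define b where "b = fact (2 * n) / (4 ^ n * (fact n)\<^sup>2 :: real)"
    let ?m = "2 * real n + 1"
    have "b\<^sup>2 * ?m \<le> 1"
      using central_binomial_le[of n] by (simp add: b_def power_divide divide_le_eq mult.commute)
    then have "b\<^sup>2 \<le> 1 / ?m" by (simp add: field_simps)
    then have "b\<^sup>2 / \<mu> \<le> 1 / ?m / \<mu>"
      using assms by (intro divide_right_mono) auto
    moreover have "b \<le> (\<mu> + b\<^sup>2 / \<mu>) / 2"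
      using assms sum_squares_bound[of \<mu> b] by (simp add: field_simps power2_eq_square)
    ultimately have "b\<^sup>2 / \<mu> \<le> 1 / ?m / \<mu>" "b \<le> (\<mu> + b\<^sup>2 / \<mu>) / 2" .
    then have "b \<le> (\<mu> + 1 / (\<mu> * ?m)) / 2" by (simp add: mult.commute)
    moreover have "0 \<le> c n" using assms by (simp add: c_def)
    ultimately have "c n * b \<le> c n * ((\<mu> + 1 / (\<mu> * ?m)) / 2)" by (rule mult_left_mono)
    moreover have "bcoef n * (t\<^sup>2) ^ n = c n * b"
    proof -
      have "(16::real) ^ n = 4 ^ n * 4 ^ n" "(2::real) ^ (2 * n) = 4 ^ n"
        by (simp_all add: power_mult_distrib[symmetric] power_mult)
      then show ?thesis
        by (simp add: bcoef_def c_def b_def power_divide power_mult[symmetric])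
    qed
    ultimately show "bcoef n * (t\<^sup>2) ^ n \<le> (\<mu> * c n + c n / (\<mu> * (2 * real n + 1))) / 2"
      by (simp add: algebra_simps)
  qed
qed

text \<open>The weight \<mu> = 1 / sqrt (t / 2) balances the two terms of
  \<open>J0_le_cosh_sinh\<close>, which then add up to a multiple of cosh + sinh = exp (t / 2). For
  t < 1 the weight 1 is enough.\<close>

lemma J0_decay:
  assumes "0 \<le> t"
  shows "exp (- t / 2) * J0 (t\<^sup>2) \<le> 2 / sqrt (1 + t)"
proof (cases "t < 1")
  case True
  have cosh: "J0 (t\<^sup>2) \<le> exp (t / 2)"
  proof (cases "t = 0")
    case False
    then have t: "0 < t" using assms by simp
    have "sinh (t / 2) / (t / 2) \<le> cosh (t / 2)"
    proof -
      have "(\<lambda>x. x * cosh x - sinh x) 0 \<le> (\<lambda>x. x * cosh x - sinh x) (t / 2)"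
        by (rule DERIV_nonneg_imp_nondecreasing[of 0 "t / 2"])
          (use t in \<open>auto intro!: exI derivative_eq_intros\<close>)
      then show ?thesis using t by (simp add: field_simps)
    qed
    then have "J0 (t\<^sup>2) \<le> cosh (t / 2)"
      using J0_le_cosh_sinh[of 1 t] t by simp
    also have "\<dots> \<le> exp (t / 2)" using t by (simp add: cosh_def)
    finally show ?thesis .
  qed simp
  then have "exp (- t / 2) * J0 (t\<^sup>2) \<le> exp (- t / 2) * exp (t / 2)" by simp
  also have "\<dots> = 1" by (simp add: exp_add[symmetric])
  also have "1 \<le> 2 / sqrt (1 + t)"
    using True assms real_sqrt_le_mono[of "1 + t" 4] by (simp add: field_simps)
  finally show ?thesis .
next
  case False
  define q where "q = sqrt (t / 2)"
  have q: "0 < q" "t / 2 = q * q" using False by (auto simp: q_def)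
  have "J0 (t\<^sup>2) \<le> (cosh (t / 2) / q + sinh (t / 2) / (1 / q * (q * q))) / 2"
    using J0_le_cosh_sinh[of "1 / q" t] q False by simp
  also have "\<dots> = (cosh (t / 2) + sinh (t / 2)) / (2 * q)" using q by (simp add: field_simps)
  also have "cosh (t / 2) + sinh (t / 2) = exp (t / 2)" by (rule cosh_plus_sinh)
  finally have "exp (- t / 2) * J0 (t\<^sup>2) \<le> exp (- t / 2) * (exp (t / 2) / (2 * q))"
    by (rule mult_left_mono) simp
  also have "\<dots> = 1 / (2 * q)" by (simp add: exp_add[symmetric] field_simps)
  also have "\<dots> \<le> 2 / sqrt (1 + t)"
  proof -
    have "sqrt (1 + t) \<le> sqrt (16 * (t / 2))" using False by (intro real_sqrt_le_mono) auto
    also have "\<dots> = sqrt 16 * q" unfolding q_def by (rule real_sqrt_mult)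
    also have "sqrt 16 = (4 :: real)" by (rule real_sqrt_unique) auto
    finally show ?thesis using q False by (simp add: field_simps)
  qed
  finally show ?thesis .
qed

section \<open>Pointwise bounds, masses and second moment of the kernels\<close>

text \<open>\<open>k0\<close> is the kernel of S(t) and \<open>k1\<close>, its time derivative, the
  kernel of the integral part of the derivative of S(t). The suffixes \<open>y\<close> and
  \<open>t\<close> stand for partial derivatives. The boundary values of \<open>k0\<close> at y = t
  and y = -t give the coefficient of the travelling part.\<close>

definition k0 :: "real \<Rightarrow> real \<Rightarrow> real" where "k0 t y = exp (- t / 2) / 2 * J0 (t\<^sup>2 - y\<^sup>2)"
definition k1 :: "real \<Rightarrow> real \<Rightarrow> real" where
  "k1 t y = exp (- t / 2) / 4 * (t * J1 (t\<^sup>2 - y\<^sup>2) - J0 (t\<^sup>2 - y\<^sup>2))"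
definition k0y :: "real \<Rightarrow> real \<Rightarrow> real" where "k0y t y = - (exp (- t / 2) / 4 * y * J1 (t\<^sup>2 - y\<^sup>2))"
definition k1y :: "real \<Rightarrow> real \<Rightarrow> real" where
  "k1y t y = exp (- t / 2) / 4 * (y * J1 (t\<^sup>2 - y\<^sup>2) / 2 - 2 * t * y * J2 (t\<^sup>2 - y\<^sup>2))"
definition k1t :: "real \<Rightarrow> real \<Rightarrow> real" where
  "k1t t y = exp (- t / 2) / 4 * (J1 (t\<^sup>2 - y\<^sup>2) + 2 * t\<^sup>2 * J2 (t\<^sup>2 - y\<^sup>2) - t * J1 (t\<^sup>2 - y\<^sup>2)
     + J0 (t\<^sup>2 - y\<^sup>2) / 2)"

lemma continuous_k [continuous_intros]:
  assumes "continuous_on A f" "continuous_on A g"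
  shows "continuous_on A (\<lambda>x. k0 (f x) (g x))" "continuous_on A (\<lambda>x. k1 (f x) (g x))"
    "continuous_on A (\<lambda>x. k0y (f x) (g x))" "continuous_on A (\<lambda>x. k1y (f x) (g x))"
    "continuous_on A (\<lambda>x. k1t (f x) (g x))"
  unfolding k0_def k1_def k0y_def k1y_def k1t_def by (auto intro!: continuous_intros assms)

lemma DERIV_k:
  "((\<lambda>t. k0 t y) has_real_derivative k1 t y) (at t)"
  "((\<lambda>t. k1 t y) has_real_derivative k1t t y) (at t)"
  "(k0 t has_real_derivative k0y t y) (at y)"
  "(k1 t has_real_derivative k1y t y) (at y)"
  unfolding k0_def k1_def k0y_def k1y_def k1t_def
  by (auto intro!: derivative_eq_intros
      simp: field_simps power2_eq_square)

lemma k_boundary [simp]: "k0 t t = exp (- t / 2) / 2" "k0 t (-t) = exp (- t / 2) / 2"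
  by (auto simp: k0_def)

lemma k0_nonneg: "\<bar>y\<bar> \<le> t \<Longrightarrow> 0 \<le> k0 t y"
  using J_nonneg(1)[of "t\<^sup>2 - y\<^sup>2"] power2_le_iff_abs_le[of t y] unfolding k0_def by auto

lemma k0_le:
  assumes "\<bar>y\<bar> \<le> t"
  shows "k0 t y \<le> 1 / sqrt (1 + t)"
proof -
  have "y\<^sup>2 \<le> t\<^sup>2" using assms by (metis abs_le_square_iff abs_of_nonneg abs_ge_zero order_trans)
  then have "exp (- t / 2) * J0 (t\<^sup>2 - y\<^sup>2) \<le> exp (- t / 2) * J0 (t\<^sup>2)"
    by (intro mult_left_mono J_mono) auto
  also have "\<dots> \<le> 2 / sqrt (1 + t)" using assms by (intro J0_decay) auto
  finally show ?thesis by (simp add: k0_def)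
qed

lemma k1_abs_le:
  assumes "\<bar>y\<bar> \<le> t"
  shows "\<bar>k1 t y\<bar> \<le> 1 / sqrt (1 + t)"
proof -
  have y: "y\<^sup>2 \<le> t\<^sup>2" using assms by (metis abs_le_square_iff abs_of_nonneg abs_ge_zero order_trans)
  have t: "0 \<le> t" using assms by auto
  have "\<bar>t * J1 (t\<^sup>2 - y\<^sup>2) - J0 (t\<^sup>2 - y\<^sup>2)\<bar> \<le> t * J1 (t\<^sup>2 - y\<^sup>2) + J0 (t\<^sup>2 - y\<^sup>2)"
    using J_nonneg[of "t\<^sup>2 - y\<^sup>2"] y t mult_nonneg_nonneg[of t "J1 (t\<^sup>2 - y\<^sup>2)"] by (auto simp: abs_le_iff)
  also have "\<dots> \<le> t * J1 (t\<^sup>2) + J0 (t\<^sup>2)"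
    using t y by (intro add_mono mult_left_mono J_mono) auto
  also have "\<dots> \<le> 2 * J0 (t\<^sup>2)" using z_J1_le_J0[OF t] by simp
  finally have "exp (- t / 2) * \<bar>t * J1 (t\<^sup>2 - y\<^sup>2) - J0 (t\<^sup>2 - y\<^sup>2)\<bar> \<le> exp (- t / 2) * (2 * J0 (t\<^sup>2))"
    by (intro mult_left_mono) auto
  also have "\<dots> \<le> 4 / sqrt (1 + t)" using J0_decay[OF t] by simp
  finally show ?thesis by (simp add: k1_def abs_mult)
qed

text \<open>The two integrals m and n vanish at t = 0 and satisfy m' = 2 + n / 2 and n' = m / 2.
  Hence m + n + 4 and m - n - 4 are pure exponentials.\<close>

lemma integral_J:
  "sym_integral t (\<lambda>y. J0 (t\<^sup>2 - y\<^sup>2)) = 4 * sinh (t / 2)"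
  "sym_integral t (\<lambda>y. t * J1 (t\<^sup>2 - y\<^sup>2)) = 4 * cosh (t / 2) - 4"
proof -
  define m where "m t = sym_integral t (\<lambda>y. J0 (t\<^sup>2 - y\<^sup>2))" for t
  define n where "n t = sym_integral t (\<lambda>y. t * J1 (t\<^sup>2 - y\<^sup>2))" for t
  have Dm: "(m has_real_derivative 2 + n t / 2) (at t)" for t
  proof -
    have "(m has_real_derivative J0 (t\<^sup>2 - t\<^sup>2) + J0 (t\<^sup>2 - (-t)\<^sup>2)
        + sym_integral t (\<lambda>y. t * J1 (t\<^sup>2 - y\<^sup>2) / 2)) (at t)"
      unfolding m_def
      by (rule sym_integral_has_derivative)
        (auto intro!: continuous_intros derivative_eq_intros simp: split_beta power2_eq_square)
    then show ?thesis by (simp add: n_def sym_integral_def)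
  qed
  have Dn: "(n has_real_derivative m t / 2) (at t)" for t
  proof -
    have "(n has_real_derivative t * J1 (t\<^sup>2 - t\<^sup>2) + t * J1 (t\<^sup>2 - (-t)\<^sup>2)
        + sym_integral t (\<lambda>y. J1 (t\<^sup>2 - y\<^sup>2) + t * (J2 (t\<^sup>2 - y\<^sup>2) * (2 * t)))) (at t)"
      unfolding n_def
      by (rule sym_integral_has_derivative)
        (auto intro!: continuous_intros derivative_eq_intros simp: split_beta)
    moreover have "sym_integral t (\<lambda>y. J1 (t\<^sup>2 - y\<^sup>2) + t * (J2 (t\<^sup>2 - y\<^sup>2) * (2 * t))) = m t / 2 - t / 2"
    proof -
      \<comment> \<open>the integrand is \<open>J0 / 2\<close> minus the \<open>y\<close>-derivative of \<open>y * J1\<close>\<close>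
      have e: "J1 (t\<^sup>2 - y\<^sup>2) + t * (J2 (t\<^sup>2 - y\<^sup>2) * (2 * t)) =
         J0 (t\<^sup>2 - y\<^sup>2) / 2 - (J1 (t\<^sup>2 - y\<^sup>2) - 2 * y\<^sup>2 * J2 (t\<^sup>2 - y\<^sup>2))" for y
        using J_ode[of "t\<^sup>2 - y\<^sup>2"] by (simp add: algebra_simps power2_eq_square)
      have "sym_integral t (\<lambda>y. J1 (t\<^sup>2 - y\<^sup>2) - 2 * y\<^sup>2 * J2 (t\<^sup>2 - y\<^sup>2)) =
          t * J1 (t\<^sup>2 - t\<^sup>2) - (- t) * J1 (t\<^sup>2 - (- t)\<^sup>2)"
        by (rule sym_integral_ftc)
          (auto simp: power2_eq_square intro!: continuous_intros derivative_eq_intros)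
      then have "sym_integral t (\<lambda>y. J1 (t\<^sup>2 - y\<^sup>2) - 2 * y\<^sup>2 * J2 (t\<^sup>2 - y\<^sup>2)) = t / 2" by simp
      moreover have "sym_integral t (\<lambda>y. J0 (t\<^sup>2 - y\<^sup>2) / 2 - (J1 (t\<^sup>2 - y\<^sup>2) - 2 * y\<^sup>2 * J2 (t\<^sup>2 - y\<^sup>2)))
        = m t / 2 - sym_integral t (\<lambda>y. J1 (t\<^sup>2 - y\<^sup>2) - 2 * y\<^sup>2 * J2 (t\<^sup>2 - y\<^sup>2))"
        unfolding m_def by (subst sym_integral_add(2)) (auto intro!: continuous_intros)
      ultimately show ?thesis unfolding e by simp
    qed
    ultimately show ?thesis by simp
  qed
  have zero: "m 0 = 0" "n 0 = 0" by (auto simp: m_def n_def sym_integral_def)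
  have "(m t + n t + 4) * exp (- t / 2) = (m 0 + n 0 + 4) * exp (- 0 / 2)"
    by (rule DERIV_isconst_all[of "\<lambda>t. (m t + n t + 4) * exp (- t / 2)"])
      (auto intro!: derivative_eq_intros Dm Dn simp: algebra_simps)
  then have 1: "m t + n t + 4 = 4 * exp (t / 2)"
    by (simp add: zero exp_minus field_simps)
  have "(m t - n t - 4) * exp (t / 2) = (m 0 - n 0 - 4) * exp (0 / 2)"
    by (rule DERIV_isconst_all[of "\<lambda>t. (m t - n t - 4) * exp (t / 2)"])
      (auto intro!: derivative_eq_intros Dm Dn simp: algebra_simps)
  then have 2: "m t - n t - 4 = - 4 * exp (- t / 2)"
    by (simp add: zero exp_minus field_simps)
  show "sym_integral t (\<lambda>y. J0 (t\<^sup>2 - y\<^sup>2)) = 4 * sinh (t / 2)"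
    "sym_integral t (\<lambda>y. t * J1 (t\<^sup>2 - y\<^sup>2)) = 4 * cosh (t / 2) - 4"
    using 1 2 unfolding m_def[symmetric] n_def[symmetric] sinh_def cosh_def real_scaleR_def
    by (simp_all add: field_simps)
qed

lemma k0_mass: "sym_integral t (k0 t) = 1 - exp (- t)"
proof -
  have "sym_integral t (k0 t) = exp (- t / 2) / 2 * sym_integral t (\<lambda>y. J0 (t\<^sup>2 - y\<^sup>2))"
    unfolding k0_def by (rule sym_integral_cmult)
  also have "\<dots> = exp (- t / 2) * exp (t / 2) - exp (- t / 2) * exp (- t / 2)"
    unfolding integral_J by (simp add: sinh_def algebra_simps)
  finally show ?thesis by (simp add: exp_add[symmetric])
qed

text \<open>Up to a multiple of \<open>J1\<close>, the absolute value of t J1 - J0 is the expression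
  itself, whose integral is not positive. The integral of \<open>J1\<close> is 1 / t times a known
  one, and this gives the rate.\<close>

lemma k1_mass:
  assumes "0 \<le> t"
  shows "sym_integral t (\<lambda>y. \<bar>k1 t y\<bar>) \<le> 8 / (1 + t)"
proof (cases "t = 0")
  case False
  then have t: "0 < t" using assms by simp
  let ?e = "exp (- t / 2)"
  have "\<bar>k1 t y\<bar> \<le> ?e / 4 * ((t * J1 (t\<^sup>2 - y\<^sup>2) - J0 (t\<^sup>2 - y\<^sup>2)) + 8 / t * (t * J1 (t\<^sup>2 - y\<^sup>2)))" if "\<bar>y\<bar> \<le> t" for y
  proof -
    define w where "w = sqrt (t\<^sup>2 - y\<^sup>2)"
    have y: "y\<^sup>2 \<le> t\<^sup>2" using that by (metis abs_le_square_iff abs_of_nonneg abs_ge_zero order_trans)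
    have w: "0 \<le> w" "w\<^sup>2 = t\<^sup>2 - y\<^sup>2" "w \<le> t"
      using y t by (auto simp: w_def intro!: real_le_lsqrt)
    have "0 \<le> (t - w) * J1 (w\<^sup>2)"
      using w(3) J_nonneg(2)[OF zero_le_power2, of w] by (intro mult_nonneg_nonneg) simp_all
    \<comment> \<open>The negative part of t J1 - J0 is at most J0 - w J1, because w \<le> t and
      \<open>J1\<close> is nonnegative.\<close>
    then have "\<bar>t * J1 (w\<^sup>2) - J0 (w\<^sup>2)\<bar> \<le> (t * J1 (w\<^sup>2) - J0 (w\<^sup>2)) + 2 * (J0 (w\<^sup>2) - w * J1 (w\<^sup>2))"
      using z_J1_le_J0[OF w(1)] by (auto simp: abs_le_iff algebra_simps)
    also have "\<dots> \<le> (t * J1 (w\<^sup>2) - J0 (w\<^sup>2)) + 8 * J1 (w\<^sup>2)"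
      using J0_minus_z_J1_le[OF w(1)] by simp
    finally have "?e / 4 * \<bar>t * J1 (w\<^sup>2) - J0 (w\<^sup>2)\<bar> \<le> ?e / 4 * ((t * J1 (w\<^sup>2) - J0 (w\<^sup>2)) + 8 * J1 (w\<^sup>2))"
      by (rule mult_left_mono) simp
    then show ?thesis using t by (simp add: k1_def abs_mult w)
  qed
  then have "sym_integral t (\<lambda>y. \<bar>k1 t y\<bar>) \<le>
    sym_integral t (\<lambda>y. ?e / 4 * ((t * J1 (t\<^sup>2 - y\<^sup>2) - J0 (t\<^sup>2 - y\<^sup>2)) + 8 / t * (t * J1 (t\<^sup>2 - y\<^sup>2))))"
    by (intro sym_integral_mono assms continuous_intros)
  also have "\<dots> = ?e / 4 * ((4 * cosh (t / 2) - 4 - 4 * sinh (t / 2)) + 8 / t * (4 * cosh (t / 2) - 4))"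
    unfolding sym_integral_cmult(1)
    by (subst sym_integral_add, (intro continuous_intros)+, subst sym_integral_add(2), (intro continuous_intros)+)
      (simp only: sym_integral_cmult(1) integral_J integral_J(2)[unfolded sym_integral_cmult(1)])
  also have "\<dots> = ?e * (?e - 1) + 4 / t * (1 - ?e)\<^sup>2"
  proof -
    have "?e * exp (t / 2) = 1" by (simp add: exp_add[symmetric])
    then show ?thesis
      unfolding cosh_def sinh_def using t by (simp add: field_simps power2_eq_square)
  qed
  also have "\<dots> \<le> 4 / t * (1 - ?e)\<^sup>2"
    using t by (simp add: mult_nonneg_nonpos)
  also have "\<dots> \<le> 8 / (1 + t)"
  proof (cases "1 \<le> t")
    case True
    have "(1 - ?e)\<^sup>2 \<le> 1\<^sup>2" using t by (intro power_mono) auto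
    then have "4 / t * (1 - ?e)\<^sup>2 \<le> 4 / t * 1" using t by (intro mult_left_mono) auto
    also have "\<dots> \<le> 8 / (1 + t)" using True by (simp add: field_simps)
    finally show ?thesis .
  next
    case False
    have "1 - ?e \<le> t / 2" using exp_ge_add_one_self[of "- t / 2"] by simp
    then have "(1 - ?e)\<^sup>2 \<le> (t / 2)\<^sup>2" using t by (intro power_mono) auto
    then have "4 / t * (1 - ?e)\<^sup>2 \<le> 4 / t * (t / 2)\<^sup>2" using t by (intro mult_left_mono) auto
    also have "\<dots> = t" using t by (simp add: power2_eq_square)
    also have "\<dots> \<le> 8 / (1 + t)"
    proof -
      have "t * (1 + t) \<le> 1 * (1 + 1)" using t False by (intro mult_mono) auto
      then show ?thesis using t by (simp add: field_simps)
    qed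
    finally show ?thesis .
  qed
  finally show ?thesis .
qed (simp add: sym_integral_def)

text \<open>With s = t^2 - y^2, the function y s J1(s) vanishes at both ends. By
  \<open>J_ode\<close>, integrating its y-derivative shows that the integral of y^2 J0 is twice that
  of s J1. Then s \<le> t^2 and \<open>integral_J\<close> apply. The linear growth in t is the
  diffusive scaling.\<close>

lemma k0_second_moment:
  assumes "0 \<le> t"
  shows "sym_integral t (\<lambda>y. y\<^sup>2 * k0 t y) \<le> 2 * t"
proof -
  let ?s = "\<lambda>y. t\<^sup>2 - y\<^sup>2"
  have "sym_integral t (\<lambda>y. ?s y * J1 (?s y) - y\<^sup>2 * J0 (?s y) / 2) =
      t * (?s t * J1 (?s t)) - (-t) * (?s (-t) * J1 (?s (-t)))"
  proof (rule sym_integral_ftc)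
    fix y
    have "y * (y * (J1 (?s y) + ?s y * J2 (?s y))) = y * (y * (J0 (?s y) / 4))"
      unfolding J_ode ..
    then show "((\<lambda>y. y * (?s y * J1 (?s y))) has_real_derivative ?s y * J1 (?s y) - y\<^sup>2 * J0 (?s y) / 2) (at y)"
      by (auto simp: power2_eq_square algebra_simps intro!: derivative_eq_intros)
  qed (auto intro!: continuous_intros)
  then have "sym_integral t (\<lambda>y. ?s y * J1 (?s y)) - sym_integral t (\<lambda>y. y\<^sup>2 * J0 (?s y)) / 2 = 0"
    by (subst (asm) sym_integral_add(2)) (auto intro!: continuous_intros)
  then have "sym_integral t (\<lambda>y. y\<^sup>2 * J0 (?s y)) = 2 * sym_integral t (\<lambda>y. ?s y * J1 (?s y))" by simp
  also have "\<dots> \<le> 2 * sym_integral t (\<lambda>y. t * (t * J1 (?s y)))"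
  proof -
    have "?s y * J1 (?s y) \<le> t * (t * J1 (?s y))" if "\<bar>y\<bar> \<le> t" for y
    proof -
      have "y\<^sup>2 \<le> t\<^sup>2" using that by (metis abs_le_square_iff abs_of_nonneg abs_ge_zero order_trans)
      then have "?s y * J1 (?s y) \<le> (t * t) * J1 (?s y)"
        using J_nonneg(2)[of "?s y"] by (intro mult_right_mono) (auto simp: power2_eq_square)
      then show ?thesis by simp
    qed
    then show ?thesis
      by (intro mult_left_mono sym_integral_mono assms) (auto intro!: continuous_intros)
  qed
  also have "\<dots> = 2 * (t * (4 * cosh (t / 2) - 4))"
    by (simp only: sym_integral_cmult(1)[of t t] integral_J)
  finally have "exp (- t / 2) / 2 * sym_integral t (\<lambda>y. y\<^sup>2 * J0 (?s y)) \<le>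
      exp (- t / 2) / 2 * (2 * (t * (4 * cosh (t / 2) - 4)))"
    by (rule mult_left_mono) simp
  also have "\<dots> = 2 * t * (1 - exp (- t / 2))\<^sup>2"
  proof -
    have "exp (- t / 2) * exp (t / 2) = 1" by (simp add: exp_add[symmetric])
    then show ?thesis
      unfolding cosh_def by (simp add: power2_eq_square algebra_simps)
  qed
  also have "\<dots> \<le> 2 * t * 1"
    using assms by (intro mult_left_mono power_le_one) auto
  also have "exp (- t / 2) / 2 * sym_integral t (\<lambda>y. y\<^sup>2 * J0 (?s y)) = sym_integral t (\<lambda>y. y\<^sup>2 * k0 t y)"
    unfolding k0_def sym_integral_cmult(1)[symmetric] by (simp add: ac_simps)
  finally show ?thesis by simp
qed

section \<open>Weak derivatives on the line\<close>

lemma integrable_mult_bounded: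
  fixes f g :: "'a \<Rightarrow> real"
  assumes "integrable M f" "g \<in> borel_measurable M" "\<And>x. \<bar>g x\<bar> \<le> C"
  shows "integrable M (\<lambda>x. f x * g x)"
proof (rule Bochner_Integration.integrable_bound)
  show "integrable M (\<lambda>x. C * f x)" using assms(1) by simp
  show "(\<lambda>x. f x * g x) \<in> borel_measurable M" using assms by auto
  have "0 \<le> C" using assms(3) abs_ge_zero order_trans by blast
  then have "\<bar>f x * g x\<bar> \<le> \<bar>C * f x\<bar>" for x
    using mult_right_mono[OF assms(3)[of x], of "\<bar>f x\<bar>"] by (simp add: abs_mult mult.commute)
  then show "AE x in M. norm (f x * g x) \<le> norm (C * f x)" by simp
qed

lemma borel_measurable_continuous:
  "continuous_on UNIV (f :: real \<Rightarrow> real) \<Longrightarrow> f \<in> borel_measurable lborel"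
  by (simp add: borel_measurable_continuous_onI)

lemma locally_integrable_measurable:
  assumes "locally_integrable g"
  shows "g \<in> borel_measurable lborel"
proof (rule borel_measurable_LIMSEQ_real)
  fix x :: real
  obtain N where "\<bar>x\<bar> \<le> real N" using real_arch_simple by blast
  then have "eventually (\<lambda>n. indicator {- real n..real n} x *\<^sub>R g x = g x) sequentially"
    unfolding eventually_sequentially by (intro exI[of _ N]) (auto simp: indicator_def)
  then show "(\<lambda>n. indicator {- real n..real n} x *\<^sub>R g x) \<longlonglongrightarrow> g x"
    by (rule tendsto_eventually)
next
  fix n :: nat
  show "(\<lambda>x. indicator {- real n..real n} x *\<^sub>R g x) \<in> borel_measurable lborel"
    using assms unfolding locally_integrable_def set_integrable_def by blast
qed

lemma locally_integrable_integrable: "integrable lborel g \<Longrightarrow> locally_integrable g"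
  unfolding locally_integrable_def set_integrable_def
  by (intro allI integrable_mult_indicator) auto

lemma locally_integrable_continuous:
  assumes "continuous_on UNIV g" shows "locally_integrable g"
  unfolding locally_integrable_def
  by (auto intro!: borel_integrable_atLeastAtMost' continuous_on_subset[OF assms])

lemma locally_integrable_add:
  "locally_integrable g \<Longrightarrow> locally_integrable h \<Longrightarrow> locally_integrable (\<lambda>x. g x + h x)"
  "locally_integrable g \<Longrightarrow> locally_integrable h \<Longrightarrow> locally_integrable (\<lambda>x. g x - h x)"
  unfolding locally_integrable_def by auto

lemma integrable_locally_mult:
  assumes m: "locally_integrable m" and \<phi>: "continuous_on UNIV \<phi>" "\<And>x. \<bar>x\<bar> > R \<Longrightarrow> \<phi> x = 0"
  shows "integrable lborel (\<lambda>x. m x * \<phi> x)"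
proof -
  have "bounded (\<phi> ` {-R..R})"
    by (intro compact_imp_bounded compact_continuous_image continuous_on_subset[OF \<phi>(1)]) auto
  then obtain C where C: "\<And>x. x \<in> {-R..R} \<Longrightarrow> \<bar>\<phi> x\<bar> \<le> C"
    by (metis bounded_iff imageI real_norm_def)
  have "\<bar>\<phi> x\<bar> \<le> \<bar>C\<bar>" for x
  proof (cases "x \<in> {-R..R}")
    case False
    then have "\<bar>x\<bar> > R" unfolding atLeastAtMost_iff by linarith
    then show ?thesis using \<phi>(2) by simp
  qed (use C in fastforce)
  then have "integrable lborel (\<lambda>x. (indicator {-R..R} x *\<^sub>R m x) * \<phi> x)"
    using m borel_measurable_continuous[OF \<phi>(1)] unfolding locally_integrable_def set_integrable_def
    by (intro integrable_mult_bounded) blast+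
  moreover have "(indicator {-R..R} x *\<^sub>R m x) * \<phi> x = m x * \<phi> x" for x
  proof (cases "x \<in> {-R..R}")
    case False
    then have "\<bar>x\<bar> > R" unfolding atLeastAtMost_iff by linarith
    then show ?thesis using \<phi>(2) by simp
  qed simp
  ultimately show ?thesis by (simp only:)
qed

section \<open>Smooth functions and test functions\<close>

definition smooth :: "(real \<Rightarrow> real) \<Rightarrow> bool" where
  "smooth f \<longleftrightarrow> (\<forall>n. ((deriv ^^ n) f) differentiable_on UNIV)"

lemma smooth_iff: "smooth f \<longleftrightarrow> f differentiable_on UNIV \<and> smooth (deriv f)"
proof
  assume *: "f differentiable_on UNIV \<and> smooth (deriv f)"
  have "((deriv ^^ n) f) differentiable_on UNIV" for n
    using * unfolding smooth_def by (cases n) (auto simp: funpow_Suc_right simp del: funpow.simps)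
  then show "smooth f" unfolding smooth_def by blast
next
  assume "smooth f"
  then show "f differentiable_on UNIV \<and> smooth (deriv f)"
    unfolding smooth_def by (metis comp_apply funpow_0 funpow_Suc_right)
qed

lemma differentiable_has_deriv:
  fixes f :: "real \<Rightarrow> real"
  assumes "f differentiable_on UNIV" shows "(f has_real_derivative deriv f x) (at x)"
  using assms unfolding differentiable_on_def
  by (simp add: DERIV_deriv_iff_real_differentiable)

lemma has_deriv_differentiable:
  "(\<And>x. (f has_real_derivative f' x) (at x)) \<Longrightarrow> f differentiable_on UNIV \<and> deriv f = f'"
  unfolding differentiable_on_def
  by (auto simp: real_differentiable_def intro!: ext DERIV_imp_deriv)

lemma smooth_has_deriv: "smooth f \<Longrightarrow> (f has_real_derivative deriv f x) (at x)"
  using smooth_iff differentiable_has_deriv by blast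

lemma smoothI: "(\<And>x. (f has_real_derivative f' x) (at x)) \<Longrightarrow> smooth f' \<Longrightarrow> smooth f"
  using has_deriv_differentiable smooth_iff by metis

lemma smooth_continuous: "smooth f \<Longrightarrow> continuous_on UNIV f"
  using smooth_has_deriv by (meson DERIV_isCont continuous_at_imp_continuous_on)

text \<open>Coinduction for smoothness: a family that contains derivatives of its members consists
  of smooth functions, and the higher derivatives never have to be computed.\<close>

lemma smooth_closed:
  assumes "f \<in> S" and S: "\<And>f. f \<in> S \<Longrightarrow> \<exists>f'\<in>S. \<forall>x. (f has_real_derivative f' x) (at x)"
  shows "smooth f"
proof -
  have *: "f \<in> S \<Longrightarrow> f differentiable_on UNIV \<and> deriv f \<in> S" for f
    using S[of f] has_deriv_differentiable by metis
  have "(deriv ^^ n) f \<in> S" for n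
    by (induction n) (use assms(1) * in auto)
  then show ?thesis using * unfolding smooth_def by blast
qed

lemma smooth_diff_shift:
  assumes "smooth f" shows "smooth (\<lambda>x. f x - f (x + d))"
proof (rule smooth_closed[where S = "(\<lambda>f x. f x - f (x + d)) ` Collect smooth"])
  fix F assume "F \<in> (\<lambda>f x. f x - f (x + d)) ` Collect smooth"
  then obtain f where f: "smooth f" "F = (\<lambda>x. f x - f (x + d))" by auto
  have "((\<lambda>x. f (x + d)) has_real_derivative deriv f (x + d)) (at x)" for x
    using smooth_has_deriv[OF f(1), of "x + d"] by (simp add: DERIV_shift)
  then have "\<forall>x. (F has_real_derivative deriv f x - deriv f (x + d)) (at x)"
    unfolding f(2) using f(1) by (auto intro!: DERIV_diff smooth_has_deriv)
  moreover have "smooth (deriv f)" using f(1) smooth_iff by blast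
  ultimately show "\<exists>f'\<in>(\<lambda>f x. f x - f (x + d)) ` Collect smooth. \<forall>x. (F has_real_derivative f' x) (at x)"
    by (intro bexI[of _ "\<lambda>x. deriv f x - deriv f (x + d)"]) auto
qed (use assms in auto)

lemma test_function_iff: "test_function \<phi> \<longleftrightarrow> smooth \<phi> \<and> (\<exists>R. \<forall>x. \<bar>x\<bar> > R \<longrightarrow> \<phi> x = 0)"
proof -
  have "compact (closure {x. \<phi> x \<noteq> 0}) \<longleftrightarrow> (\<exists>R. \<forall>x. \<bar>x\<bar> > R \<longrightarrow> \<phi> x = 0)"
    unfolding compact_closure bounded_iff by (auto simp: not_less[symmetric])
  then show ?thesis unfolding test_function_def smooth_def by simp
qed

lemma test_functionD:
  assumes "test_function \<phi>"
  shows "\<And>x. (\<phi> has_real_derivative deriv \<phi> x) (at x)"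
    "continuous_on UNIV \<phi>" "continuous_on UNIV (deriv \<phi>)"
    "\<exists>R>0. \<forall>x. \<bar>x\<bar> > R \<longrightarrow> \<phi> x = 0 \<and> deriv \<phi> x = 0"
proof -
  have s: "smooth \<phi>" "smooth (deriv \<phi>)" using assms smooth_iff test_function_iff by blast+
  then show "\<And>x. (\<phi> has_real_derivative deriv \<phi> x) (at x)"
    "continuous_on UNIV \<phi>" "continuous_on UNIV (deriv \<phi>)"
    using smooth_has_deriv smooth_continuous by blast+
  obtain R where R: "\<And>x. \<bar>x\<bar> > R \<Longrightarrow> \<phi> x = 0" using assms test_function_iff by blast
  have "deriv \<phi> x = 0" if "\<bar>x\<bar> > max R 1" for x
  proof -
    have "\<forall>\<^sub>F y in nhds x. y \<in> {y. \<bar>y\<bar> > max R 1}"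
      using that by (intro eventually_nhds_in_open open_Collect_less continuous_intros) auto
    then have "\<forall>\<^sub>F y in nhds x. \<phi> y = 0" by eventually_elim (use R in auto)
    then have "deriv \<phi> x = deriv (\<lambda>_. 0) x" by (intro deriv_cong_ev) auto
    then show ?thesis by simp
  qed
  then show "\<exists>R>0. \<forall>x. \<bar>x\<bar> > R \<longrightarrow> \<phi> x = 0 \<and> deriv \<phi> x = 0"
    using R by (intro exI[of _ "max R 1"]) auto
qed

lemma integrable_test:
  assumes "locally_integrable m" "test_function \<phi>"
  shows "integrable lborel (\<lambda>x. m x * \<phi> x)" "integrable lborel (\<lambda>x. m x * deriv \<phi> x)"
  using test_functionD[OF assms(2)] by (auto intro: integrable_locally_mult[OF assms(1)])

section \<open>A family of bump functions closed under differentiation\<close>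

text \<open>For \<open>P = 1\<close> and \<open>k = 0\<close> this is the classical bump exp (-1 /
  (c (x - a) (b - x))). The factors \<open>P\<close> and the \<open>k\<close>-th power appear on
  differentiation and close the family. As c grows the bump tends to the indicator of the open
  interval.\<close>

definition bump :: "real \<Rightarrow> real \<Rightarrow> real \<Rightarrow> real poly \<Rightarrow> nat \<Rightarrow> real \<Rightarrow> real" where
  "bump a b c P k x = (if a < x \<and> x < b
     then poly P x * (1 / ((x - a) * (b - x))) ^ k * exp (- (1 / (c * ((x - a) * (b - x))))) else 0)"

text \<open>A single term of the exponential series is at most its sum.\<close>

lemma power_exp_bound:
  fixes u c :: real
  assumes "0 \<le> u" "0 < c"
  shows "u ^ m * exp (- (u / c)) \<le> fact m * c ^ m"
proof -
  have "(u / c) ^ m /\<^sub>R fact m \<le> exp (u / c)"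
  proof -
    have "(u / c) ^ m /\<^sub>R fact m = (\<Sum>n\<in>{m}. (u / c) ^ n /\<^sub>R fact n)" by simp
    also have "\<dots> \<le> (\<Sum>n. (u / c) ^ n /\<^sub>R fact n)"
      using assms summable_exp_generic[of "u / c"] by (intro sum_le_suminf) auto
    also have "\<dots> = exp (u / c)" by (simp add: exp_def)
    finally show ?thesis .
  qed
  then show ?thesis using assms by (simp add: exp_minus field_simps)
qed

lemma has_derivative_zeroI:
  assumes "\<And>y. \<bar>f y - f x\<bar> \<le> C * \<bar>y - x\<bar>\<^sup>2"
  shows "(f has_real_derivative 0) (at x)"
  unfolding has_field_derivative_iff
proof (rule Lim_null_comparison)
  show "\<forall>\<^sub>F y in at x. norm ((f y - f x) / (y - x)) \<le> C * \<bar>y - x\<bar>"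
  proof (rule eventually_mono[OF eventually_neq_at_within[of x]])
    fix y assume "y \<noteq> x"
    then show "norm ((f y - f x) / (y - x)) \<le> C * \<bar>y - x\<bar>"
      using assms[of y] by (simp add: abs_divide pos_divide_le_eq power2_eq_square mult.assoc)
  qed
  have "((\<lambda>y. C * \<bar>y - x\<bar>) \<longlongrightarrow> C * \<bar>x - x\<bar>) (at x)" by (intro tendsto_intros)
  then show "((\<lambda>y. C * \<bar>y - x\<bar>) \<longlongrightarrow> 0) (at x)" by simp
qed

text \<open>Inside the interval this is the product rule, brought to the common power
  \<open>k + 2\<close>. At the end points and outside, the exponential beats every power of 1 / ((x
  - a) (b - x)), so the function is O(|y - x|^2) and its derivative is 0.\<close>

lemma bump_deriv:
  assumes "a < b" "0 < c"
  defines "q \<equiv> [:- a, 1:] * [:b, -1:]"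
  defines "q' \<equiv> [:a + b, -2:]"
  shows "(bump a b c P k has_real_derivative
    bump a b c (pderiv P * q\<^sup>2 - of_nat k * (P * q' * q) + smult (1 / c) (P * q')) (k + 2) x) (at x)"
    (is "(_ has_real_derivative bump a b c ?Q (k + 2) x) _")
proof (cases "a < x \<and> x < b")
  case True
  define R where "R y = 1 / ((y - a) * (b - y))" for y
  define d where "d = a + b - 2 * x"
  define \<rho> where "\<rho> = R x"
  define r where "r = (x - a) * (b - x)"
  have r: "0 < r" "r * \<rho> = 1" using True by (auto simp: r_def \<rho>_def R_def)
  have q: "poly q x = r" "poly q' x = d"
    by (simp_all add: q_def q'_def r_def d_def algebra_simps)
  have "((\<lambda>y. (y - a) * (b - y)) has_real_derivative d) (at x)"
    unfolding d_def by (auto intro!: derivative_eq_intros)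
  from DERIV_inverse_fun[OF this] r True
  have DR: "(R has_real_derivative - (d * \<rho>\<^sup>2)) (at x)"
    unfolding R_def \<rho>_def r_def by (simp add: power2_eq_square divide_inverse)
  have D: "((\<lambda>x. poly P x * R x ^ k * exp (- (R x / c))) has_real_derivative
      poly (pderiv P) x * \<rho> ^ k * exp (- (\<rho> / c)) - poly P x * (of_nat k * \<rho> ^ (k - 1) * \<rho>\<^sup>2) * d * exp (- (\<rho> / c))
      + poly P x * \<rho> ^ k * (exp (- (\<rho> / c)) * (d * \<rho>\<^sup>2 / c))) (at x)"
    unfolding \<rho>_def
    using assms(2) by (auto intro!: derivative_eq_intros DR[unfolded \<rho>_def] simp: algebra_simps)
  have E: "poly (pderiv P) x * \<rho> ^ k * exp (- (\<rho> / c)) - poly P x * (of_nat k * \<rho> ^ (k - 1) * \<rho>\<^sup>2) * d * exp (- (\<rho> / c))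
      + poly P x * \<rho> ^ k * (exp (- (\<rho> / c)) * (d * \<rho>\<^sup>2 / c)) = bump a b c ?Q (k + 2) x"
  proof -
    have 1: "of_nat k * \<rho> ^ (k - 1) * \<rho>\<^sup>2 = of_nat k * (\<rho> ^ k * \<rho>)"
      by (cases k) (auto simp: power2_eq_square)
    have 2: "r\<^sup>2 * \<rho> ^ (k + 2) = \<rho> ^ k" "r * \<rho> ^ (k + 2) = \<rho> ^ k * \<rho>"
    proof -
      have "r\<^sup>2 * \<rho> ^ (k + 2) = (r * \<rho>)\<^sup>2 * \<rho> ^ k" by (simp add: power_add power2_eq_square)
      then show "r\<^sup>2 * \<rho> ^ (k + 2) = \<rho> ^ k" using r by simp
      have "r * \<rho> ^ (k + 2) = (r * \<rho>) * (\<rho> ^ k * \<rho>)" by (simp add: power_add power2_eq_square)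
      then show "r * \<rho> ^ (k + 2) = \<rho> ^ k * \<rho>" using r by simp
    qed
    have "bump a b c ?Q (k + 2) x = (poly (pderiv P) x * r\<^sup>2 - of_nat k * (poly P x * d * r)
       + (1 / c) * (poly P x * d)) * \<rho> ^ (k + 2) * exp (- (\<rho> / c))"
      using True by (simp add: bump_def \<rho>_def R_def q of_nat_poly)
    also have "\<dots> = (poly (pderiv P) x * (r\<^sup>2 * \<rho> ^ (k + 2)) - of_nat k * (poly P x * d * (r * \<rho> ^ (k + 2)))
       + (1 / c) * (poly P x * d * \<rho> ^ (k + 2))) * exp (- (\<rho> / c))"
    proof -
      have "(A * s - K * (B * t) + C * D) * Z * E = (A * (s * Z) - K * (B * (t * Z)) + C * (D * Z)) * E"
        for A s K B t C D Z E :: real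
        by algebra
      then show ?thesis .
    qed
    also have "\<dots> = poly (pderiv P) x * \<rho> ^ k * exp (- (\<rho> / c)) - poly P x * (of_nat k * \<rho> ^ (k - 1) * \<rho>\<^sup>2) * d * exp (- (\<rho> / c))
      + poly P x * \<rho> ^ k * (exp (- (\<rho> / c)) * (d * \<rho>\<^sup>2 / c))"
      unfolding 1 2 unfolding power_add by (simp add: algebra_simps)
    finally show ?thesis by simp
  qed
  have "((\<lambda>x. poly P x * R x ^ k * exp (- (R x / c))) has_real_derivative bump a b c ?Q (k + 2) x) (at x)"
    using D unfolding E .
  moreover have "\<forall>\<^sub>F y in nhds x. bump a b c P k y = poly P y * R y ^ k * exp (- (R y / c))"
  proof -
    have "\<forall>\<^sub>F y in nhds x. y \<in> {a<..<b}" using True by (intro eventually_nhds_in_open) auto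
    then show ?thesis by eventually_elim (auto simp: bump_def R_def)
  qed
  ultimately show ?thesis by (subst DERIV_cong_ev[OF refl _ refl]) auto
next
  case False
  have "bounded (poly P ` {a..b})"
    by (intro compact_imp_bounded compact_continuous_image continuous_intros) auto
  then obtain M where M: "\<And>x. x \<in> {a..b} \<Longrightarrow> \<bar>poly P x\<bar> \<le> M"
    by (metis bounded_iff imageI real_norm_def)
  have M0: "0 \<le> M" using M[of a] assms(1) by auto
  have "\<bar>bump a b c P k y - bump a b c P k x\<bar> \<le> (M * (fact (k + 2) * c ^ (k + 2)) * (b - a)\<^sup>2) * \<bar>y - x\<bar>\<^sup>2" for y
  proof (cases "a < y \<and> y < b")
    case True
    define r where "r = (y - a) * (b - y)"
    have r: "0 < r" using True by (simp add: r_def)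
    have "r \<le> (b - a) * \<bar>y - x\<bar>"
    proof (cases "x \<le> a")
      case True
      have "(y - a) * (b - y) \<le> \<bar>y - x\<bar> * (b - a)"
        using True \<open>a < y \<and> y < b\<close> by (intro mult_mono) auto
      then show ?thesis by (simp add: r_def mult.commute)
    next
      case False
      then have "b \<le> x" using \<open>\<not> (a < x \<and> x < b)\<close> by auto
      then have "(y - a) * (b - y) \<le> (b - a) * \<bar>y - x\<bar>"
        using \<open>a < y \<and> y < b\<close> by (intro mult_mono) auto
      then show ?thesis by (simp add: r_def)
    qed
    then have r2: "r\<^sup>2 \<le> (b - a)\<^sup>2 * \<bar>y - x\<bar>\<^sup>2"
      using r power_mono[of r "(b - a) * \<bar>y - x\<bar>" 2] by (simp add: power_mult_distrib)
    \<comment> \<open>Two extra powers of 1 / r are bounded as well. They leave a factor r^2, which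
      is at most a multiple of |y - x|^2.\<close>
    have "(1 / r) ^ (k + 2) * exp (- ((1 / r) / c)) \<le> fact (k + 2) * c ^ (k + 2)"
      using r assms(2) by (intro power_exp_bound) auto
    then have "(1 / r) ^ (k + 2) * exp (- ((1 / r) / c)) * r\<^sup>2 \<le> fact (k + 2) * c ^ (k + 2) * r\<^sup>2"
      by (intro mult_right_mono) auto
    moreover have "(1 / r) ^ (k + 2) * exp (- ((1 / r) / c)) * r\<^sup>2 = (1 / r) ^ k * exp (- (1 / (c * r)))"
      using r by (simp add: power_add power2_eq_square field_simps)
    ultimately have "(1 / r) ^ k * exp (- (1 / (c * r))) \<le> fact (k + 2) * c ^ (k + 2) * r\<^sup>2" by (simp only:)
    also have "\<dots> \<le> fact (k + 2) * c ^ (k + 2) * ((b - a)\<^sup>2 * \<bar>y - x\<bar>\<^sup>2)"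
      using assms(2) by (intro mult_left_mono[OF r2]) auto
    finally have 1: "(1 / r) ^ k * exp (- (1 / (c * r))) \<le> fact (k + 2) * c ^ (k + 2) * ((b - a)\<^sup>2 * \<bar>y - x\<bar>\<^sup>2)" .
    have "\<bar>bump a b c P k y - bump a b c P k x\<bar> = \<bar>poly P y\<bar> * ((1 / r) ^ k * exp (- (1 / (c * r))))"
      using True False r by (auto simp: bump_def r_def[symmetric] abs_mult)
    also have "\<dots> \<le> M * (fact (k + 2) * c ^ (k + 2) * ((b - a)\<^sup>2 * \<bar>y - x\<bar>\<^sup>2))"
      using r M[of y] True by (intro mult_mono[OF _ 1 M0]) simp_all
    finally show ?thesis by (simp only: mult.assoc)
  next
    case 2: False
    then show ?thesis using False M0 assms(2) by (auto simp: bump_def)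
  qed
  then have "(bump a b c P k has_real_derivative 0) (at x)" by (rule has_derivative_zeroI)
  moreover have "bump a b c ?Q (k + 2) x = 0" using False unfolding bump_def by (rule if_not_P)
  ultimately show ?thesis by (simp only:)
qed

lemma smooth_bump:
  assumes "a < b" "0 < c" shows "smooth (bump a b c P k)"
proof (rule smooth_closed[where S = "range (\<lambda>(P, k). bump a b c P k)"])
  fix f assume "f \<in> range (\<lambda>(P, k). bump a b c P k)"
  then obtain P k where f: "f = bump a b c P k" by auto
  show "\<exists>f'\<in>range (\<lambda>(P, k). bump a b c P k). \<forall>x. (f has_real_derivative f' x) (at x)"
    unfolding f by (rule bexI, rule allI, rule bump_deriv[OF assms]) auto
qed auto

lemma test_bump:
  assumes "a < b" "0 < c" shows "test_function (bump a b c P k)"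
  unfolding test_function_iff
proof (intro conjI smooth_bump[OF assms] exI[of _ "max \<bar>a\<bar> \<bar>b\<bar>"] allI impI)
  fix x assume "max \<bar>a\<bar> \<bar>b\<bar> < \<bar>x\<bar>"
  then have "\<not> (a < x \<and> x < b)" by (auto simp: abs_if split: if_splits)
  then show "bump a b c P k x = 0" by (auto simp: bump_def)
qed

lemma bump_bounds:
  assumes "0 < c" shows "0 \<le> bump a b c 1 0 x" "bump a b c 1 0 x \<le> indicator {a..b} x"
proof -
  have "0 \<le> bump a b c 1 0 x \<and> bump a b c 1 0 x \<le> indicator {a..b} x"
  proof (cases "a < x \<and> x < b")
    case True
    then have "0 < c * ((x - a) * (b - x))" using assms by simp
    then have "exp (- (1 / (c * ((x - a) * (b - x))))) \<le> 1" by simp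
    then show ?thesis using True by (simp add: bump_def)
  next
    case False
    then have "bump a b c 1 0 x = 0" unfolding bump_def by (rule if_not_P)
    then show ?thesis by simp
  qed
  then show "0 \<le> bump a b c 1 0 x" "bump a b c 1 0 x \<le> indicator {a..b} x" by auto
qed

section \<open>Functions that vanish when tested, and uniqueness of weak derivatives\<close>

text \<open>On a bounded window the positive and the negative part of \<open>m\<close> are densities
  of two finite measures. These agree on half-lines, hence everywhere, and so the densities agree
  almost everywhere.\<close>

lemma AE_zero_of_intervals:
  assumes m: "locally_integrable m"
    and z: "\<And>a b. a < b \<Longrightarrow> (LINT x|lborel. m x * indicator {a<..<b} x) = 0"
  shows "AE x in lborel. m x = 0"
proof -
  have [measurable]: "m \<in> borel_measurable lborel" by (rule locally_integrable_measurable[OF m])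
  have int: "integrable lborel (\<lambda>x. m x * indicator {a<..<b} x)" for a b :: real
  proof -
    have "set_integrable lborel {a..b} m" using m by (simp add: locally_integrable_def)
    then have "set_integrable lborel {a<..<b} m" by (rule set_integrable_subset) auto
    then show ?thesis by (simp add: set_integrable_def mult.commute)
  qed
  have "AE x in lborel. m x * indicator {- real N<..<real N} x = 0" for N :: nat
  proof -
    define v where "v x = m x * indicator {- real N<..<real N} x" for x
    have [measurable]: "v \<in> borel_measurable lborel" unfolding v_def by measurable
    have iv: "integrable lborel v" unfolding v_def by (rule int)
    let ?p = "\<lambda>x. ennreal (max 0 (v x))" and ?n = "\<lambda>x. ennreal (max 0 (- v x))"
    have ip: "integrable lborel (\<lambda>x. max 0 (v x) * indicator A x)" "integrable lborel (\<lambda>x. max 0 (- v x) * indicator A x)"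
      if "A \<in> sets borel" for A
      using iv that by (auto intro!: integrable_real_mult_indicator integrable_max)
    have em: "emeasure (density lborel ?p) A = ennreal (LINT x|lborel. max 0 (v x) * indicator A x)"
         "emeasure (density lborel ?n) A = ennreal (LINT x|lborel. max 0 (- v x) * indicator A x)"
         if "A \<in> sets borel" for A
      using that ip[OF that] by (auto simp: emeasure_density nn_integral_eq_integral[symmetric] indicator_def
          intro!: nn_integral_cong)
    have "density lborel ?p = density lborel ?n"
    proof (rule measure_eqI_lessThan)
      fix x :: real
      have s: "{x<..} \<in> sets borel" by simp
      have "(LINT y|lborel. v y * indicator {x<..} y) = 0"
      proof (cases "max x (- real N) < real N")
        case True
        have "v y * indicator {x<..} y = m y * indicator {max x (- real N)<..<real N} y" for y
          by (auto simp: v_def indicator_def)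
        then show ?thesis using z[OF True] by simp
      next
        case False
        then have "v y * indicator {x<..} y = 0" for y by (auto simp: v_def indicator_def)
        then show ?thesis by (simp only: integral_zero)
      qed
      moreover have "(LINT y|lborel. v y * indicator {x<..} y) =
        (LINT y|lborel. max 0 (v y) * indicator {x<..} y) - (LINT y|lborel. max 0 (- v y) * indicator {x<..} y)"
        by (subst Bochner_Integration.integral_diff[OF ip, symmetric])
          (auto intro!: Bochner_Integration.integral_cong simp: left_diff_distrib[symmetric] max_def)
      ultimately show "emeasure (density lborel ?p) {x<..} = emeasure (density lborel ?n) {x<..}"
        unfolding em(1)[OF s] em(2)[OF s] by simp
      show "emeasure (density lborel ?p) {x<..} < \<infinity>"
        unfolding em(1)[OF s] by simp
    qed auto
    then have "AE x in lborel. ?p x = ?n x"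
      using em(1)[of UNIV] by (subst (asm) finite_density_unique) (auto simp: emeasure_density)
    then show ?thesis
      by eventually_elim (auto simp: v_def[symmetric] max_def split: if_splits)
  qed
  then have "AE x in lborel. \<forall>N::nat. m x * indicator {- real N<..<real N} x = 0"
    unfolding AE_all_countable by blast
  then show ?thesis
  proof eventually_elim
    case (elim x)
    obtain N :: nat where "\<bar>x\<bar> < real N" using reals_Archimedean2 by blast
    then show ?case using elim[rule_format, of N] by (auto simp: indicator_def)
  qed
qed

text \<open>With c = n + 1 the bumps converge pointwise to the indicator of the open interval and
  stay below that of the closed one, so dominated convergence reduces the claim to
  intervals.\<close>

lemma AE_zero_of_test:
  assumes m: "locally_integrable m"
    and z: "\<And>a b c. a < b \<Longrightarrow> 0 < c \<Longrightarrow> (LINT x|lborel. m x * bump a b c 1 0 x) = 0"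
  shows "AE x in lborel. m x = 0"
proof (rule AE_zero_of_intervals[OF m])
  fix a b :: real assume ab: "a < b"
  have [measurable]: "m \<in> borel_measurable lborel" by (rule locally_integrable_measurable[OF m])
  have "(\<lambda>n. LINT x|lborel. m x * bump a b (Suc n) 1 0 x) \<longlonglongrightarrow> (LINT x|lborel. m x * indicator {a<..<b} x)"
  proof (rule integral_dominated_convergence)
    show "integrable lborel (\<lambda>x. \<bar>indicator {a..b} x *\<^sub>R m x\<bar>)"
      using m unfolding locally_integrable_def set_integrable_def by (intro integrable_abs) blast
    fix n
    have "continuous_on UNIV (bump a b (Suc n) 1 0)"
      by (rule smooth_continuous[OF smooth_bump]) (use ab in auto)
    then have [measurable]: "bump a b (Suc n) 1 0 \<in> borel_measurable lborel" by (rule borel_measurable_continuous)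
    show "(\<lambda>x. m x * bump a b (Suc n) 1 0 x) \<in> borel_measurable lborel" by measurable
    show "AE x in lborel. norm (m x * bump a b (Suc n) 1 0 x) \<le> \<bar>indicator {a..b} x *\<^sub>R m x\<bar>"
    proof (rule AE_I2, unfold real_norm_def)
      fix x
      have "\<bar>m x\<bar> * bump a b (Suc n) 1 0 x \<le> \<bar>m x\<bar> * indicator {a..b} x"
        by (intro mult_left_mono bump_bounds) auto
      then show "\<bar>m x * bump a b (Suc n) 1 0 x\<bar> \<le> \<bar>indicator {a..b} x *\<^sub>R m x\<bar>"
        using bump_bounds(1)[of "Suc n" a b x] by (simp add: abs_mult mult.commute)
    qed
  next
    show "AE x in lborel. (\<lambda>n. m x * bump a b (Suc n) 1 0 x) \<longlonglongrightarrow> m x * indicator {a<..<b} x"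
    proof (rule AE_I2)
      fix x :: real
      show "(\<lambda>n. m x * bump a b (Suc n) 1 0 x) \<longlonglongrightarrow> m x * indicator {a<..<b} x"
      proof (cases "a < x \<and> x < b")
        case True
        define r where "r = (x - a) * (b - x)"
        have "(\<lambda>n. inverse (real (Suc n)) * (1 / r)) \<longlonglongrightarrow> 0 * (1 / r)"
          by (intro tendsto_intros LIMSEQ_inverse_real_of_nat)
        then have "(\<lambda>n. exp (- (inverse (real (Suc n)) * (1 / r)))) \<longlonglongrightarrow> exp (- 0)"
          by (intro tendsto_intros) simp
        then have "(\<lambda>n. m x * exp (- (inverse (real (Suc n)) * (1 / r)))) \<longlonglongrightarrow> m x * 1"
          by (intro tendsto_intros) simp
        moreover have "bump a b (Suc n) 1 0 x = exp (- (inverse (real (Suc n)) * (1 / r)))" for n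
          using True by (simp add: bump_def r_def[symmetric] divide_inverse)
        moreover have "indicator {a<..<b} x = (1 :: real)" using True by simp
        ultimately show ?thesis by (simp only:)
      next
        case False
        then have "bump a b (Suc n) 1 0 x = 0" for n unfolding bump_def by (rule if_not_P)
        moreover have "indicator {a<..<b} x = (0 :: real)" using False by (simp add: indicator_def)
        ultimately show ?thesis by simp
      qed
    qed
  qed auto
  then show "(LINT x|lborel. m x * indicator {a<..<b} x) = 0"
    using z[OF ab] by (simp add: LIMSEQ_const_iff)
qed

lemma weak_deriv_unique:
  assumes "has_weak_deriv g h" "has_weak_deriv g h'"
  shows "AE x in lborel. h x = h' x"
proof -
  have li: "locally_integrable h" "locally_integrable h'" using assms by (auto simp: has_weak_deriv_def)
  have "AE x in lborel. h x - h' x = 0"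
  proof (rule AE_zero_of_test)
    show "locally_integrable (\<lambda>x. h x - h' x)" using li by (rule locally_integrable_add)
    fix a b c :: real assume "a < b" "0 < c"
    then have t: "test_function (bump a b c 1 0)" by (rule test_bump)
    have "(LINT x|lborel. g x * deriv (bump a b c 1 0) x) = - (LINT x|lborel. h x * bump a b c 1 0 x)"
      "(LINT x|lborel. g x * deriv (bump a b c 1 0) x) = - (LINT x|lborel. h' x * bump a b c 1 0 x)"
      using assms t unfolding has_weak_deriv_def by blast+
    then show "(LINT x|lborel. (h x - h' x) * bump a b c 1 0 x) = 0"
      unfolding left_diff_distrib
        Bochner_Integration.integral_diff[OF integrable_test(1)[OF li(1) t] integrable_test(1)[OF li(2) t]]
      by simp
  qed
  then show ?thesis by eventually_elim simp
qed

lemma weak_deriv_props: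
  assumes "has_weak_deriv g h"
  shows "has_weak_deriv g (weak_deriv g)" "AE x in lborel. weak_deriv g x = h x"
proof -
  show 1: "has_weak_deriv g (weak_deriv g)"
    unfolding weak_deriv_def using assms by (rule someI[of "has_weak_deriv g"])
  show "AE x in lborel. weak_deriv g x = h x" by (rule weak_deriv_unique[OF 1 assms])
qed

lemma has_weak_deriv_diff:
  assumes "has_weak_deriv g h" "has_weak_deriv g' h'"
  shows "has_weak_deriv (\<lambda>x. g x - g' x) (\<lambda>x. h x - h' x)"
  unfolding has_weak_deriv_def
proof (intro conjI allI impI)
  show "locally_integrable (\<lambda>x. g x - g' x)" "locally_integrable (\<lambda>x. h x - h' x)"
    using assms by (auto simp: has_weak_deriv_def intro: locally_integrable_add)
  fix \<phi> assume t: "test_function \<phi>"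
  have li: "locally_integrable g" "locally_integrable g'" "locally_integrable h" "locally_integrable h'"
    using assms by (auto simp: has_weak_deriv_def)
  have "(LINT x|lborel. g x * deriv \<phi> x) = - (LINT x|lborel. h x * \<phi> x)"
    "(LINT x|lborel. g' x * deriv \<phi> x) = - (LINT x|lborel. h' x * \<phi> x)"
    using assms t unfolding has_weak_deriv_def by blast+
  then show "(LINT x|lborel. (g x - g' x) * deriv \<phi> x) = - (LINT x|lborel. (h x - h' x) * \<phi> x)"
    unfolding left_diff_distrib
      Bochner_Integration.integral_diff[OF integrable_test(1)[OF li(3) t] integrable_test(1)[OF li(4) t]]
      Bochner_Integration.integral_diff[OF integrable_test(2)[OF li(1) t] integrable_test(2)[OF li(2) t]]
    by simp
qed

section \<open>Primitives as representatives of Sobolev functions\<close>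

text \<open>Local absolute continuity in integrated form. In contrast to
  \<open>has_weak_deriv\<close> it is a property of the values of \<open>g\<close> and so selects
  the continuous representative of its class.\<close>

definition density_of :: "(real \<Rightarrow> real) \<Rightarrow> (real \<Rightarrow> real) \<Rightarrow> bool" where
  "density_of h g \<longleftrightarrow> locally_integrable h \<and> (\<forall>x y. x \<le> y \<longrightarrow> g y - g x = (LINT s:{x..y}|lborel. h s))"

lemma density_of_continuous:
  assumes "density_of h g" shows "continuous_on UNIV g"
proof -
  have "isCont g x" for x
  proof -
    let ?a = "x - 1" and ?b = "x + 1"
    have si: "set_integrable lborel {?a..y} h" for y
      using assms by (simp add: density_of_def locally_integrable_def)
    have "continuous_on {?a..?b} (\<lambda>y. g ?a + integral {?a..y} h)"
      using si set_borel_integral_eq_integral(1)[OF si]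
      by (intro continuous_intros indefinite_integral_continuous_1) auto
    moreover have "g ?a + integral {?a..y} h = g y" if "y \<in> {?a..?b}" for y
    proof -
      have "g y - g ?a = (LINT s:{?a..y}|lborel. h s)" using assms that unfolding density_of_def by simp
      also have "\<dots> = integral {?a..y} h" by (rule set_borel_integral_eq_integral(2)[OF si])
      finally show ?thesis by simp
    qed
    ultimately have "continuous_on {?a..?b} g" by (subst (asm) continuous_on_cong[OF refl]) auto
    then show "isCont g x" by (rule continuous_on_interior) auto
  qed
  then show ?thesis by (simp add: continuous_at_imp_continuous_on)
qed

lemma integrable_product:
  fixes f g :: "real \<Rightarrow> real"
  assumes "integrable lborel f" "integrable lborel g"
  shows "integrable (lborel \<Otimes>\<^sub>M lborel) (\<lambda>(x, y). f x * g y)"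
proof (rule lborel_pair.Fubini_integrable)
  have [measurable]: "f \<in> borel_measurable borel" "g \<in> borel_measurable borel"
    using assms by (auto dest: borel_measurable_integrable)
  show "(\<lambda>(x, y). f x * g y) \<in> borel_measurable (lborel \<Otimes>\<^sub>M lborel)" by measurable
  show "integrable lborel (\<lambda>x. LINT y|lborel. norm (case (x, y) of (x, y) \<Rightarrow> f x * g y))"
    using assms by (simp add: abs_mult)
  show "AE x in lborel. integrable lborel (\<lambda>y. case (x, y) of (x, y) \<Rightarrow> f x * g y)"
    using assms by simp
qed

text \<open>Integration by parts as an exchange of integrals: both sides are iterated integrals of
  h(s) \<phi>'(x) over the triangle s \<le> x.\<close>

lemma density_of_has_weak_deriv:
  assumes "density_of h g" shows "has_weak_deriv g h"
  unfolding has_weak_deriv_def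
proof (intro conjI allI impI)
  have li: "locally_integrable h" using assms by (simp add: density_of_def)
  have gc: "continuous_on UNIV g" by (rule density_of_continuous[OF assms])
  show "locally_integrable h" by fact
  show lg: "locally_integrable g" by (rule locally_integrable_continuous[OF gc])
  fix \<phi> assume t: "test_function \<phi>"
  note T = test_functionD[OF t]
  obtain R0 where R0: "0 < R0" "\<And>x. \<bar>x\<bar> > R0 \<Longrightarrow> \<phi> x = 0 \<and> deriv \<phi> x = 0" using T(4) by blast
  \<comment> \<open>Beyond \<open>R0\<close>, so that the test function also vanishes at the end
    points \<open>R\<close> and \<open>- R\<close> themselves.\<close>
  define R where "R = R0 + 1"
  have R: "0 < R" "\<phi> R = 0" "\<phi> (- R) = 0" "\<And>x. \<bar>x\<bar> > R \<Longrightarrow> \<phi> x = 0 \<and> deriv \<phi> x = 0"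
    using R0 by (auto simp: R_def)
  let ?d = "deriv \<phi>" and ?I = "\<lambda>x. indicator {-R..R} x :: real"
  have ftc: "(LINT x|lborel. ?d x * indicator {a..b} x) = \<phi> b - \<phi> a" if "a \<le> b" for a b
    using that T(1,3) by (intro integral_FTC_Icc_real) (auto simp: continuous_on_eq_continuous_at)
  define hI where "hI s = indicator {-R..R} s *\<^sub>R h s" for s
  have hI: "integrable lborel hI"
    using li unfolding hI_def locally_integrable_def set_integrable_def by blast
  have dI: "integrable lborel (\<lambda>x. ?d x * ?I x)"
    using borel_integrable_atLeastAtMost'[OF continuous_on_subset[OF T(3)], of "-R" R]
    by (simp add: set_integrable_def mult.commute)
  have [measurable]: "hI \<in> borel_measurable borel" "?d \<in> borel_measurable borel"
    using hI borel_measurable_continuous_onI[OF T(3)] by (auto dest: borel_measurable_integrable)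
  define K where "K s x = (if s \<le> x then hI s * (?d x * ?I x) else 0)" for s x
  have Kint: "integrable (lborel \<Otimes>\<^sub>M lborel) (\<lambda>(s, x). K s x)"
  proof (rule Bochner_Integration.integrable_bound[OF integrable_product[OF hI dI]])
    show "(\<lambda>(s, x). K s x) \<in> borel_measurable (lborel \<Otimes>\<^sub>M lborel)"
      unfolding K_def by measurable
  qed (auto simp: K_def)
  have "(LINT x|lborel. LINT s|lborel. K s x) = (LINT s|lborel. LINT x|lborel. K s x)"
    by (rule lborel_pair.Fubini_integral[OF Kint])
  moreover have "(LINT x|lborel. K s x) = - (h s * \<phi> s)" for s
  proof (cases "s \<in> {-R..R}")
    case True
    have "K s x = h s * (?d x * indicator {s..R} x)" for x
      using True by (auto simp: K_def hI_def indicator_def)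
    then have "(LINT x|lborel. K s x) = h s * (LINT x|lborel. ?d x * indicator {s..R} x)" by simp
    then show ?thesis using ftc[of s R] True R by simp
  next
    case False
    then have "K s x = 0" for x by (simp add: K_def hI_def)
    moreover have "\<phi> s = 0" using False R(4)[of s] unfolding atLeastAtMost_iff by linarith
    ultimately show ?thesis by simp
  qed
  moreover have "(LINT s|lborel. K s x) = (g x - g (- R)) * (?d x * ?I x)" for x
  proof (cases "x \<in> {-R..R}")
    case True
    have "K s x = (indicator {-R..x} s * h s) * (?d x * ?I x)" for s
      using True by (auto simp: K_def hI_def indicator_def)
    then have "(LINT s|lborel. K s x) = (LINT s:{-R..x}|lborel. h s) * (?d x * ?I x)"
      by (simp add: set_lebesgue_integral_def)
    then show ?thesis using assms True unfolding density_of_def by auto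
  next
    case False
    then have "K s x = 0" for s by (simp add: K_def)
    then show ?thesis using False by simp
  qed
  moreover have "(LINT x|lborel. (g x - g (- R)) * (?d x * ?I x)) = (LINT x|lborel. g x * ?d x)"
  proof -
    have "?d x * ?I x = ?d x" for x
      using R(4)[of x] by (cases "x \<in> {-R..R}") (auto simp: abs_if split: if_splits)
    then have "(LINT x|lborel. (g x - g (- R)) * (?d x * ?I x)) =
      (LINT x|lborel. g x * ?d x - g (- R) * (?d x * ?I x))" by (simp only: left_diff_distrib)
    also have "\<dots> = (LINT x|lborel. g x * ?d x) - (LINT x|lborel. g (- R) * (?d x * ?I x))"
      by (intro Bochner_Integration.integral_diff integrable_test(2)[OF lg t] integrable_mult_right dI)
    also have "(LINT x|lborel. g (- R) * (?d x * ?I x)) = 0"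
      using ftc[of "-R" R] R by simp
    finally show ?thesis by simp
  qed
  ultimately show "(LINT x|lborel. g x * ?d x) = - (LINT x|lborel. h x * \<phi> x)" by simp
qed

definition prim :: "(real \<Rightarrow> real) \<Rightarrow> real \<Rightarrow> real" where
  "prim h x = (LINT s:{..x}|lborel. h s)"

lemma prim_density:
  assumes h: "integrable lborel h" shows "density_of h (prim h)"
  unfolding density_of_def
proof (intro conjI allI impI locally_integrable_integrable h)
  fix x y :: real assume "x \<le> y"
  have si: "set_integrable lborel A h" if "A \<in> sets borel" for A
    using h that unfolding set_integrable_def by (intro integrable_mult_indicator) auto
  have "prim h y = (LINT s:{..x} \<union> {x<..y}|lborel. h s)"
    unfolding prim_def using \<open>x \<le> y\<close> by (intro arg_cong[where f = "\<lambda>A. LINT s:A|lborel. h s"]) auto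
  also have "\<dots> = prim h x + (LINT s:{x<..y}|lborel. h s)"
    unfolding prim_def by (rule set_integral_Un) (auto intro: si)
  also have "(LINT s:{x<..y}|lborel. h s) = (LINT s:{x..y}|lborel. h s)"
    unfolding set_lebesgue_integral_def
    by (rule integral_cong_AE)
      (use h AE_lborel_singleton[of x] in \<open>auto simp: indicator_def elim!: eventually_mono\<close>)
  finally show "prim h y - prim h x = (LINT s:{x..y}|lborel. h s)" by simp
qed

lemma prim_abs_le:
  assumes h: "integrable lborel h" shows "\<bar>prim h x\<bar> \<le> (LINT s|lborel. \<bar>h s\<bar>)"
proof -
  have "\<bar>prim h x\<bar> \<le> (LINT s|lborel. \<bar>indicator {..x} s *\<^sub>R h s\<bar>)"
    unfolding prim_def set_lebesgue_integral_def by (rule integral_abs_bound)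
  also have "\<dots> \<le> (LINT s|lborel. \<bar>h s\<bar>)"
    using h by (intro integral_mono integrable_abs integrable_mult_indicator) (auto simp: indicator_def)
  finally show ?thesis .
qed

lemma prim_at_minus_infinity:
  assumes h: "integrable lborel h" shows "(\<lambda>n. prim h (x - real n)) \<longlonglongrightarrow> 0"
proof -
  have [measurable]: "h \<in> borel_measurable borel" using h by (auto dest: borel_measurable_integrable)
  have "(\<lambda>n. LINT s|lborel. indicator {..x - real n} s *\<^sub>R h s) \<longlonglongrightarrow> integral\<^sup>L lborel (\<lambda>s::real. 0)"
  proof (rule integral_dominated_convergence[where w = "\<lambda>s. \<bar>h s\<bar>"])
    show "AE s in lborel. (\<lambda>n. indicator {..x - real n} s *\<^sub>R h s) \<longlonglongrightarrow> 0"
    proof (rule AE_I2, rule tendsto_eventually)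
      fix s
      obtain N :: nat where "x - s < real N" using reals_Archimedean2 by blast
      then show "\<forall>\<^sub>F n in sequentially. indicator {..x - real n} s *\<^sub>R h s = 0"
        unfolding eventually_sequentially by (intro exI[of _ N]) (auto simp: indicator_def)
    qed
  qed (use h in \<open>auto simp: indicator_def\<close>)
  then show ?thesis by (simp add: prim_def set_lebesgue_integral_def)
qed

lemma integral_lborel_shift:
  fixes f :: "real \<Rightarrow> real"
  shows "(LINT x|lborel. f (x + t)) = (LINT x|lborel. f x)" "integrable lborel (\<lambda>x. f (x + t)) \<longleftrightarrow> integrable lborel f"
  using lborel_integral_real_affine[of 1 f t] lborel_integrable_real_affine_iff[of 1 f t]
  by (simp_all add: add.commute)

text \<open>The difference m of \<open>g\<close> and the primitive has weak derivative 0. A bump and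
  its translate by n differ by the derivative of a test function, so m has the same integral against
  both. The integral against the translate tends to 0, since \<open>g\<close> is integrable and the
  primitive vanishes at minus infinity. This shows at once that m is constant and that the constant
  is 0.\<close>

lemma weak_deriv_primitive:
  assumes g: "integrable lborel g" and h: "integrable lborel h" and w: "has_weak_deriv g h"
  shows "AE x in lborel. g x = prim h x"
proof -
  let ?m = "\<lambda>x. g x - prim h x"
  note pd = prim_density[OF h]
  note pc = density_of_continuous[OF pd]
  have lim: "locally_integrable g" "locally_integrable (prim h)"
    using g pc by (auto intro: locally_integrable_integrable locally_integrable_continuous)
  have m: "has_weak_deriv ?m (\<lambda>x. h x - h x)"
    by (rule has_weak_deriv_diff[OF w density_of_has_weak_deriv[OF pd]])
  have "AE x in lborel. ?m x = 0"
  proof (rule AE_zero_of_test)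
    show "locally_integrable ?m" by (rule locally_integrable_add[OF lim])
    fix a b c :: real assume abc: "a < b" "0 < c"
    define \<psi> where "\<psi> = bump a b c 1 0"
    have t: "test_function \<psi>" unfolding \<psi>_def by (rule test_bump[OF abc])
    have \<psi>01: "0 \<le> \<psi> x" "\<psi> x \<le> 1" for x
      unfolding \<psi>_def
      by (rule bump_bounds(1)[OF abc(2)], rule order_trans[OF bump_bounds(2)[OF abc(2)] indicator_le_1])
    obtain R where R: "0 < R" "\<And>x. \<bar>x\<bar> > R \<Longrightarrow> \<psi> x = 0"
      using test_functionD(4)[OF t] by blast
    have \<psi>c: "continuous_on UNIV \<psi>" by (rule test_functionD(2)[OF t])
    define \<Psi> where "\<Psi> x = (LBINT y=0..ereal x. \<psi> y)" for x
    have D\<Psi>: "(\<Psi> has_real_derivative \<psi> x) (at x)" for x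
    proof -
      have "((\<lambda>u. LBINT y=0..ereal u. \<psi> y) has_vector_derivative \<psi> x) (at x within {-\<bar>x\<bar>-1..\<bar>x\<bar>+1})"
        unfolding zero_ereal_def
        by (rule interval_integral_FTC2) (auto intro: continuous_on_subset[OF \<psi>c])
      moreover have "at x within {-\<bar>x\<bar>-1..\<bar>x\<bar>+1} = at x"
        by (rule at_within_interior) auto
      ultimately show ?thesis
        unfolding \<Psi>_def has_real_derivative_iff_has_vector_derivative by simp
    qed
    have \<Psi>s: "smooth \<Psi>" by (rule smoothI[OF D\<Psi>]) (use t test_function_iff in blast)
    have "(LINT x|lborel. ?m x * \<psi> x) = (LINT x|lborel. ?m x * \<psi> (x + real n))" for n :: nat
    proof -
      \<comment> \<open>Neither primitive has compact support, but their difference does: if |x| > R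
        + n, the interval from x to x + n misses the support of \<open>\<psi>\<close>, where
        \<open>\<Psi>\<close> is constant.\<close>
      define \<phi> where "\<phi> x = \<Psi> x - \<Psi> (x + real n)" for x
      have "\<phi> x = 0" if x: "\<bar>x\<bar> > R + real n" for x
      proof (cases "n = 0")
        case False
        then obtain z where z: "x < z" "z < x + real n" "\<Psi> (x + real n) - \<Psi> x = (x + real n - x) * \<psi> z"
          using MVT2[of x "x + real n" \<Psi> \<psi>] D\<Psi> by auto
        then have "\<bar>z\<bar> > R" using x by linarith
        then show ?thesis using z R(2) by (simp add: \<phi>_def)
      qed (simp add: \<phi>_def)
      then have tp: "test_function \<phi>"
        unfolding test_function_iff using smooth_diff_shift[OF \<Psi>s] unfolding \<phi>_def by blast
      have "(\<phi> has_real_derivative \<psi> x - \<psi> (x + real n)) (at x)" for x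
        unfolding \<phi>_def using D\<Psi>[of "x + real n"] by (intro DERIV_diff D\<Psi>) (simp add: DERIV_shift)
      then have "deriv \<phi> = (\<lambda>x. \<psi> x - \<psi> (x + real n))" by (intro ext DERIV_imp_deriv)
      moreover have "(LINT x|lborel. ?m x * deriv \<phi> x) = - (LINT x|lborel. (h x - h x) * \<phi> x)"
        using m tp unfolding has_weak_deriv_def by blast
      ultimately have "(LINT x|lborel. ?m x * \<psi> x - ?m x * \<psi> (x + real n)) = 0"
        by (simp add: right_diff_distrib)
      moreover have "integrable lborel (\<lambda>x. ?m x * \<psi> x)"
        by (rule integrable_test(1)[OF locally_integrable_add(2)[OF lim] t])
      moreover have "integrable lborel (\<lambda>x. ?m x * \<psi> (x + real n))"
      proof (rule integrable_locally_mult[OF locally_integrable_add(2)[OF lim]])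
        show "continuous_on UNIV (\<lambda>x. \<psi> (x + real n))"
          by (intro continuous_on_compose2[OF \<psi>c] continuous_intros) auto
        show "\<psi> (x + real n) = 0" if "\<bar>x\<bar> > R + real n" for x using that by (intro R(2)) linarith
      qed
      ultimately show ?thesis by (subst (asm) Bochner_Integration.integral_diff) auto
    qed
    moreover have "(\<lambda>n. LINT x|lborel. ?m x * \<psi> (x + real n)) \<longlonglongrightarrow> 0"
    proof -
      have [measurable]: "g \<in> borel_measurable borel" "\<psi> \<in> borel_measurable borel" "prim h \<in> borel_measurable borel"
        using g borel_measurable_continuous_onI[OF \<psi>c] borel_measurable_continuous_onI[OF pc]
        by (auto dest: borel_measurable_integrable)
      have 1: "(\<lambda>n. LINT x|lborel. g x * \<psi> (x + real n)) \<longlonglongrightarrow> integral\<^sup>L lborel (\<lambda>s::real. 0)"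
      proof (rule integral_dominated_convergence[where w = "\<lambda>x. \<bar>g x\<bar>"])
        show "AE x in lborel. (\<lambda>n. g x * \<psi> (x + real n)) \<longlonglongrightarrow> 0"
        proof (rule AE_I2, rule tendsto_eventually)
          fix x
          obtain N :: nat where "R - x < real N" using reals_Archimedean2 by blast
          then show "\<forall>\<^sub>F n in sequentially. g x * \<psi> (x + real n) = 0"
            unfolding eventually_sequentially by (intro exI[of _ N]) (auto intro!: R(2))
        qed
        show "AE x in lborel. norm (g x * \<psi> (x + real n)) \<le> \<bar>g x\<bar>" for n
          using \<psi>01 by (intro AE_I2) (simp add: abs_mult mult_left_le)
      qed (use g in auto)
      have 2: "(\<lambda>n. LINT x|lborel. prim h (x - real n) * \<psi> x) \<longlonglongrightarrow> integral\<^sup>L lborel (\<lambda>s::real. 0)"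
      proof (rule integral_dominated_convergence[where w = "\<lambda>x. (LINT s|lborel. \<bar>h s\<bar>) * \<psi> x"])
        show "integrable lborel (\<lambda>x. (LINT s|lborel. \<bar>h s\<bar>) * \<psi> x)"
          using integrable_test(1)[OF locally_integrable_continuous t, of "\<lambda>_. 1"] by simp
        show "AE x in lborel. (\<lambda>n. prim h (x - real n) * \<psi> x) \<longlonglongrightarrow> 0"
          by (rule AE_I2, rule tendsto_mult_left_zero, rule prim_at_minus_infinity[OF h])
        show "AE x in lborel. norm (prim h (x - real n) * \<psi> x) \<le> (LINT s|lborel. \<bar>h s\<bar>) * \<psi> x" for n
          using \<psi>01 prim_abs_le[OF h] by (intro AE_I2) (simp add: abs_mult mult_right_mono)
      qed auto
      have "(LINT x|lborel. ?m x * \<psi> (x + real n)) = (LINT x|lborel. g x * \<psi> (x + real n)) - (LINT x|lborel. prim h (x - real n) * \<psi> x)" for n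
      proof -
        have ct: "continuous_on UNIV (\<lambda>x. \<psi> (x + real n))"
          by (intro continuous_on_compose2[OF \<psi>c] continuous_intros) auto
        have z: "\<psi> (x + real n) = 0" if "\<bar>x\<bar> > R + real n" for x using that by (intro R(2)) linarith
        have "(LINT x|lborel. ?m x * \<psi> (x + real n)) =
           (LINT x|lborel. g x * \<psi> (x + real n)) - (LINT x|lborel. prim h x * \<psi> (x + real n))"
          unfolding left_diff_distrib
          by (intro Bochner_Integration.integral_diff integrable_locally_mult[OF lim(1) ct z]
              integrable_locally_mult[OF lim(2) ct z])
        also have "(LINT x|lborel. prim h x * \<psi> (x + real n)) = (LINT x|lborel. prim h (x - real n) * \<psi> x)"
          using integral_lborel_shift(1)[of "\<lambda>x. prim h (x - real n) * \<psi> x" "real n"] by simp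
        finally show ?thesis .
      qed
      then show ?thesis using tendsto_diff[OF 1 2] by simp
    qed
    ultimately show "(LINT x|lborel. ?m x * bump a b c 1 0 x) = 0"
      unfolding \<psi>_def by (simp add: LIMSEQ_const_iff)
  qed
  then show ?thesis by eventually_elim simp
qed

section \<open>Continuity of translations\<close>

text \<open>Enclose \<open>A\<close> between a closed \<open>C\<close> and an open \<open>U\<close>
  with \<open>U - C\<close> small. If the indicators at x and x + t differ, then one of the two
  points lies in \<open>U - C\<close>, or one lies in \<open>C\<close> while the other has left
  \<open>U\<close>. The last event has vanishing measure by dominated convergence, because
  \<open>U\<close> is open.\<close>

lemma L1_translation_indicator:
  fixes t :: "nat \<Rightarrow> real"
  assumes A: "A \<in> sets lborel" "emeasure lborel A < \<infinity>" and t: "t \<longlonglongrightarrow> 0"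
  shows "(\<lambda>n. LINT x|lborel. \<bar>indicator A (x + t n) - indicator A x :: real\<bar>) \<longlonglongrightarrow> 0"
proof (rule LIMSEQ_I)
  fix r :: real assume r: "0 < r"
  \<comment> \<open>Two copies of the measure of \<open>U - C\<close>, at most \<open>2 * e\<close>
    each, and a leakage below \<open>e\<close> make \<open>5 * e\<close>.\<close>
  define e where "e = r / 6"
  have e: "0 < e" using r by (simp add: e_def)
  have AL: "A \<in> sets lebesgue" using A(1) by simp
  obtain U where U: "open U" "A \<subseteq> U" "emeasure lebesgue (U - A) < ennreal e"
    using sets_lebesgue_outer_open[OF AL e] by metis
  obtain C where C: "closed C" "C \<subseteq> A" "emeasure lebesgue (A - C) < ennreal e"
    using sets_lebesgue_inner_closed[OF AL e] by metis
  have [measurable]: "A \<in> sets borel" "U \<in> sets borel" "C \<in> sets borel" using A U C by auto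
  have UC: "U - C \<in> sets borel" by auto
  have eUC: "emeasure lborel (U - C) \<le> ennreal (2 * e)"
  proof -
    have "U - C = (U - A) \<union> (A - C)" using U C by auto
    then have "emeasure lborel (U - C) \<le> emeasure lborel (U - A) + emeasure lborel (A - C)"
      by (metis emeasure_subadditive UC \<open>A \<in> sets borel\<close> \<open>U \<in> sets borel\<close> \<open>C \<in> sets borel\<close> sets.Diff sets_lborel)
    also have "\<dots> \<le> ennreal e + ennreal e"
      using U(3) C(3) A(1) \<open>U \<in> sets borel\<close> \<open>C \<in> sets borel\<close> by (intro add_mono) (auto simp: less_imp_le)
    also have "\<dots> = ennreal (2 * e)" using e by (simp flip: ennreal_plus)
    finally show ?thesis .
  qed
  have iUC: "integrable lborel (indicator (U - C) :: real \<Rightarrow> real)"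
    using eUC UC by (auto intro!: integrable_real_indicator simp: ennreal_less_top order_le_less_trans)
  have mUC: "(LINT x|lborel. indicator (U - C) x :: real) \<le> 2 * e"
  proof -
    have "measure lborel (U - C) \<le> 2 * e"
      unfolding measure_def using eUC e by (intro enn2real_leI) auto
    then show ?thesis using UC by simp
  qed
  have iC: "integrable lborel (indicator C :: real \<Rightarrow> real)"
  proof (rule integrable_real_indicator)
    show "emeasure lborel C < \<infinity>" using A C emeasure_mono[of C A lborel] by (auto intro: le_less_trans)
  qed auto
  have leak: "(\<lambda>n. LINT x|lborel. indicator C x * (1 - indicator U (x + s n)) :: real) \<longlonglongrightarrow> 0"
    if s: "s \<longlonglongrightarrow> 0" for s :: "nat \<Rightarrow> real"
  proof -
    have "(\<lambda>n. LINT x|lborel. indicator C x * (1 - indicator U (x + s n)) :: real) \<longlonglongrightarrow> integral\<^sup>L lborel (\<lambda>x::real. 0)"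
    proof (rule integral_dominated_convergence[where w = "indicator C"])
      show "AE x in lborel. (\<lambda>n. indicator C x * (1 - indicator U (x + s n)) :: real) \<longlonglongrightarrow> 0"
      proof (rule AE_I2, rule tendsto_eventually)
        fix x :: real
        show "\<forall>\<^sub>F n in sequentially. indicator C x * (1 - indicator U (x + s n)) = (0::real)"
        proof (cases "x \<in> C")
          case True
          then have "x \<in> U" using U C by auto
          have "(\<lambda>n. x + s n) \<longlonglongrightarrow> x + 0" by (intro tendsto_intros s)
          then have "\<forall>\<^sub>F n in sequentially. x + s n \<in> U"
            using U(1) \<open>x \<in> U\<close> by (simp add: tendsto_def)
          then show ?thesis by eventually_elim simp
        qed simp
      qed
      show "AE x in lborel. norm (indicator C x * (1 - indicator U (x + s n)) :: real) \<le> indicator C x" for n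
        by (intro AE_I2) (auto simp: indicator_def)
    qed (use iC in auto)
    then show ?thesis by simp
  qed
  have t': "(\<lambda>n. - t n) \<longlonglongrightarrow> 0" using tendsto_minus[OF t] by simp
  have "(\<lambda>n. (LINT x|lborel. indicator C x * (1 - indicator U (x + t n)) :: real)
      + (LINT x|lborel. indicator C x * (1 - indicator U (x + - t n)) :: real)) \<longlonglongrightarrow> 0 + 0"
    by (intro tendsto_add leak t t')
  from LIMSEQ_D[OF this e] obtain N where N: "\<And>n. n \<ge> N \<Longrightarrow> norm ((LINT x|lborel. indicator C x * (1 - indicator U (x + t n)) :: real)
      + (LINT x|lborel. indicator C x * (1 - indicator U (x + - t n)) :: real) - (0 + 0)) < e"
    by blast
  have "norm ((LINT x|lborel. \<bar>indicator A (x + t n) - indicator A x :: real\<bar>) - 0) < r" if "n \<ge> N" for n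
  proof -
    let ?L1 = "\<lambda>x. indicator C x * (1 - indicator U (x + t n)) :: real"
    let ?L2 = "\<lambda>x. indicator C x * (1 - indicator U (x + - t n)) :: real"
    let ?W = "indicator (U - C) :: real \<Rightarrow> real"
    have iL: "integrable lborel (\<lambda>x. indicator C x * (1 - indicator U (x + s)) :: real)" for s
      by (rule Bochner_Integration.integrable_bound[OF iC]) (auto simp: indicator_def)
    have i2: "integrable lborel (\<lambda>x. ?L2 (x + t n))" "integrable lborel (\<lambda>x. ?W (x + t n))"
      unfolding integral_lborel_shift(2)[where f = ?L2] integral_lborel_shift(2)[where f = ?W] by (rule iL iUC)+
    have "(LINT x|lborel. \<bar>indicator A (x + t n) - indicator A x :: real\<bar>) \<le>
       (LINT x|lborel. (?W x + ?W (x + t n)) + (?L1 x + ?L2 (x + t n)))"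
    proof (rule integral_mono')
      show "integrable lborel (\<lambda>x. (?W x + ?W (x + t n)) + (?L1 x + ?L2 (x + t n)))"
        by (intro Bochner_Integration.integrable_add iUC i2 iL)
      show "\<bar>indicator A (x + t n) - indicator A x :: real\<bar> \<le> (?W x + ?W (x + t n)) + (?L1 x + ?L2 (x + t n))" for x
        using U(2) C(2) by (auto simp: indicator_def)
    qed (auto simp: indicator_def)
    also have "\<dots> = ((LINT x|lborel. ?W x) + (LINT x|lborel. ?W (x + t n))) + ((LINT x|lborel. ?L1 x) + (LINT x|lborel. ?L2 (x + t n)))"
      using iUC i2 iL[of "t n"] by (simp only: Bochner_Integration.integral_add Bochner_Integration.integrable_add)
    also have "(LINT x|lborel. ?W (x + t n)) = (LINT x|lborel. ?W x)" by (rule integral_lborel_shift)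
    also have "(LINT x|lborel. ?L2 (x + t n)) = (LINT x|lborel. ?L2 x)" by (rule integral_lborel_shift(1)[of ?L2])
    finally have "(LINT x|lborel. \<bar>indicator A (x + t n) - indicator A x :: real\<bar>) \<le> 5 * e"
      using N[OF that] mUC unfolding real_norm_def diff_0_right add_0_right abs_less_iff by linarith
    moreover have "0 \<le> (LINT x|lborel. \<bar>indicator A (x + t n) - indicator A x :: real\<bar>)" by simp
    ultimately show ?thesis using r unfolding e_def by simp
  qed
  then show "\<exists>no. \<forall>n\<ge>no. norm ((LINT x|lborel. \<bar>indicator A (x + t n) - indicator A x :: real\<bar>) - 0) < r" by blast
qed

text \<open>Quantifying over all null sequences inside the statement provides the induction
  hypothesis for each approximating function along the sequence at hand.\<close>

lemma L1_translation:
  fixes h :: "real \<Rightarrow> real"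
  assumes "integrable lborel h"
  shows "\<forall>t. t \<longlonglongrightarrow> 0 \<longrightarrow> (\<lambda>n. LINT x|lborel. \<bar>h (x + t n) - h x\<bar>) \<longlonglongrightarrow> 0"
  using assms
proof (induction rule: integrable_induct)
  case (base A c)
  show ?case
  proof (intro allI impI)
    fix t :: "nat \<Rightarrow> real" assume "t \<longlonglongrightarrow> 0"
    from tendsto_mult_right[OF L1_translation_indicator[OF base this], of "\<bar>c\<bar>"]
    show "(\<lambda>n. LINT x|lborel. \<bar>indicator A (x + t n) *\<^sub>R c - indicator A x *\<^sub>R c\<bar>) \<longlonglongrightarrow> 0"
      by (simp add: left_diff_distrib[symmetric] abs_mult)
  qed
next
  case (add f g)
  show ?case
  proof (intro allI impI)
    fix t :: "nat \<Rightarrow> real" assume t: "t \<longlonglongrightarrow> 0"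
    show "(\<lambda>n. LINT x|lborel. \<bar>f (x + t n) + g (x + t n) - (f x + g x)\<bar>) \<longlonglongrightarrow> 0"
    proof (rule tendsto_sandwich[where f = "\<lambda>_. 0"])
      show "(\<lambda>n. (LINT x|lborel. \<bar>f (x + t n) - f x\<bar>) + (LINT x|lborel. \<bar>g (x + t n) - g x\<bar>)) \<longlonglongrightarrow> 0"
        using add t by (intro tendsto_add_zero) auto
      have i: "integrable lborel (\<lambda>x. f (x + s))" "integrable lborel (\<lambda>x. g (x + s))" for s
        using add by (simp_all add: integral_lborel_shift(2))
      show "\<forall>\<^sub>F n in sequentially. (LINT x|lborel. \<bar>f (x + t n) + g (x + t n) - (f x + g x)\<bar>)
          \<le> (LINT x|lborel. \<bar>f (x + t n) - f x\<bar>) + (LINT x|lborel. \<bar>g (x + t n) - g x\<bar>)"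
      proof (rule always_eventually, rule allI)
        fix n
        have "(LINT x|lborel. \<bar>f (x + t n) + g (x + t n) - (f x + g x)\<bar>)
          \<le> (LINT x|lborel. \<bar>f (x + t n) - f x\<bar> + \<bar>g (x + t n) - g x\<bar>)"
          using i add by (intro integral_mono) auto
        also have "\<dots> = (LINT x|lborel. \<bar>f (x + t n) - f x\<bar>) + (LINT x|lborel. \<bar>g (x + t n) - g x\<bar>)"
          using i add by (intro Bochner_Integration.integral_add) auto
        finally show "(LINT x|lborel. \<bar>f (x + t n) + g (x + t n) - (f x + g x)\<bar>)
          \<le> (LINT x|lborel. \<bar>f (x + t n) - f x\<bar>) + (LINT x|lborel. \<bar>g (x + t n) - g x\<bar>)" .
      qed
    qed (auto intro!: always_eventually)
  qed
next
  case (lim f s)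
  have li: "integrable lborel (s i)" and lb: "norm (s i x) \<le> 2 * norm (f x)" and lf: "integrable lborel f"
    and lt: "(\<lambda>i. s i x) \<longlonglongrightarrow> f x"
    and lP: "t \<longlonglongrightarrow> 0 \<Longrightarrow> (\<lambda>n. LINT x|lborel. \<bar>s i (x + t n) - s i x\<bar>) \<longlonglongrightarrow> 0" for i x t
    using lim by auto
  have [measurable]: "f \<in> borel_measurable borel" "s i \<in> borel_measurable borel" for i
    using borel_measurable_integrable[OF lf] borel_measurable_integrable[OF li] by simp_all
  have L: "(\<lambda>i. LINT x|lborel. \<bar>s i x - f x\<bar>) \<longlonglongrightarrow> integral\<^sup>L lborel (\<lambda>x::real. 0)"
  proof (rule integral_dominated_convergence[where w = "\<lambda>x. 3 * \<bar>f x\<bar>"])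
    show "AE x in lborel. (\<lambda>i. \<bar>s i x - f x\<bar>) \<longlonglongrightarrow> 0"
    proof (rule AE_I2)
      fix x :: real
      have "(\<lambda>i. s i x - f x) \<longlonglongrightarrow> f x - f x" by (intro tendsto_intros lt)
      then show "(\<lambda>i. \<bar>s i x - f x\<bar>) \<longlonglongrightarrow> 0" by (simp add: tendsto_rabs_zero)
    qed
    show "AE x in lborel. norm \<bar>s i x - f x\<bar> \<le> 3 * \<bar>f x\<bar>" for i
    proof (rule AE_I2)
      fix x
      have "\<bar>s i x\<bar> \<le> 2 * \<bar>f x\<bar>" using lb[of i x] by simp
      then show "norm \<bar>s i x - f x\<bar> \<le> 3 * \<bar>f x\<bar>" by simp
    qed
  qed (use lf in auto)
  show ?case
  proof (intro allI impI)
    fix t :: "nat \<Rightarrow> real" assume t: "t \<longlonglongrightarrow> 0"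
    show "(\<lambda>n. LINT x|lborel. \<bar>f (x + t n) - f x\<bar>) \<longlonglongrightarrow> 0"
    proof (rule LIMSEQ_I)
      fix r :: real assume r: "0 < r"
      have r3: "0 < r / 3" using r by simp
      obtain i where i: "(LINT x|lborel. \<bar>s i x - f x\<bar>) < r / 3"
        using LIMSEQ_D[OF L r3] by fastforce
      from lP[OF t, of i] obtain N where N: "\<And>n. n \<ge> N \<Longrightarrow> (LINT x|lborel. \<bar>s i (x + t n) - s i x\<bar>) < r / 3"
        using LIMSEQ_D[OF _ r3] by fastforce
      have "(LINT x|lborel. \<bar>f (x + t n) - f x\<bar>) < r" if "n \<ge> N" for n
      proof -
        let ?d = "\<lambda>x. \<bar>s i x - f x\<bar>"
        have d: "integrable lborel ?d" using li lf by auto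
        have d': "integrable lborel (\<lambda>x. ?d (x + t n))"
          unfolding integral_lborel_shift(2)[where f = ?d] by (rule d)
        have sf: "integrable lborel (\<lambda>x. s i (x + t n))" "integrable lborel (\<lambda>x. f (x + t n))"
          using li lf by (simp_all add: integral_lborel_shift(2))
        have "(LINT x|lborel. \<bar>f (x + t n) - f x\<bar>) \<le> (LINT x|lborel. ?d (x + t n) + \<bar>s i (x + t n) - s i x\<bar> + ?d x)"
          using d d' sf li[of i] lf by (intro integral_mono) auto
        also have "\<dots> = (LINT x|lborel. ?d (x + t n)) + (LINT x|lborel. \<bar>s i (x + t n) - s i x\<bar>) + (LINT x|lborel. ?d x)"
          using d d' sf(1) li[of i] by simp
        also have "(LINT x|lborel. ?d (x + t n)) = (LINT x|lborel. ?d x)" by (rule integral_lborel_shift(1)[of ?d])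
        finally show ?thesis using i N[OF that] by linarith
      qed
      then show "\<exists>no. \<forall>n\<ge>no. norm ((LINT x|lborel. \<bar>f (x + t n) - f x\<bar>) - 0) < r" by (intro exI[of _ N]) simp
    qed
  qed
qed

section \<open>Convexity inequalities and translations in L^q\<close>

lemma powr_superadd:
  fixes a b q :: real
  assumes "0 \<le> b" "b \<le> a" "1 \<le> q"
  shows "(a - b) powr q \<le> a powr q - b powr q"
proof -
  have e: "x powr q = x * x powr (q - 1)" if "0 \<le> x" for x :: real
    using that powr_add[of x 1 "q - 1"] by (cases "x = 0") auto
  have "(a - b) * (a - b) powr (q - 1) + b * b powr (q - 1) \<le> (a - b) * a powr (q - 1) + b * a powr (q - 1)"
    using assms by (intro add_mono mult_left_mono powr_mono2) auto
  also have "\<dots> = a * a powr (q - 1)" by (simp add: algebra_simps)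
  finally show ?thesis using e[of "a - b"] e[of a] e[of b] assms by simp
qed

lemma powr_add_le:
  fixes a b q :: real
  assumes "0 \<le> q"
  shows "\<bar>a + b\<bar> powr q \<le> 2 powr q * (\<bar>a\<bar> powr q + \<bar>b\<bar> powr q)"
proof -
  have "\<bar>a + b\<bar> powr q \<le> (2 * max \<bar>a\<bar> \<bar>b\<bar>) powr q" using assms by (intro powr_mono2) auto
  also have "\<dots> = 2 powr q * (max \<bar>a\<bar> \<bar>b\<bar>) powr q" by (rule powr_mult)
  also have "(max \<bar>a\<bar> \<bar>b\<bar>) powr q \<le> \<bar>a\<bar> powr q + \<bar>b\<bar> powr q" by (auto simp: max_def)
  finally show ?thesis by simp
qed

text \<open>Reduces continuity of translations in L^q to L^1, applied to the signed power sgn h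
  |h|^q. For equal signs it is superadditivity of the power; for opposite signs the right-hand side
  is a sum of two powers.\<close>

lemma powr_diff_le_signed:
  fixes a b q :: real
  assumes "1 \<le> q"
  shows "\<bar>a - b\<bar> powr q \<le> 2 powr q * \<bar>sgn a * \<bar>a\<bar> powr q - sgn b * \<bar>b\<bar> powr q\<bar>"
proof -
  have pos: "\<bar>a - b\<bar> powr q \<le> 1 * \<bar>\<bar>a\<bar> powr q - \<bar>b\<bar> powr q\<bar>" if "0 \<le> a" "0 \<le> b" for a b :: real
    using that assms powr_superadd[of b a q] powr_superadd[of a b q]
    by (cases "b \<le> a") (auto simp: abs_minus_commute)
  have two: "1 \<le> 2 powr q" using assms by (simp add: ge_one_powr_ge_zero)
  have pos': "\<bar>a - b\<bar> powr q \<le> 2 powr q * \<bar>\<bar>a\<bar> powr q - \<bar>b\<bar> powr q\<bar>" if "0 \<le> a" "0 \<le> b" for a b :: real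
    using pos[OF that] mult_right_mono[OF two, of "\<bar>\<bar>a\<bar> powr q - \<bar>b\<bar> powr q\<bar>"] by simp
  have opp: "\<bar>a - b\<bar> powr q \<le> 2 powr q * (\<bar>a\<bar> powr q + \<bar>b\<bar> powr q)"
    using powr_add_le[of q a "- b"] assms by simp
  consider "0 < a" "0 < b" | "a < 0" "b < 0" | "a = 0 \<or> b = 0" | "0 < a" "b < 0" | "a < 0" "0 < b" by linarith
  then show ?thesis
  proof cases
    case 1
    then show ?thesis using pos'[of a b] by simp
  next
    case 2
    then show ?thesis using pos'[of "- a" "- b"] by (simp add: abs_minus_commute)
  next
    case 3
    have "\<bar>sgn x * \<bar>x\<bar> powr q\<bar> = \<bar>x\<bar> powr q" for x :: real by (simp add: abs_mult abs_sgn_eq)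
    then show ?thesis
      using 3 mult_right_mono[OF two, of "\<bar>a\<bar> powr q"] mult_right_mono[OF two, of "\<bar>b\<bar> powr q"] by auto
  next
    case 4
    then show ?thesis using opp by simp
  next
    case 5
    have "\<bar>- (\<bar>a\<bar> powr q) - \<bar>b\<bar> powr q\<bar> = \<bar>a\<bar> powr q + \<bar>b\<bar> powr q"
      using powr_ge_zero[of "\<bar>a\<bar>" q] powr_ge_zero[of "\<bar>b\<bar>" q] by linarith
    then show ?thesis using opp 5 by (simp del: abs_of_neg abs_of_pos)
  qed
qed

lemma Lq_translation:
  fixes h :: "real \<Rightarrow> real"
  assumes q: "1 \<le> q" and h: "h \<in> borel_measurable lborel" "integrable lborel (\<lambda>x. \<bar>h x\<bar> powr q)"
    and t: "t \<longlonglongrightarrow> 0"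
  shows "(\<lambda>n. LINT x|lborel. \<bar>h (x + t n) - h x\<bar> powr q) \<longlonglongrightarrow> 0"
proof -
  define H where "H x = sgn (h x) * \<bar>h x\<bar> powr q" for x
  have [measurable]: "h \<in> borel_measurable borel" using h(1) by simp
  have [measurable]: "H \<in> borel_measurable borel"
    unfolding H_def sgn_if by measurable
  have H: "integrable lborel H"
    by (rule Bochner_Integration.integrable_bound[OF h(2)]) (auto simp: H_def sgn_if)
  have lim: "(\<lambda>n. 2 powr q * (LINT x|lborel. \<bar>H (x + t n) - H x\<bar>)) \<longlonglongrightarrow> 0"
    using L1_translation[OF H] t by (intro tendsto_mult_right_zero) blast
  have "(LINT x|lborel. \<bar>h (x + s) - h x\<bar> powr q) \<le> 2 powr q * (LINT x|lborel. \<bar>H (x + s) - H x\<bar>)" for s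
  proof -
    have "(LINT x|lborel. \<bar>h (x + s) - h x\<bar> powr q) \<le> (LINT x|lborel. 2 powr q * \<bar>H (x + s) - H x\<bar>)"
    proof (rule integral_mono')
      show "integrable lborel (\<lambda>x. 2 powr q * \<bar>H (x + s) - H x\<bar>)"
        using H integral_lborel_shift(2)[of H s] by auto
      show "\<bar>h (x + s) - h x\<bar> powr q \<le> 2 powr q * \<bar>H (x + s) - H x\<bar>" for x
        unfolding H_def by (rule powr_diff_le_signed[OF q])
    qed simp
    then show ?thesis by simp
  qed
  then show ?thesis
    by (intro tendsto_sandwich[OF _ _ tendsto_const lim]) (auto intro!: always_eventually)
qed

text \<open>The supporting line of a convex function. It gives both versions of Jensen's inequality
  below and, after rearrangement, the local Lipschitz bound \<open>powr_lipschitz\<close>.\<close>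

lemma powr_tangent:
  fixes a b q :: real
  assumes q: "1 \<le> q"
  shows "\<bar>a\<bar> powr q + q * \<bar>a\<bar> powr (q - 1) * sgn a * (b - a) \<le> \<bar>b\<bar> powr q"
proof -
  have pos: "a powr q + q * a powr (q - 1) * (b - a) \<le> \<bar>b\<bar> powr q" if a: "0 < a" for a b :: real
  proof (cases "0 < b")
    case True
    have "b powr q - a powr q \<ge> (q * a powr (q - 1)) * (b - a)"
      using a True q
      by (intro convex_on_imp_above_tangent[where A = "{0<..}"] powr_convex)
        (auto intro!: derivative_eq_intros simp: interior_open)
    then show ?thesis using True by simp
  next
    case False
    have "q * a powr (q - 1) * (b - a) \<le> q * a powr (q - 1) * (- a)"
      using False q by (intro mult_left_mono) auto
    also have "\<dots> = - (q * a powr q)"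
      using a powr_add[of a 1 "q - 1"] by simp
    also have "\<dots> \<le> - (1 * a powr q)" using q by (intro le_imp_neg_le mult_right_mono) auto
    finally show ?thesis using powr_ge_zero[of "\<bar>b\<bar>" q] by linarith
  qed
  consider "0 < a" | "a < 0" | "a = 0" by linarith
  then show ?thesis
  proof cases
    case 2
    then show ?thesis using pos[of "- a" "- b"] by (simp add: algebra_simps)
  qed (use pos[of a b] in auto)
qed

text \<open>The proof integrates the tangent inequality at the mean value. The form with extended
  nonnegative integrals is the one that can be integrated in a further variable by Tonelli.\<close>

lemma jensen_unit_interval:
  fixes w :: "real \<Rightarrow> real"
  assumes q: "1 \<le> q" and w: "w \<in> borel_measurable borel" "set_integrable lborel {0..1} w"
  shows "ennreal (\<bar>LINT s:{0..1}|lborel. w s\<bar> powr q) \<le>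
    (\<integral>\<^sup>+s. ennreal (indicator {0..1} s * \<bar>w s\<bar> powr q) \<partial>lborel)"
proof (cases "(\<integral>\<^sup>+s. ennreal (indicator {0..1} s * \<bar>w s\<bar> powr q) \<partial>lborel) = \<infinity>")
  case False
  note [measurable] = w(1)
  let ?f = "\<lambda>s. indicator {0..1} s * \<bar>w s\<bar> powr q :: real" and ?I = "indicator {0..1} :: real \<Rightarrow> real"
  define v where "v = (LINT s:{0..1}|lborel. w s)"
  define c where "c = q * \<bar>v\<bar> powr (q - 1) * sgn v"
  have f: "integrable lborel ?f"
    using False by (intro integrableI_nonneg) (auto simp: top.not_eq_extremum)
  have I: "integrable lborel ?I" by (rule integrable_real_indicator) auto
  have wI: "integrable lborel (\<lambda>s. ?I s * w s)" using w(2) by (simp add: set_integrable_def)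
  have "(LINT s|lborel. (\<bar>v\<bar> powr q - c * v) * ?I s + c * (?I s * w s)) \<le> (LINT s|lborel. ?f s)"
  proof (rule integral_mono)
    show "(\<bar>v\<bar> powr q - c * v) * ?I s + c * (?I s * w s) \<le> ?f s" for s
      using powr_tangent[OF q, of v "w s"] by (cases "s \<in> {0..1}") (auto simp: c_def algebra_simps)
  qed (use I wI f in auto)
  also have "(LINT s|lborel. (\<bar>v\<bar> powr q - c * v) * ?I s + c * (?I s * w s)) = \<bar>v\<bar> powr q"
    using I wI by (simp add: v_def set_lebesgue_integral_def)
  finally have "ennreal (\<bar>v\<bar> powr q) \<le> ennreal (LINT s|lborel. ?f s)" by (rule ennreal_leI)
  also have "\<dots> = (\<integral>\<^sup>+s. ennreal (?f s) \<partial>lborel)"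
    using f by (intro nn_integral_eq_integral[symmetric]) auto
  finally show ?thesis unfolding v_def .
qed simp

lemma density_diff_quotient:
  assumes d: "density_of h g" and "\<delta> \<noteq> 0"
  shows "(g (x + \<delta>) - g x) / \<delta> = (LINT s:{0..1}|lborel. h (x + \<delta> * s))"
proof (cases "0 < \<delta>")
  case True
  have "g (x + \<delta>) - g x = (LINT s:{x..x + \<delta>}|lborel. h s)"
    using d True unfolding density_of_def by auto
  also have "\<dots> = \<delta> * (LINT s|lborel. indicator {x..x + \<delta>} (x + \<delta> * s) * h (x + \<delta> * s))"
    unfolding set_lebesgue_integral_def
    using True by (subst lborel_integral_real_affine[of \<delta> _ x]) auto
  also have "(\<lambda>s. indicator {x..x + \<delta>} (x + \<delta> * s) * h (x + \<delta> * s)) = (\<lambda>s. indicator {0..1} s * h (x + \<delta> * s))"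
    using True by (auto simp: fun_eq_iff indicator_def zero_le_mult_iff)
  finally show ?thesis using True by (simp add: set_lebesgue_integral_def)
next
  case False
  then have neg: "\<delta> < 0" using assms by simp
  have "g x - g (x + \<delta>) = (LINT s:{x + \<delta>..x}|lborel. h s)"
    using d neg unfolding density_of_def by auto
  also have "\<dots> = - \<delta> * (LINT s|lborel. indicator {x + \<delta>..x} (x + \<delta> * s) * h (x + \<delta> * s))"
    unfolding set_lebesgue_integral_def
    using neg by (subst lborel_integral_real_affine[of \<delta> _ x]) auto
  also have "(\<lambda>s. indicator {x + \<delta>..x} (x + \<delta> * s) * h (x + \<delta> * s)) = (\<lambda>s. indicator {0..1} s * h (x + \<delta> * s))"
    using neg by (auto simp: fun_eq_iff indicator_def mult_le_0_iff)
  finally show ?thesis using neg by (simp add: set_lebesgue_integral_def field_simps)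
qed

section \<open>Closure properties of L^q and convergence in L^q\<close>

lemma Lq_iff: "f \<in> Lq q \<longleftrightarrow> f \<in> borel_measurable borel \<and> integrable lborel (\<lambda>x. \<bar>f x\<bar> powr q)"
  by (simp add: Lq_def)

lemma Lq_add:
  assumes "0 \<le> q" "f \<in> Lq q" "g \<in> Lq q" shows "(\<lambda>x. f x + g x) \<in> Lq q"
proof -
  have [measurable]: "f \<in> borel_measurable borel" "g \<in> borel_measurable borel" using assms by (auto simp: Lq_iff)
  have "integrable lborel (\<lambda>x. \<bar>f x + g x\<bar> powr q)"
  proof (rule Bochner_Integration.integrable_bound)
    show "integrable lborel (\<lambda>x. 2 powr q * (\<bar>f x\<bar> powr q + \<bar>g x\<bar> powr q))"
      using assms by (auto simp: Lq_iff)
    show "AE x in lborel. norm (\<bar>f x + g x\<bar> powr q) \<le> norm (2 powr q * (\<bar>f x\<bar> powr q + \<bar>g x\<bar> powr q))"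
      using powr_add_le[OF assms(1)] by (auto simp: abs_mult)
  qed measurable
  then show ?thesis by (simp add: Lq_iff)
qed

lemma Lq_cmult: "f \<in> Lq q \<Longrightarrow> (\<lambda>x. c * f x) \<in> Lq q"
  by (auto simp: Lq_iff abs_mult powr_mult)

lemma Lq_diff:
  assumes "0 \<le> q" "f \<in> Lq q" "g \<in> Lq q" shows "(\<lambda>x. f x - g x) \<in> Lq q"
  using Lq_add[OF assms(1,2) Lq_cmult[OF assms(3), of "-1"]] by simp

lemma Lq_divide: "f \<in> Lq q \<Longrightarrow> (\<lambda>x. f x / c) \<in> Lq q"
  using Lq_cmult[of f q "1 / c"] by simp

lemma Lq_shift: "f \<in> Lq q \<Longrightarrow> (\<lambda>x. f (x + t)) \<in> Lq q"
  using integral_lborel_shift(2)[of "\<lambda>x. \<bar>f x\<bar> powr q" t] by (auto simp: Lq_iff)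

lemma Lq_mono:
  assumes "0 \<le> q" "g \<in> Lq q" "f \<in> borel_measurable borel" "\<And>x. \<bar>f x\<bar> \<le> \<bar>g x\<bar>"
  shows "f \<in> Lq q"
  unfolding Lq_iff
proof
  show "integrable lborel (\<lambda>x. \<bar>f x\<bar> powr q)"
    using assms(2) by (rule Bochner_Integration.integrable_bound[of _ "\<lambda>x. \<bar>g x\<bar> powr q", OF conjunct2[OF Lq_iff[THEN iffD1]]])
      (use assms in \<open>auto intro!: powr_mono2\<close>)
qed (fact assms)

lemma Lq_bounded:
  assumes q: "1 \<le> q" and f: "integrable lborel f" "\<And>x. \<bar>f x\<bar> \<le> M"
  shows "f \<in> Lq q"
  unfolding Lq_iff
proof
  show [measurable]: "f \<in> borel_measurable borel" using f(1) by (auto dest: borel_measurable_integrable)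
  have "0 \<le> M" using f(2)[of 0] by simp
  show "integrable lborel (\<lambda>x. \<bar>f x\<bar> powr q)"
  proof (rule Bochner_Integration.integrable_bound)
    show "integrable lborel (\<lambda>x. M powr (q - 1) * \<bar>f x\<bar>)" using f(1) by simp
    show "AE x in lborel. norm (\<bar>f x\<bar> powr q) \<le> norm (M powr (q - 1) * \<bar>f x\<bar>)"
    proof (rule AE_I2)
      fix x
      have "\<bar>f x\<bar> powr q = \<bar>f x\<bar> powr (q - 1) * \<bar>f x\<bar>"
        using powr_add[of "\<bar>f x\<bar>" "q - 1" 1] by simp
      also have "\<dots> \<le> M powr (q - 1) * \<bar>f x\<bar>"
        using q f(2) by (intro mult_right_mono powr_mono2) auto
      finally show "norm (\<bar>f x\<bar> powr q) \<le> norm (M powr (q - 1) * \<bar>f x\<bar>)" by simp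
    qed
  qed measurable
qed

text \<open>The q-th power of the norm. Only convergence to 0 matters here, and for that the
  elementary bound \<open>Iq_add_le\<close> with the factor 2^q replaces Minkowski's
  inequality.\<close>

definition Iq :: "real \<Rightarrow> (real \<Rightarrow> real) \<Rightarrow> real" where "Iq q f = (LINT x|lborel. \<bar>f x\<bar> powr q)"

lemma Iq_nonneg: "0 \<le> Iq q f" by (simp add: Iq_def)

lemma Iq_add_le:
  assumes "0 \<le> q" "f \<in> Lq q" "g \<in> Lq q"
  shows "Iq q (\<lambda>x. f x + g x) \<le> 2 powr q * (Iq q f + Iq q g)"
proof -
  have "Iq q (\<lambda>x. f x + g x) \<le> (LINT x|lborel. 2 powr q * (\<bar>f x\<bar> powr q + \<bar>g x\<bar> powr q))"
    unfolding Iq_def using assms powr_add_le[OF assms(1)] by (intro integral_mono') (auto simp: Lq_iff)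
  also have "\<dots> = 2 powr q * (Iq q f + Iq q g)" using assms by (simp add: Iq_def Lq_iff)
  finally show ?thesis .
qed

lemma Iq_cmult: "Iq q (\<lambda>x. c * f x) = \<bar>c\<bar> powr q * Iq q f"
  by (simp add: Iq_def abs_mult powr_mult)

lemma Iq_add_tendsto:
  assumes "0 \<le> q" "\<And>n. f n \<in> Lq q" "\<And>n. g n \<in> Lq q"
    and "(\<lambda>n. Iq q (f n)) \<longlonglongrightarrow> 0" "(\<lambda>n. Iq q (g n)) \<longlonglongrightarrow> 0"
  shows "(\<lambda>n. Iq q (\<lambda>x. f n x + g n x)) \<longlonglongrightarrow> 0"
proof (rule tendsto_sandwich[where f = "\<lambda>_. 0"])
  show "(\<lambda>n. 2 powr q * (Iq q (f n) + Iq q (g n))) \<longlonglongrightarrow> 0"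
    by (intro tendsto_mult_right_zero tendsto_add_zero assms)
qed (use Iq_add_le assms Iq_nonneg in \<open>auto intro!: always_eventually\<close>)

lemma Iq_dominated:
  assumes q: "0 < q" and E: "E \<in> Lq q" and f: "\<And>n. f n \<in> borel_measurable borel" "\<And>n x. \<bar>f n x\<bar> \<le> E x"
    and lim: "\<And>x. (\<lambda>n. f n x) \<longlonglongrightarrow> 0"
  shows "(\<lambda>n. Iq q (f n)) \<longlonglongrightarrow> 0"
proof -
  note [measurable] = f(1)
  have "(\<lambda>n. LINT x|lborel. \<bar>f n x\<bar> powr q) \<longlonglongrightarrow> integral\<^sup>L lborel (\<lambda>x::real. 0)"
  proof (rule integral_dominated_convergence[where w = "\<lambda>x. \<bar>E x\<bar> powr q"])
    show "AE x in lborel. (\<lambda>n. \<bar>f n x\<bar> powr q) \<longlonglongrightarrow> 0"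
      using q by (intro AE_I2 tendsto_zero_powrI[where b = q] tendsto_rabs_zero lim) auto
    show "AE x in lborel. norm (\<bar>f n x\<bar> powr q) \<le> \<bar>E x\<bar> powr q" for n
      using q order_trans[OF f(2) abs_ge_self] by (intro AE_I2) (auto intro!: powr_mono2)
  qed (use E in \<open>auto simp: Lq_iff\<close>)
  then show ?thesis by (simp add: Iq_def)
qed

text \<open>The difference quotient minus h is the average over s in [0, 1] of h(x + t s) - h(x). By
  Jensen and Tonelli its q-th power integral is at most the average of the translation moduli
  \<open>\<omega> (t n * s)\<close>. These tend to 0 and are uniformly bounded.\<close>

lemma Lq_diff_quotient:
  assumes q: "1 \<le> q" and h: "h \<in> Lq q" and d: "density_of h g"
    and t: "t \<longlonglongrightarrow> 0" "\<And>n. t n \<noteq> 0"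
  shows "(\<lambda>n. Iq q (\<lambda>x. (g (x + t n) - g x) / t n - h x)) \<longlonglongrightarrow> 0"
proof -
  have [measurable]: "h \<in> borel_measurable borel" "g \<in> borel_measurable borel"
    using h borel_measurable_continuous_onI[OF density_of_continuous[OF d]] by (auto simp: Lq_iff)
  define \<omega> where "\<omega> \<eta> = Iq q (\<lambda>x. h (x + \<eta>) - h x)" for \<eta>
  have hs: "(\<lambda>x. h (x + \<eta>) - h x) \<in> Lq q" for \<eta>
    using q by (intro Lq_diff Lq_shift h) auto
  define B where "B = 2 powr q * (Iq q h + Iq q h)"
  have \<omega>B: "\<omega> \<eta> \<le> B" for \<eta>
  proof -
    have "\<omega> \<eta> \<le> 2 powr q * (Iq q (\<lambda>x. h (x + \<eta>)) + Iq q (\<lambda>x. - 1 * h x))"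
      unfolding \<omega>_def using Iq_add_le[OF _ Lq_shift[OF h] Lq_cmult[OF h, of "- 1"], of \<eta>] q by simp
    also have "Iq q (\<lambda>x. h (x + \<eta>)) = Iq q h"
      unfolding Iq_def by (rule integral_lborel_shift(1)[of "\<lambda>x. \<bar>h x\<bar> powr q"])
    finally show ?thesis by (simp add: B_def Iq_def)
  qed
  have nn: "(\<integral>\<^sup>+x. ennreal (\<bar>h (x + \<eta>) - h x\<bar> powr q) \<partial>lborel) = ennreal (\<omega> \<eta>)" for \<eta>
    using hs[of \<eta>] unfolding \<omega>_def Iq_def Lq_iff by (intro nn_integral_eq_integral) auto
  let ?Q = "\<lambda>n x. (g (x + t n) - g x) / t n - h x"
  have bound: "(\<integral>\<^sup>+x. ennreal (\<bar>?Q n x\<bar> powr q) \<partial>lborel) \<le> (\<integral>\<^sup>+s. indicator {0..1} s * ennreal (\<omega> (t n * s)) \<partial>lborel)" for n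
  proof -
    have "ennreal (\<bar>?Q n x\<bar> powr q) \<le> (\<integral>\<^sup>+s. ennreal (indicator {0..1} s * \<bar>h (x + t n * s) - h x\<bar> powr q) \<partial>lborel)" for x
    proof -
      have "set_integrable lborel {min x (x + t n)..max x (x + t n)} h"
        using d unfolding density_of_def locally_integrable_def by blast
      then have "integrable lborel (\<lambda>s. indicator {min x (x + t n)..max x (x + t n)} (x + t n * s) *\<^sub>R h (x + t n * s))"
        unfolding set_integrable_def using t(2) by (intro lborel_integrable_real_affine) auto
      moreover have "indicator {min x (x + t n)..max x (x + t n)} (x + t n * s) = (indicator {0..1} s :: real)" for s
        using t(2)[of n] by (cases "0 < t n") (auto simp: indicator_def zero_le_mult_iff mult_le_0_iff min_def max_def)
      ultimately have si: "set_integrable lborel {0..1} (\<lambda>s. h (x + t n * s))"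
        by (simp add: set_integrable_def)
      have c: "set_integrable lborel {0..1::real} (\<lambda>s. h x)"
        unfolding set_integrable_def by (intro integrable_mult_indicator[of _ _ "\<lambda>_. h x", unfolded real_scaleR_def] | simp)+
      have "?Q n x = (LINT s:{0..1}|lborel. h (x + t n * s) - h x)"
        using density_diff_quotient[OF d t(2), of x n] set_integral_diff(2)[OF si c]
        by (simp add: set_lebesgue_integral_def)
      then show ?thesis
        using jensen_unit_interval[OF q _ set_integral_diff(1)[OF si c]] by simp
    qed
    then have "(\<integral>\<^sup>+x. ennreal (\<bar>?Q n x\<bar> powr q) \<partial>lborel) \<le>
      (\<integral>\<^sup>+x. \<integral>\<^sup>+s. ennreal (indicator {0..1} s * \<bar>h (x + t n * s) - h x\<bar> powr q) \<partial>lborel \<partial>lborel)"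
      by (intro nn_integral_mono)
    also have "\<dots> = (\<integral>\<^sup>+s. \<integral>\<^sup>+x. ennreal (indicator {0..1} s * \<bar>h (x + t n * s) - h x\<bar> powr q) \<partial>lborel \<partial>lborel)"
      by (rule lborel_pair.Fubini') measurable
    also have "\<dots> = (\<integral>\<^sup>+s. indicator {0..1} s * ennreal (\<omega> (t n * s)) \<partial>lborel)"
      by (intro nn_integral_cong) (auto simp: indicator_def nn)
    finally show ?thesis .
  qed
  have \<omega>m [measurable]: "(\<lambda>s. ennreal (\<omega> (c * s))) \<in> borel_measurable borel" for c
    unfolding nn[symmetric] by measurable
  have "(\<lambda>n. \<integral>\<^sup>+s. indicator {0..1} s * ennreal (\<omega> (t n * s)) \<partial>lborel) \<longlonglongrightarrow> (\<integral>\<^sup>+s. 0 \<partial>(lborel :: real measure))"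
  proof (rule nn_integral_dominated_convergence[where w = "\<lambda>s. indicator {0..1} s * ennreal B"])
    show "(\<integral>\<^sup>+(s::real). indicator {0..1} s * ennreal B \<partial>lborel) < \<infinity>"
      by (subst nn_integral_multc) (auto simp: ennreal_mult_less_top)
    show "AE s in lborel. (\<lambda>n. indicator {0..1} s * ennreal (\<omega> (t n * s))) \<longlonglongrightarrow> 0"
    proof (rule AE_I2)
      fix s :: real
      have "(\<lambda>n. t n * s) \<longlonglongrightarrow> 0" using tendsto_mult_left_zero[OF t(1)] .
      then have "(\<lambda>n. \<omega> (t n * s)) \<longlonglongrightarrow> 0"
        unfolding \<omega>_def Iq_def using h q by (intro Lq_translation) (auto simp: Lq_iff)
      then have "(\<lambda>n. ennreal (\<omega> (t n * s))) \<longlonglongrightarrow> ennreal 0" by (rule tendsto_ennrealI)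
      then show "(\<lambda>n. indicator {0..1} s * ennreal (\<omega> (t n * s))) \<longlonglongrightarrow> 0"
        by (cases "s \<in> {0..1}") auto
    qed
    show "AE s in lborel. indicator {0..1} s * ennreal (\<omega> (t n * s)) \<le> indicator {0..1} s * ennreal B" for n
      using \<omega>B by (intro AE_I2 mult_left_mono ennreal_leI) auto
  qed measurable
  then have lim: "(\<lambda>n. \<integral>\<^sup>+s. indicator {0..1} s * ennreal (\<omega> (t n * s)) \<partial>lborel) \<longlonglongrightarrow> 0" by simp
  have "(\<lambda>n. \<integral>\<^sup>+x. ennreal (\<bar>?Q n x\<bar> powr q) \<partial>lborel) \<longlonglongrightarrow> 0"
    by (rule tendsto_sandwich[OF _ _ tendsto_const lim]; rule always_eventually, rule allI; (rule bound | rule zero_le))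
  then have "(\<lambda>n. enn2real (\<integral>\<^sup>+x. ennreal (\<bar>?Q n x\<bar> powr q) \<partial>lborel)) \<longlonglongrightarrow> enn2real 0"
    by (intro tendsto_enn2real) auto
  moreover have "Iq q (?Q n) = enn2real (\<integral>\<^sup>+x. ennreal (\<bar>?Q n x\<bar> powr q) \<partial>lborel)" for n
    unfolding Iq_def by (rule integral_eq_nn_integral) auto
  ultimately show ?thesis by (simp only: enn2real_0)
qed

section \<open>Curves in Sobolev spaces\<close>

text \<open>The damped d'Alembert part of the derivative of S(t). It is the only part of the
  solution that inherits the roughness of the data.\<close>

definition wave :: "(real \<Rightarrow> real) \<Rightarrow> real \<Rightarrow> real \<Rightarrow> real" where
  "wave h t x = exp (- t / 2) * ((h (x + t) + h (x - t)) / 2)"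

lemma Lq_norm_Iq: "Lq_norm q f = Iq q f powr (1 / q)"
  by (simp add: Lq_norm_def Iq_def)

lemma Lq_norm_tendsto:
  assumes "0 < q" "(\<lambda>n. Iq q (f n)) \<longlonglongrightarrow> 0" shows "(\<lambda>n. Lq_norm q (f n)) \<longlonglongrightarrow> 0"
  unfolding Lq_norm_Iq
  using assms by (intro tendsto_zero_powrI[where b = "1 / q"]) (auto simp: Iq_nonneg)

lemma Iq_cong_AE:
  assumes "f \<in> borel_measurable borel" "g \<in> borel_measurable borel" "AE x in lborel. f x = g x"
  shows "Iq q f = Iq q g"
  unfolding Iq_def using assms by (intro integral_cong_AE) auto

lemma Iq_shift: "Iq q (\<lambda>x. f (x + t)) = Iq q f"
  unfolding Iq_def by (rule integral_lborel_shift(1)[of "\<lambda>x. \<bar>f x\<bar> powr q"])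

lemma Iq_minus: "Iq q (\<lambda>x. - f x) = Iq q f" by (simp add: Iq_def)

lemma Iq_cmult_tendsto:
  assumes "0 < q" "c \<longlonglongrightarrow> c0" "(\<lambda>n. Iq q (f n)) \<longlonglongrightarrow> 0"
  shows "(\<lambda>n. Iq q (\<lambda>x. c n * f n x)) \<longlonglongrightarrow> 0"
proof -
  have "(\<lambda>n. \<bar>c n\<bar> powr q) \<longlonglongrightarrow> \<bar>c0\<bar> powr q"
    using assms(1) by (intro tendsto_powr' tendsto_intros assms(2)) auto
  from tendsto_mult[OF this assms(3)] show ?thesis unfolding Iq_cmult by simp
qed

lemma Iq_cmult_tendsto_0:
  assumes "0 < q" "c \<longlonglongrightarrow> 0"
  shows "(\<lambda>n. Iq q (\<lambda>x. c n * f x)) \<longlonglongrightarrow> 0"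
proof -
  have "(\<lambda>n. \<bar>c n\<bar> powr q) \<longlonglongrightarrow> 0"
    using assms by (intro tendsto_zero_powrI[where b = q] tendsto_rabs_zero) auto
  then show ?thesis unfolding Iq_cmult by (intro tendsto_mult_left_zero)
qed

lemma translate_tendsto:
  assumes "1 \<le> q" "h \<in> Lq q" "s \<longlonglongrightarrow> t"
  shows "(\<lambda>n. Iq q (\<lambda>x. h (x + s n) - h (x + t))) \<longlonglongrightarrow> 0"
proof -
  have "(\<lambda>n. s n - t) \<longlonglongrightarrow> t - t" by (intro tendsto_intros assms)
  then have "(\<lambda>n. Iq q (\<lambda>x. h (x + (s n - t)) - h x)) \<longlonglongrightarrow> 0"
    unfolding Iq_def using assms by (intro Lq_translation) (auto simp: Lq_iff)
  moreover have "Iq q (\<lambda>x. h (x + (s n - t)) - h x) = Iq q (\<lambda>x. h (x + s n) - h (x + t))" for n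
    using Iq_shift[of q "\<lambda>x. h (x + (s n - t)) - h x" t] by (simp add: algebra_simps)
  ultimately show ?thesis by simp
qed

lemma Lq_wave:
  assumes "0 \<le> q" "h \<in> Lq q" shows "wave h t \<in> Lq q"
proof -
  have "(\<lambda>x. exp (- t / 2) * ((h (x + t) + h (x + - t)) / 2)) \<in> Lq q"
    by (intro Lq_cmult Lq_divide Lq_add Lq_shift assms)
  then show ?thesis by (simp add: wave_def[abs_def])
qed

lemma wave_tendsto:
  assumes q: "1 \<le> q" and h: "h \<in> Lq q" and s: "s \<longlonglongrightarrow> t"
  shows "(\<lambda>n. Iq q (\<lambda>x. wave h (s n) x - wave h t x)) \<longlonglongrightarrow> 0"
proof -
  let ?e = "\<lambda>s::real. exp (- s / 2)"
  have e: "(\<lambda>n. ?e (s n)) \<longlonglongrightarrow> ?e t" by (intro tendsto_intros s) auto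
  have e2: "(\<lambda>n. ?e (s n) / 2) \<longlonglongrightarrow> ?e t / 2" by (intro tendsto_intros e) auto
  have e0: "(\<lambda>n. ?e (s n) - ?e t) \<longlonglongrightarrow> 0" using tendsto_diff[OF e tendsto_const[of "?e t"]] by simp
  have ms: "(\<lambda>n. - s n) \<longlonglongrightarrow> - t" by (intro tendsto_intros s)
  have q': "0 < q" "0 \<le> q" using q by auto
  have "(\<lambda>n. Iq q (\<lambda>x. ?e (s n) / 2 * (h (x + s n) - h (x + t)) +
     (?e (s n) / 2 * (h (x + - s n) - h (x + - t)) + (?e (s n) - ?e t) * ((h (x + t) + h (x + - t)) / 2)))) \<longlonglongrightarrow> 0"
    by (intro Iq_add_tendsto Iq_cmult_tendsto[OF _ e2] Iq_cmult_tendsto_0[OF _ e0] translate_tendsto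
        Lq_cmult Lq_add Lq_diff Lq_divide Lq_shift h s ms q q')
  then show ?thesis
    by (simp add: wave_def algebra_simps add_divide_distrib diff_divide_distrib)
qed

text \<open>The time derivative of \<open>wave g\<close>, with \<open>h\<close> in place of the
  derivative of \<open>g\<close>.\<close>

definition wave_dt :: "(real \<Rightarrow> real) \<Rightarrow> (real \<Rightarrow> real) \<Rightarrow> real \<Rightarrow> real \<Rightarrow> real" where
  "wave_dt g h t x = exp (- t / 2) * ((h (x + t) - h (x - t)) / 2) - wave g t x / 2"

lemma Lq_wave_dt:
  assumes "0 \<le> q" "g \<in> Lq q" "h \<in> Lq q" shows "wave_dt g h t \<in> Lq q"
proof -
  have "(\<lambda>x. exp (- t / 2) * ((h (x + t) - h (x + - t)) / 2) - wave g t x / 2) \<in> Lq q"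
    by (intro Lq_cmult Lq_divide Lq_diff Lq_shift Lq_wave assms)
  then show ?thesis by (simp add: wave_dt_def[abs_def])
qed

lemma wave_dt_tendsto:
  assumes q: "1 \<le> q" and g: "g \<in> Lq q" and h: "h \<in> Lq q" and s: "s \<longlonglongrightarrow> t"
  shows "(\<lambda>n. Iq q (\<lambda>x. wave_dt g h (s n) x - wave_dt g h t x)) \<longlonglongrightarrow> 0"
proof -
  let ?e = "\<lambda>s::real. exp (- s / 2)"
  have e: "(\<lambda>n. ?e (s n)) \<longlonglongrightarrow> ?e t" by (intro tendsto_intros s) auto
  have e2: "(\<lambda>n. ?e (s n) / 2) \<longlonglongrightarrow> ?e t / 2" by (intro tendsto_intros e) auto
  have e2m: "(\<lambda>n. - ?e (s n) / 2) \<longlonglongrightarrow> - ?e t / 2" by (intro tendsto_intros e) auto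
  have e0: "(\<lambda>n. ?e (s n) - ?e t) \<longlonglongrightarrow> 0" using tendsto_diff[OF e tendsto_const[of "?e t"]] by simp
  have ms: "(\<lambda>n. - s n) \<longlonglongrightarrow> - t" by (intro tendsto_intros s)
  have q': "0 < q" "0 \<le> q" using q by auto
  have "(\<lambda>n. Iq q (\<lambda>x. ?e (s n) / 2 * (h (x + s n) - h (x + t)) +
     ((- ?e (s n) / 2 * (h (x + - s n) - h (x + - t)) + (?e (s n) - ?e t) * ((h (x + t) - h (x + - t)) / 2))
      + - 1 / 2 * (wave g (s n) x - wave g t x)))) \<longlonglongrightarrow> 0"
    by (intro Iq_add_tendsto Iq_cmult_tendsto[OF _ e2] Iq_cmult_tendsto[OF _ e2m] Iq_cmult_tendsto_0[OF _ e0]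
        Iq_cmult_tendsto[OF _ tendsto_const] wave_tendsto translate_tendsto
        Lq_cmult Lq_add Lq_diff Lq_divide Lq_shift Lq_wave g h s ms q q')
  then show ?thesis
    by (simp add: wave_dt_def algebra_simps add_divide_distrib diff_divide_distrib)
qed

text \<open>The limit is taken in norm, as \<open>h\<close> is only an element of L^q. Each
  travelling wave reduces to \<open>Lq_diff_quotient\<close> after a translation, and the damping
  factor contributes the remaining terms.\<close>

lemma wave_diff_quotient:
  assumes q: "1 \<le> q" and g: "g \<in> Lq q" and h: "h \<in> Lq q" and d: "density_of h g"
    and s: "s \<longlonglongrightarrow> t" "\<And>n. s n \<noteq> t"
  shows "(\<lambda>n. Iq q (\<lambda>x. (wave g (s n) x - wave g t x) / (s n - t) - wave_dt g h t x)) \<longlonglongrightarrow> 0"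
proof -
  let ?e = "\<lambda>s::real. exp (- s / 2)"
  have q': "0 < q" "0 \<le> q" using q by auto
  have e: "(\<lambda>n. ?e (s n)) \<longlonglongrightarrow> ?e t" by (intro tendsto_intros s) auto
  have e2: "(\<lambda>n. ?e (s n) / 2) \<longlonglongrightarrow> ?e t / 2" by (intro tendsto_intros e) auto
  have e0: "(\<lambda>n. ?e (s n) - ?e t) \<longlonglongrightarrow> 0" using tendsto_diff[OF e tendsto_const[of "?e t"]] by simp
  have ed: "(\<lambda>n. (?e (s n) - ?e t) / (s n - t) + ?e t / 2) \<longlonglongrightarrow> 0"
  proof -
    have "(?e has_real_derivative - (?e t / 2)) (at t)"
      by (auto intro!: derivative_eq_intros)
    then have "((\<lambda>s. (?e s - ?e t) / (s - t)) \<longlongrightarrow> - (?e t / 2)) (at t)"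
      by (simp add: has_field_derivative_iff)
    then have "(\<lambda>n. (?e (s n) - ?e t) / (s n - t)) \<longlonglongrightarrow> - (?e t / 2)"
      by (rule filterlim_compose) (use s in \<open>auto simp: filterlim_at intro!: always_eventually\<close>)
    from tendsto_add[OF this tendsto_const[of "?e t / 2"]] show ?thesis by simp
  qed
  have A: "(\<lambda>n. Iq q (\<lambda>x. (g (x + s n) - g (x + t)) / (s n - t) - h (x + t))) \<longlonglongrightarrow> 0"
  proof -
    have "(\<lambda>n. s n - t) \<longlonglongrightarrow> t - t" by (intro tendsto_intros s)
    then have "(\<lambda>n. Iq q (\<lambda>x. (g (x + (s n - t)) - g x) / (s n - t) - h x)) \<longlonglongrightarrow> 0"
      using s(2) by (intro Lq_diff_quotient[OF q h d]) auto
    moreover have "Iq q (\<lambda>x. (g (x + (s n - t)) - g x) / (s n - t) - h x) = Iq q (\<lambda>x. (g (x + s n) - g (x + t)) / (s n - t) - h (x + t))" for n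
    proof -
      have e: "x + t + (s n - t) = x + s n" for x by simp
      show ?thesis using Iq_shift[of q "\<lambda>x. (g (x + (s n - t)) - g x) / (s n - t) - h x" t] by (simp only: e)
    qed
    ultimately show ?thesis by simp
  qed
  have B: "(\<lambda>n. Iq q (\<lambda>x. (g (x + - s n) - g (x + - t)) / (s n - t) + h (x + - t))) \<longlonglongrightarrow> 0"
  proof -
    have "(\<lambda>n. t - s n) \<longlonglongrightarrow> t - t" by (intro tendsto_intros s)
    then have "(\<lambda>n. Iq q (\<lambda>x. (g (x + (t - s n)) - g x) / (t - s n) - h x)) \<longlonglongrightarrow> 0"
      using s(2)[THEN not_sym] by (intro Lq_diff_quotient[OF q h d]) auto
    moreover have "Iq q (\<lambda>x. (g (x + (t - s n)) - g x) / (t - s n) - h x) = Iq q (\<lambda>x. (g (x + - s n) - g (x + - t)) / (s n - t) + h (x + - t))" for n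
    proof -
      have "Iq q (\<lambda>x. (g (x + (t - s n)) - g x) / (t - s n) - h x) = Iq q (\<lambda>x. (g (x + - s n) - g (x + - t)) / (t - s n) - h (x + - t))"
      proof -
        have e: "x + - t + (t - s n) = x + - s n" for x by simp
        show ?thesis using Iq_shift[of q "\<lambda>x. (g (x + (t - s n)) - g x) / (t - s n) - h x" "- t"] by (simp only: e)
      qed
      also have "\<dots> = Iq q (\<lambda>x. - ((g (x + - s n) - g (x + - t)) / (t - s n) - h (x + - t)))" by (rule Iq_minus[symmetric])
      also have "(\<lambda>x. - ((g (x + - s n) - g (x + - t)) / (t - s n) - h (x + - t))) = (\<lambda>x. (g (x + - s n) - g (x + - t)) / (s n - t) + h (x + - t))"
      proof (rule ext)
        fix x
        show "- ((g (x + - s n) - g (x + - t)) / (t - s n) - h (x + - t)) = (g (x + - s n) - g (x + - t)) / (s n - t) + h (x + - t)"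
          using minus_divide_right[of "g (x + - s n) - g (x + - t)" "t - s n"] by (simp only: minus_diff_eq)
      qed
      finally show ?thesis .
    qed
    ultimately show ?thesis by simp
  qed
  have "(\<lambda>n. Iq q (\<lambda>x. ?e (s n) / 2 * ((g (x + s n) - g (x + t)) / (s n - t) - h (x + t)) +
     ((?e (s n) / 2 * ((g (x + - s n) - g (x + - t)) / (s n - t) + h (x + - t)) + (?e (s n) - ?e t) * ((h (x + t) - h (x + - t)) / 2))
      + ((?e (s n) - ?e t) / (s n - t) + ?e t / 2) * ((g (x + t) + g (x + - t)) / 2)))) \<longlonglongrightarrow> 0"
    by (intro Iq_add_tendsto Iq_cmult_tendsto[OF _ e2] Iq_cmult_tendsto_0[OF _ e0] Iq_cmult_tendsto_0[OF _ ed]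
        A B Lq_cmult Lq_add Lq_diff Lq_divide Lq_shift g h q q')
  moreover have "?e (s n) / 2 * ((g (x + s n) - g (x + t)) / (s n - t) - h (x + t)) +
     ((?e (s n) / 2 * ((g (x + - s n) - g (x + - t)) / (s n - t) + h (x + - t)) + (?e (s n) - ?e t) * ((h (x + t) - h (x + - t)) / 2))
      + ((?e (s n) - ?e t) / (s n - t) + ?e t / 2) * ((g (x + t) + g (x + - t)) / 2)) =
     (wave g (s n) x - wave g t x) / (s n - t) - wave_dt g h t x" for n x
  proof -
    have "E / 2 * ((a - b) / D - c) + ((E / 2 * ((a' - b') / D + c') + (E - F) * ((c - c') / 2)) + ((E - F) / D + F / 2) * ((b + b') / 2)) =
      (E * ((a + a') / 2) - F * ((b + b') / 2)) / D - (F * ((c - c') / 2) - F * ((b + b') / 2) / 2)"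
      if "D \<noteq> 0" for E F D a b c a' b' c' :: real
      using that by (simp add: field_simps)
    from this[of "s n - t"] s(2)[of n] show ?thesis unfolding wave_def wave_dt_def by simp
  qed
  ultimately show ?thesis by simp
qed

lemma density_of_add:
  assumes "density_of h g" "density_of h' g'" shows "density_of (\<lambda>x. h x + h' x) (\<lambda>x. g x + g' x)"
  unfolding density_of_def
proof (intro conjI allI impI)
  show "locally_integrable (\<lambda>x. h x + h' x)"
    using assms by (auto simp: density_of_def intro: locally_integrable_add)
  fix x y :: real assume "x \<le> y"
  have "set_integrable lborel {x..y} h" "set_integrable lborel {x..y} h'"
    using assms by (auto simp: density_of_def locally_integrable_def)
  show "g y + g' y - (g x + g' x) = (LINT s:{x..y}|lborel. h s + h' s)"
  proof -
    have "g y - g x = (LINT s:{x..y}|lborel. h s)" "g' y - g' x = (LINT s:{x..y}|lborel. h' s)"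
      using assms \<open>x \<le> y\<close> unfolding density_of_def by blast+
    then show ?thesis using set_integral_add(2)[OF \<open>set_integrable lborel {x..y} h\<close> \<open>set_integrable lborel {x..y} h'\<close>] by simp
  qed
qed

lemma density_of_cmult:
  assumes "density_of h g" shows "density_of (\<lambda>x. c * h x) (\<lambda>x. c * g x)"
  using assms unfolding density_of_def locally_integrable_def
  by (auto simp: right_diff_distrib[symmetric])

lemma density_of_shift:
  assumes "density_of h g" shows "density_of (\<lambda>x. h (x + t)) (\<lambda>x. g (x + t))"
  unfolding density_of_def locally_integrable_def
proof (intro conjI allI impI)
  have e: "indicator {a..b} x = (indicator {a + t..b + t} (x + t) :: real)" for a b x
    by (auto simp: indicator_def)
  show "set_integrable lborel {a..b} (\<lambda>x. h (x + t))" for a b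
  proof -
    have "set_integrable lborel {a + t..b + t} h" using assms by (simp add: density_of_def locally_integrable_def)
    then have "integrable lborel (\<lambda>x. indicator {a + t..b + t} (x + t) *\<^sub>R h (x + t))"
      using integral_lborel_shift(2)[of "\<lambda>x. indicator {a + t..b + t} x *\<^sub>R h x" t] by (simp add: set_integrable_def)
    then show ?thesis by (simp only: set_integrable_def e[symmetric])
  qed
  fix x y :: real assume "x \<le> y"
  then have "g (y + t) - g (x + t) = (LINT s:{x + t..y + t}|lborel. h s)" using assms unfolding density_of_def by auto
  also have "\<dots> = (LINT s:{x..y}|lborel. h (s + t))"
    using integral_lborel_shift(1)[of "\<lambda>s. indicator {x + t..y + t} s *\<^sub>R h s" t]
    by (simp only: set_lebesgue_integral_def e[symmetric])
  finally show "g (y + t) - g (x + t) = (LINT s:{x..y}|lborel. h (s + t))" .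
qed

lemma density_of_wave: "density_of h g \<Longrightarrow> density_of (wave h t) (wave g t)"
  using density_of_cmult[OF density_of_add[OF density_of_shift[of h g t] density_of_shift[of h g "- t"]], of "exp (- t / 2) / 2"]
  by (simp add: wave_def[abs_def])

lemma density_of_C1:
  assumes "\<And>x. (g has_real_derivative h x) (at x)" "continuous_on UNIV h"
  shows "density_of h g"
  unfolding density_of_def
proof (intro conjI allI impI locally_integrable_continuous assms)
  fix x y :: real assume "x \<le> y"
  then have "(LINT s|lborel. h s * indicator {x..y} s) = g y - g x"
    using assms by (intro integral_FTC_Icc_real) (auto simp: continuous_on_eq_continuous_at)
  then show "g y - g x = (LINT s:{x..y}|lborel. h s)"
    by (simp add: set_lebesgue_integral_def mult.commute)
qed

lemma weak_deriv_norm: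
  assumes "has_weak_deriv g h" "h \<in> borel_measurable borel"
  shows "Lq_norm q (weak_deriv g) = Lq_norm q h"
proof -
  have "weak_deriv g \<in> borel_measurable borel"
    using weak_deriv_props(1)[OF assms(1)] locally_integrable_measurable by (auto simp: has_weak_deriv_def)
  then show ?thesis
    unfolding Lq_norm_Iq by (subst Iq_cong_AE[OF _ assms(2) weak_deriv_props(2)[OF assms(1)]]) auto
qed

lemma time_interval_nhd:
  assumes "0 \<le> t" "ereal t < T"
  obtains S where "t < S" "ereal S < T"
proof -
  obtain r where "ereal t < r" "r < T" using dense[OF assms(2)] by blast
  then show ?thesis using that by (cases r) auto
qed

lemma C0_curveI:
  assumes mem: "\<And>t. t \<in> J \<Longrightarrow> u t \<in> X"
    and lim: "\<And>t s. t \<in> J \<Longrightarrow> (\<And>n. s n \<in> J) \<Longrightarrow> s \<longlonglongrightarrow> t \<Longrightarrow> (\<lambda>n. N (\<lambda>x. u (s n) x - u t x)) \<longlonglongrightarrow> 0"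
  shows "C0_curve J X N u"
  unfolding C0_curve_def
proof (intro conjI ballI mem)
  fix t assume t: "t \<in> J"
  show "((\<lambda>s. N (\<lambda>x. u s x - u t x)) \<longlongrightarrow> 0) (at t within J)"
    unfolding tendsto_at_iff_sequentially comp_def using lim[OF t] by auto
qed

section \<open>Membership of a solution in the required spaces of curves\<close>

text \<open>The travelling part is continuous and differentiable in norm by continuity of
  translations. The remainder \<open>Z\<close> has classical derivatives, and on each compact time
  interval it is dominated by one function in both L^1 and L^p, so pointwise convergence suffices
  for it.\<close>

locale regular_curve =
  fixes p :: real and T :: ereal and g h :: "real \<Rightarrow> real" and Z Zx Zt U :: "real \<Rightarrow> real \<Rightarrow> real"
  assumes p: "1 \<le> p"
    and gL: "\<And>q. q \<in> {1, p} \<Longrightarrow> g \<in> Lq q" and hL: "\<And>q. q \<in> {1, p} \<Longrightarrow> h \<in> Lq q" and d: "density_of h g"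
    and cont: "\<And>S. ereal S < T \<Longrightarrow> continuous_on ({0..S} \<times> UNIV) (\<lambda>(t, x). Z t x)"
      "\<And>S. ereal S < T \<Longrightarrow> continuous_on ({0..S} \<times> UNIV) (\<lambda>(t, x). Zx t x)"
      "\<And>S. ereal S < T \<Longrightarrow> continuous_on ({0..S} \<times> UNIV) (\<lambda>(t, x). Zt t x)"
    and dx: "\<And>t x. 0 \<le> t \<Longrightarrow> ereal t < T \<Longrightarrow> (Z t has_real_derivative Zx t x) (at x)"
    and dt: "\<And>t x. 0 < t \<Longrightarrow> ereal t < T \<Longrightarrow> ((\<lambda>t. Z t x) has_real_derivative Zt t x) (at t)"
    and env: "\<And>S. ereal S < T \<Longrightarrow> \<exists>E. (\<forall>q\<in>{1, p}. E \<in> Lq q) \<and>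
       (\<forall>t\<in>{0..S}. \<forall>x. \<bar>Z t x\<bar> \<le> E x \<and> \<bar>Zx t x\<bar> \<le> E x \<and> \<bar>Zt t x\<bar> \<le> E x)"
    and U: "\<And>t x. 0 \<le> t \<Longrightarrow> ereal t < T \<Longrightarrow> U t x = wave g t x + Z t x"
begin

abbreviation "J \<equiv> {t. 0 \<le> t \<and> ereal t < T}"

lemma cont_x: assumes "t \<in> J"
  shows "continuous_on UNIV (Z t)" "continuous_on UNIV (Zx t)" "continuous_on UNIV (Zt t)"
  using assms continuous_on_slice[OF cont(1), of t t] continuous_on_slice[OF cont(2), of t t] continuous_on_slice[OF cont(3), of t t]
  by auto

lemma cont_t:
  assumes "ereal S < T"
  shows "continuous_on {0..S} (\<lambda>t. Z t x)" "continuous_on {0..S} (\<lambda>t. Zx t x)" "continuous_on {0..S} (\<lambda>t. Zt t x)"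
proof -
  have *: "continuous_on {0..S} (\<lambda>t. F t x)" if "continuous_on ({0..S} \<times> UNIV) (\<lambda>(t, x). F t x)" for F :: "real \<Rightarrow> real \<Rightarrow> real"
  proof -
    have "continuous_on {0..S} (\<lambda>t. (\<lambda>(t, x). F t x) (t, x))"
      by (rule continuous_on_compose2[OF that]) (auto intro!: continuous_intros)
    then show ?thesis by simp
  qed
  show "continuous_on {0..S} (\<lambda>t. Z t x)" "continuous_on {0..S} (\<lambda>t. Zx t x)" "continuous_on {0..S} (\<lambda>t. Zt t x)"
    using cont[OF assms] by (auto intro: *)
qed

text \<open>The envelope is available only on compact time intervals, so a convergent sequence is
  replaced by a tail that stays in one of them.\<close>

lemma J_bound: assumes "t \<in> J" "s \<longlonglongrightarrow> t" "\<And>n. s n \<in> J"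
  obtains S N where "ereal S < T" "t < S" "\<And>n. s (n + N) \<in> {0..S}"
proof -
  obtain S where S: "t < S" "ereal S < T" using assms(1) time_interval_nhd by auto
  have "\<forall>\<^sub>F n in sequentially. s n < S" using order_tendstoD(2)[OF assms(2) S(1)] .
  then obtain N where "\<And>n. n \<ge> N \<Longrightarrow> s n < S" unfolding eventually_sequentially by blast
  then have "s (n + N) \<in> {0..S}" for n using assms(3)[of "n + N"] by (auto simp: less_imp_le)
  then show ?thesis using that S by blast
qed

lemma Z_Lq: assumes "t \<in> J" "q \<in> {1, p}" shows "Z t \<in> Lq q" "Zx t \<in> Lq q" "Zt t \<in> Lq q"
proof -
  have "ereal t < T" "t \<in> {0..t}" using assms by auto
  then obtain E where E: "\<forall>q\<in>{1, p}. E \<in> Lq q"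
    "\<And>x. \<bar>Z t x\<bar> \<le> E x \<and> \<bar>Zx t x\<bar> \<le> E x \<and> \<bar>Zt t x\<bar> \<le> E x"
    using env[of t] by blast
  have "0 \<le> q" "E \<in> Lq q" using assms p E by auto
  then show "Z t \<in> Lq q" "Zx t \<in> Lq q" "Zt t \<in> Lq q"
    using E(2) cont_x[OF assms(1)]
    by (auto intro!: Lq_mono[of q E] borel_measurable_continuous_onI intro: order_trans[OF _ abs_ge_self])
qed

lemma Z_tendsto:
  assumes t: "t \<in> J" and s: "s \<longlonglongrightarrow> t" "\<And>n. s n \<in> J" and q: "q \<in> {1, p}"
  shows "(\<lambda>n. Iq q (\<lambda>x. Z (s n) x - Z t x)) \<longlonglongrightarrow> 0" "(\<lambda>n. Iq q (\<lambda>x. Zx (s n) x - Zx t x)) \<longlonglongrightarrow> 0"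
    "(\<lambda>n. Iq q (\<lambda>x. Zt (s n) x - Zt t x)) \<longlonglongrightarrow> 0"
proof -
  from J_bound[OF t s] obtain S N where S: "ereal S < T" "t < S" "\<And>n. s (n + N) \<in> {0..S}" by blast
  obtain E where E: "\<forall>q\<in>{1, p}. E \<in> Lq q"
    "\<And>t x. t \<in> {0..S} \<Longrightarrow> \<bar>Z t x\<bar> \<le> E x \<and> \<bar>Zx t x\<bar> \<le> E x \<and> \<bar>Zt t x\<bar> \<le> E x"
    using env[OF S(1)] by blast
  have q': "0 < q" using q p by auto
  have tS: "t \<in> {0..S}" using t S by auto
  have sN: "(\<lambda>n. s (n + N)) \<longlonglongrightarrow> t" using s(1) by (rule LIMSEQ_ignore_initial_segment)
  have *: "(\<lambda>n. Iq q (\<lambda>x. F (s n) x - F t x)) \<longlonglongrightarrow> 0"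
    if c: "\<And>x. continuous_on {0..S} (\<lambda>t. F t x)" and m: "\<And>t. t \<in> J \<Longrightarrow> continuous_on UNIV (F t)"
      and b: "\<And>t x. t \<in> {0..S} \<Longrightarrow> \<bar>F t x\<bar> \<le> E x" for F :: "real \<Rightarrow> real \<Rightarrow> real"
  proof -
    have "(\<lambda>n. Iq q (\<lambda>x. F (s (n + N)) x - F t x)) \<longlonglongrightarrow> 0"
    proof (rule Iq_dominated[OF q'])
      show "(\<lambda>x. 2 * E x) \<in> Lq q" using E q by (intro Lq_cmult) auto
      show "(\<lambda>x. F (s (n + N)) x - F t x) \<in> borel_measurable borel" for n
        using m[OF s(2)] m[OF t] by (auto intro!: borel_measurable_continuous_onI continuous_intros)
      show "\<bar>F (s (n + N)) x - F t x\<bar> \<le> 2 * E x" for n x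
        using b[OF S(3), of n x] b[OF tS, of x] by linarith
      show "(\<lambda>n. F (s (n + N)) x - F t x) \<longlonglongrightarrow> 0" for x
      proof -
        have "(\<lambda>n. F (s (n + N)) x) \<longlonglongrightarrow> F t x"
          by (rule continuous_on_tendsto_compose[OF c sN tS]) (use S(3) in auto)
        from tendsto_diff[OF this tendsto_const[of "F t x"]] show ?thesis by simp
      qed
    qed
    then show ?thesis by (rule LIMSEQ_offset)
  qed
  show "(\<lambda>n. Iq q (\<lambda>x. Z (s n) x - Z t x)) \<longlonglongrightarrow> 0" "(\<lambda>n. Iq q (\<lambda>x. Zx (s n) x - Zx t x)) \<longlonglongrightarrow> 0"
    "(\<lambda>n. Iq q (\<lambda>x. Zt (s n) x - Zt t x)) \<longlonglongrightarrow> 0"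
    using cont_t[OF S(1)] cont_x E(2) by (auto intro!: *)
qed

text \<open>By the mean value theorem a difference quotient is a value of \<open>Zt\<close> and has
  the same envelope; dominated convergence does the rest.\<close>

lemma Z_diff_quotient:
  assumes t: "t \<in> J" "0 < t" and s: "s \<longlonglongrightarrow> t" "\<And>n. s n \<in> J" "\<And>n. 0 < s n" "\<And>n. s n \<noteq> t" and q: "q \<in> {1, p}"
  shows "(\<lambda>n. Iq q (\<lambda>x. (Z (s n) x - Z t x) / (s n - t) - Zt t x)) \<longlonglongrightarrow> 0"
proof -
  from J_bound[OF t(1) s(1,2)] obtain S N where S: "ereal S < T" "t < S" "\<And>n. s (n + N) \<in> {0..S}" by blast
  obtain E where E: "\<forall>q\<in>{1, p}. E \<in> Lq q"
    "\<And>t x. t \<in> {0..S} \<Longrightarrow> \<bar>Z t x\<bar> \<le> E x \<and> \<bar>Zx t x\<bar> \<le> E x \<and> \<bar>Zt t x\<bar> \<le> E x"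
    using env[OF S(1)] by blast
  have q': "0 < q" using q p by auto
  have tS: "t \<in> {0..S}" using t S by auto
  have DZ: "((\<lambda>t. Z t x) has_real_derivative Zt r x) (at r)" if "0 < r" "r \<le> S" for r x
  proof -
    have "ereal r < T" using that S(1) by (metis ereal_less_eq(3) order_le_less_trans)
    then show ?thesis using that by (intro dt)
  qed
  have quot: "\<bar>(Z r x - Z t x) / (r - t)\<bar> \<le> E x" if r: "0 < r" "r \<le> S" "r \<noteq> t" for r x
  proof -
    have mvt: "\<exists>z. a < z \<and> z < b \<and> Z b x - Z a x = (b - a) * Zt z x" if "0 < a" "a < b" "b \<le> S" for a b
      by (rule MVT2[OF that(2)]) (use DZ that in auto)
    have "\<exists>z\<in>{0..S}. (Z r x - Z t x) / (r - t) = Zt z x"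
    proof (cases "r < t")
      case True
      then obtain z where z: "r < z" "z < t" "Z t x - Z r x = (t - r) * Zt z x" using mvt[of r t] r tS by auto
      then have "(Z r x - Z t x) / (r - t) = Zt z x" using True by (simp add: field_simps)
      then show ?thesis using z r tS by (intro bexI[of _ z]) auto
    next
      case False
      then obtain z where z: "t < z" "z < r" "Z r x - Z t x = (r - t) * Zt z x" using mvt[of t r] r t(2) by auto
      then have "(Z r x - Z t x) / (r - t) = Zt z x" using False r by (simp add: field_simps)
      then show ?thesis using z r t(2) by (intro bexI[of _ z]) auto
    qed
    then obtain z where z: "z \<in> {0..S}" "(Z r x - Z t x) / (r - t) = Zt z x" by blast
    show ?thesis unfolding z(2) using E(2)[OF z(1), of x] by blast
  qed
  have "(\<lambda>n. Iq q (\<lambda>x. (Z (s (n + N)) x - Z t x) / (s (n + N) - t) - Zt t x)) \<longlonglongrightarrow> 0"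
  proof (rule Iq_dominated[OF q'])
    show "(\<lambda>x. 2 * E x) \<in> Lq q" using E q by (intro Lq_cmult) auto
    show "(\<lambda>x. (Z (s (n + N)) x - Z t x) / (s (n + N) - t) - Zt t x) \<in> borel_measurable borel" for n
    proof -
      have "s (n + N) - t \<noteq> 0" using s(4)[of "n + N"] by simp
      then show ?thesis
        using cont_x(1)[OF s(2), of "n + N"] cont_x[OF t(1)]
        by (intro borel_measurable_continuous_onI continuous_intros) auto
    qed
    show "\<bar>(Z (s (n + N)) x - Z t x) / (s (n + N) - t) - Zt t x\<bar> \<le> 2 * E x" for n x
    proof -
      have "s (n + N) \<le> S" using S(3)[of n] by simp
      from quot[OF s(3) this s(4), of x] E(2)[OF tS, of x] show ?thesis by linarith
    qed
    show "(\<lambda>n. (Z (s (n + N)) x - Z t x) / (s (n + N) - t) - Zt t x) \<longlonglongrightarrow> 0" for x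
    proof -
      have "((\<lambda>r. (Z r x - Z t x) / (r - t)) \<longlongrightarrow> Zt t x) (at t)"
        using DZ[of t x] t(2) S(2) by (simp add: has_field_derivative_iff)
      moreover have "filterlim (\<lambda>n. s (n + N)) (at t) sequentially"
        using LIMSEQ_ignore_initial_segment[OF s(1), of N] s(4) by (simp add: filterlim_at)
      ultimately have "(\<lambda>n. (Z (s (n + N)) x - Z t x) / (s (n + N) - t)) \<longlonglongrightarrow> Zt t x"
        by (rule filterlim_compose)
      from tendsto_diff[OF this tendsto_const[of "Zt t x"]] show ?thesis by simp
    qed
  qed
  then show ?thesis by (rule LIMSEQ_offset)
qed

abbreviation "Ux t x \<equiv> wave h t x + Zx t x"

lemma U_eq: "t \<in> J \<Longrightarrow> U t = (\<lambda>x. wave g t x + Z t x)"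
  using U by auto

lemma q_bounds: "q \<in> {1, p} \<Longrightarrow> 1 \<le> q" "q \<in> {1, p} \<Longrightarrow> 0 \<le> q" "q \<in> {1, p} \<Longrightarrow> 0 < q" using p by auto

lemma U_density: "t \<in> J \<Longrightarrow> density_of (Ux t) (U t)"
  unfolding U_eq using dx cont_x(2) by (intro density_of_add density_of_wave d density_of_C1) auto

lemma U_Lq: "t \<in> J \<Longrightarrow> q \<in> {1, p} \<Longrightarrow> U t \<in> Lq q \<and> Ux t \<in> Lq q"
  unfolding U_eq using Z_Lq gL hL q_bounds by (auto intro!: Lq_add Lq_wave)

lemma U_tendsto:
  assumes t: "t \<in> J" and s: "s \<longlonglongrightarrow> t" "\<And>n. s n \<in> J" and q: "q \<in> {1, p}"
  shows "(\<lambda>n. Iq q (\<lambda>x. U (s n) x - U t x)) \<longlonglongrightarrow> 0" "(\<lambda>n. Iq q (\<lambda>x. Ux (s n) x - Ux t x)) \<longlonglongrightarrow> 0"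
proof -
  have 1: "(\<lambda>n. Iq q (\<lambda>x. (wave g (s n) x - wave g t x) + (Z (s n) x - Z t x))) \<longlonglongrightarrow> 0"
    using q_bounds[OF q]
    by (intro Iq_add_tendsto wave_tendsto Z_tendsto Lq_diff Lq_wave Z_Lq gL t s q)
  show "(\<lambda>n. Iq q (\<lambda>x. U (s n) x - U t x)) \<longlonglongrightarrow> 0"
    using 1 unfolding U_eq[OF t] U_eq[OF s(2)] by (simp add: algebra_simps)
  have 2: "(\<lambda>n. Iq q (\<lambda>x. (wave h (s n) x - wave h t x) + (Zx (s n) x - Zx t x))) \<longlonglongrightarrow> 0"
    using q_bounds[OF q]
    by (intro Iq_add_tendsto wave_tendsto Z_tendsto Lq_diff Lq_wave Z_Lq hL t s q)
  then show "(\<lambda>n. Iq q (\<lambda>x. Ux (s n) x - Ux t x)) \<longlonglongrightarrow> 0" by (simp add: algebra_simps)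
qed

lemma C0_Lq: "C0_curve J (Lq 1 \<inter> Lq p) (L1_Lp_norm p) U"
proof (rule C0_curveI)
  show "U t \<in> Lq 1 \<inter> Lq p" if "t \<in> J" for t using U_Lq[OF that] by auto
  fix t s assume ts: "t \<in> J" "\<And>n. s n \<in> J" "s \<longlonglongrightarrow> t"
  have "(\<lambda>n. Lq_norm 1 (\<lambda>x. U (s n) x - U t x) + Lq_norm p (\<lambda>x. U (s n) x - U t x)) \<longlonglongrightarrow> 0"
    using p by (intro tendsto_add_zero Lq_norm_tendsto U_tendsto ts) auto
  then show "(\<lambda>n. L1_Lp_norm p (\<lambda>x. U (s n) x - U t x)) \<longlonglongrightarrow> 0" by (simp add: L1_Lp_norm_def)
qed

lemma C0_W: "C0_curve J (W1 1 \<inter> W1 p) (W11_W1p_norm p) U"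
proof (rule C0_curveI)
  show "U t \<in> W1 1 \<inter> W1 p" if "t \<in> J" for t
    using U_Lq[OF that] density_of_has_weak_deriv[OF U_density[OF that]] unfolding W1_def by blast
  fix t s assume ts: "t \<in> J" "\<And>n. s n \<in> J" "s \<longlonglongrightarrow> t"
  have w: "Lq_norm q (weak_deriv (\<lambda>x. U (s n) x - U t x)) = Lq_norm q (\<lambda>x. Ux (s n) x - Ux t x)" if "q \<in> {1, p}" for q n
  proof (rule weak_deriv_norm)
    show "has_weak_deriv (\<lambda>x. U (s n) x - U t x) (\<lambda>x. Ux (s n) x - Ux t x)"
      by (intro has_weak_deriv_diff density_of_has_weak_deriv U_density ts)
    have "(\<lambda>x. Ux (s n) x - Ux t x) \<in> Lq q"
      using U_Lq[OF ts(1) that] U_Lq[OF ts(2) that, of n] q_bounds[OF that] by (intro Lq_diff) auto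
    then show "(\<lambda>x. Ux (s n) x - Ux t x) \<in> borel_measurable borel" by (simp add: Lq_iff)
  qed
  have "(\<lambda>n. (Lq_norm 1 (\<lambda>x. U (s n) x - U t x) + Lq_norm 1 (\<lambda>x. Ux (s n) x - Ux t x)) +
      (Lq_norm p (\<lambda>x. U (s n) x - U t x) + Lq_norm p (\<lambda>x. Ux (s n) x - Ux t x))) \<longlonglongrightarrow> 0"
    using p by (intro tendsto_add_zero Lq_norm_tendsto U_tendsto ts) auto
  then show "(\<lambda>n. W11_W1p_norm p (\<lambda>x. U (s n) x - U t x)) \<longlonglongrightarrow> 0"
    unfolding W11_W1p_norm_def W1_norm_def using w by simp
qed

lemma C1_Lq: "C1_curve {t. 0 < t \<and> ereal t < T} (Lq 1 \<inter> Lq p) (L1_Lp_norm p) U"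
  unfolding C1_curve_def
proof (intro conjI ballI exI[of _ "\<lambda>t x. wave_dt g h t x + Zt t x"])
  let ?J = "{t. 0 < t \<and> ereal t < T}" and ?V = "\<lambda>t x. wave_dt g h t x + Zt t x"
  have JJ: "t \<in> J" if "t \<in> ?J" for t using that by auto
  show "U t \<in> Lq 1 \<inter> Lq p" if "t \<in> ?J" for t using U_Lq[OF JJ[OF that]] by auto
  show "C0_curve ?J (Lq 1 \<inter> Lq p) (L1_Lp_norm p) ?V"
  proof (rule C0_curveI)
    have "?V t \<in> Lq q" if "t \<in> ?J" "q \<in> {1, p}" for t q
      using Z_Lq[OF JJ] that gL hL q_bounds by (intro Lq_add Lq_wave_dt) auto
    then show "?V t \<in> Lq 1 \<inter> Lq p" if "t \<in> ?J" for t using that by auto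
    fix t s assume ts: "t \<in> ?J" "\<And>n. s n \<in> ?J" "s \<longlonglongrightarrow> t"
    have *: "(\<lambda>n. Iq q (\<lambda>x. ?V (s n) x - ?V t x)) \<longlonglongrightarrow> 0" if q: "q \<in> {1, p}" for q
    proof -
      have "(\<lambda>n. Iq q (\<lambda>x. (wave_dt g h (s n) x - wave_dt g h t x) + (Zt (s n) x - Zt t x))) \<longlonglongrightarrow> 0"
        using q_bounds[OF q]
        by (intro Iq_add_tendsto wave_dt_tendsto Z_tendsto Lq_diff Lq_wave_dt Z_Lq gL hL JJ ts q)
      then show ?thesis by (simp add: algebra_simps)
    qed
    have "(\<lambda>n. Lq_norm 1 (\<lambda>x. ?V (s n) x - ?V t x) + Lq_norm p (\<lambda>x. ?V (s n) x - ?V t x)) \<longlonglongrightarrow> 0"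
      using p by (intro tendsto_add_zero Lq_norm_tendsto *) auto
    then show "(\<lambda>n. L1_Lp_norm p (\<lambda>x. ?V (s n) x - ?V t x)) \<longlonglongrightarrow> 0" by (simp add: L1_Lp_norm_def)
  qed
  fix t assume t: "t \<in> ?J"
  show "((\<lambda>s. L1_Lp_norm p (\<lambda>x. (U s x - U t x) / (s - t) - ?V t x)) \<longlongrightarrow> 0) (at t within ?J)"
    unfolding tendsto_at_iff_sequentially comp_def
  proof (intro allI impI)
    fix s assume "\<forall>n. s n \<in> ?J - {t}" and lim: "s \<longlonglongrightarrow> t"
    then have s: "\<And>n. s n \<in> ?J" "\<And>n. s n \<noteq> t" by auto
    have *: "(\<lambda>n. Iq q (\<lambda>x. (U (s n) x - U t x) / (s n - t) - ?V t x)) \<longlonglongrightarrow> 0" if q: "q \<in> {1, p}" for q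
    proof -
      have "(\<lambda>n. Iq q (\<lambda>x. ((wave g (s n) x - wave g t x) / (s n - t) - wave_dt g h t x) + ((Z (s n) x - Z t x) / (s n - t) - Zt t x))) \<longlonglongrightarrow> 0"
        using q_bounds[OF q] s t
        by (intro Iq_add_tendsto wave_diff_quotient Z_diff_quotient Lq_diff Lq_divide Lq_wave Lq_wave_dt Z_Lq gL hL JJ lim d q) auto
      then show ?thesis
        unfolding U_eq[OF JJ[OF t]] U_eq[OF JJ[OF s(1)]] by (simp add: algebra_simps add_divide_distrib diff_divide_distrib)
    qed
    have "(\<lambda>n. Lq_norm 1 (\<lambda>x. (U (s n) x - U t x) / (s n - t) - ?V t x) + Lq_norm p (\<lambda>x. (U (s n) x - U t x) / (s n - t) - ?V t x)) \<longlonglongrightarrow> 0"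
      using p by (intro tendsto_add_zero Lq_norm_tendsto *) auto
    then show "(\<lambda>n. L1_Lp_norm p (\<lambda>x. (U (s n) x - U t x) / (s n - t) - ?V t x)) \<longlonglongrightarrow> 0" by (simp add: L1_Lp_norm_def)
  qed
qed

end

section \<open>Convolution with the kernels and the Duhamel operator\<close>

definition conv :: "(real \<Rightarrow> real \<Rightarrow> real) \<Rightarrow> real \<Rightarrow> (real \<Rightarrow> real) \<Rightarrow> real \<Rightarrow> real" where
  "conv k s g x = sym_integral s (\<lambda>y. k s y * g (x - y))"

abbreviation jcont :: "(real \<Rightarrow> real \<Rightarrow> real) \<Rightarrow> bool" where
  "jcont k \<equiv> continuous_on UNIV (\<lambda>(t, y). k t y)"

lemma jcont_k: "jcont k0" "jcont k1" "jcont k0y" "jcont k1y" "jcont k1t"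
  unfolding split_beta by (intro continuous_intros)+

lemma continuous_on_pairD:
  assumes "continuous_on (A \<times> B) (\<lambda>(q, x). F q x)" "continuous_on C f" "continuous_on C g"
    "\<And>c. c \<in> C \<Longrightarrow> f c \<in> A" "\<And>c. c \<in> C \<Longrightarrow> g c \<in> B"
  shows "continuous_on C (\<lambda>c. F (f c) (g c))"
proof -
  have "continuous_on C (\<lambda>c. (\<lambda>(q, x). F q x) (f c, g c))"
    by (rule continuous_on_compose2[OF assms(1)]) (use assms in \<open>auto intro!: continuous_on_Pair\<close>)
  then show ?thesis by simp
qed

lemmas jcontD = continuous_on_pairD[where A = UNIV and B = UNIV, simplified]

lemma continuous_on_conv:
  fixes F :: "'a::topological_space \<Rightarrow> real \<Rightarrow> real"
  assumes k: "jcont k" and F: "continuous_on (A \<times> UNIV) (\<lambda>(q, x). F q x)"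
    and "continuous_on A \<sigma>" "continuous_on A \<xi>"
  shows "continuous_on A (\<lambda>q. conv k (\<sigma> q) (F q) (\<xi> q))"
  unfolding conv_def
proof (rule continuous_on_sym_integral)
  have s: "continuous_on (A \<times> {-1..1}) (\<lambda>c. \<sigma> (fst c))" "continuous_on (A \<times> {-1..1}) (\<lambda>c. \<xi> (fst c))"
    by (auto intro!: continuous_on_compose2[OF assms(3)] continuous_on_compose2[OF assms(4)] continuous_intros)
  have "continuous_on (A \<times> {-1..1}) (\<lambda>c. k (\<sigma> (fst c)) (\<sigma> (fst c) * snd c) * F (fst c) (\<xi> (fst c) - \<sigma> (fst c) * snd c))"
    by (intro continuous_on_mult jcontD[OF k] continuous_on_pairD[OF F] s continuous_on_diff continuous_on_fst
        continuous_on_snd continuous_on_id) auto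
  then show "continuous_on (A \<times> {-1..1}) (\<lambda>(q, z). k (\<sigma> q) (\<sigma> q * z) * F q (\<xi> q - \<sigma> q * z))"
    by (simp add: split_beta)
qed fact

lemma conv_integrand_continuous:
  assumes "jcont k" "continuous_on UNIV g"
  shows "continuous_on A (\<lambda>y. k s y * g (x - y))"
  by (intro continuous_on_mult jcontD[OF assms(1)] continuous_on_compose2[OF assms(2)] continuous_intros) auto

lemma conv_has_derivative_t:
  assumes k: "jcont k" "jcont kt" "\<And>t y. ((\<lambda>t. k t y) has_real_derivative kt t y) (at t)"
    and g: "continuous_on UNIV g"
  shows "((\<lambda>s. conv k s g x) has_real_derivative k s s * g (x - s) + k s (- s) * g (x + s) + conv kt s g x) (at s)"
proof -
  have c: "continuous_on UNIV (\<lambda>(t, y). f t y * g (x - y))" if "jcont f" for f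
    unfolding split_beta
    by (intro continuous_on_mult jcontD[OF that] continuous_on_compose2[OF g] continuous_intros) auto
  have "((\<lambda>s. sym_integral s (\<lambda>y. k s y * g (x - y))) has_real_derivative
      k s s * g (x - s) + k s (- s) * g (x - - s) + sym_integral s (\<lambda>y. kt s y * g (x - y))) (at s)"
    by (rule sym_integral_has_derivative[OF c[OF k(1)] c[OF k(2)]]) (rule DERIV_cmult_right[OF k(3)])
  then show ?thesis by (simp add: conv_def)
qed

text \<open>Moves the dependence on x from \<open>g\<close>, which is only continuous, to the smooth
  kernel.\<close>

lemma conv_alt:
  assumes k: "jcont k" and g: "continuous_on UNIV g" and s: "0 \<le> s"
  shows "conv k s g x = integral {x - s..x + s} (\<lambda>y. k s (x - y) * g y)"
proof -
  have c: "continuous_on UNIV (\<lambda>y. k s (x - y) * g y)"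
    by (intro continuous_on_mult jcontD[OF k] continuous_intros g)
  have "((\<lambda>y. k s (x - y) * g y) has_integral integral {x - s..x + s} (\<lambda>y. k s (x - y) * g y)) (cbox (x - s) (x + s))"
    by (auto intro!: integrable_integral integrable_continuous_real continuous_on_subset[OF c])
  from has_integral_affinity[OF this, of "-1" x]
  have "((\<lambda>y. k s y * g (x - y)) has_integral integral {x - s..x + s} (\<lambda>y. k s (x - y) * g y)) ((\<lambda>y. - y + x) ` {x - s..x + s})"
    by simp
  moreover have "(\<lambda>y. - y + x) ` {x - s..x + s} = {-s..s}"
  proof -
    have "y \<in> (\<lambda>y. - y + x) ` {x - s..x + s}" if "y \<in> {-s..s}" for y
      using that by (intro image_eqI[of _ _ "x - y"]) auto
    then show ?thesis by auto
  qed
  ultimately have "integral {-s..s} (\<lambda>y. k s y * g (x - y)) = integral {x - s..x + s} (\<lambda>y. k s (x - y) * g y)"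
    by (simp add: integral_unique)
  then show ?thesis
    unfolding conv_def using sym_integral_nonneg_eq[OF s conv_integrand_continuous[OF k g]] by simp
qed

lemma DERIV_shift_diff: "(f has_real_derivative D) (at (x - y)) \<Longrightarrow> ((\<lambda>x. f (x - y)) has_real_derivative D) (at x)"
  using DERIV_shift[of f D x "- y"] by simp

text \<open>The derivative falls on the kernel and on the end points of the interval around x, so
  continuity of \<open>g\<close> is enough. This is how the Duhamel term gains a derivative over its
  source.\<close>

lemma conv_has_derivative_x:
  assumes k: "jcont k" "jcont ky" "\<And>t y. (k t has_real_derivative ky t y) (at y)"
    and g: "continuous_on UNIV g" and s: "0 \<le> s"
  shows "(conv k s g has_real_derivative k s (- s) * g (x + s) - k s s * g (x - s) + conv ky s g x) (at x)"
proof -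
  define c where "c = x - s - 1"
  define d where "d = x + s + 1"
  have ct: "continuous_on UNIV (\<lambda>(x, y). f s (x - y) * g y)" if "jcont f" for f
    unfolding split_beta
    by (intro continuous_on_mult jcontD[OF that] continuous_on_compose2[OF g] continuous_intros) auto
  have D: "((\<lambda>x. k s (x - y) * g y) has_real_derivative ky s (x - y) * g y) (at x)" for x y
  proof -
    have "((\<lambda>x. k s (x - y)) has_real_derivative ky s (x - y)) (at x)"
      by (rule DERIV_shift_diff[OF k(3)])
    then show ?thesis by (rule DERIV_cmult_right)
  qed
  have split: "integral {c..b} (\<lambda>y. f s (x' - y) * g y) - integral {c..a} (\<lambda>y. f s (x' - y) * g y)
     = integral {a..b} (\<lambda>y. f s (x' - y) * g y)"
    if "jcont f" "c \<le> a" "a \<le> b" for f a b x'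
  proof -
    have "(\<lambda>y. f s (x' - y) * g y) integrable_on {c..b}"
      by (intro integrable_continuous_real continuous_on_mult jcontD[OF that(1)] continuous_intros
          continuous_on_subset[OF g]) auto
    from Henstock_Kurzweil_Integration.integral_combine[OF that(2,3) this] show ?thesis by simp
  qed
  have M: "((\<lambda>x. integral {c..x + r} (\<lambda>y. k s (x - y) * g y)) has_real_derivative
      k s (x - (x + r)) * g (x + r) * 1 + integral {c..x + r} (\<lambda>y. ky s (x - y) * g y)) (at x)" if "\<bar>r\<bar> \<le> s" for r
    by (rule leibniz_moving[where U = UNIV and d = d])
      (use that in \<open>auto intro!: continuous_on_subset[OF ct[OF k(1)]] continuous_on_subset[OF ct[OF k(2)]] D derivative_eq_intros simp: c_def d_def\<close>)
  have "((\<lambda>x. integral {c..x + s} (\<lambda>y. k s (x - y) * g y) - integral {c..x + - s} (\<lambda>y. k s (x - y) * g y)) has_real_derivative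
     (k s (x - (x + s)) * g (x + s) * 1 + integral {c..x + s} (\<lambda>y. ky s (x - y) * g y)) -
     (k s (x - (x + - s)) * g (x + - s) * 1 + integral {c..x + - s} (\<lambda>y. ky s (x - y) * g y))) (at x)"
    by (intro DERIV_diff M) (use s in auto)
  moreover have "integral {c..x + s} (\<lambda>y. ky s (x - y) * g y) - integral {c..x + - s} (\<lambda>y. ky s (x - y) * g y) = conv ky s g x"
    unfolding conv_alt[OF k(2) g s] using s by (subst split[OF k(2)]) (auto simp: c_def)
  ultimately have "((\<lambda>x. integral {c..x + s} (\<lambda>y. k s (x - y) * g y) - integral {c..x + - s} (\<lambda>y. k s (x - y) * g y)) has_real_derivative
     k s (- s) * g (x + s) - k s s * g (x - s) + conv ky s g x) (at x)"
    by (simp add: algebra_simps)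
  moreover have "\<forall>\<^sub>F x' in nhds x. integral {c..x' + s} (\<lambda>y. k s (x' - y) * g y) - integral {c..x' + - s} (\<lambda>y. k s (x' - y) * g y) = conv k s g x'"
  proof -
    have "\<forall>\<^sub>F x' in nhds x. x' \<in> {x - 1<..}" by (rule eventually_nhds_in_open) auto
    then show ?thesis
    proof eventually_elim
      case (elim x')
      then show ?case
        unfolding conv_alt[OF k(1) g s] using s by (subst split[OF k(1)]) (auto simp: c_def)
    qed
  qed
  ultimately show ?thesis by (subst (asm) DERIV_cong_ev[OF refl _ refl]) auto
qed

lemma conv_abs_le:
  assumes k: "jcont k" and g: "continuous_on UNIV g" and s: "0 \<le> s" and B: "\<And>y. \<bar>y\<bar> \<le> s \<Longrightarrow> \<bar>g (x + y)\<bar> \<le> B"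
  shows "\<bar>conv k s g x\<bar> \<le> sym_integral s (\<lambda>y. \<bar>k s y\<bar>) * B"
proof -
  have "\<bar>conv k s g x\<bar> \<le> sym_integral s (\<lambda>y. \<bar>k s y * g (x - y)\<bar>)"
    unfolding conv_def by (rule sym_integral_abs_le[OF s conv_integrand_continuous[OF k g]])
  also have "\<dots> \<le> sym_integral s (\<lambda>y. \<bar>k s y\<bar> * B)"
  proof (rule sym_integral_mono[OF s])
    show "\<bar>k s y * g (x - y)\<bar> \<le> \<bar>k s y\<bar> * B" if "\<bar>y\<bar> \<le> s" for y
      using B[of "- y"] that by (simp add: abs_mult mult_left_mono)
  qed (intro continuous_intros conv_integrand_continuous k g jcontD[OF k])+
  finally show ?thesis by simp
qed

lemma k0_abs_mass: "0 \<le> s \<Longrightarrow> sym_integral s (\<lambda>y. \<bar>k0 s y\<bar>) = 1 - exp (- s)"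
proof -
  assume s: "0 \<le> s"
  have "sym_integral s (\<lambda>y. \<bar>k0 s y\<bar>) = sym_integral s (k0 s)"
    by (intro antisym sym_integral_mono s continuous_intros) (auto simp: k0_nonneg)
  then show ?thesis by (simp add: k0_mass)
qed

lemma conv_k0_abs_le:
  assumes g: "continuous_on UNIV g" and s: "0 \<le> s" and B: "\<And>y. \<bar>y\<bar> \<le> s \<Longrightarrow> \<bar>g (x + y)\<bar> \<le> B"
  shows "\<bar>conv k0 s g x\<bar> \<le> B"
proof -
  have "0 \<le> B" using B[of 0] s by auto
  then have "(1 - exp (- s)) * B \<le> B" by (simp add: algebra_simps)
  then show ?thesis using conv_abs_le[OF jcont_k(1) g s B] k0_abs_mass[OF s] by simp
qed

lemma conv_k1_abs_le:
  assumes g: "continuous_on UNIV g" and s: "0 \<le> s" and B: "\<And>y. \<bar>y\<bar> \<le> s \<Longrightarrow> \<bar>g (x + y)\<bar> \<le> B"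
  shows "\<bar>conv k1 s g x\<bar> \<le> 8 * B"
proof -
  have B0: "0 \<le> B" using B[of 0] s by auto
  have "sym_integral s (\<lambda>y. \<bar>k1 s y\<bar>) \<le> 8 / (1 + s)" by (rule k1_mass[OF s])
  also have "\<dots> \<le> 8" using s by (simp add: divide_le_eq)
  finally have "sym_integral s (\<lambda>y. \<bar>k1 s y\<bar>) * B \<le> 8 * B" using B0 by (rule mult_right_mono)
  then show ?thesis using conv_abs_le[OF jcont_k(2) g s B] by simp
qed

lemma kernel_bound:
  assumes "jcont k" obtains K where "0 \<le> K" "\<And>s y. 0 \<le> s \<Longrightarrow> s \<le> S \<Longrightarrow> \<bar>y\<bar> \<le> s \<Longrightarrow> \<bar>k s y\<bar> \<le> K"
proof -
  have "bounded ((\<lambda>(t, y). k t y) ` ({0..S} \<times> {-S..S}))"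
    by (intro compact_imp_bounded compact_continuous_image continuous_on_subset[OF assms] compact_Times) auto
  then obtain K where K: "\<And>c. c \<in> (\<lambda>(t, y). k t y) ` ({0..S} \<times> {-S..S}) \<Longrightarrow> norm c \<le> K"
    unfolding bounded_iff by blast
  have "\<bar>k s y\<bar> \<le> \<bar>K\<bar>" if "0 \<le> s" "s \<le> S" "\<bar>y\<bar> \<le> s" for s y
  proof -
    have "k s y \<in> (\<lambda>(t, y). k t y) ` ({0..S} \<times> {-S..S})" using that by (intro image_eqI[of _ _ "(s, y)"]) auto
    from K[OF this] show ?thesis by simp
  qed
  then show ?thesis using that[of "\<bar>K\<bar>"] by auto
qed

lemma conv_bound:
  assumes k: "jcont k" obtains C where "0 \<le> C" "\<And>g s x B. continuous_on UNIV g \<Longrightarrow> 0 \<le> s \<Longrightarrow> s \<le> S \<Longrightarrow>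
    (\<And>y. \<bar>y\<bar> \<le> s \<Longrightarrow> \<bar>g (x + y)\<bar> \<le> B) \<Longrightarrow> \<bar>conv k s g x\<bar> \<le> C * B"
proof -
  obtain K where K: "0 \<le> K" "\<And>s y. 0 \<le> s \<Longrightarrow> s \<le> S \<Longrightarrow> \<bar>y\<bar> \<le> s \<Longrightarrow> \<bar>k s y\<bar> \<le> K" using kernel_bound[OF k] by metis
  show ?thesis
  proof (rule that[of "2 * \<bar>S\<bar> * K"])
    fix g s x B assume *: "continuous_on UNIV g" "0 \<le> s" "s \<le> S" "\<And>y. \<bar>y\<bar> \<le> s \<Longrightarrow> \<bar>g (x + y)\<bar> \<le> (B::real)"
    have B: "0 \<le> B" using *(4)[of 0] *(2) by auto
    have "sym_integral s (\<lambda>y. \<bar>k s y\<bar>) \<le> sym_integral s (\<lambda>y. K * 1)"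
      using * K by (intro sym_integral_mono continuous_intros jcontD[OF k]) auto
    also have "\<dots> = K * (s * 2)" unfolding sym_integral_cmult(1) by (simp add: sym_integral_def)
    also have "\<dots> \<le> K * (\<bar>S\<bar> * 2)" using * K by (intro mult_left_mono) auto
    finally have "sym_integral s (\<lambda>y. \<bar>k s y\<bar>) \<le> 2 * \<bar>S\<bar> * K" by (simp add: ac_simps)
    then have "sym_integral s (\<lambda>y. \<bar>k s y\<bar>) * B \<le> 2 * \<bar>S\<bar> * K * B" using B by (rule mult_right_mono)
    then show "\<bar>conv k s g x\<bar> \<le> 2 * \<bar>S\<bar> * K * B" using conv_abs_le[OF k *(1,2,4)] by linarith
  qed (use K in auto)
qed

section \<open>Convolution in time\<close>

text \<open>The argument \<open>s\<close> of \<open>G\<close> is the elapsed time and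
  \<open>\<tau>\<close> the time of the source. Keeping them apart makes a derivative in t act on
  \<open>s\<close> alone.\<close>

definition timeconv :: "(real \<Rightarrow> real \<Rightarrow> real \<Rightarrow> real) \<Rightarrow> real \<Rightarrow> real \<Rightarrow> real" where
  "timeconv G t x = integral {0..t} (\<lambda>\<tau>. G (t - \<tau>) \<tau> x)"

text \<open>The elapsed time ranges over the whole line: to differentiate at t, the Leibniz rule
  moves t in an open set with \<tau> fixed, and t - \<tau> may become negative.
  \<open>sym_integral\<close> makes sense there.\<close>

abbreviation tcont :: "real \<Rightarrow> (real \<Rightarrow> real \<Rightarrow> real \<Rightarrow> real) \<Rightarrow> bool" where
  "tcont S G \<equiv> continuous_on (UNIV \<times> {0..S} \<times> UNIV) (\<lambda>(s, \<tau>, x). G s \<tau> x)"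

abbreviation fcont :: "real \<Rightarrow> (real \<Rightarrow> real \<Rightarrow> real) \<Rightarrow> bool" where
  "fcont S F \<equiv> continuous_on ({0..S} \<times> UNIV) (\<lambda>(\<tau>, x). F \<tau> x)"

lemma tcontD:
  assumes "tcont S G" "continuous_on A f" "continuous_on A g" "continuous_on A h" "\<And>a. a \<in> A \<Longrightarrow> g a \<in> {0..S}"
  shows "continuous_on A (\<lambda>a. G (f a) (g a) (h a))"
proof -
  have "continuous_on A (\<lambda>a. (\<lambda>(s, \<tau>, x). G s \<tau> x) (f a, g a, h a))"
    by (rule continuous_on_compose2[OF assms(1)]) (use assms in \<open>auto intro!: continuous_on_Pair\<close>)
  then show ?thesis by simp
qed

lemma fcont_slice: "fcont S F \<Longrightarrow> \<tau> \<in> {0..S} \<Longrightarrow> continuous_on UNIV (F \<tau>)"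
  by (rule continuous_on_slice)

lemmas fcontD = continuous_on_pairD[where B = UNIV and A = "{0..S}" for S, simplified]

lemma tcont_conv:
  assumes k: "jcont k" and F: "fcont S F" shows "tcont S (\<lambda>s \<tau> x. conv k s (F \<tau>) x)"
proof -
  have "continuous_on (UNIV \<times> {0..S} \<times> UNIV) (\<lambda>c. conv k (fst c) (F (fst (snd c))) (snd (snd c)))"
  proof (rule continuous_on_conv[OF k])
    show "continuous_on ((UNIV \<times> {0..S} \<times> UNIV) \<times> UNIV) (\<lambda>(c, x). F (fst (snd c)) x)"
      unfolding split_beta by (rule fcontD[OF F]) (auto intro!: continuous_intros)
  qed (auto intro!: continuous_intros)
  then show ?thesis by (simp add: split_beta)
qed

lemma timeconv_integrable:
  assumes "tcont S G" "t \<le> S" shows "(\<lambda>\<tau>. G (t - \<tau>) \<tau> x) integrable_on {0..t}"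
  using assms by (intro integrable_continuous_real tcontD[OF assms(1)] continuous_intros) auto

lemma timeconv_continuous:
  assumes G: "tcont S G" shows "fcont S (timeconv G)"
proof -
  have e: "timeconv G t x = t * integral {0..1} (\<lambda>z. G (t - t * z) (t * z) x)" if "t \<in> {0..S}" for t x
  proof (cases "t = 0")
    case False
    then have t: "0 < t" using that by simp
    have "((\<lambda>\<tau>. G (t - \<tau>) \<tau> x) has_integral timeconv G t x) (cbox 0 t)"
      unfolding timeconv_def using timeconv_integrable[OF G, of t x] that by (auto intro: integrable_integral)
    from has_integral_affinity[OF this, of t 0] t
    have "((\<lambda>z. G (t - t * z) (t * z) x) has_integral (1 / t) * timeconv G t x) ((\<lambda>z. z / t) ` {0..t})"
      by simp
    moreover have "(\<lambda>z. z / t) ` {0..t} = {0..1}"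
      using t by (subst image_divide_atLeastAtMost) auto
    ultimately show ?thesis using t by (simp add: integral_unique)
  qed (simp add: timeconv_def)
  have "continuous_on ({0..S} \<times> UNIV) (\<lambda>c. integral (cbox 0 1) (\<lambda>z. G (fst c - fst c * z) (fst c * z) (snd c)))"
  proof (rule integral_continuous_on_param)
    show "continuous_on (({0..S} \<times> UNIV) \<times> cbox 0 1) (\<lambda>(c, z). G (fst c - fst c * z) (fst c * z) (snd c))"
      unfolding split_beta
    proof (intro tcontD[OF G] continuous_intros)
      fix a assume "a \<in> ({0..S} \<times> (UNIV::real set)) \<times> cbox 0 (1::real)"
      then have "0 \<le> fst (fst a)" "fst (fst a) \<le> S" "0 \<le> snd a" "snd a \<le> 1" by auto
      then show "fst (fst a) * snd a \<in> {0..S}"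
        using mult_left_le[of "snd a" "fst (fst a)"] by auto
    qed
  qed
  then have "continuous_on ({0..S} \<times> UNIV) (\<lambda>c. fst c * integral (cbox 0 1) (\<lambda>z. G (fst c - fst c * z) (fst c * z) (snd c)))"
    by (intro continuous_intros)
  then show ?thesis
    by (rule continuous_on_eq) (auto simp: e)
qed

lemma timeconv_abs_le:
  assumes G: "tcont S G" and t: "0 \<le> t" "t \<le> S" and B: "continuous_on {0..t} B"
    and le: "\<And>\<tau>. 0 \<le> \<tau> \<Longrightarrow> \<tau> \<le> t \<Longrightarrow> \<bar>G (t - \<tau>) \<tau> x\<bar> \<le> B \<tau>"
  shows "\<bar>timeconv G t x\<bar> \<le> integral {0..t} B"
  unfolding timeconv_def
  using integral_norm_bound_integral[OF timeconv_integrable[OF G t(2)] integrable_continuous_real[OF B]] le by simp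

lemma timeconv_has_derivative_x:
  assumes G: "tcont S G" "tcont S Gx" and t: "0 \<le> t" "t \<le> S"
    and d: "\<And>s \<tau> x. 0 \<le> s \<Longrightarrow> \<tau> \<in> {0..S} \<Longrightarrow> (G s \<tau> has_real_derivative Gx s \<tau> x) (at x)"
  shows "(timeconv G t has_real_derivative timeconv Gx t x) (at x)"
  unfolding timeconv_def interval_cbox
proof (rule leibniz_rule_field_derivative[where U = UNIV])
  show "continuous_on (UNIV \<times> cbox 0 t) (\<lambda>(x, \<tau>). Gx (t - \<tau>) \<tau> x)"
    unfolding split_beta using t by (intro tcontD[OF G(2)] continuous_intros) auto
qed (use d t timeconv_integrable[OF G(1) t(2)] in auto)

lemma timeconv_has_derivative_t:
  assumes G: "tcont S G" "tcont S Gt" and t: "0 < t" "t < S"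
    and d: "\<And>s \<tau> x. \<tau> \<in> {0..S} \<Longrightarrow> ((\<lambda>s. G s \<tau> x) has_real_derivative Gt s \<tau> x) (at s)"
    and z: "\<And>\<tau>. G 0 \<tau> x = 0"
  shows "((\<lambda>t. timeconv G t x) has_real_derivative timeconv Gt t x) (at t)"
proof -
  have "((\<lambda>t. integral {0..t} (\<lambda>\<tau>. G (t - \<tau>) \<tau> x)) has_real_derivative
      G (t - t) t x * 1 + integral {0..t} (\<lambda>\<tau>. Gt (t - \<tau>) \<tau> x)) (at t)"
  proof (rule leibniz_moving[where U = UNIV and d = S])
    show "continuous_on (UNIV \<times> {0..S}) (\<lambda>(t, \<tau>). G (t - \<tau>) \<tau> x)" "continuous_on (UNIV \<times> {0..S}) (\<lambda>(t, \<tau>). Gt (t - \<tau>) \<tau> x)"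
      unfolding split_beta by (intro tcontD[OF G(1)] tcontD[OF G(2)] continuous_intros; auto)+
    show "((\<lambda>t. G (t - \<tau>) \<tau> x) has_real_derivative Gt (r - \<tau>) \<tau> x) (at r)" if "\<tau> \<in> {0..S}" for r \<tau>
      by (rule DERIV_shift_diff[OF d[OF that]])
  qed (use t in \<open>auto intro!: derivative_eq_intros\<close>)
  then show ?thesis using z by (simp add: timeconv_def)
qed

section \<open>Identification with the propagators of the statement\<close>

lemma bessel_I_0: "0 \<le> s \<Longrightarrow> bessel_I 0 (sqrt s / 2) = J0 s"
proof -
  assume s: "0 \<le> s"
  have "1 / (fact k * fact (k + 0)) * (sqrt s / 2 / 2) ^ (2 * k + 0) = bcoef k * s ^ k" for k
  proof -
    have "(sqrt s / 2 / 2) ^ (2 * k) = ((sqrt s / 4)\<^sup>2) ^ k" by (simp add: power_mult)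
    also have "(sqrt s / 4)\<^sup>2 = s / 16" using s by (simp add: power_divide)
    finally show ?thesis by (simp add: bcoef_def power_divide power2_eq_square)
  qed
  then show ?thesis by (simp add: bessel_I_def J0_def)
qed

lemma bessel_I_1: "0 \<le> s \<Longrightarrow> bessel_I 1 (sqrt s / 2) = sqrt s * J1 s"
proof -
  assume s: "0 \<le> s"
  have "1 / (fact k * fact (k + 1)) * (sqrt s / 2 / 2) ^ (2 * k + 1) = sqrt s * (4 * diffs bcoef k * s ^ k)" for k
  proof -
    have "(sqrt s / 2 / 2) ^ (2 * k + 1) = ((sqrt s / 4)\<^sup>2) ^ k * (sqrt s / 4)" by (simp add: power_mult)
    also have "(sqrt s / 4)\<^sup>2 = s / 16" using s by (simp add: power_divide)
    finally have e: "(sqrt s / 2 / 2) ^ (2 * k + 1) = s ^ k / 16 ^ k * (sqrt s / 4)" by (simp add: power_divide)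
    have "1 / (f * (N * f)) * (a / b * (r / 4)) = r * (1 / (b * f\<^sup>2) / (4 * N) * a)" for f N a b r :: real
      by (simp add: power2_eq_square ac_simps)
    from this[of "fact k" "1 + real k" "s ^ k" "16 ^ k" "sqrt s"] show ?thesis
      unfolding e bcoef_Suc bcoef_def by simp
  qed
  then have "bessel_I 1 (sqrt s / 2) = (\<Sum>k. sqrt s * (4 * diffs bcoef k * s ^ k))" by (simp only: bessel_I_def)
  then show ?thesis unfolding J1_def by (subst (asm) suminf_mult[OF J1_summable])
qed

lemma sq_diff_nonneg: "y \<in> {-t..t} \<Longrightarrow> 0 \<le> t\<^sup>2 - y\<^sup>2" for t y :: real
proof -
  assume "y \<in> {-t..t}"
  then have "\<bar>y\<bar> \<le> \<bar>t\<bar>" by auto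
  then show ?thesis by (simp add: abs_le_square_iff)
qed

lemma LINT_conv:
  assumes k: "jcont k" and g: "continuous_on UNIV g" and t: "0 \<le> t"
  shows "(LINT y:{-t..t}|lborel. k t y * g (x - y)) = conv k t g x"
  unfolding conv_def sym_integral_nonneg_eq[OF t conv_integrand_continuous[OF k g]]
  by (rule set_borel_integral_eq_integral(2)[OF borel_integrable_atLeastAtMost'[OF conv_integrand_continuous[OF k g]]])

lemma propagator_conv:
  assumes g: "continuous_on UNIV g" and t: "0 \<le> t"
  shows "propagator t g x = conv k0 t g x"
proof -
  have "(LINT y:{-t..t}|lborel. exp (- t / 2) * bessel_I 0 (sqrt (t\<^sup>2 - y\<^sup>2) / 2) * g (x - y)) =
    (LINT y:{-t..t}|lborel. 2 * (k0 t y * g (x - y)))"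
    by (rule set_lebesgue_integral_cong) (simp_all add: k0_def bessel_I_0[OF sq_diff_nonneg])
  then show ?thesis unfolding propagator_def using LINT_conv[OF jcont_k(1) g t] by simp
qed

definition dt_kernel :: "real \<Rightarrow> real \<Rightarrow> real" where
  "dt_kernel t y = indicator {-t..t} y * (let \<omega> = sqrt (t\<^sup>2 - y\<^sup>2)
     in exp (- t / 2) / 4 * (t / \<omega> * bessel_I 1 (\<omega> / 2) - bessel_I 0 (\<omega> / 2)))"

text \<open>At \<open>y = \<plusminus>t\<close> the division by zero makes the two kernels differ.\<close>

lemma dt_kernel_eq:
  assumes t: "0 \<le> t" and "y \<noteq> t" "y \<noteq> - t"
  shows "dt_kernel t y = indicator {-t..t} y * k1 t y"
proof (cases "y \<in> {-t..t}")
  case True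
  then have "\<bar>y\<bar> < \<bar>t\<bar>" using assms by auto
  then have pos: "0 < t\<^sup>2 - y\<^sup>2" by (metis abs_ge_zero diff_gt_0_iff_gt pos2 power2_abs power_strict_mono)
  then show ?thesis
    unfolding dt_kernel_def Let_def k1_def
      bessel_I_0[OF less_imp_le[OF pos]] bessel_I_1[OF less_imp_le[OF pos]] by simp
qed (simp add: dt_kernel_def)

lemma dt_kernel_measurable: "0 \<le> t \<Longrightarrow> dt_kernel t \<in> borel_measurable borel"
proof -
  assume t: "0 \<le> t"
  have [measurable]: "k1 t \<in> borel_measurable borel"
    by (intro borel_measurable_continuous_onI jcontD[OF jcont_k(2)] continuous_intros)
  have "dt_kernel t = (\<lambda>y. if y = t then dt_kernel t t else if y = - t then dt_kernel t (- t) else indicator {-t..t} y * k1 t y)"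
    using dt_kernel_eq[OF t] by auto
  moreover have "(\<lambda>y. if y = t then dt_kernel t t else if y = - t then dt_kernel t (- t) else indicator {-t..t} y * k1 t y) \<in> borel_measurable borel"
    by measurable
  ultimately show ?thesis by simp
qed

lemma dt_propagator_alt:
  "dt_propagator t g x = wave g t x + (LINT y|lborel. dt_kernel t y * g (x - y))"
  unfolding dt_propagator_def wave_def set_lebesgue_integral_def dt_kernel_def Let_def by (simp add: mult.assoc)

lemma dt_propagator_conv:
  assumes g: "continuous_on UNIV g" and t: "0 \<le> t"
  shows "dt_propagator t g x = wave g t x + conv k1 t g x"
proof -
  have [measurable]: "g \<in> borel_measurable borel" "dt_kernel t \<in> borel_measurable borel" "k1 t \<in> borel_measurable borel"
    using borel_measurable_continuous_onI[OF g] dt_kernel_measurable[OF t]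
      borel_measurable_continuous_onI[OF jcontD[OF jcont_k(2)], of "\<lambda>_. t" "\<lambda>y. y"] by (auto intro: continuous_intros)
  have "(LINT y|lborel. dt_kernel t y * g (x - y)) = (LINT y|lborel. indicator {-t..t} y * k1 t y * g (x - y))"
  proof (rule integral_cong_AE)
    show "AE y in lborel. dt_kernel t y * g (x - y) = indicator {-t..t} y * k1 t y * g (x - y)"
      using AE_lborel_singleton[of t] AE_lborel_singleton[of "- t"]
      by eventually_elim (simp add: dt_kernel_eq[OF t])
  qed measurable
  also have "\<dots> = conv k1 t g x" using LINT_conv[OF jcont_k(2) g t] by (simp add: set_lebesgue_integral_def mult.assoc)
  finally show ?thesis by (simp add: dt_propagator_alt)
qed

lemma AE_reflect:
  assumes "AE y in lborel. P (y :: real)" shows "AE y in lborel. P (x - y)"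
proof -
  obtain N where N: "N \<in> null_sets lborel" "{y. \<not> P y} \<subseteq> N" using assms by (auto simp: eventually_ae_filter)
  have [measurable]: "N \<in> sets borel" using N by auto
  let ?V = "(\<lambda>y. x - y) -` N"
  have [measurable]: "?V \<in> sets borel"
    using measurable_sets[of "\<lambda>y. x - y" borel borel N] by simp
  have "emeasure lborel ?V = (\<integral>\<^sup>+y. indicator ?V y \<partial>lborel)" by (rule nn_integral_indicator[symmetric]) simp
  also have "(indicator ?V :: real \<Rightarrow> ennreal) = (\<lambda>y. indicator N (x - y))" by (auto simp: indicator_def fun_eq_iff)
  also have "(\<integral>\<^sup>+y. indicator N (x - y) \<partial>lborel) = (\<integral>\<^sup>+y. indicator N y \<partial>lborel)"
    using nn_integral_real_affine[of "indicator N" "-1" x] by simp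
  also have "\<dots> = 0" using N by auto
  finally have "?V \<in> null_sets lborel" by (intro null_setsI) auto
  then show ?thesis using N(2) by (intro AE_I'[of ?V]) auto
qed

lemma AE_translate:
  assumes "AE y in lborel. P (y :: real)" shows "AE y in lborel. P (y + t)"
  using AE_reflect[OF AE_reflect[OF assms, of 0], of "- t"] by (simp add: add.commute)

text \<open>Only for almost every x: the integral part depends on the class of the datum alone, but
  the travelling part evaluates it at x + t and x - t.\<close>

lemma dt_propagator_cong_AE:
  assumes t: "0 \<le> t" and m: "f \<in> borel_measurable borel" "g \<in> borel_measurable borel" and ae: "AE y in lborel. f y = g y"
  shows "AE x in lborel. dt_propagator t f x = dt_propagator t g x"
proof -
  note [measurable] = m dt_kernel_measurable[OF t]
  have i: "(LINT y|lborel. dt_kernel t y * f (x - y)) = (LINT y|lborel. dt_kernel t y * g (x - y))" for x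
    by (rule integral_cong_AE) (use AE_reflect[OF ae, of x] in \<open>auto elim: eventually_mono\<close>)
  show ?thesis
    using AE_translate[OF ae, of t] AE_translate[OF ae, of "- t"]
    by eventually_elim (simp add: dt_propagator_alt i wave_def)
qed

lemma propagator_cong_AE:
  assumes m: "f \<in> borel_measurable borel" "g \<in> borel_measurable borel" and ae: "AE y in lborel. f y = g y"
  shows "propagator t f x = propagator t g x"
proof -
  define K where "K y = indicator {-t..t} y * (exp (- t / 2) * bessel_I 0 (sqrt (t\<^sup>2 - y\<^sup>2) / 2))" for y
  have "K = (\<lambda>y. 2 * k0 t y * indicator {-t..t} y)"
    by (simp add: K_def fun_eq_iff indicator_def k0_def bessel_I_0[OF sq_diff_nonneg])
  moreover have "k0 t \<in> borel_measurable borel"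
    by (intro borel_measurable_continuous_onI jcontD[OF jcont_k(1)] continuous_intros)
  ultimately have [measurable]: "K \<in> borel_measurable borel" by simp
  note [measurable] = m
  have "(LINT y|lborel. K y * f (x - y)) = (LINT y|lborel. K y * g (x - y))"
    by (rule integral_cong_AE) (use AE_reflect[OF ae, of x] in \<open>auto elim: eventually_mono\<close>)
  then show ?thesis unfolding propagator_def set_lebesgue_integral_def K_def by (simp add: mult.assoc)
qed

section \<open>Bounded continuous solutions of the integral equation\<close>

definition src :: "real \<Rightarrow> (real \<Rightarrow> real \<Rightarrow> real) \<Rightarrow> real \<Rightarrow> real \<Rightarrow> real" where
  "src p U \<tau> x = \<bar>U \<tau> x\<bar> powr p"

definition duh :: "(real \<Rightarrow> real \<Rightarrow> real) \<Rightarrow> real \<Rightarrow> real \<Rightarrow> real" where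
  "duh F = timeconv (\<lambda>s \<tau> x. conv k0 s (F \<tau>) x)"

definition ulin :: "(real \<Rightarrow> real) \<Rightarrow> real \<Rightarrow> real \<Rightarrow> real" where
  "ulin g t x = wave g t x + conv k1 t g x"

text \<open>The classical counterpart of a regular mild solution. Values are compared at every
  point, and the closed time interval makes one bound \<open>M\<close> serve for the Lipschitz
  constant of the source. The term S(t)(u0 + u1) is 0 for the data in question, hence the linear
  part is \<open>ulin g\<close>.\<close>

definition csol :: "real \<Rightarrow> (real \<Rightarrow> real) \<Rightarrow> real \<Rightarrow> (real \<Rightarrow> real \<Rightarrow> real) \<Rightarrow> bool" where
  "csol p g S U \<longleftrightarrow> fcont S U \<and> (\<exists>M. \<forall>t\<in>{0..S}. \<forall>x. \<bar>U t x\<bar> \<le> M) \<and>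
     (\<forall>t\<in>{0..S}. \<forall>x. U t x = ulin g t x + duh (src p U) t x)"

lemma fcont_src: "0 < p \<Longrightarrow> fcont S U \<Longrightarrow> fcont S (src p U)"
  unfolding src_def split_beta
  by (rule continuous_on_powr') (auto intro!: continuous_intros)

lemma fcont_mono: "fcont S F \<Longrightarrow> S' \<le> S \<Longrightarrow> fcont S' F"
  by (erule continuous_on_subset) auto

lemma csol_mono: "csol p g S U \<Longrightarrow> S' \<le> S \<Longrightarrow> csol p g S' U"
  unfolding csol_def using fcont_mono[of S U S'] by (meson atLeastAtMost_iff order_trans)

lemma powr_lipschitz:
  fixes a b M p :: real
  assumes p: "1 \<le> p" and "\<bar>a\<bar> \<le> M" "\<bar>b\<bar> \<le> M"
  shows "\<bar>\<bar>a\<bar> powr p - \<bar>b\<bar> powr p\<bar> \<le> p * M powr (p - 1) * \<bar>a - b\<bar>"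
proof -
  have *: "\<bar>a\<bar> powr p - \<bar>b\<bar> powr p \<le> p * M powr (p - 1) * \<bar>a - b\<bar>" if "\<bar>a\<bar> \<le> M" for a b :: real
  proof -
    have "\<bar>a\<bar> powr p - \<bar>b\<bar> powr p \<le> p * \<bar>a\<bar> powr (p - 1) * (sgn a * (a - b))"
      using powr_tangent[OF p, of a b] by (simp add: algebra_simps)
    also have "\<dots> \<le> p * \<bar>a\<bar> powr (p - 1) * \<bar>a - b\<bar>"
      using p by (intro mult_left_mono) (auto simp: sgn_if)
    also have "\<dots> \<le> p * M powr (p - 1) * \<bar>a - b\<bar>"
      using p that by (intro mult_right_mono mult_left_mono powr_mono2) auto
    finally show ?thesis .
  qed
  from *[OF assms(2), of b] *[OF assms(3), of a] show ?thesis by (simp add: abs_le_iff abs_minus_commute)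
qed

lemma duh_continuous: "fcont S F \<Longrightarrow> fcont S (duh F)"
  unfolding duh_def by (intro timeconv_continuous tcont_conv jcont_k)

lemma duh_abs_le:
  assumes F: "fcont S F" and t: "0 \<le> t" "t \<le> S" and B: "continuous_on {0..t} B"
    and le: "\<And>\<tau> y. 0 \<le> \<tau> \<Longrightarrow> \<tau> \<le> t \<Longrightarrow> \<bar>y\<bar> \<le> t - \<tau> \<Longrightarrow> \<bar>F \<tau> (x + y)\<bar> \<le> B \<tau>"
  shows "\<bar>duh F t x\<bar> \<le> integral {0..t} B"
  unfolding duh_def
proof (rule timeconv_abs_le[OF tcont_conv[OF jcont_k(1) F] t B])
  fix \<tau> assume "0 \<le> \<tau>" "\<tau> \<le> t"
  then show "\<bar>conv k0 (t - \<tau>) (F \<tau>) x\<bar> \<le> B \<tau>"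
    using t by (intro conv_k0_abs_le fcont_slice[OF F] le) auto
qed

lemma conv_diff:
  assumes k: "jcont k" and "continuous_on UNIV f" "continuous_on UNIV g"
  shows "conv k s (\<lambda>x. f x - g x) x = conv k s f x - conv k s g x"
  unfolding conv_def right_diff_distrib
  by (intro sym_integral_add(2) conv_integrand_continuous assms)

lemma duh_diff:
  assumes F: "fcont S F" "fcont S G" and t: "0 \<le> t" "t \<le> S"
  shows "duh (\<lambda>\<tau> x. F \<tau> x - G \<tau> x) t x = duh F t x - duh G t x"
proof -
  have "duh (\<lambda>\<tau> x. F \<tau> x - G \<tau> x) t x = integral {0..t} (\<lambda>\<tau>. conv k0 (t - \<tau>) (F \<tau>) x - conv k0 (t - \<tau>) (G \<tau>) x)"
    unfolding duh_def timeconv_def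
    using t by (intro Henstock_Kurzweil_Integration.integral_cong conv_diff jcont_k fcont_slice[OF F(1)] fcont_slice[OF F(2)]) auto
  also have "\<dots> = duh F t x - duh G t x"
    unfolding duh_def timeconv_def
    by (intro Henstock_Kurzweil_Integration.integral_diff timeconv_integrable[OF tcont_conv[OF jcont_k(1) F(1)] t(2)]
        timeconv_integrable[OF tcont_conv[OF jcont_k(1) F(2)] t(2)])
  finally show ?thesis .
qed

text \<open>Finite speed of propagation allows a Gronwall argument inside each backward light cone.\<close>

lemma cone_gronwall:
  assumes L: "0 < L" and F: "fcont S F"
    and bd: "\<And>t y. 0 \<le> t \<Longrightarrow> t \<le> S \<Longrightarrow> \<bar>D t y\<bar> \<le> M"
    and lip: "\<And>t y. 0 \<le> t \<Longrightarrow> t \<le> S \<Longrightarrow> \<bar>F t y\<bar> \<le> L * \<bar>D t y\<bar>"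
    and eq: "\<And>t y. 0 \<le> t \<Longrightarrow> t \<le> S \<Longrightarrow> \<bar>y\<bar> \<le> S - t \<Longrightarrow> \<bar>D t (x + y)\<bar> \<le> A + \<bar>duh F t (x + y)\<bar>"
    and t: "0 \<le> t" "t \<le> S" "\<bar>y\<bar> \<le> S - t"
  shows "\<bar>D t (x + y)\<bar> \<le> 2 * A * exp (2 * L * t)"
proof -
  define Q where "Q = {(t, y). 0 \<le> t \<and> t \<le> S \<and> \<bar>y\<bar> \<le> S - t}"
  \<comment> \<open>With the weight exp (-2 L t) the integral operator has norm at most 1/2 on the
    cone, so the supremum \<open>N\<close> satisfies \<open>N \<le> A + N / 2\<close>.\<close>
  define w where "w = (\<lambda>(t, y). exp (- (2 * L * t)) * \<bar>D t (x + y)\<bar>)"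
  define N where "N = (SUP c\<in>Q. w c)"
  have bdd: "bdd_above (w ` Q)"
  proof (rule bdd_aboveI2)
    fix c assume "c \<in> Q"
    then obtain t y where c: "c = (t, y)" "0 \<le> t" "t \<le> S" by (auto simp: Q_def)
    have "exp (- (2 * L * t)) * \<bar>D t (x + y)\<bar> \<le> 1 * M"
      using L c bd by (intro mult_mono) auto
    then show "w c \<le> M" by (simp add: w_def c)
  qed
  have wN: "w c \<le> N" if "c \<in> Q" for c unfolding N_def by (rule cSUP_upper[OF that bdd])
  have tyQ: "(t, y) \<in> Q" using t by (simp add: Q_def)
  have DN: "\<bar>D t (x + y)\<bar> \<le> exp (2 * L * t) * N" if "(t, y) \<in> Q" for t y
  proof -
    have "exp (2 * L * t) * (exp (- (2 * L * t)) * \<bar>D t (x + y)\<bar>) \<le> exp (2 * L * t) * N"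
      using wN[OF that] by (intro mult_left_mono) (auto simp: w_def)
    then show ?thesis by (simp add: mult.assoc[symmetric] exp_add[symmetric])
  qed
  have N0: "0 \<le> N" using wN[OF tyQ] by (auto simp: w_def intro: order_trans[rotated])
  have "w c \<le> A + N / 2" if "c \<in> Q" for c
  proof -
    obtain t y where c: "c = (t, y)" "0 \<le> t" "t \<le> S" "\<bar>y\<bar> \<le> S - t" using \<open>c \<in> Q\<close> by (auto simp: Q_def)
    have "\<bar>duh F t (x + y)\<bar> \<le> integral {0..t} (\<lambda>\<tau>. L * (exp (2 * L * \<tau>) * N))"
    proof (rule duh_abs_le[OF F c(2,3)])
      fix \<tau> z assume z: "0 \<le> \<tau>" "\<tau> \<le> t" "\<bar>z\<bar> \<le> t - \<tau>"
      have "(\<tau>, y + z) \<in> Q" using z c by (auto simp: Q_def)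
      then have "L * \<bar>D \<tau> (x + (y + z))\<bar> \<le> L * (exp (2 * L * \<tau>) * N)" using L DN by (intro mult_left_mono) auto
      then show "\<bar>F \<tau> (x + y + z)\<bar> \<le> L * (exp (2 * L * \<tau>) * N)"
        using lip[of \<tau> "x + y + z"] z c by (simp add: add.assoc)
    qed (intro continuous_intros)
    also have "\<dots> = exp (2 * L * t) * N / 2 - exp (2 * L * 0) * N / 2"
    proof (rule integral_unique, rule fundamental_theorem_of_calculus[OF c(2)])
      show "((\<lambda>\<tau>. exp (2 * L * \<tau>) * N / 2) has_vector_derivative L * (exp (2 * L * \<tau>) * N)) (at \<tau> within {0..t})" for \<tau>
        unfolding has_real_derivative_iff_has_vector_derivative[symmetric]
        by (auto intro!: derivative_eq_intros)
    qed
    also have "\<dots> \<le> exp (2 * L * t) * (N / 2)" using N0 by simp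
    finally have "\<bar>D t (x + y)\<bar> \<le> A + exp (2 * L * t) * (N / 2)"
      using eq[OF c(2-4)] by linarith
    then have "w c \<le> exp (- (2 * L * t)) * (A + exp (2 * L * t) * (N / 2))"
      unfolding w_def c(1) by (simp add: mult_left_mono)
    also have "\<dots> = exp (- (2 * L * t)) * A + N / 2"
      by (simp add: distrib_left mult.assoc[symmetric] exp_add[symmetric])
    also have "\<dots> \<le> A + N / 2"
    proof -
      \<comment> \<open>At time 0 the Duhamel term vanishes, and the hypothesis forces
        \<open>A\<close> to be nonnegative.\<close>
      have "\<bar>duh F 0 x\<bar> = 0" by (simp add: duh_def timeconv_def)
      moreover have "0 \<le> S" using c by auto
      ultimately have "0 \<le> A" using eq[of 0 0] by simp
      then have "exp (- (2 * L * t)) * A \<le> 1 * A" using L c by (intro mult_right_mono) auto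
      then show ?thesis by simp
    qed
    finally show ?thesis .
  qed
  then have "N \<le> A + N / 2" unfolding N_def using tyQ by (intro cSUP_least) auto
  then have "N \<le> 2 * A" by simp
  then have "exp (2 * L * t) * N \<le> exp (2 * L * t) * (2 * A)" by (intro mult_left_mono) auto
  then have "\<bar>D t (x + y)\<bar> \<le> exp (2 * L * t) * (2 * A)" using DN[OF tyQ] by linarith
  then show ?thesis by (simp only: mult.commute)
qed

lemma csol_unique:
  assumes p: "1 < p" and U: "csol p g S U" and V: "csol p g S V" and t: "0 \<le> t" "t \<le> S"
  shows "U t x = V t x"
proof -
  obtain M1 M2 where M: "\<And>t x. t \<in> {0..S} \<Longrightarrow> \<bar>U t x\<bar> \<le> M1" "\<And>t x. t \<in> {0..S} \<Longrightarrow> \<bar>V t x\<bar> \<le> M2"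
    using U V unfolding csol_def by blast
  define M where "M = max M1 M2 + 1"
  define L where "L = p * M powr (p - 1)"
  have "0 \<le> M1" using M(1)[of 0 0] t by auto
  then have "0 < M" by (simp add: M_def)
  then have L: "0 < L" using p by (simp add: L_def)
  have Mb: "\<bar>U t x\<bar> \<le> M" "\<bar>V t x\<bar> \<le> M" if "0 \<le> t" "t \<le> S" for t x
    using M(1)[of t x] M(2)[of t x] that by (auto simp: M_def)
  have c: "fcont S (src p U)" "fcont S (src p V)" using U V p by (auto simp: csol_def intro!: fcont_src)
  have "\<bar>U t (x + 0) - V t (x + 0)\<bar> \<le> 2 * 0 * exp (2 * L * t)"
  proof (rule cone_gronwall[where S = S and F = "\<lambda>\<tau> x. src p U \<tau> x - src p V \<tau> x" and D = "\<lambda>t x. U t x - V t x" and M = "2 * M"])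
    show "fcont S (\<lambda>\<tau> x. src p U \<tau> x - src p V \<tau> x)"
      using continuous_on_diff[OF c] by (simp add: split_beta)
    show "\<bar>src p U \<tau> y - src p V \<tau> y\<bar> \<le> L * \<bar>U \<tau> y - V \<tau> y\<bar>" if "0 \<le> \<tau>" "\<tau> \<le> S" for \<tau> y
      unfolding src_def L_def using p Mb[OF that] by (intro powr_lipschitz) auto
    show "\<bar>U \<tau> y - V \<tau> y\<bar> \<le> 2 * M" if "0 \<le> \<tau>" "\<tau> \<le> S" for \<tau> y
      using Mb[OF that, of y] by linarith
    show "\<bar>U \<tau> (x + y) - V \<tau> (x + y)\<bar> \<le> 0 + \<bar>duh (\<lambda>\<tau> x. src p U \<tau> x - src p V \<tau> x) \<tau> (x + y)\<bar>"
      if "0 \<le> \<tau>" "\<tau> \<le> S" for \<tau> y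
    proof -
      have "U \<tau> (x + y) = ulin g \<tau> (x + y) + duh (src p U) \<tau> (x + y)" "V \<tau> (x + y) = ulin g \<tau> (x + y) + duh (src p V) \<tau> (x + y)"
        using U V that unfolding csol_def by auto
      then show ?thesis using duh_diff[OF c that] by simp
    qed
  qed (use L t in auto)
  then show ?thesis by simp
qed

section \<open>Solutions with a fixed datum: envelope and regularity\<close>

text \<open>Normal form of an initial function. Requiring \<open>g = prim h\<close> at every point
  fixes the continuous representative that tends to 0 at minus infinity, and bounds it by the L^1
  norm of \<open>h\<close>.\<close>

locale datum =
  fixes p :: real and g h :: "real \<Rightarrow> real"
  assumes p: "1 < p" and hL: "h \<in> Lq 1" "h \<in> Lq p" and g1: "g \<in> Lq 1" and g: "g = prim h"
begin

lemma h_int: "integrable lborel h" and g_int: "integrable lborel g"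
proof -
  show "integrable lborel h"
    using hL(1) by (intro integrable_abs_cancel[of _ h]) (auto simp: Lq_iff)
  show "integrable lborel g"
    using g1 by (intro integrable_abs_cancel[of _ g]) (auto simp: Lq_iff)
qed

definition "H = (LINT s|lborel. \<bar>h s\<bar>)"

lemma g_le: "\<bar>g x\<bar> \<le> H" unfolding g H_def by (rule prim_abs_le[OF h_int])

lemma H_nonneg: "0 \<le> H" by (simp add: H_def)

lemma g_density: "density_of h g" unfolding g by (rule prim_density[OF h_int])

lemma g_cont: "continuous_on UNIV g" by (rule density_of_continuous[OF g_density])

lemma gL: "q \<in> {1, p} \<Longrightarrow> g \<in> Lq q" using p g_int g_le by (intro Lq_bounded) auto

text \<open>Bounds |g| on the whole interval of radius \<open>S\<close> around x by the fundamental
  theorem of calculus, and yet lies in every L^q. By finite speed of propagation it also dominates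
  the solution at x up to time \<open>S\<close>.\<close>

definition env :: "real \<Rightarrow> real \<Rightarrow> real" where
  "env S x = \<bar>g x\<bar> + (LINT y|lborel. indicator {-S..S} y * \<bar>h (x + y)\<bar>)"

lemma h_meas [measurable]: "h \<in> borel_measurable borel" using hL by (simp add: Lq_iff)
lemma g_meas [measurable]: "g \<in> borel_measurable borel" using g_int by (auto dest: borel_measurable_integrable)

lemma env_int1: "integrable lborel (\<lambda>y. indicator {-S..S} y * \<bar>h (x + y)\<bar>)"
proof -
  have "integrable lborel (\<lambda>y. \<bar>h (y + x)\<bar>)"
    using h_int integral_lborel_shift(2)[of h x] by auto
  then show ?thesis
    by (rule Bochner_Integration.integrable_bound) (auto simp: indicator_def add.commute)
qed

lemma env_ge:
  assumes "\<bar>y\<bar> \<le> S" shows "\<bar>g (x + y)\<bar> \<le> env S x"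
proof -
  have 1: "\<bar>g b - g a\<bar> \<le> (LINT s|lborel. indicator {-S..S} s * \<bar>h (x + s)\<bar>)"
    if ab: "a \<le> b" "x - S \<le> a" "b \<le> x + S" for a b
  proof -
    have "g b - g a = (LINT s|lborel. indicator {a..b} s *\<^sub>R h s)"
      using g_density ab unfolding density_of_def set_lebesgue_integral_def by blast
    also have "\<dots> = (LINT s|lborel. indicator {a..b} (s + x) *\<^sub>R h (s + x))"
      by (rule integral_lborel_shift(1)[symmetric])
    also have "\<bar>\<dots>\<bar> \<le> (LINT s|lborel. \<bar>indicator {a..b} (s + x) *\<^sub>R h (s + x)\<bar>)" by (rule integral_abs_bound)
    also have "\<dots> \<le> (LINT s|lborel. indicator {-S..S} s * \<bar>h (x + s)\<bar>)"
      using ab by (intro integral_mono' env_int1) (auto simp: indicator_def add.commute)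
    finally show ?thesis .
  qed
  have "\<bar>g (x + y) - g x\<bar> \<le> (LINT s|lborel. indicator {-S..S} s * \<bar>h (x + s)\<bar>)"
  proof (cases "0 \<le> y")
    case True
    then show ?thesis using assms by (intro 1) auto
  next
    case False
    then have "\<bar>g x - g (x + y)\<bar> \<le> (LINT s|lborel. indicator {-S..S} s * \<bar>h (x + s)\<bar>)" using assms by (intro 1) auto
    then show ?thesis by (simp add: abs_minus_commute)
  qed
  then show ?thesis unfolding env_def by linarith
qed

lemma env_nonneg: "0 \<le> env S x" by (simp add: env_def)

text \<open>By Tonelli the moving average has integral at most the window length times
  \<open>H\<close>. Together with the bound \<open>2 * H\<close> this covers all exponents.\<close>

lemma env_L: assumes "1 \<le> q" shows "env S \<in> Lq q"
proof (rule Lq_bounded[OF assms])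
  have m: "(\<lambda>x. LINT y|lborel. indicator {-S..S} y * \<bar>h (x + y)\<bar>) \<in> borel_measurable borel" by measurable
  have "integrable lborel (\<lambda>x. LINT y|lborel. indicator {-S..S} y * \<bar>h (x + y)\<bar>)"
  proof (rule integrableI_nonneg)
    have "(\<integral>\<^sup>+x. ennreal (LINT y|lborel. indicator {-S..S} y * \<bar>h (x + y)\<bar>) \<partial>lborel) =
       (\<integral>\<^sup>+x. \<integral>\<^sup>+y. ennreal (indicator {-S..S} y * \<bar>h (x + y)\<bar>) \<partial>lborel \<partial>lborel)"
      by (intro nn_integral_cong nn_integral_eq_integral[symmetric] env_int1) auto
    also have "\<dots> = (\<integral>\<^sup>+y. \<integral>\<^sup>+x. ennreal (indicator {-S..S} y * \<bar>h (x + y)\<bar>) \<partial>lborel \<partial>lborel)"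
      by (rule lborel_pair.Fubini') measurable
    also have "\<dots> = (\<integral>\<^sup>+(y::real). indicator {-S..S} y * ennreal H \<partial>lborel)"
    proof (rule nn_integral_cong)
      fix y
      have "(\<integral>\<^sup>+x. ennreal \<bar>h (x + y)\<bar> \<partial>lborel) = ennreal (LINT x|lborel. \<bar>h (x + y)\<bar>)"
        using h_int integral_lborel_shift(2)[of h y] by (intro nn_integral_eq_integral) auto
      also have "(LINT x|lborel. \<bar>h (x + y)\<bar>) = H" unfolding H_def by (rule integral_lborel_shift(1)[of "\<lambda>x. \<bar>h x\<bar>"])
      finally show "(\<integral>\<^sup>+x. ennreal (indicator {-S..S} y * \<bar>h (x + y)\<bar>) \<partial>lborel) = indicator {-S..S} y * ennreal H"
        by (auto simp: indicator_def)
    qed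
    also have "\<dots> < \<infinity>"
    proof (subst nn_integral_multc)
      have "emeasure lborel {-S..S} < \<infinity>" by (cases "- S \<le> S") auto
      then show "(\<integral>\<^sup>+(y::real). indicator {-S..S} y \<partial>lborel) * ennreal H < \<infinity>" by (simp add: ennreal_mult_less_top)
    qed measurable
    finally show "(\<integral>\<^sup>+x. ennreal (LINT y|lborel. indicator {-S..S} y * \<bar>h (x + y)\<bar>) \<partial>lborel) < \<infinity>" .
  qed (use m in auto)
  then show "integrable lborel (env S)" unfolding env_def[abs_def] using g_int by auto
  show "\<bar>env S x\<bar> \<le> 2 * H" for x
  proof -
    have "(LINT y|lborel. indicator {-S..S} y * \<bar>h (x + y)\<bar>) \<le> (LINT y|lborel. \<bar>h (y + x)\<bar>)"
      using h_int integral_lborel_shift(2)[of h x] by (intro integral_mono') (auto simp: indicator_def add.commute)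
    also have "\<dots> = H" unfolding H_def by (rule integral_lborel_shift(1)[of "\<lambda>x. \<bar>h x\<bar>"])
    finally show ?thesis using g_le[of x] env_nonneg[of S x] by (simp add: env_def)
  qed
qed

text \<open>The factor 9 is 1 from the travelling part and 8 from \<open>k1_mass\<close>.\<close>

lemma ulin_env:
  assumes "0 \<le> t" "\<bar>y\<bar> \<le> S - t" shows "\<bar>ulin g t (x + y)\<bar> \<le> 9 * env S x"
proof -
  have e: "\<bar>g (x + y + z)\<bar> \<le> env S x" if "\<bar>z\<bar> \<le> t" for z
    using env_ge[of "y + z" S x] assms that by (simp add: add.assoc)
  have "\<bar>wave g t (x + y)\<bar> \<le> 1 * env S x"
  proof -
    have "\<bar>(g (x + y + t) + g (x + y - t)) / 2\<bar> \<le> env S x"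
      using e[of t] e[of "- t"] assms by simp
    then show ?thesis
      unfolding wave_def abs_mult using assms(1) by (intro mult_mono) auto
  qed
  moreover have "\<bar>conv k1 t g (x + y)\<bar> \<le> 8 * env S x"
    by (rule conv_k1_abs_le[OF g_cont assms(1) e])
  ultimately show ?thesis unfolding ulin_def by linarith
qed

lemma ulin_bound: "0 \<le> t \<Longrightarrow> \<bar>ulin g t x\<bar> \<le> 9 * H"
proof -
  assume t: "0 \<le> t"
  have "\<bar>wave g t x\<bar> \<le> 1 * H"
  proof -
    have "\<bar>(g (x + t) + g (x - t)) / 2\<bar> \<le> H" using g_le[of "x + t"] g_le[of "x - t"] by simp
    then show ?thesis unfolding wave_def abs_mult using t by (intro mult_mono) auto
  qed
  moreover have "\<bar>conv k1 t g x\<bar> \<le> 8 * H" using g_le by (intro conv_k1_abs_le g_cont t)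
  ultimately show ?thesis unfolding ulin_def by linarith
qed

lemma fcont_const: "fcont S (\<lambda>\<tau>. g)"
  unfolding split_beta by (intro continuous_on_compose2[OF g_cont] continuous_intros) auto

lemma fcont_conv_g: "jcont k \<Longrightarrow> fcont S (\<lambda>t x. conv k t g x)"
proof -
  assume k: "jcont k"
  have "continuous_on ({0..S} \<times> UNIV) (\<lambda>c. conv k (fst c) ((\<lambda>_. g) c) (snd c))"
    by (rule continuous_on_conv[OF k])
      (auto intro!: continuous_on_compose2[OF g_cont] continuous_intros simp: split_beta)
  then show ?thesis by (simp add: split_beta)
qed

lemma fcont_ulin: "fcont S (ulin g)"
proof -
  have "continuous_on ({0..S} \<times> UNIV) (\<lambda>c. exp (- fst c / 2) * ((g (snd c + fst c) + g (snd c - fst c)) / 2) + conv k1 (fst c) g (snd c))"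
    using fcont_conv_g[OF jcont_k(2), of S]
    by (intro continuous_intros continuous_on_compose2[OF g_cont]) (auto simp: split_beta)
  then show ?thesis by (simp add: split_beta ulin_def wave_def)
qed

text \<open>\<open>cone_gronwall\<close> with the linear envelope as inhomogeneity. This is where a
  solution that was only assumed bounded and continuous acquires integrability in x, locally
  uniformly in time.\<close>

lemma csol_env:
  assumes U: "csol p g S U" and S: "0 \<le> S"
  obtains C where "1 \<le> C" "\<And>t x y. 0 \<le> t \<Longrightarrow> t \<le> S \<Longrightarrow> \<bar>y\<bar> \<le> S - t \<Longrightarrow> \<bar>U t (x + y)\<bar> \<le> C * env S x"
    "\<And>t x y. 0 \<le> t \<Longrightarrow> t \<le> S \<Longrightarrow> \<bar>y\<bar> \<le> S - t \<Longrightarrow> \<bar>src p U t (x + y)\<bar> \<le> C * env S x"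
proof -
  obtain M1 where M1: "\<And>t x. t \<in> {0..S} \<Longrightarrow> \<bar>U t x\<bar> \<le> M1" using U unfolding csol_def by blast
  define M where "M = M1 + 1"
  have "0 \<le> M1" using M1[of 0 0] S by auto
  then have M: "0 < M" "\<bar>U t x\<bar> \<le> M" if "0 \<le> t" "t \<le> S" for t x
    using M1[of t x] that by (auto simp: M_def)
  have M0: "0 < M" using \<open>0 \<le> M1\<close> by (simp add: M_def)
  define L where "L = p * M powr (p - 1)"
  have L: "0 < L" using p M0 by (simp add: L_def)
  have lip: "\<bar>src p U \<tau> y\<bar> \<le> L * \<bar>U \<tau> y\<bar>" if "0 \<le> \<tau>" "\<tau> \<le> S" for \<tau> y
    using powr_lipschitz[of p "U \<tau> y" M 0] p M0 M(2)[OF that] by (simp add: src_def L_def)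
  define C1 where "C1 = 18 * exp (2 * L * S)"
  have UC: "\<bar>U t (x + y)\<bar> \<le> C1 * env S x" if t: "0 \<le> t" "t \<le> S" "\<bar>y\<bar> \<le> S - t" for t x y
  proof -
    have "\<bar>U t (x + y)\<bar> \<le> 2 * (9 * env S x) * exp (2 * L * t)"
    proof (rule cone_gronwall[where D = U, OF L _ M(2) lip _ t])
      show "fcont S (src p U)" using U p by (auto simp: csol_def intro!: fcont_src)
      show "\<bar>U \<tau> (x + y)\<bar> \<le> 9 * env S x + \<bar>duh (src p U) \<tau> (x + y)\<bar>"
        if "0 \<le> \<tau>" "\<tau> \<le> S" "\<bar>y\<bar> \<le> S - \<tau>" for \<tau> y
      proof -
        have "U \<tau> (x + y) = ulin g \<tau> (x + y) + duh (src p U) \<tau> (x + y)"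
          using U that unfolding csol_def by auto
        then show ?thesis using ulin_env[OF that(1,3), of x] by linarith
      qed
    qed
    also have "\<dots> \<le> 2 * (9 * env S x) * exp (2 * L * S)"
      using t L env_nonneg by (intro mult_left_mono) auto
    finally show ?thesis by (simp add: C1_def ac_simps)
  qed
  show ?thesis
  proof (rule that[of "max 1 (max C1 (L * C1))"])
    fix t x y assume t: "0 \<le> t" "t \<le> S" "\<bar>y\<bar> \<le> S - t"
    have "C1 * env S x \<le> max 1 (max C1 (L * C1)) * env S x"
      using env_nonneg by (intro mult_right_mono) auto
    then show "\<bar>U t (x + y)\<bar> \<le> max 1 (max C1 (L * C1)) * env S x" using UC[OF t, of x] by linarith
    have "L * \<bar>U t (x + y)\<bar> \<le> L * (C1 * env S x)" using L UC[OF t] by (intro mult_left_mono) auto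
    moreover have "L * C1 * env S x \<le> max 1 (max C1 (L * C1)) * env S x"
      using env_nonneg by (intro mult_right_mono) auto
    ultimately show "\<bar>src p U t (x + y)\<bar> \<le> max 1 (max C1 (L * C1)) * env S x"
      using lip[OF t(1,2), of "x + y"] by (simp add: mult.assoc)
  qed simp
qed

end

text \<open>With \<open>ky\<close> and \<open>kt\<close> the derivatives of \<open>k\<close> in its
  second and first argument, \<open>bdry_x\<close> and \<open>bdry_t\<close> are the x- and
  s-derivatives of \<open>conv k s g x\<close>. The point values of \<open>g\<close> come from the
  moving end points.\<close>

definition bdry_x :: "(real \<Rightarrow> real \<Rightarrow> real) \<Rightarrow> (real \<Rightarrow> real \<Rightarrow> real) \<Rightarrow> real \<Rightarrow> (real \<Rightarrow> real) \<Rightarrow> real \<Rightarrow> real" where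
  "bdry_x k ky s g x = k s (- s) * g (x + s) - k s s * g (x - s) + conv ky s g x"
definition bdry_t :: "(real \<Rightarrow> real \<Rightarrow> real) \<Rightarrow> (real \<Rightarrow> real \<Rightarrow> real) \<Rightarrow> real \<Rightarrow> (real \<Rightarrow> real) \<Rightarrow> real \<Rightarrow> real" where
  "bdry_t k kt s g x = k s s * g (x - s) + k s (- s) * g (x + s) + conv kt s g x"

lemma tcont_bdry:
  assumes k: "jcont k" "jcont k'" and F: "fcont S F"
  shows "tcont S (\<lambda>s \<tau> x. bdry_x k k' s (F \<tau>) x)" "tcont S (\<lambda>s \<tau> x. bdry_t k k' s (F \<tau>) x)"
proof -
  let ?A = "(UNIV :: real set) \<times> {0..S} \<times> (UNIV :: real set)"
  have 1: "continuous_on ?A (\<lambda>c. F (fst (snd c)) (snd (snd c) + fst c))" "continuous_on ?A (\<lambda>c. F (fst (snd c)) (snd (snd c) - fst c))"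
    by (rule fcontD[OF F]; auto intro!: continuous_intros)+
  have 2: "continuous_on ?A (\<lambda>c. k (fst c) (- fst c))" "continuous_on ?A (\<lambda>c. k (fst c) (fst c))"
    by (intro jcontD[OF k(1)] continuous_intros)+
  have 3: "continuous_on ?A (\<lambda>c. conv k' (fst c) (F (fst (snd c))) (snd (snd c)))"
    using tcont_conv[OF k(2) F] by (simp add: split_beta)
  have "continuous_on ?A (\<lambda>c. k (fst c) (- fst c) * F (fst (snd c)) (snd (snd c) + fst c) - k (fst c) (fst c) * F (fst (snd c)) (snd (snd c) - fst c)
     + conv k' (fst c) (F (fst (snd c))) (snd (snd c)))"
    "continuous_on ?A (\<lambda>c. k (fst c) (fst c) * F (fst (snd c)) (snd (snd c) - fst c) + k (fst c) (- fst c) * F (fst (snd c)) (snd (snd c) + fst c)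
     + conv k' (fst c) (F (fst (snd c))) (snd (snd c)))"
    by (intro continuous_on_add continuous_on_diff continuous_on_mult 1 2 3)+
  then show "tcont S (\<lambda>s \<tau> x. bdry_x k k' s (F \<tau>) x)" "tcont S (\<lambda>s \<tau> x. bdry_t k k' s (F \<tau>) x)"
    by (simp_all add: split_beta bdry_x_def bdry_t_def)
qed

lemma bdry_bound:
  assumes k: "jcont k" "jcont k'"
  obtains C where "0 \<le> C" "\<And>g s x B. continuous_on UNIV g \<Longrightarrow> 0 \<le> s \<Longrightarrow> s \<le> S \<Longrightarrow>
    (\<And>y. \<bar>y\<bar> \<le> s \<Longrightarrow> \<bar>g (x + y)\<bar> \<le> B) \<Longrightarrow> \<bar>bdry_x k k' s g x\<bar> \<le> C * B \<and> \<bar>bdry_t k k' s g x\<bar> \<le> C * B"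
proof -
  obtain K where K: "0 \<le> K" "\<And>s y. 0 \<le> s \<Longrightarrow> s \<le> S \<Longrightarrow> \<bar>y\<bar> \<le> s \<Longrightarrow> \<bar>k s y\<bar> \<le> K" using kernel_bound[OF k(1)] by metis
  obtain C where C: "0 \<le> C" "\<And>g s x B. continuous_on UNIV g \<Longrightarrow> 0 \<le> s \<Longrightarrow> s \<le> S \<Longrightarrow>
    (\<And>y. \<bar>y\<bar> \<le> s \<Longrightarrow> \<bar>g (x + y)\<bar> \<le> B) \<Longrightarrow> \<bar>conv k' s g x\<bar> \<le> C * B"
    using conv_bound[OF k(2)] by blast
  show ?thesis
  proof (rule that[of "2 * K + C"])
    fix g s x B assume *: "continuous_on UNIV g" "0 \<le> s" "s \<le> S" "\<And>y. \<bar>y\<bar> \<le> s \<Longrightarrow> \<bar>g (x + y)\<bar> \<le> (B::real)"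
    have "\<bar>k s (- s) * g (x + s)\<bar> \<le> K * B" "\<bar>k s s * g (x - s)\<bar> \<le> K * B"
      unfolding abs_mult using K *(2,3) *(4)[of s] *(4)[of "- s"] by (auto intro!: mult_mono)
    then show "\<bar>bdry_x k k' s g x\<bar> \<le> (2 * K + C) * B \<and> \<bar>bdry_t k k' s g x\<bar> \<le> (2 * K + C) * B"
      using C(2)[OF *] unfolding bdry_x_def bdry_t_def distrib_right by linarith
  qed (use K C in auto)
qed

context datum
begin

lemma fcont_bdry_g:
  assumes "jcont k" "jcont k'"
  shows "fcont S (\<lambda>t x. bdry_x k k' t g x)" "fcont S (\<lambda>t x. bdry_t k k' t g x)"
proof -
  have "continuous_on ({0..S} \<times> UNIV) (\<lambda>c. bdry_x k k' (fst c) g (snd c))"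
    "continuous_on ({0..S} \<times> UNIV) (\<lambda>c. bdry_t k k' (fst c) g (snd c))"
  proof -
    have c: "continuous_on ({0..S} \<times> (UNIV :: real set)) fst" "continuous_on ({0..S} \<times> (UNIV :: real set)) snd"
      using continuous_on_fst[OF continuous_on_id] continuous_on_snd[OF continuous_on_id] by simp_all
    show "continuous_on ({0..S} \<times> UNIV) (\<lambda>c. bdry_x k k' (fst c) g (snd c))"
      "continuous_on ({0..S} \<times> UNIV) (\<lambda>c. bdry_t k k' (fst c) g (snd c))"
      by (rule tcontD[OF tcont_bdry(1)[OF assms fcont_const[of S]] c(1) c(1) c(2)], force,
          rule tcontD[OF tcont_bdry(2)[OF assms fcont_const[of S]] c(1) c(1) c(2)], force)
  qed
  then show "fcont S (\<lambda>t x. bdry_x k k' t g x)" "fcont S (\<lambda>t x. bdry_t k k' t g x)" by (simp_all add: split_beta)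
qed

text \<open>The solution minus \<open>wave g\<close> consists of convolutions, so it is
  differentiable classically in both variables; in the Duhamel term the s-derivative of the kernel
  \<open>k0\<close> is \<open>k1\<close>. The envelope of \<open>regular_curve\<close> is a multiple
  of \<open>env S\<close>.\<close>

lemma csol_regular:
  assumes U: "\<And>S. 0 \<le> S \<Longrightarrow> ereal S < T \<Longrightarrow> csol p g S U"
  shows "regular_curve p T g h
    (\<lambda>t x. conv k1 t g x + duh (src p U) t x)
    (\<lambda>t x. bdry_x k1 k1y t g x + timeconv (\<lambda>s \<tau> x. bdry_x k0 k0y s (src p U \<tau>) x) t x)
    (\<lambda>t x. bdry_t k1 k1t t g x + timeconv (\<lambda>s \<tau> x. bdry_t k0 k1 s (src p U \<tau>) x) t x) U"
proof
  have F: "fcont S (src p U)" if "ereal S < T" for S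
  proof (cases "0 \<le> S")
    case True
    then show ?thesis using U[OF True that] p unfolding csol_def by (intro fcont_src) auto
  qed auto
  have add: "fcont S (\<lambda>t x. A t x + B t x)" if "fcont S A" "fcont S B" for S A B
    using continuous_on_add[OF that] by (simp add: split_beta)
  show "1 \<le> p" using p by simp
  show "g \<in> Lq q" if "q \<in> {1, p}" for q using gL[OF that] .
  show "h \<in> Lq q" if "q \<in> {1, p}" for q using hL that by auto
  show "density_of h g" by (rule g_density)
  fix S assume S: "ereal S < T"
  note FS = F[OF S]
  show "fcont S (\<lambda>t x. conv k1 t g x + duh (src p U) t x)"
    by (intro add fcont_conv_g duh_continuous FS jcont_k)
  show "fcont S (\<lambda>t x. bdry_x k1 k1y t g x + timeconv (\<lambda>s \<tau> x. bdry_x k0 k0y s (src p U \<tau>) x) t x)"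
    by (intro add fcont_bdry_g timeconv_continuous tcont_bdry FS jcont_k)
  show "fcont S (\<lambda>t x. bdry_t k1 k1t t g x + timeconv (\<lambda>s \<tau> x. bdry_t k0 k1 s (src p U \<tau>) x) t x)"
    by (intro add fcont_bdry_g timeconv_continuous tcont_bdry FS jcont_k)
  show "\<exists>E. (\<forall>q\<in>{1, p}. E \<in> Lq q) \<and>
       (\<forall>t\<in>{0..S}. \<forall>x. \<bar>conv k1 t g x + duh (src p U) t x\<bar> \<le> E x \<and>
        \<bar>bdry_x k1 k1y t g x + timeconv (\<lambda>s \<tau> x. bdry_x k0 k0y s (src p U \<tau>) x) t x\<bar> \<le> E x \<and>
        \<bar>bdry_t k1 k1t t g x + timeconv (\<lambda>s \<tau> x. bdry_t k0 k1 s (src p U \<tau>) x) t x\<bar> \<le> E x)"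
  proof (cases "0 \<le> S")
    case True
    obtain C where C: "1 \<le> C" "\<And>t x y. 0 \<le> t \<Longrightarrow> t \<le> S \<Longrightarrow> \<bar>y\<bar> \<le> S - t \<Longrightarrow> \<bar>src p U t (x + y)\<bar> \<le> C * env S x"
      using csol_env[OF U[OF True S] True] by metis
    obtain C1 where C1: "0 \<le> C1" "\<And>g s x B. continuous_on UNIV g \<Longrightarrow> 0 \<le> s \<Longrightarrow> s \<le> S \<Longrightarrow>
      (\<And>y. \<bar>y\<bar> \<le> s \<Longrightarrow> \<bar>g (x + y)\<bar> \<le> B) \<Longrightarrow> \<bar>bdry_x k1 k1y s g x\<bar> \<le> C1 * B \<and> \<bar>bdry_t k1 k1y s g x\<bar> \<le> C1 * B"
      using bdry_bound[OF jcont_k(2,4)] by blast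
    obtain C2 where C2: "0 \<le> C2" "\<And>g s x B. continuous_on UNIV g \<Longrightarrow> 0 \<le> s \<Longrightarrow> s \<le> S \<Longrightarrow>
      (\<And>y. \<bar>y\<bar> \<le> s \<Longrightarrow> \<bar>g (x + y)\<bar> \<le> B) \<Longrightarrow> \<bar>bdry_x k1 k1t s g x\<bar> \<le> C2 * B \<and> \<bar>bdry_t k1 k1t s g x\<bar> \<le> C2 * B"
      using bdry_bound[OF jcont_k(2,5)] by blast
    obtain C3 where C3: "0 \<le> C3" "\<And>g s x B. continuous_on UNIV g \<Longrightarrow> 0 \<le> s \<Longrightarrow> s \<le> S \<Longrightarrow>
      (\<And>y. \<bar>y\<bar> \<le> s \<Longrightarrow> \<bar>g (x + y)\<bar> \<le> B) \<Longrightarrow> \<bar>bdry_x k0 k0y s g x\<bar> \<le> C3 * B \<and> \<bar>bdry_t k0 k0y s g x\<bar> \<le> C3 * B"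
      using bdry_bound[OF jcont_k(1,3)] by blast
    obtain C4 where C4: "0 \<le> C4" "\<And>g s x B. continuous_on UNIV g \<Longrightarrow> 0 \<le> s \<Longrightarrow> s \<le> S \<Longrightarrow>
      (\<And>y. \<bar>y\<bar> \<le> s \<Longrightarrow> \<bar>g (x + y)\<bar> \<le> B) \<Longrightarrow> \<bar>bdry_x k0 k1 s g x\<bar> \<le> C4 * B \<and> \<bar>bdry_t k0 k1 s g x\<bar> \<le> C4 * B"
      using bdry_bound[OF jcont_k(1,2)] by blast
    define K where "K = (8 + S * C) + (C1 + S * (C3 * C)) + (C2 + S * (C4 * C))"
    have pos: "0 \<le> S * C" "0 \<le> S * (C3 * C)" "0 \<le> S * (C4 * C)" using True C C3 C4 by auto
    have tc: "\<bar>timeconv (\<lambda>s \<tau> x. G s (src p U \<tau>) x) t x\<bar> \<le> S * (c * C) * env S x"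
      if G: "tcont S (\<lambda>s \<tau> x. G s (src p U \<tau>) x)" and c: "0 \<le> c" and t: "0 \<le> t" "t \<le> S"
        and Gb: "\<And>g s x B. continuous_on UNIV g \<Longrightarrow> 0 \<le> s \<Longrightarrow> s \<le> S \<Longrightarrow> (\<And>y. \<bar>y\<bar> \<le> s \<Longrightarrow> \<bar>g (x + y)\<bar> \<le> B) \<Longrightarrow> \<bar>G s g x\<bar> \<le> c * B"
      for G c t x
    proof -
      have "\<bar>timeconv (\<lambda>s \<tau> x. G s (src p U \<tau>) x) t x\<bar> \<le> integral {0..t} (\<lambda>_. c * (C * env S x))"
      proof (rule timeconv_abs_le[OF G t])
        fix \<tau> assume \<tau>: "0 \<le> \<tau>" "\<tau> \<le> t"
        show "\<bar>G (t - \<tau>) (src p U \<tau>) x\<bar> \<le> c * (C * env S x)"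
          using \<tau> t by (intro Gb fcont_slice[OF FS] C(2)) auto
      qed auto
      also have "\<dots> = t * (c * (C * env S x))" using t by simp
      also have "\<dots> \<le> S * (c * (C * env S x))" using t c C env_nonneg by (intro mult_right_mono) auto
      finally show ?thesis by (simp add: mult.assoc)
    qed
    have ge: "\<bar>g (x + y)\<bar> \<le> env S x" if "\<bar>y\<bar> \<le> t" "t \<le> S" for x y t using that by (intro env_ge) auto
    show ?thesis
    proof (intro exI[of _ "\<lambda>x. K * env S x"] conjI ballI allI)
      show "(\<lambda>x. K * env S x) \<in> Lq q" if "q \<in> {1, p}" for q using that p by (intro Lq_cmult env_L) auto
      fix t x assume t: "t \<in> {0..S}"
      then have t': "0 \<le> t" "t \<le> S" by auto
      have e0: "0 \<le> env S x" by (rule env_nonneg)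
      have mono: "c * env S x \<le> K * env S x" if "c \<le> K" for c using that e0 by (rule mult_right_mono)
      have "\<bar>conv k1 t g x\<bar> \<le> 8 * env S x" by (rule conv_k1_abs_le[OF g_cont t'(1) ge[OF _ t'(2)]])
      moreover have "\<bar>duh (src p U) t x\<bar> \<le> S * (1 * C) * env S x"
        unfolding duh_def using conv_k0_abs_le by (intro tc tcont_conv jcont_k FS t') auto
      moreover have "(8 + S * C) * env S x \<le> K * env S x" using pos C1 C2 by (intro mono) (simp add: K_def)
      ultimately show "\<bar>conv k1 t g x + duh (src p U) t x\<bar> \<le> K * env S x" by (simp add: distrib_right)
      have "\<bar>bdry_x k1 k1y t g x\<bar> \<le> C1 * env S x" using C1(2)[OF g_cont t' ge[OF _ t'(2)]] by blast
      moreover have "\<bar>timeconv (\<lambda>s \<tau> x. bdry_x k0 k0y s (src p U \<tau>) x) t x\<bar> \<le> S * (C3 * C) * env S x"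
        using C3(2) by (intro tc[where G = "bdry_x k0 k0y"] tcont_bdry jcont_k FS t' C3(1)) blast
      moreover have "(C1 + S * (C3 * C)) * env S x \<le> K * env S x" using pos C1 C2 by (intro mono) (simp add: K_def)
      ultimately show "\<bar>bdry_x k1 k1y t g x + timeconv (\<lambda>s \<tau> x. bdry_x k0 k0y s (src p U \<tau>) x) t x\<bar> \<le> K * env S x"
        unfolding distrib_right by linarith
      have "\<bar>bdry_t k1 k1t t g x\<bar> \<le> C2 * env S x" using C2(2)[OF g_cont t' ge[OF _ t'(2)]] by blast
      moreover have "\<bar>timeconv (\<lambda>s \<tau> x. bdry_t k0 k1 s (src p U \<tau>) x) t x\<bar> \<le> S * (C4 * C) * env S x"
        using C4(2) by (intro tc[where G = "bdry_t k0 k1"] tcont_bdry jcont_k FS t' C4(1)) blast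
      moreover have "(C2 + S * (C4 * C)) * env S x \<le> K * env S x" using pos C1 C2 by (intro mono) (simp add: K_def)
      ultimately show "\<bar>bdry_t k1 k1t t g x + timeconv (\<lambda>s \<tau> x. bdry_t k0 k1 s (src p U \<tau>) x) t x\<bar> \<le> K * env S x"
        unfolding distrib_right by linarith
    qed
  qed (auto intro!: exI[of _ "\<lambda>_. 0"] simp: Lq_iff)
next
  have F: "fcont S (src p U)" if "0 \<le> S" "ereal S < T" for S
    using U[OF that] p unfolding csol_def by (intro fcont_src) auto
  fix t x assume t: "0 \<le> t" "ereal t < T"
  show "((\<lambda>x. conv k1 t g x + duh (src p U) t x) has_real_derivative
      bdry_x k1 k1y t g x + timeconv (\<lambda>s \<tau> x. bdry_x k0 k0y s (src p U \<tau>) x) t x) (at x)"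
  proof (rule DERIV_add)
    show "(conv k1 t g has_real_derivative bdry_x k1 k1y t g x) (at x)"
      unfolding bdry_x_def using DERIV_k(4) by (intro conv_has_derivative_x jcont_k g_cont t)
    show "(duh (src p U) t has_real_derivative timeconv (\<lambda>s \<tau> x. bdry_x k0 k0y s (src p U \<tau>) x) t x) (at x)"
      unfolding duh_def
    proof (rule timeconv_has_derivative_x[where S = t])
      show "(conv k0 s (src p U \<tau>) has_real_derivative bdry_x k0 k0y s (src p U \<tau>) x) (at x)" if "0 \<le> s" "\<tau> \<in> {0..t}" for s \<tau> x
        unfolding bdry_x_def using DERIV_k(3) that by (intro conv_has_derivative_x jcont_k fcont_slice[OF F[OF t]])
    qed (use t in \<open>auto intro!: tcont_conv tcont_bdry jcont_k F\<close>)
  qed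
  show "U t x = wave g t x + (conv k1 t g x + duh (src p U) t x)"
    using U[OF t] t(1) unfolding csol_def ulin_def by auto
next
  have F: "fcont S (src p U)" if "0 \<le> S" "ereal S < T" for S
    using U[OF that] p unfolding csol_def by (intro fcont_src) auto
  fix t x assume t: "0 < t" "ereal t < T"
  obtain S where S: "t < S" "ereal S < T" using time_interval_nhd[of t T] t by auto
  then have FS: "fcont S (src p U)" using t by (intro F) auto
  show "((\<lambda>t. conv k1 t g x + duh (src p U) t x) has_real_derivative
      bdry_t k1 k1t t g x + timeconv (\<lambda>s \<tau> x. bdry_t k0 k1 s (src p U \<tau>) x) t x) (at t)"
  proof (rule DERIV_add)
    show "((\<lambda>t. conv k1 t g x) has_real_derivative bdry_t k1 k1t t g x) (at t)"
      unfolding bdry_t_def by (intro conv_has_derivative_t jcont_k DERIV_k g_cont)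
    show "((\<lambda>t. duh (src p U) t x) has_real_derivative timeconv (\<lambda>s \<tau> x. bdry_t k0 k1 s (src p U \<tau>) x) t x) (at t)"
      unfolding duh_def
    proof (rule timeconv_has_derivative_t[where S = S])
      show "((\<lambda>s. conv k0 s (src p U \<tau>) x) has_real_derivative bdry_t k0 k1 s (src p U \<tau>) x) (at s)" if "\<tau> \<in> {0..S}" for s \<tau> x
        unfolding bdry_t_def by (intro conv_has_derivative_t jcont_k DERIV_k fcont_slice[OF FS that])
      show "conv k0 0 (src p U \<tau>) x = 0" for \<tau> by (simp add: conv_def sym_integral_def)
    qed (use t S in \<open>auto intro!: tcont_conv tcont_bdry jcont_k FS\<close>)
  qed
qed

end

section \<open>Decay estimates and existence\<close>

text \<open>The L^1 norm with values in \<open>ennreal\<close>, so that Tonelli applies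
  directly.\<close>

definition mass :: "(real \<Rightarrow> real) \<Rightarrow> ennreal" where "mass f = (\<integral>\<^sup>+x. ennreal \<bar>f x\<bar> \<partial>lborel)"

lemma mass_cmult: "f \<in> borel_measurable borel \<Longrightarrow> mass (\<lambda>x. c * f x) = ennreal \<bar>c\<bar> * mass f"
  unfolding mass_def by (simp add: abs_mult ennreal_mult nn_integral_cmult)

lemma mass_add_le:
  "f \<in> borel_measurable borel \<Longrightarrow> g \<in> borel_measurable borel \<Longrightarrow> mass (\<lambda>x. f x + g x) \<le> mass f + mass g"
  unfolding mass_def
  by (subst nn_integral_add[symmetric]) (auto intro!: nn_integral_mono simp: ennreal_plus[symmetric] simp del: ennreal_plus intro!: ennreal_leI)

lemma mass_shift: "f \<in> borel_measurable borel \<Longrightarrow> mass (\<lambda>x. f (x + t)) = mass f"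
  unfolding mass_def using nn_integral_real_affine[of "\<lambda>x. ennreal \<bar>f x\<bar>" 1 t] by (simp add: add.commute)

lemma mass_reflect: "f \<in> borel_measurable borel \<Longrightarrow> mass (\<lambda>y. f (x - y)) = mass f"
  unfolding mass_def using nn_integral_real_affine[of "\<lambda>x. ennreal \<bar>f x\<bar>" "-1" x] by simp

lemma mass_mono: "(\<And>x. \<bar>f x\<bar> \<le> \<bar>g x\<bar>) \<Longrightarrow> mass f \<le> mass g"
  unfolding mass_def by (intro nn_integral_mono ennreal_leI)

lemma conv_abs_nn:
  assumes k: "jcont k" and g: "continuous_on UNIV g" and s: "0 \<le> s"
  shows "ennreal \<bar>conv k s g x\<bar> \<le> (\<integral>\<^sup>+y. ennreal (indicator {-s..s} y * \<bar>k s y\<bar>) * ennreal \<bar>g (x - y)\<bar> \<partial>lborel)"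
proof -
  have c: "continuous_on A (\<lambda>y. \<bar>k s y * g (x - y)\<bar>)" for A
    by (intro continuous_on_rabs conv_integrand_continuous k g)
  have "\<bar>conv k s g x\<bar> \<le> sym_integral s (\<lambda>y. \<bar>k s y * g (x - y)\<bar>)"
    unfolding conv_def by (rule sym_integral_abs_le[OF s conv_integrand_continuous[OF k g]])
  also have "\<dots> = (LINT y:{-s..s}|lborel. \<bar>k s y * g (x - y)\<bar>)"
    unfolding sym_integral_nonneg_eq[OF s c]
    by (rule set_borel_integral_eq_integral(2)[OF borel_integrable_atLeastAtMost'[OF c], symmetric])
  finally have "ennreal \<bar>conv k s g x\<bar> \<le> ennreal (LINT y|lborel. indicator {-s..s} y *\<^sub>R \<bar>k s y * g (x - y)\<bar>)"
    unfolding set_lebesgue_integral_def by (rule ennreal_leI)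
  also have "\<dots> = (\<integral>\<^sup>+y. ennreal (indicator {-s..s} y *\<^sub>R \<bar>k s y * g (x - y)\<bar>) \<partial>lborel)"
    using borel_integrable_atLeastAtMost'[OF c, of "-s" s] unfolding set_integrable_def
    by (intro nn_integral_eq_integral[symmetric]) auto
  also have "\<dots> = (\<integral>\<^sup>+y. ennreal (indicator {-s..s} y * \<bar>k s y\<bar>) * ennreal \<bar>g (x - y)\<bar> \<partial>lborel)"
    by (intro nn_integral_cong) (simp add: abs_mult ennreal_mult[symmetric] mult.assoc)
  finally show ?thesis .
qed

lemma kernel_measurable: "jcont k \<Longrightarrow> k s \<in> borel_measurable borel"
  by (intro borel_measurable_continuous_onI jcontD[of k] continuous_intros)

lemma conv_mass:
  assumes k: "jcont k" and g: "continuous_on UNIV g" and s: "0 \<le> s"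
  shows "mass (conv k s g) \<le> ennreal (sym_integral s (\<lambda>y. \<bar>k s y\<bar>)) * mass g"
proof -
  have [measurable]: "g \<in> borel_measurable borel" "k s \<in> borel_measurable borel"
    using borel_measurable_continuous_onI[OF g] kernel_measurable[OF k] by auto
  have "mass (conv k s g) \<le> (\<integral>\<^sup>+x. \<integral>\<^sup>+y. ennreal (indicator {-s..s} y * \<bar>k s y\<bar>) * ennreal \<bar>g (x - y)\<bar> \<partial>lborel \<partial>lborel)"
    unfolding mass_def by (intro nn_integral_mono conv_abs_nn assms)
  also have "\<dots> = (\<integral>\<^sup>+y. \<integral>\<^sup>+x. ennreal (indicator {-s..s} y * \<bar>k s y\<bar>) * ennreal \<bar>g (x - y)\<bar> \<partial>lborel \<partial>lborel)"
    by (rule lborel_pair.Fubini') measurable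
  also have "\<dots> = (\<integral>\<^sup>+y. ennreal (indicator {-s..s} y * \<bar>k s y\<bar>) * mass g \<partial>lborel)"
  proof (rule nn_integral_cong)
    fix y
    have "(\<integral>\<^sup>+x. ennreal \<bar>g (x - y)\<bar> \<partial>lborel) = mass g" using mass_shift[of g "- y"] by (simp add: mass_def)
    then show "(\<integral>\<^sup>+x. ennreal (indicator {-s..s} y * \<bar>k s y\<bar>) * ennreal \<bar>g (x - y)\<bar> \<partial>lborel) = ennreal (indicator {-s..s} y * \<bar>k s y\<bar>) * mass g"
      by (subst nn_integral_cmult) auto
  qed
  also have "\<dots> = (\<integral>\<^sup>+y. ennreal (indicator {-s..s} y * \<bar>k s y\<bar>) \<partial>lborel) * mass g"
    by (rule nn_integral_multc) measurable
  also have "(\<integral>\<^sup>+y. ennreal (indicator {-s..s} y * \<bar>k s y\<bar>) \<partial>lborel) = ennreal (sym_integral s (\<lambda>y. \<bar>k s y\<bar>))"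
  proof -
    have c: "continuous_on A (\<lambda>y. \<bar>k s y\<bar>)" for A
      by (intro continuous_on_rabs jcontD[OF k] continuous_intros)
    have "sym_integral s (\<lambda>y. \<bar>k s y\<bar>) = (LINT y:{-s..s}|lborel. \<bar>k s y\<bar>)"
      unfolding sym_integral_nonneg_eq[OF s c]
      by (rule set_borel_integral_eq_integral(2)[OF borel_integrable_atLeastAtMost'[OF c], symmetric])
    then show ?thesis
      using borel_integrable_atLeastAtMost'[OF c, of "-s" s]
      unfolding set_lebesgue_integral_def set_integrable_def
      by (subst nn_integral_eq_integral) auto
  qed
  finally show ?thesis .
qed

lemma conv_sup:
  assumes k: "jcont k" and g: "continuous_on UNIV g" and s: "0 \<le> s"
    and K: "\<And>y. \<bar>y\<bar> \<le> s \<Longrightarrow> \<bar>k s y\<bar> \<le> K" and b: "mass g \<le> ennreal b" "0 \<le> b"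
  shows "\<bar>conv k s g x\<bar> \<le> K * b"
proof -
  have [measurable]: "g \<in> borel_measurable borel" using borel_measurable_continuous_onI[OF g] .
  have K0: "0 \<le> K" using K[of 0] s by auto
  have "ennreal \<bar>conv k s g x\<bar> \<le> (\<integral>\<^sup>+y. ennreal K * ennreal \<bar>g (x - y)\<bar> \<partial>lborel)"
  proof (rule order_trans[OF conv_abs_nn[OF k g s]], intro nn_integral_mono mult_right_mono ennreal_leI)
    show "indicator {-s..s} y * \<bar>k s y\<bar> \<le> K" for y using K[of y] K0 by (auto simp: indicator_def)
  qed auto
  also have "\<dots> = ennreal K * mass g"
    using mass_reflect[of g x] unfolding mass_def by (subst nn_integral_cmult) auto
  also have "\<dots> \<le> ennreal K * ennreal b" by (intro mult_left_mono b) auto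
  also have "\<dots> = ennreal (K * b)" using K0 b by (simp add: ennreal_mult)
  finally show ?thesis using K0 b by (simp add: ennreal_le_iff)
qed

lemma duh_mass:
  assumes F: "fcont S F" and t: "0 \<le> t" "t \<le> S" and B: "continuous_on {0..t} B" "\<And>\<tau>. \<tau> \<in> {0..t} \<Longrightarrow> 0 \<le> B \<tau>"
    and le: "\<And>\<tau>. \<tau> \<in> {0..t} \<Longrightarrow> mass (F \<tau>) \<le> ennreal (B \<tau>)"
  shows "mass (duh F t) \<le> ennreal (integral {0..t} B)"
proof -
  let ?G = "\<lambda>\<tau> x. conv k0 (t - \<tau>) (F \<tau>) x"
  have Ft: "fcont t F" by (rule fcont_mono[OF F t(2)])
  have gc: "continuous_on ({0..t} \<times> UNIV) (\<lambda>c. ?G (fst c) (snd c))"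
    by (rule tcontD[OF tcont_conv[OF jcont_k(1) Ft], of _ "\<lambda>c. t - fst c" fst snd]) (auto intro!: continuous_intros)
  have [measurable]: "(\<lambda>(\<tau>, x). indicator {0..t} \<tau> * ?G \<tau> x) \<in> borel_measurable (borel \<Otimes>\<^sub>M borel)"
  proof -
    have "(\<lambda>c. indicator ({0..t} \<times> UNIV) c *\<^sub>R ?G (fst c) (snd c)) \<in> borel_measurable borel"
      by (rule borel_measurable_continuous_on_indicator[OF _ gc]) (auto intro!: borel_closed closed_Times)
    moreover have "indicator ({0..t} \<times> UNIV) c *\<^sub>R ?G (fst c) (snd c) = (case c of (\<tau>, x) \<Rightarrow> indicator {0..t} \<tau> * ?G \<tau> x)" for c
      by (auto simp: indicator_def split_beta mem_Times_iff)
    ultimately show ?thesis by (simp add: borel_prod)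
  qed
  have "ennreal \<bar>duh F t x\<bar> \<le> (\<integral>\<^sup>+\<tau>. ennreal \<bar>indicator {0..t} \<tau> * ?G \<tau> x\<bar> \<partial>lborel)" for x
  proof -
    have c: "continuous_on {0..t} (\<lambda>\<tau>. ?G \<tau> x)"
      by (rule tcontD[OF tcont_conv[OF jcont_k(1) Ft]]) (auto intro!: continuous_intros)
    have si: "set_integrable lborel {0..t} (\<lambda>\<tau>. ?G \<tau> x)" by (rule borel_integrable_atLeastAtMost'[OF c])
    have "\<bar>duh F t x\<bar> = \<bar>LINT \<tau>:{0..t}|lborel. ?G \<tau> x\<bar>"
      unfolding duh_def timeconv_def by (subst set_borel_integral_eq_integral(2)[OF si]) simp
    also have "\<dots> \<le> (LINT \<tau>|lborel. \<bar>indicator {0..t} \<tau> * ?G \<tau> x\<bar>)"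
      unfolding set_lebesgue_integral_def real_scaleR_def by (rule integral_abs_bound)
    finally have "ennreal \<bar>duh F t x\<bar> \<le> ennreal (LINT \<tau>|lborel. \<bar>indicator {0..t} \<tau> * ?G \<tau> x\<bar>)" by (rule ennreal_leI)
    also have "\<dots> = (\<integral>\<^sup>+\<tau>. ennreal \<bar>indicator {0..t} \<tau> * ?G \<tau> x\<bar> \<partial>lborel)"
      using si unfolding set_integrable_def real_scaleR_def
      by (intro nn_integral_eq_integral[symmetric] integrable_abs) auto
    finally show ?thesis .
  qed
  then have "mass (duh F t) \<le> (\<integral>\<^sup>+x. \<integral>\<^sup>+\<tau>. ennreal \<bar>indicator {0..t} \<tau> * ?G \<tau> x\<bar> \<partial>lborel \<partial>lborel)"
    unfolding mass_def by (intro nn_integral_mono)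
  also have "\<dots> = (\<integral>\<^sup>+\<tau>. \<integral>\<^sup>+x. ennreal \<bar>indicator {0..t} \<tau> * ?G \<tau> x\<bar> \<partial>lborel \<partial>lborel)"
    by (rule lborel_pair.Fubini'[symmetric]) measurable
  also have "\<dots> \<le> (\<integral>\<^sup>+\<tau>. ennreal (indicator {0..t} \<tau> * B \<tau>) \<partial>lborel)"
  proof (rule nn_integral_mono)
    fix \<tau>
    show "(\<integral>\<^sup>+x. ennreal \<bar>indicator {0..t} \<tau> * ?G \<tau> x\<bar> \<partial>lborel) \<le> ennreal (indicator {0..t} \<tau> * B \<tau>)"
    proof (cases "\<tau> \<in> {0..t}")
      case True
      have "mass (?G \<tau>) \<le> ennreal (sym_integral (t - \<tau>) (\<lambda>y. \<bar>k0 (t - \<tau>) y\<bar>)) * mass (F \<tau>)"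
        using True t by (intro conv_mass jcont_k fcont_slice[OF F]) auto
      also have "\<dots> \<le> 1 * ennreal (B \<tau>)"
        using True k0_abs_mass[of "t - \<tau>"] by (intro mult_mono le) (auto simp: ennreal_le_1)
      finally show ?thesis using True by (simp add: mass_def)
    qed simp
  qed
  also have "\<dots> = ennreal (integral {0..t} B)"
  proof -
    have si: "set_integrable lborel {0..t} B" by (rule borel_integrable_atLeastAtMost'[OF B(1)])
    have "(\<integral>\<^sup>+\<tau>. ennreal (indicator {0..t} \<tau> * B \<tau>) \<partial>lborel) = ennreal (LINT \<tau>|lborel. indicator {0..t} \<tau> * B \<tau>)"
      using si B(2) unfolding set_integrable_def real_scaleR_def
      by (intro nn_integral_eq_integral) (auto simp: indicator_def)
    also have "(LINT \<tau>|lborel. indicator {0..t} \<tau> * B \<tau>) = integral {0..t} B"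
      using set_borel_integral_eq_integral(2)[OF si] by (simp add: set_lebesgue_integral_def)
    finally show ?thesis .
  qed
  finally show ?thesis .
qed

text \<open>The supremum of the Duhamel term is controlled by the L^1 norm of the source alone, with
  the heat-like factor of \<open>k0_le\<close>.\<close>

lemma duh_sup:
  assumes F: "fcont S F" and t: "0 \<le> t" "t \<le> S" and B: "continuous_on {0..t} B" "\<And>\<tau>. \<tau> \<in> {0..t} \<Longrightarrow> 0 \<le> B \<tau>"
    and le: "\<And>\<tau>. \<tau> \<in> {0..t} \<Longrightarrow> mass (F \<tau>) \<le> ennreal (B \<tau>)"
  shows "\<bar>duh F t x\<bar> \<le> integral {0..t} (\<lambda>\<tau>. 1 / sqrt (1 + (t - \<tau>)) * B \<tau>)"
  unfolding duh_def
proof (rule timeconv_abs_le[OF tcont_conv[OF jcont_k(1) F] t])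
  show "continuous_on {0..t} (\<lambda>\<tau>. 1 / sqrt (1 + (t - \<tau>)) * B \<tau>)"
    by (intro continuous_intros B) auto
  fix \<tau> assume \<tau>: "0 \<le> \<tau>" "\<tau> \<le> t"
  show "\<bar>conv k0 (t - \<tau>) (F \<tau>) x\<bar> \<le> 1 / sqrt (1 + (t - \<tau>)) * B \<tau>"
  proof (rule conv_sup)
    show "\<bar>k0 (t - \<tau>) y\<bar> \<le> 1 / sqrt (1 + (t - \<tau>))" if "\<bar>y\<bar> \<le> t - \<tau>" for y
      using k0_nonneg[OF that] k0_le[OF that] by simp
  qed (use \<tau> t B le in \<open>auto intro!: jcont_k fcont_slice[OF F]\<close>)
qed

lemma exp_le_inverse: "0 \<le> t \<Longrightarrow> exp (- t / 2) \<le> 2 / (1 + t)" for t :: real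
proof -
  assume t: "0 \<le> t"
  have "(1 + t) / 2 \<le> 1 + t / 2" by (simp add: add_divide_distrib)
  then have "(1 + t) / 2 \<le> exp (t / 2)" by (rule order_trans[OF _ exp_ge_add_one_self])
  then show ?thesis using t by (simp add: exp_minus field_simps)
qed

lemma inverse_le_inverse_sqrt: "0 \<le> t \<Longrightarrow> 1 / (1 + t) \<le> 1 / sqrt (1 + t)" for t :: real
proof -
  assume t: "0 \<le> t"
  have "sqrt (1 + t) * 1 \<le> sqrt (1 + t) * sqrt (1 + t)" using t by (intro mult_left_mono) auto
  then show ?thesis using t by (simp add: field_simps)
qed

context datum
begin

text \<open>10 = 2 + 8: the damping costs 2 / (1 + t) by \<open>exp_le_inverse\<close>, and the
  integral part 8 / (1 + t) by \<open>k1_mass\<close>. The number \<open>H\<close> enters through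
  the supremum bound. \<open>N\<close> is homogeneous of degree 1 in the datum.\<close>

definition "N = 10 * ((LINT x|lborel. \<bar>g x\<bar>) + H)"

lemma mass_g: "mass g = ennreal (LINT x|lborel. \<bar>g x\<bar>)"
  unfolding mass_def using g_int by (intro nn_integral_eq_integral) auto

lemma N_nonneg: "0 \<le> N" using H_nonneg by (simp add: N_def)

lemma conv_measurable: "jcont k \<Longrightarrow> continuous_on UNIV f \<Longrightarrow> conv k s f \<in> borel_measurable borel"
proof -
  assume k: "jcont k" "continuous_on UNIV f"
  have "continuous_on UNIV (\<lambda>x. conv k s ((\<lambda>_. f) x) x)"
    by (rule continuous_on_conv[OF k(1)]) (auto intro!: continuous_on_compose2[OF k(2)] continuous_intros simp: split_beta)
  then show ?thesis by (intro borel_measurable_continuous_onI) simp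
qed

lemma ulin_mass:
  assumes t: "0 \<le> t" shows "mass (ulin g t) \<le> ennreal (N / (1 + t))"
proof -
  let ?G = "LINT x|lborel. \<bar>g x\<bar>"
  have G: "0 \<le> ?G" by simp
  have w: "mass (wave g t) \<le> ennreal (exp (- t / 2) * ?G)"
  proof -
    have "mass (wave g t) = ennreal \<bar>exp (- t / 2) / 2\<bar> * mass (\<lambda>x. g (x + t) + g (x + - t))"
      using mass_cmult[of "\<lambda>x. g (x + t) + g (x + - t)" "exp (- t / 2) / 2"] by (simp add: wave_def[abs_def])
    also have "\<dots> \<le> ennreal \<bar>exp (- t / 2) / 2\<bar> * (mass (\<lambda>x. g (x + t)) + mass (\<lambda>x. g (x + - t)))"
      by (intro mult_left_mono mass_add_le) auto
    also have "\<dots> = ennreal (exp (- t / 2) / 2) * (ennreal ?G + ennreal ?G)"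
      using mass_shift[of g t] mass_shift[of g "- t"] by (simp add: mass_g)
    also have "\<dots> = ennreal (exp (- t / 2) * ?G)"
      using G by (simp add: ennreal_plus[symmetric] ennreal_mult[symmetric] del: ennreal_plus)
    finally show ?thesis by simp
  qed
  have "mass (conv k1 t g) \<le> ennreal (sym_integral t (\<lambda>y. \<bar>k1 t y\<bar>)) * mass g"
    by (intro conv_mass jcont_k g_cont t)
  also have "\<dots> \<le> ennreal (8 / (1 + t)) * ennreal ?G"
    unfolding mass_g by (intro mult_right_mono ennreal_leI k1_mass t) auto
  also have "\<dots> = ennreal (8 / (1 + t) * ?G)" using G t by (intro ennreal_mult[symmetric]) simp_all
  finally have c: "mass (conv k1 t g) \<le> ennreal (8 / (1 + t) * ?G)" .
  have "mass (ulin g t) \<le> mass (wave g t) + mass (conv k1 t g)"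
    unfolding ulin_def[abs_def]
    by (intro mass_add_le conv_measurable jcont_k g_cont) (simp add: wave_def[abs_def])
  also have "\<dots> \<le> ennreal (exp (- t / 2) * ?G) + ennreal (8 / (1 + t) * ?G)" by (intro add_mono w c)
  also have "\<dots> = ennreal (exp (- t / 2) * ?G + 8 / (1 + t) * ?G)" using G t by (simp add: ennreal_plus)
  also have "\<dots> \<le> ennreal (N / (1 + t))"
  proof (rule ennreal_leI)
    have "exp (- t / 2) * ?G \<le> 2 / (1 + t) * ?G" by (intro mult_right_mono exp_le_inverse t) simp
    moreover have "2 / (1 + t) * ?G + 8 / (1 + t) * ?G = 10 * ?G / (1 + t)"
      by (simp add: add_divide_distrib[symmetric] distrib_right[symmetric])
    moreover have "10 * ?G / (1 + t) \<le> N / (1 + t)" using H_nonneg t by (intro divide_right_mono) (auto simp: N_def)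
    ultimately show "exp (- t / 2) * ?G + 8 / (1 + t) * ?G \<le> N / (1 + t)" by linarith
  qed
  finally show ?thesis .
qed

lemma ulin_sup:
  assumes t: "0 \<le> t" shows "\<bar>ulin g t x\<bar> \<le> N / sqrt (1 + t)"
proof -
  let ?G = "LINT x|lborel. \<bar>g x\<bar>"
  have G: "0 \<le> ?G" by simp
  have "\<bar>wave g t x\<bar> \<le> exp (- t / 2) * H"
  proof -
    have "\<bar>(g (x + t) + g (x - t)) / 2\<bar> \<le> H" using g_le[of "x + t"] g_le[of "x - t"] by simp
    then show ?thesis unfolding wave_def abs_mult by simp
  qed
  also have "\<dots> \<le> (2 * (1 / sqrt (1 + t))) * H"
    using exp_le_inverse[OF t] inverse_le_inverse_sqrt[OF t] H_nonneg by (intro mult_right_mono) auto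
  finally have w: "\<bar>wave g t x\<bar> \<le> 2 * H / sqrt (1 + t)" by simp
  have "\<bar>conv k1 t g x\<bar> \<le> 1 / sqrt (1 + t) * ?G"
    by (rule conv_sup[OF jcont_k(2) g_cont t k1_abs_le]) (auto simp: mass_g)
  then have "\<bar>ulin g t x\<bar> \<le> 2 * H / sqrt (1 + t) + ?G / sqrt (1 + t)" using w unfolding ulin_def by simp
  also have "\<dots> = (2 * H + ?G) / sqrt (1 + t)" by (simp add: add_divide_distrib)
  also have "\<dots> \<le> N / sqrt (1 + t)" using H_nonneg G t by (intro divide_right_mono) (auto simp: N_def)
  finally show ?thesis .
qed

end

lemma powr_mass:
  assumes p: "1 < p" and f: "f \<in> borel_measurable borel" and a: "0 \<le> a" "0 \<le> b"
    and s: "\<And>x. \<bar>f x\<bar> \<le> a" and m: "mass f \<le> ennreal b"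
  shows "mass (\<lambda>x. \<bar>f x\<bar> powr p) \<le> ennreal (a powr (p - 1) * b)"
proof -
  have "\<bar>\<bar>f x\<bar> powr p\<bar> \<le> \<bar>a powr (p - 1) * f x\<bar>" for x
  proof -
    have "\<bar>f x\<bar> powr p = \<bar>f x\<bar> powr (p - 1) * \<bar>f x\<bar>" using powr_add[of "\<bar>f x\<bar>" "p - 1" 1] by simp
    also have "\<dots> \<le> a powr (p - 1) * \<bar>f x\<bar>" using p s by (intro mult_right_mono powr_mono2) auto
    finally show ?thesis by (simp add: abs_mult)
  qed
  then have "mass (\<lambda>x. \<bar>f x\<bar> powr p) \<le> mass (\<lambda>x. a powr (p - 1) * f x)" by (rule mass_mono)
  also have "\<dots> = ennreal (a powr (p - 1)) * mass f" using mass_cmult[OF f] by simp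
  also have "\<dots> \<le> ennreal (a powr (p - 1)) * ennreal b" by (intro mult_left_mono m) auto
  finally show ?thesis using a by (simp add: ennreal_mult)
qed

section \<open>Time integrals behind the decay estimates\<close>

text \<open>A common bound, for times up to \<open>S\<close>, of the integral of (1 +
  \<tau>)^(-(p-1)/2) and of the power (1 + t)^((3-p)/2). These are the two quantities that
  \<open>decay_integral\<close> produces. Its growth, a power for p < 3 and a logarithm for p = 3,
  determines the lifespan.\<close>

definition Lam :: "real \<Rightarrow> real \<Rightarrow> real" where
  "Lam p S = (if p < 3 then 2 / (3 - p) * (1 + S) powr ((3 - p) / 2) else 1 + ln (1 + S))"

lemma Lam_ge:
  assumes p: "1 < p" "p \<le> 3" and t: "0 \<le> t" "t \<le> S"
  shows "(1 + t) powr (1 - (p - 1) / 2) \<le> Lam p S" "integral {0..t} (\<lambda>\<tau>. (1 + \<tau>) powr (- ((p - 1) / 2))) \<le> Lam p S"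
proof -
  have e: "1 - (p - 1) / 2 = (3 - p) / 2" by (simp add: field_simps)
  show "(1 + t) powr (1 - (p - 1) / 2) \<le> Lam p S"
  proof (cases "p < 3")
    case True
    have "1 * (1 + t) powr ((3 - p) / 2) \<le> 2 / (3 - p) * (1 + S) powr ((3 - p) / 2)"
      using t p True by (intro mult_mono powr_mono2) (auto simp: field_simps)
    then show ?thesis unfolding e Lam_def using True by simp
  next
    case False
    then have "p = 3" using p by simp
    then show ?thesis using t by (simp add: Lam_def)
  qed
  show "integral {0..t} (\<lambda>\<tau>. (1 + \<tau>) powr (- ((p - 1) / 2))) \<le> Lam p S"
  proof (cases "p < 3")
    case True
    have "((\<lambda>\<tau>. (1 + \<tau>) powr (- ((p - 1) / 2))) has_integral
       2 / (3 - p) * (1 + t) powr ((3 - p) / 2) - 2 / (3 - p) * (1 + 0) powr ((3 - p) / 2)) {0..t}"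
    proof (rule fundamental_theorem_of_calculus[OF t(1)])
      fix \<tau> assume "\<tau> \<in> {0..t}"
      then have "((\<lambda>\<tau>. 2 / (3 - p) * (1 + \<tau>) powr ((3 - p) / 2)) has_real_derivative
          2 / (3 - p) * ((3 - p) / 2 * (1 + \<tau>) powr ((3 - p) / 2 - 1))) (at \<tau> within {0..t})"
        by (auto intro!: derivative_eq_intros)
      moreover have "2 / (3 - p) * ((3 - p) / 2 * (1 + \<tau>) powr ((3 - p) / 2 - 1)) = (1 + \<tau>) powr (- ((p - 1) / 2))"
      proof -
        have e1: "(3 - p) / 2 - 1 = - ((p - 1) / 2)" by (simp add: field_simps)
        have "2 / (3 - p) * ((3 - p) / 2 * z) = z" for z using True by (simp add: field_simps)
        then show ?thesis unfolding e1 .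
      qed
      ultimately show "((\<lambda>\<tau>. 2 / (3 - p) * (1 + \<tau>) powr ((3 - p) / 2)) has_vector_derivative (1 + \<tau>) powr (- ((p - 1) / 2))) (at \<tau> within {0..t})"
        by (simp add: has_real_derivative_iff_has_vector_derivative)
    qed
    then have "integral {0..t} (\<lambda>\<tau>. (1 + \<tau>) powr (- ((p - 1) / 2))) \<le> 2 / (3 - p) * (1 + t) powr ((3 - p) / 2)"
      using True by (simp add: integral_unique)
    also have "\<dots> \<le> Lam p S" unfolding Lam_def using True t by (simp add: divide_right_mono powr_mono2)
    finally show ?thesis .
  next
    case False
    then have p3: "p = 3" using p by simp
    have "((\<lambda>\<tau>. (1 + \<tau>) powr (- ((p - 1) / 2))) has_integral ln (1 + t) - ln (1 + 0)) {0..t}"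
      by (rule fundamental_theorem_of_calculus[OF t(1)])
        (auto simp: p3 has_real_derivative_iff_has_vector_derivative[symmetric] powr_minus divide_inverse intro!: derivative_eq_intros)
    then have "integral {0..t} (\<lambda>\<tau>. (1 + \<tau>) powr (- ((p - 1) / 2))) = ln (1 + t)" by (simp add: integral_unique)
    also have "\<dots> \<le> ln (1 + S)" using t by (subst ln_le_cancel_iff) auto
    also have "\<dots> \<le> Lam p S" using p3 by (simp add: Lam_def)
    finally show ?thesis .
  qed
qed

text \<open>The exponent (p + 1) / 2 exceeds 1, so the bound is uniform in t: the source made of the
  linear part alone contributes a bounded amount for all times.\<close>

lemma integral_powr_gt1:
  fixes p t :: real
  assumes p: "1 < p" and t: "0 \<le> t"
  shows "integral {0..t} (\<lambda>\<tau>. (1 + \<tau>) powr (- ((p + 1) / 2))) \<le> 2 / (p - 1)"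
proof -
  have "((\<lambda>\<tau>. (1 + \<tau>) powr (- ((p + 1) / 2))) has_integral
     (- 2 / (p - 1)) * (1 + t) powr (- ((p - 1) / 2)) - (- 2 / (p - 1)) * (1 + 0) powr (- ((p - 1) / 2))) {0..t}"
  proof (rule fundamental_theorem_of_calculus[OF t])
    fix \<tau> assume "\<tau> \<in> {0..t}"
    then have "((\<lambda>\<tau>. (- 2 / (p - 1)) * (1 + \<tau>) powr (- ((p - 1) / 2))) has_real_derivative
        (- 2 / (p - 1)) * (- ((p - 1) / 2) * (1 + \<tau>) powr (- ((p - 1) / 2) - 1))) (at \<tau> within {0..t})"
      by (auto intro!: derivative_eq_intros)
    moreover have "(- 2 / (p - 1)) * (- ((p - 1) / 2) * (1 + \<tau>) powr (- ((p - 1) / 2) - 1)) = (1 + \<tau>) powr (- ((p + 1) / 2))"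
    proof -
      have e1: "- ((p - 1) / 2) - 1 = - ((p + 1) / 2)" by (simp add: field_simps)
      have "(- 2 / (p - 1)) * (- ((p - 1) / 2) * z) = z" for z using p by (simp add: field_simps)
      then show ?thesis unfolding e1 .
    qed
    ultimately show "((\<lambda>\<tau>. (- 2 / (p - 1)) * (1 + \<tau>) powr (- ((p - 1) / 2))) has_vector_derivative (1 + \<tau>) powr (- ((p + 1) / 2))) (at \<tau> within {0..t})"
      by (simp add: has_real_derivative_iff_has_vector_derivative)
  qed
  then have "integral {0..t} (\<lambda>\<tau>. (1 + \<tau>) powr (- ((p + 1) / 2))) = 2 / (p - 1) - 2 / (p - 1) * (1 + t) powr (- ((p - 1) / 2))"
    by (simp add: integral_unique)
  also have "\<dots> \<le> 2 / (p - 1)" using p by simp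
  finally show ?thesis .
qed

text \<open>Splitting at \<open>\<tau> = t / 2\<close>, written without a case distinction in the integral.\<close>

lemma decay_integral:
  fixes \<gamma> t :: real
  assumes \<gamma>: "0 \<le> \<gamma>" and t: "0 \<le> t"
  shows "integral {0..t} (\<lambda>\<tau>. 1 / sqrt (1 + (t - \<tau>)) * (1 + \<tau>) powr (- \<gamma>)) \<le>
    (2 * integral {0..t} (\<lambda>\<tau>. (1 + \<tau>) powr (- \<gamma>)) + 2 * 2 powr \<gamma> * (1 + t) powr (1 - \<gamma>)) / sqrt (1 + t)"
proof -
  let ?f = "\<lambda>\<tau>. (1 + \<tau>) powr (- \<gamma>)" and ?s = "\<lambda>\<tau>. 1 / sqrt (1 + (t - \<tau>))"
  have cf: "continuous_on {0..t} ?f" by (intro continuous_intros) auto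
  have cs: "continuous_on {0..t} ?s" by (intro continuous_intros) auto
  have pw: "?s \<tau> * ?f \<tau> \<le> 2 / sqrt (1 + t) * ?f \<tau> + 2 powr \<gamma> * (1 + t) powr (- \<gamma>) * ?s \<tau>" if \<tau>: "\<tau> \<in> {0..t}" for \<tau>
  proof (cases "\<tau> \<le> t / 2")
    case True
    have "sqrt (1 + t) \<le> sqrt (4 * (1 + (t - \<tau>)))" using True t by (intro real_sqrt_le_mono) auto
    also have "\<dots> = sqrt 4 * sqrt (1 + (t - \<tau>))" by (rule real_sqrt_mult)
    also have "sqrt 4 = (2::real)" by (rule real_sqrt_unique) auto
    finally have "?s \<tau> \<le> 2 / sqrt (1 + t)" using \<tau> by (simp add: field_simps)
    then have "?s \<tau> * ?f \<tau> \<le> 2 / sqrt (1 + t) * ?f \<tau>" by (rule mult_right_mono) simp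
    moreover have "0 \<le> 2 powr \<gamma> * (1 + t) powr (- \<gamma>) * ?s \<tau>" using \<tau> by simp
    ultimately show ?thesis by linarith
  next
    case False
    have "?f \<tau> \<le> ((1 + t) / 2) powr (- \<gamma>)"
      using False t \<gamma> \<tau> by (intro powr_mono2') auto
    also have "\<dots> = 2 powr \<gamma> * (1 + t) powr (- \<gamma>)"
      using t by (simp add: powr_divide powr_minus field_simps)
    finally have "?s \<tau> * ?f \<tau> \<le> ?s \<tau> * (2 powr \<gamma> * (1 + t) powr (- \<gamma>))" using \<tau> by (intro mult_left_mono) auto
    moreover have "0 \<le> 2 / sqrt (1 + t) * ?f \<tau>" using t by simp
    ultimately show ?thesis by (simp only: mult.commute[of "?s \<tau>"])
  qed
  have si: "((?s) has_integral 2 * sqrt (1 + t) - 2) {0..t}"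
  proof -
    have "(?s has_integral - 2 * sqrt (1 + (t - t)) - - 2 * sqrt (1 + (t - 0))) {0..t}"
      by (rule fundamental_theorem_of_calculus[OF t])
        (auto simp: has_real_derivative_iff_has_vector_derivative[symmetric] field_simps intro!: derivative_eq_intros)
    then show ?thesis by simp
  qed
  have "integral {0..t} (\<lambda>\<tau>. ?s \<tau> * ?f \<tau>) \<le> integral {0..t} (\<lambda>\<tau>. 2 / sqrt (1 + t) * ?f \<tau> + 2 powr \<gamma> * (1 + t) powr (- \<gamma>) * ?s \<tau>)"
    by (intro Henstock_Kurzweil_Integration.integral_le integrable_continuous_real continuous_on_add continuous_on_mult
        continuous_on_const cf cs pw)
  also have "\<dots> = 2 / sqrt (1 + t) * integral {0..t} ?f + 2 powr \<gamma> * (1 + t) powr (- \<gamma>) * integral {0..t} ?s"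
    by (subst Henstock_Kurzweil_Integration.integral_add;
        (intro integrable_continuous_real continuous_on_mult continuous_on_const cf cs)?)
      (simp only: Henstock_Kurzweil_Integration.integral_mult_right)
  also have "integral {0..t} ?s = 2 * sqrt (1 + t) - 2" using si by (rule integral_unique)
  also have "2 / sqrt (1 + t) * integral {0..t} ?f + 2 powr \<gamma> * (1 + t) powr (- \<gamma>) * (2 * sqrt (1 + t) - 2) \<le>
     2 / sqrt (1 + t) * integral {0..t} ?f + 2 powr \<gamma> * (1 + t) powr (- \<gamma>) * (2 * sqrt (1 + t))"
    by (intro add_left_mono mult_left_mono) auto
  also have "\<dots> = (2 * integral {0..t} ?f + 2 * 2 powr \<gamma> * (1 + t) powr (1 - \<gamma>)) / sqrt (1 + t)"
  proof -
    have "(1 + t) powr (1 - \<gamma>) = (1 + t) powr (- \<gamma>) * (1 + t)"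
      using t powr_add[of "1 + t" "- \<gamma>" 1] by simp
    moreover have "(1 + t) = sqrt (1 + t) * sqrt (1 + t)" using t by simp
    ultimately have e: "(1 + t) powr (1 - \<gamma>) / sqrt (1 + t) = (1 + t) powr (- \<gamma>) * sqrt (1 + t)"
      using t by (metis (no_types, lifting) mult.assoc nonzero_mult_div_cancel_right real_sqrt_eq_zero_cancel_iff add_nonneg_eq_0_iff zero_le_one one_neq_zero times_divide_eq_right)
    have "(2 * A + 2 * B * C) / s = 2 / s * A + B * (2 * (C / s))" for A B C s :: real
      by (simp add: add_divide_distrib)
    from this[of "integral {0..t} ?f" "2 powr \<gamma>" "(1 + t) powr (1 - \<gamma>)" "sqrt (1 + t)"]
    show ?thesis unfolding e by (simp add: ac_simps)
  qed
  finally show ?thesis .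
qed

section \<open>Picard iteration around the linear part\<close>

text \<open>Here \<open>v\<close> is the linear part and \<open>w\<close> the correction. Both decay
  like (1 + t)^(-1/2) in the supremum norm, but only \<open>v\<close> also decays in L^1. The extra
  factor 1 / (1 + t) turns the exponent (p - 1) / 2 into (p + 1) / 2.\<close>

lemma src_mass:
  assumes p: "1 < p" and t: "0 \<le> t" and U: "continuous_on UNIV v" "continuous_on UNIV w"
    and v: "\<And>x. \<bar>v x\<bar> \<le> N / sqrt (1 + t)" "mass v \<le> ennreal (N / (1 + t))" "0 \<le> N"
    and w: "\<And>x. \<bar>w x\<bar> \<le> a / sqrt (1 + t)" "mass w \<le> ennreal a" "0 \<le> a"
  shows "mass (\<lambda>x. \<bar>v x + w x\<bar> powr p) \<le>
    ennreal (2 powr p * (N powr p * (1 + t) powr (- ((p + 1) / 2)) + a powr p * (1 + t) powr (- ((p - 1) / 2))))"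
proof -
  have [measurable]: "v \<in> borel_measurable borel" "w \<in> borel_measurable borel"
    using U borel_measurable_continuous_onI by auto
  have sq: "(c / sqrt (1 + t)) powr (p - 1) * c = c powr p * (1 + t) powr (- ((p - 1) / 2))" if "0 \<le> c" for c
  proof -
    have "c powr (p - 1) * c = c powr p" using that powr_add[of c "p - 1" 1] by simp
    moreover have "(c / sqrt (1 + t)) powr (p - 1) = c powr (p - 1) * (1 + t) powr (- ((p - 1) / 2))"
    proof -
      have "(1 / sqrt (1 + t)) powr (p - 1) = (1 + t) powr (- ((p - 1) / 2))"
        using t by (simp add: powr_half_sqrt[symmetric] powr_divide powr_powr powr_minus_divide)
      then show ?thesis using that t by (simp add: powr_divide field_simps)
    qed
    ultimately show ?thesis by (simp add: ac_simps)
  qed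
  have V: "mass (\<lambda>x. \<bar>v x\<bar> powr p) \<le> ennreal (N powr p * (1 + t) powr (- ((p + 1) / 2)))"
  proof -
    have "mass (\<lambda>x. \<bar>v x\<bar> powr p) \<le> ennreal ((N / sqrt (1 + t)) powr (p - 1) * (N / (1 + t)))"
      using v t by (intro powr_mass[OF p]) auto
    also have "(N / sqrt (1 + t)) powr (p - 1) * (N / (1 + t)) = ((N / sqrt (1 + t)) powr (p - 1) * N) / (1 + t)" by simp
    also have "\<dots> = N powr p * ((1 + t) powr (- ((p - 1) / 2)) / (1 + t))" unfolding sq[OF v(3)] by simp
    also have "(1 + t) powr (- ((p - 1) / 2)) / (1 + t) = (1 + t) powr (- ((p + 1) / 2))"
    proof -
      have "(1 + t) powr (- ((p - 1) / 2)) / (1 + t) = (1 + t) powr (- ((p - 1) / 2) - 1)"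
        using t by (simp add: powr_diff)
      also have "- ((p - 1) / 2) - 1 = - ((p + 1) / 2)" by (simp add: field_simps)
      finally show ?thesis .
    qed
    finally show ?thesis .
  qed
  have W: "mass (\<lambda>x. \<bar>w x\<bar> powr p) \<le> ennreal (a powr p * (1 + t) powr (- ((p - 1) / 2)))"
    unfolding sq[OF w(3), symmetric] using w t by (intro powr_mass[OF p]) auto
  have "mass (\<lambda>x. \<bar>v x + w x\<bar> powr p) \<le> mass (\<lambda>x. 2 powr p * (\<bar>v x\<bar> powr p + \<bar>w x\<bar> powr p))"
    using p by (intro mass_mono) (auto simp: abs_mult intro: powr_add_le order_trans[OF powr_add_le])
  also have "\<dots> = ennreal (2 powr p) * mass (\<lambda>x. \<bar>v x\<bar> powr p + \<bar>w x\<bar> powr p)"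
    using mass_cmult[of "\<lambda>x. \<bar>v x\<bar> powr p + \<bar>w x\<bar> powr p" "2 powr p"] by simp
  also have "\<dots> \<le> ennreal (2 powr p) * (ennreal (N powr p * (1 + t) powr (- ((p + 1) / 2))) + ennreal (a powr p * (1 + t) powr (- ((p - 1) / 2))))"
    by (intro mult_left_mono order_trans[OF mass_add_le] add_mono V W) auto
  also have "\<dots> = ennreal (2 powr p * (N powr p * (1 + t) powr (- ((p + 1) / 2)) + a powr p * (1 + t) powr (- ((p - 1) / 2))))"
    by (subst ennreal_plus[symmetric]) (auto simp: ennreal_mult)
  finally show ?thesis .
qed

text \<open>From \<open>decay_integral\<close> with exponent \<gamma> = (p + 1) / 2: twice the bound
  2 / (p - 1), and 2 * 2^\<gamma>, which is at most 8 for p \<le> 3.\<close>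

definition Kp :: "real \<Rightarrow> real" where "Kp p = 4 / (p - 1) + 8"

text \<open>Both integrals of the source bound are estimated by the same expression, so one
  condition closes the iteration in L^1 and in the supremum norm. The factor 6 is 2 + 2 * 2 from
  \<open>decay_integral\<close> with exponent (p - 1) / 2 \<le> 1.\<close>

lemma src_integrals:
  assumes p: "1 < p" "p \<le> 3" and t: "0 \<le> t" "t \<le> S" and nn: "0 \<le> A" "0 \<le> B"
  defines "b \<equiv> \<lambda>\<tau>. 2 powr p * (A * (1 + \<tau>) powr (- ((p + 1) / 2)) + B * (1 + \<tau>) powr (- ((p - 1) / 2)))"
  shows "continuous_on {0..t} b" "\<And>\<tau>. \<tau> \<in> {0..t} \<Longrightarrow> 0 \<le> b \<tau>"
    "integral {0..t} b \<le> 2 powr p * (Kp p * A + 6 * B * Lam p S)"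
    "integral {0..t} (\<lambda>\<tau>. 1 / sqrt (1 + (t - \<tau>)) * b \<tau>) \<le> 2 powr p * (Kp p * A + 6 * B * Lam p S) / sqrt (1 + t)"
proof -
  let ?f = "\<lambda>\<tau>. (1 + \<tau>) powr (- ((p + 1) / 2)) :: real" and ?g = "\<lambda>\<tau>. (1 + \<tau>) powr (- ((p - 1) / 2)) :: real"
  let ?s = "\<lambda>\<tau>. 1 / sqrt (1 + (t - \<tau>))"
  have c: "continuous_on {0..t} ?f" "continuous_on {0..t} ?g" "continuous_on {0..t} ?s"
    by (intro continuous_intros; auto)+
  show "continuous_on {0..t} b" unfolding b_def by (intro continuous_on_mult continuous_on_add continuous_on_const c)
  show "0 \<le> b \<tau>" if "\<tau> \<in> {0..t}" for \<tau> unfolding b_def using nn by simp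
  have L0: "0 \<le> Lam p S" using Lam_ge(1)[OF p t] powr_ge_zero order_trans by blast
  have f1: "integral {0..t} ?f \<le> 2 / (p - 1)" by (rule integral_powr_gt1[OF p(1) t(1)])
  have g1: "integral {0..t} ?g \<le> Lam p S" by (rule Lam_ge(2)[OF p t])
  have lin: "integral {0..t} (\<lambda>\<tau>. 2 powr p * (A * F \<tau> + B * G \<tau>)) = 2 powr p * (A * integral {0..t} F + B * integral {0..t} G)"
    if "continuous_on {0..t} F" "continuous_on {0..t} G" for F G
    unfolding Henstock_Kurzweil_Integration.integral_mult_right
    by (subst Henstock_Kurzweil_Integration.integral_add;
        (intro integrable_continuous_real continuous_on_mult continuous_on_const that)?)
      (simp only: Henstock_Kurzweil_Integration.integral_mult_right)
  have "A * integral {0..t} ?f \<le> A * Kp p"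
  proof (rule mult_left_mono[OF _ nn(1)])
    have "2 / (p - 1) \<le> 4 / (p - 1)" using p by (intro divide_right_mono) auto
    then show "integral {0..t} ?f \<le> Kp p" using f1 unfolding Kp_def by linarith
  qed
  moreover have "B * integral {0..t} ?g \<le> B * (6 * Lam p S)" using g1 L0 by (intro mult_left_mono nn) auto
  ultimately have "2 powr p * (A * integral {0..t} ?f + B * integral {0..t} ?g) \<le> 2 powr p * (Kp p * A + 6 * B * Lam p S)"
    by (intro mult_left_mono) (auto simp: ac_simps)
  then show "integral {0..t} b \<le> 2 powr p * (Kp p * A + 6 * B * Lam p S)" unfolding b_def lin[OF c(1,2)] .
  have fs: "integral {0..t} (\<lambda>\<tau>. ?s \<tau> * ?f \<tau>) \<le> Kp p / sqrt (1 + t)"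
  proof -
    have "2 powr ((p + 1) / 2) \<le> 2 powr 2" using p by (intro powr_mono) auto
    moreover have "(1 + t) powr (1 - (p + 1) / 2) \<le> (1 + t) powr 0" using p t by (intro powr_mono) auto
    ultimately have "2 powr ((p + 1) / 2) * (1 + t) powr (1 - (p + 1) / 2) \<le> 4 * 1" using t by (intro mult_mono) auto
    then have "2 * integral {0..t} ?f + 2 * 2 powr ((p + 1) / 2) * (1 + t) powr (1 - (p + 1) / 2) \<le> Kp p"
      using f1 by (simp add: Kp_def)
    then have "(2 * integral {0..t} ?f + 2 * 2 powr ((p + 1) / 2) * (1 + t) powr (1 - (p + 1) / 2)) / sqrt (1 + t) \<le> Kp p / sqrt (1 + t)"
      using t by (intro divide_right_mono) auto
    moreover have "integral {0..t} (\<lambda>\<tau>. ?s \<tau> * ?f \<tau>) \<le>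
        (2 * integral {0..t} ?f + 2 * 2 powr ((p + 1) / 2) * (1 + t) powr (1 - (p + 1) / 2)) / sqrt (1 + t)"
      using p by (intro decay_integral t(1)) simp
    ultimately show ?thesis by (rule order_trans[rotated])
  qed
  have gs: "integral {0..t} (\<lambda>\<tau>. ?s \<tau> * ?g \<tau>) \<le> 6 * Lam p S / sqrt (1 + t)"
  proof -
    have "2 powr ((p - 1) / 2) \<le> 2 powr 1" using p by (intro powr_mono) auto
    then have "2 powr ((p - 1) / 2) * (1 + t) powr (1 - (p - 1) / 2) \<le> 2 * Lam p S"
      using Lam_ge(1)[OF p t] by (intro mult_mono) auto
    then have "2 * integral {0..t} ?g + 2 * 2 powr ((p - 1) / 2) * (1 + t) powr (1 - (p - 1) / 2) \<le> 6 * Lam p S"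
      using g1 by linarith
    then have "(2 * integral {0..t} ?g + 2 * 2 powr ((p - 1) / 2) * (1 + t) powr (1 - (p - 1) / 2)) / sqrt (1 + t) \<le> 6 * Lam p S / sqrt (1 + t)"
      using t by (intro divide_right_mono) auto
    moreover have "integral {0..t} (\<lambda>\<tau>. ?s \<tau> * ?g \<tau>) \<le>
        (2 * integral {0..t} ?g + 2 * 2 powr ((p - 1) / 2) * (1 + t) powr (1 - (p - 1) / 2)) / sqrt (1 + t)"
      using p by (intro decay_integral t(1)) simp
    ultimately show ?thesis by (rule order_trans[rotated])
  qed
  have "integral {0..t} (\<lambda>\<tau>. ?s \<tau> * b \<tau>) = integral {0..t} (\<lambda>\<tau>. 2 powr p * (A * (?s \<tau> * ?f \<tau>) + B * (?s \<tau> * ?g \<tau>)))"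
    unfolding b_def by (intro arg_cong[where f = "integral {0..t}"] ext) (simp add: algebra_simps)
  also have "\<dots> = 2 powr p * (A * integral {0..t} (\<lambda>\<tau>. ?s \<tau> * ?f \<tau>) + B * integral {0..t} (\<lambda>\<tau>. ?s \<tau> * ?g \<tau>))"
    by (intro lin continuous_on_mult c)
  also have "\<dots> \<le> 2 powr p * (A * (Kp p / sqrt (1 + t)) + B * (6 * Lam p S / sqrt (1 + t)))"
    by (intro mult_left_mono add_mono fs gs nn) auto
  also have "\<dots> = 2 powr p * (Kp p * A + 6 * B * Lam p S) / sqrt (1 + t)"
    by (simp add: add_divide_distrib algebra_simps)
  finally show "integral {0..t} (\<lambda>\<tau>. ?s \<tau> * b \<tau>) \<le> 2 powr p * (Kp p * A + 6 * B * Lam p S) / sqrt (1 + t)" .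
qed

context datum
begin

text \<open>Iterates of the correction to the linear part rather than of the solution itself: the
  correction is the part that stays of order \<epsilon>^p.\<close>

primrec picard :: "nat \<Rightarrow> real \<Rightarrow> real \<Rightarrow> real" where
  "picard 0 = (\<lambda>t x. 0)"
| "picard (Suc n) = duh (src p (\<lambda>t x. ulin g t x + picard n t x))"

text \<open>The condition on \<open>a\<close> says that the ball of radius \<open>a\<close>, for the
  L^1 norm and the decaying supremum norm, is mapped into itself.\<close>

lemma picard_props:
  assumes p3: "p \<le> 3" and a: "0 \<le> a" "2 powr p * (Kp p * N powr p + 6 * a powr p * Lam p S) \<le> a"
  shows "fcont S (picard n) \<and> (\<forall>t\<in>{0..S}. (\<forall>x. \<bar>picard n t x\<bar> \<le> a / sqrt (1 + t)) \<and> mass (picard n t) \<le> ennreal a)"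
proof (induction n)
  case 0
  then show ?case using a by (auto simp: mass_def)
next
  case (Suc n)
  let ?U = "\<lambda>t x. ulin g t x + picard n t x"
  have fU: "fcont S ?U" using continuous_on_add[OF fcont_ulin[of S]] Suc.IH by (simp add: split_beta)
  have F: "fcont S (src p ?U)" using p by (intro fcont_src fU) auto
  let ?b = "\<lambda>\<tau>. 2 powr p * (N powr p * (1 + \<tau>) powr (- ((p + 1) / 2)) + a powr p * (1 + \<tau>) powr (- ((p - 1) / 2)))"
  have m: "mass (src p ?U \<tau>) \<le> ennreal (?b \<tau>)" if "\<tau> \<in> {0..S}" for \<tau>
    unfolding src_def[abs_def]
    using that Suc.IH a N_nonneg ulin_sup ulin_mass
    by (intro src_mass[OF p] fcont_slice[OF fcont_ulin that] fcont_slice[OF conjunct1[OF Suc.IH] that]) auto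
  show ?case
  proof (intro conjI ballI allI)
    show "fcont S (picard (Suc n))" by (simp add: duh_continuous[OF F])
    fix t assume t: "t \<in> {0..S}"
    then have t': "0 \<le> t" "t \<le> S" by auto
    note I = src_integrals[OF p p3 t', of "N powr p" "a powr p"]
    show "\<bar>picard (Suc n) t x\<bar> \<le> a / sqrt (1 + t)" for x
    proof -
      have "\<bar>duh (src p ?U) t x\<bar> \<le> integral {0..t} (\<lambda>\<tau>. 1 / sqrt (1 + (t - \<tau>)) * ?b \<tau>)"
        using t' by (intro duh_sup[OF F t'] I(1,2) m) auto
      also have "\<dots> \<le> 2 powr p * (Kp p * N powr p + 6 * a powr p * Lam p S) / sqrt (1 + t)"
        by (rule I(4)) auto
      also have "\<dots> \<le> a / sqrt (1 + t)" using t' by (intro divide_right_mono a) auto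
      finally show ?thesis by simp
    qed
    have "mass (duh (src p ?U) t) \<le> ennreal (integral {0..t} ?b)"
      using t' by (intro duh_mass[OF F t'] I(1,2) m) auto
    also have "\<dots> \<le> ennreal a" by (intro ennreal_leI order_trans[OF I(3) a(2)]) auto
    finally show "mass (picard (Suc n) t) \<le> ennreal a" by simp
  qed
qed

text \<open>Smallness enters only through the invariant ball. Convergence of the iterates on the
  finite interval follows from the Lipschitz bound on that ball, as for any Volterra
  equation.\<close>

theorem existence:
  assumes p3: "p \<le> 3" and a: "0 \<le> a" "2 powr p * (Kp p * N powr p + 6 * a powr p * Lam p S) \<le> a" and S: "0 \<le> S"
  obtains U where "csol p g S U" "\<And>t x. 0 \<le> t \<Longrightarrow> t \<le> S \<Longrightarrow> \<bar>U t x - ulin g t x\<bar> \<le> a"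
proof -
  note P = picard_props[OF p3 a]
  define M where "M = 9 * H + a"
  define L where "L = p * M powr (p - 1)"
  have L0: "0 \<le> L" using p by (simp add: L_def)
  let ?w = picard
  let ?U = "\<lambda>n t x. ulin g t x + ?w n t x"
  have wa: "\<bar>?w n t x\<bar> \<le> a" if "0 \<le> t" "t \<le> S" for n t x
  proof -
    have "\<bar>?w n t x\<bar> \<le> a / sqrt (1 + t)" using P that by auto
    also have "\<dots> \<le> a / 1" using that a by (intro divide_left_mono) auto
    finally show ?thesis by simp
  qed
  have fw: "fcont S (?w n)" for n using P by blast
  have fU: "fcont S (?U n)" for n using continuous_on_add[OF fcont_ulin fw] by (simp add: split_beta)
  have F: "fcont S (src p (?U n))" for n using p by (intro fcont_src fU) auto
  have UM: "\<bar>?U n t x\<bar> \<le> M" if "0 \<le> t" "t \<le> S" for n t x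
    using wa[OF that, of n x] ulin_bound[OF that(1), of x] unfolding M_def by linarith
  \<comment> \<open>Each iteration adds a time integral, so n of them produce (L t)^n / n!.\<close>
  have diff: "\<bar>?w (Suc n) t x - ?w n t x\<bar> \<le> a * (L * t) ^ n / fact n" if "0 \<le> t" "t \<le> S" for n t x
    using that
  proof (induction n arbitrary: t x)
    case 0
    then show ?case using wa[of t "Suc 0" x] by simp
  next
    case (Suc n)
    let ?D = "\<lambda>\<tau> x. src p (?U (Suc n)) \<tau> x - src p (?U n) \<tau> x"
    have FD: "fcont S ?D" using continuous_on_diff[OF F[of "Suc n"] F[of n]] by (simp add: split_beta del: picard.simps)
    have "\<bar>?w (Suc (Suc n)) t x - ?w (Suc n) t x\<bar> = \<bar>duh ?D t x\<bar>"
      using duh_diff[OF F[of "Suc n"] F[of n] Suc.prems, of x] by (simp only: picard.simps(2))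
    also have "\<dots> \<le> integral {0..t} (\<lambda>\<tau>. L * (a * (L * \<tau>) ^ n / fact n))"
    proof (rule duh_abs_le[OF FD Suc.prems])
      fix \<tau> y assume \<tau>: "0 \<le> \<tau>" "\<tau> \<le> t"
      then have \<tau>S: "\<tau> \<le> S" using Suc.prems by simp
      have "\<bar>?D \<tau> (x + y)\<bar> \<le> L * \<bar>?U (Suc n) \<tau> (x + y) - ?U n \<tau> (x + y)\<bar>"
        unfolding src_def L_def
        by (rule powr_lipschitz[OF less_imp_le[OF p] UM[OF \<tau>(1) \<tau>S] UM[OF \<tau>(1) \<tau>S]])
      also have "\<dots> = L * \<bar>?w (Suc n) \<tau> (x + y) - ?w n \<tau> (x + y)\<bar>" by simp
      also have "\<dots> \<le> L * (a * (L * \<tau>) ^ n / fact n)" by (intro mult_left_mono Suc.IH \<tau>(1) \<tau>S L0)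
      finally show "\<bar>?D \<tau> (x + y)\<bar> \<le> L * (a * (L * \<tau>) ^ n / fact n)" .
    qed (intro continuous_intros, simp)
    also have "\<dots> = a * (L * t) ^ Suc n / fact (Suc n) - a * (L * 0) ^ Suc n / fact (Suc n)"
    proof (rule integral_unique, rule fundamental_theorem_of_calculus[OF Suc.prems(1)])
      fix \<tau> assume "\<tau> \<in> {0..t}"
      have "((\<lambda>\<tau>. (a / fact (Suc n)) * (L * \<tau>) ^ Suc n) has_real_derivative
          (a / fact (Suc n)) * (of_nat (Suc n) * (L * \<tau>) ^ n * L)) (at \<tau> within {0..t})"
        by (auto intro!: derivative_eq_intros simp del: fact_Suc of_nat_Suc power_Suc)
      moreover have "(a / fact (Suc n)) * (of_nat (Suc n) * (L * \<tau>) ^ n * L) = L * (a * (L * \<tau>) ^ n / fact n)"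
      proof -
        have "(a / (N * f)) * (N * z * L) = L * (a * z / f)" if "N \<noteq> 0" for N f z :: real
          using that by (simp add: field_simps)
        from this[of "of_nat (Suc n)" "fact n" "(L * \<tau>) ^ n"] show ?thesis by (simp only: fact_Suc)
      qed
      ultimately show "((\<lambda>\<tau>. a * (L * \<tau>) ^ Suc n / fact (Suc n)) has_vector_derivative L * (a * (L * \<tau>) ^ n / fact n)) (at \<tau> within {0..t})"
        unfolding has_real_derivative_iff_has_vector_derivative[symmetric] by (simp only: times_divide_eq_left)
    qed
    finally show ?case by simp
  qed
  define w where "w t x = (\<Sum>k. ?w (Suc k) t x - ?w k t x)" for t x
  have ul: "uniform_limit ({0..S} \<times> UNIV) (\<lambda>n (t, x). ?w n t x) (\<lambda>(t, x). w t x) sequentially"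
  proof -
    have "uniform_limit ({0..S} \<times> UNIV) (\<lambda>n c. \<Sum>k<n. ?w (Suc k) (fst c) (snd c) - ?w k (fst c) (snd c))
       (\<lambda>c. \<Sum>k. ?w (Suc k) (fst c) (snd c) - ?w k (fst c) (snd c)) sequentially"
    proof (rule Weierstrass_m_test[where M = "\<lambda>n. a * ((L * S) ^ n / fact n)"])
      show "summable (\<lambda>n. a * ((L * S) ^ n / fact n))"
        using summable_exp[of "L * S"] by (intro summable_mult) (simp add: divide_inverse mult.commute)
      fix n c assume "c \<in> {0..S} \<times> (UNIV :: real set)"
      then have c: "0 \<le> fst c" "fst c \<le> S" by auto
      have "\<bar>?w (Suc n) (fst c) (snd c) - ?w n (fst c) (snd c)\<bar> \<le> a * (L * fst c) ^ n / fact n" by (rule diff[OF c])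
      also have "\<dots> \<le> a * (L * S) ^ n / fact n"
        using c a L0 by (intro divide_right_mono mult_left_mono power_mono) auto
      finally show "norm (?w (Suc n) (fst c) (snd c) - ?w n (fst c) (snd c)) \<le> a * ((L * S) ^ n / fact n)" by simp
    qed
    moreover have "(\<Sum>k<n. ?w (Suc k) t x - ?w k t x) = ?w n t x" for n t x
      by (subst sum_lessThan_telescope) simp
    ultimately show ?thesis unfolding w_def case_prod_unfold by (simp only:)
  qed
  have fcw: "fcont S w"
    by (rule uniform_limit_theorem[OF _ ul]) (use fw in \<open>auto intro!: always_eventually\<close>)
  have lim: "(\<lambda>n. ?w n t x) \<longlonglongrightarrow> w t x" if "0 \<le> t" "t \<le> S" for t x
    using tendsto_uniform_limitI[OF ul, of "(t, x)"] that by simp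
  have wb: "\<bar>w t x\<bar> \<le> a" if "0 \<le> t" "t \<le> S" for t x
    by (rule LIMSEQ_le_const2[OF tendsto_rabs[OF lim[OF that]]]) (use wa[OF that] in auto)
  define U where "U t x = ulin g t x + w t x" for t x
  have fcU: "fcont S U" unfolding U_def using continuous_on_add[OF fcont_ulin fcw] by (simp add: split_beta)
  have FU: "fcont S (src p U)" using p by (intro fcont_src fcU) auto
  have UM': "\<bar>U t x\<bar> \<le> M" if "0 \<le> t" "t \<le> S" for t x
    using wb[OF that, of x] ulin_bound[OF that(1), of x] unfolding M_def U_def by linarith
  have eq: "w t x = duh (src p U) t x" if t: "0 \<le> t" "t \<le> S" for t x
  proof -
    have "(\<lambda>n. duh (src p (?U n)) t x) \<longlonglongrightarrow> duh (src p U) t x"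
    proof (rule LIMSEQ_I)
      fix r :: real assume r: "0 < r"
      define e where "e = r / (2 * (S + 1) * (L + 1))"
      have e: "0 < e" using r S L0 by (simp add: e_def)
      from uniform_limitD[OF ul e] obtain n0 where n0: "\<And>n c. n \<ge> n0 \<Longrightarrow> c \<in> {0..S} \<times> UNIV \<Longrightarrow>
          dist (case c of (t, x) \<Rightarrow> ?w n t x) (case c of (t, x) \<Rightarrow> w t x) < e"
        unfolding eventually_sequentially by blast
      have "norm (duh (src p (?U n)) t x - duh (src p U) t x) < r" if n: "n \<ge> n0" for n
      proof -
        let ?D = "\<lambda>\<tau> x. src p (?U n) \<tau> x - src p U \<tau> x"
        have FD: "fcont S ?D" using continuous_on_diff[OF F FU] by (simp add: split_beta)
        have "\<bar>duh ?D t x\<bar> \<le> integral {0..t} (\<lambda>\<tau>. L * e)"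
        proof (rule duh_abs_le[OF FD t])
          fix \<tau> y assume \<tau>: "0 \<le> \<tau>" "\<tau> \<le> t"
          then have \<tau>S: "\<tau> \<le> S" using t by simp
          have "\<bar>?D \<tau> (x + y)\<bar> \<le> L * \<bar>?U n \<tau> (x + y) - U \<tau> (x + y)\<bar>"
            unfolding src_def L_def using p UM[OF \<tau>(1) \<tau>S] UM'[OF \<tau>(1) \<tau>S] by (intro powr_lipschitz) auto
          also have "\<dots> \<le> L * e"
            using n0[OF n, of "(\<tau>, x + y)"] \<tau> \<tau>S L0 by (intro mult_left_mono) (auto simp: U_def dist_real_def)
          finally show "\<bar>?D \<tau> (x + y)\<bar> \<le> L * e" .
        qed auto
        also have "\<dots> = t * (L * e)" using t by simp
        also have "\<dots> \<le> (S + 1) * ((L + 1) * e)" using t L0 e by (intro mult_mono) auto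
        also have "\<dots> = r / 2"
        proof -
          have "X * (Y * (r / (2 * X * Y))) = r / 2" if "X \<noteq> 0" "Y \<noteq> 0" for X Y :: real
            using that by (simp add: field_simps)
          from this[of "S + 1" "L + 1"] show ?thesis unfolding e_def using S L0 by linarith
        qed
        also have "\<dots> < r" using r by simp
        finally show ?thesis using duh_diff[OF F FU t] by simp
      qed
      then show "\<exists>no. \<forall>n\<ge>no. norm (duh (src p (?U n)) t x - duh (src p U) t x) < r" by blast
    qed
    moreover have "(\<lambda>n. ?w (Suc n) t x) \<longlonglongrightarrow> w t x" by (rule LIMSEQ_Suc[OF lim[OF t]])
    ultimately show ?thesis by (simp add: LIMSEQ_unique)
  qed
  show ?thesis
  proof (rule that[of U])
    show "csol p g S U"
    proof -
      have "\<forall>t\<in>{0..S}. \<forall>x. U t x = ulin g t x + duh (src p U) t x"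
      proof (intro ballI allI)
        fix t x assume "t \<in> {0..S}"
        then have "w t x = duh (src p U) t x" by (intro eq) auto
        moreover have "U t x = ulin g t x + w t x" by (rule U_def)
        ultimately show "U t x = ulin g t x + duh (src p U) t x" by linarith
      qed
      moreover have "\<exists>M. \<forall>t\<in>{0..S}. \<forall>x. \<bar>U t x\<bar> \<le> M" using UM' by (intro exI[of _ M]) simp
      ultimately show ?thesis using fcU unfolding csol_def by blast
    qed
    show "\<bar>U t x - ulin g t x\<bar> \<le> a" if "0 \<le> t" "t \<le> S" for t x using wb[OF that] by (simp add: U_def)
  qed
qed

end

section \<open>Regular mild solutions and continuous representatives\<close>

lemma AE_eq_continuous:
  fixes f g :: "real \<Rightarrow> real"
  assumes "continuous_on UNIV f" "continuous_on UNIV g" "AE x in lborel. f x = g x"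
  shows "f = g"
proof (rule ccontr)
  assume "f \<noteq> g"
  then have ne: "{x. f x \<noteq> g x} \<noteq> {}" by auto
  have op: "open {x. f x \<noteq> g x}" by (intro open_Collect_neq assms)
  have "{x. f x \<noteq> g x} \<in> null_sets lborel"
    using assms(3) op by (intro null_setsI AE_iff_measurable[THEN iffD1, rotated 2]) auto
  then have "negligible {x. f x \<noteq> g x}"
    unfolding negligible_iff_null_sets by (rule null_sets_completionI)
  then show False using open_not_negligible[OF op ne] by simp
qed

lemma duh_eq_LINT:
  assumes F: "fcont S F" and t: "0 \<le> t" "t \<le> S"
    and G: "\<And>\<tau>. \<tau> \<in> {0..t} \<Longrightarrow> G \<tau> \<in> borel_measurable borel" "\<And>\<tau>. \<tau> \<in> {0..t} \<Longrightarrow> AE x in lborel. G \<tau> x = F \<tau> x"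
  shows "(LINT \<tau>:{0..t}|lborel. propagator (t - \<tau>) (G \<tau>) x) = duh F t x"
proof -
  have c: "continuous_on {0..t} (\<lambda>\<tau>. conv k0 (t - \<tau>) (F \<tau>) x)"
    using t by (intro tcontD[OF tcont_conv[OF jcont_k(1) F]] continuous_intros) auto
  have "propagator (t - \<tau>) (G \<tau>) x = conv k0 (t - \<tau>) (F \<tau>) x" if \<tau>: "\<tau> \<in> {0..t}" for \<tau>
  proof -
    have cF: "continuous_on UNIV (F \<tau>)" using \<tau> t by (intro fcont_slice[OF F]) auto
    have "propagator (t - \<tau>) (G \<tau>) x = propagator (t - \<tau>) (F \<tau>) x"
      by (intro propagator_cong_AE G[OF \<tau>] borel_measurable_continuous_onI cF)
    also have "\<dots> = conv k0 (t - \<tau>) (F \<tau>) x" using \<tau> by (intro propagator_conv cF) auto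
    finally show ?thesis .
  qed
  then have "(LINT \<tau>:{0..t}|lborel. propagator (t - \<tau>) (G \<tau>) x) = (LINT \<tau>:{0..t}|lborel. conv k0 (t - \<tau>) (F \<tau>) x)"
    by (intro set_lebesgue_integral_cong) auto
  also have "\<dots> = duh F t x"
    unfolding duh_def timeconv_def
    by (rule set_borel_integral_eq_integral(2)[OF borel_integrable_atLeastAtMost'[OF c]])
  finally show ?thesis .
qed

text \<open>The limit in \<open>C0_curve\<close> is over a punctured neighbourhood. Knowing that the
  zero function has norm 0 admits sequences that take the value \<open>t\<close>.\<close>

lemma C0_curveD:
  assumes "C0_curve J X Nm u" "t \<in> J" "\<And>n. s n \<in> J" "s \<longlonglongrightarrow> t" "Nm (\<lambda>x. 0) = 0"
  shows "(\<lambda>n. Nm (\<lambda>x. u (s n) x - u t x)) \<longlonglongrightarrow> 0"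
proof -
  have "((\<lambda>s. Nm (\<lambda>x. u s x - u t x)) \<longlongrightarrow> Nm (\<lambda>x. u t x - u t x)) (at t within J)"
    using assms(1,2,5) unfolding C0_curve_def by simp
  then have "continuous (at t within J) (\<lambda>s. Nm (\<lambda>x. u s x - u t x))"
    by (simp add: continuous_within)
  then have "((\<lambda>s. Nm (\<lambda>x. u s x - u t x)) \<circ> s) \<longlonglongrightarrow> Nm (\<lambda>x. u t x - u t x)"
    using assms(3,4) unfolding continuous_within_sequentially by blast
  then show ?thesis using assms(5) by (simp add: comp_def)
qed

text \<open>\<open>weak_deriv\<close> is a choice, so for the zero function it is 0 only almost
  everywhere, which the norm does not see.\<close>

lemma W11_W1p_norm_zero: "W11_W1p_norm p (\<lambda>x. 0) = 0"
proof -
  have "has_weak_deriv (\<lambda>x. 0) (\<lambda>x. 0)"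
    by (auto simp: has_weak_deriv_def locally_integrable_def set_integrable_def)
  then have "Lq_norm q (weak_deriv (\<lambda>x. 0)) = 0" for q
    by (subst weak_deriv_norm[of "\<lambda>x. 0" "\<lambda>x. 0"]) (auto simp: Lq_norm_def)
  moreover have "Lq_norm q (\<lambda>x. 0) = 0" for q by (simp add: Lq_norm_def)
  ultimately show ?thesis unfolding W11_W1p_norm_def W1_norm_def by (simp only: add_0_left)
qed

lemma Lq1_integrable: "f \<in> Lq 1 \<longleftrightarrow> integrable lborel f"
proof
  assume "f \<in> Lq 1"
  then show "integrable lborel f" by (intro integrable_abs_cancel[of _ f]) (auto simp: Lq_iff)
next
  assume "integrable lborel f"
  then show "f \<in> Lq 1" by (auto simp: Lq_iff)
qed

lemma W1_weak_deriv:
  assumes "g \<in> W1 1"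
  shows "integrable lborel g" "integrable lborel (weak_deriv g)" "has_weak_deriv g (weak_deriv g)"
    "AE x in lborel. g x = prim (weak_deriv g) x"
proof -
  obtain h where h: "h \<in> Lq 1" "has_weak_deriv g h" and g: "g \<in> Lq 1" using assms by (auto simp: W1_def)
  note w = weak_deriv_props[OF h(2)]
  show w1: "has_weak_deriv g (weak_deriv g)" by (rule w)
  have "weak_deriv g \<in> borel_measurable lborel"
    using w1 locally_integrable_measurable by (auto simp: has_weak_deriv_def)
  then show wi: "integrable lborel (weak_deriv g)"
    using h(1) w(2) unfolding Lq1_integrable by (subst integrable_cong_AE[of _ _ h]) (auto simp: borel_measurable_integrable)
  show gi: "integrable lborel g" using g by (simp add: Lq1_integrable)
  show "AE x in lborel. g x = prim (weak_deriv g) x" by (rule weak_deriv_primitive[OF gi wi w1])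
qed

lemma prim_diff_le:
  assumes "integrable lborel h" "integrable lborel h'"
  shows "\<bar>prim h x - prim h' x\<bar> \<le> (LINT s|lborel. \<bar>h s - h' s\<bar>)"
proof -
  have si: "set_integrable lborel {..x} h" "set_integrable lborel {..x} h'"
    using assms unfolding set_integrable_def by (intro integrable_mult_indicator; simp)+
  have "prim h x - prim h' x = prim (\<lambda>s. h s - h' s) x"
    unfolding prim_def by (rule set_integral_diff(2)[OF si, symmetric])
  then show ?thesis using prim_abs_le[of "\<lambda>s. h s - h' s" x] assms by simp
qed

context datum
begin

text \<open>Take for \<open>U t\<close> the primitive of the weak derivative of \<open>v t\<close>.
  Continuity in W^{1,1} bounds the differences of these primitives uniformly in x, which makes
  \<open>U\<close> jointly continuous and locally bounded in time. The equation passes from almost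
  every x to every x because both sides are continuous.\<close>

lemma mild_representative:
  assumes m: "u0 \<in> borel_measurable borel" "AE x in lborel. u0 x = g x" "\<And>x. u0 x + u1 x = 0"
    and v: "regular_mild_solution p u0 u1 T v"
  obtains U where "\<And>S. 0 \<le> S \<Longrightarrow> ereal S < T \<Longrightarrow> csol p g S U"
    "\<And>t. 0 \<le> t \<Longrightarrow> ereal t < T \<Longrightarrow> AE x in lborel. v t x = U t x"
proof -
  let ?J = "{t. 0 \<le> t \<and> ereal t < T}"
  define d where "d t = weak_deriv (v t)" for t
  define U where "U t = prim (d t)" for t
  have W: "C0_curve ?J (W1 1 \<inter> W1 p) (W11_W1p_norm p) v" using v by (simp add: regular_mild_solution_def)
  have vW: "v t \<in> W1 1" if "t \<in> ?J" for t using W that unfolding C0_curve_def by blast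
  note vt = W1_weak_deriv[OF vW, folded d_def]
  have di: "integrable lborel (d t)" if "t \<in> ?J" for t using vt(2)[OF that] .
  have ae: "AE x in lborel. v t x = U t x" if "t \<in> ?J" for t using vt(4)[OF that] by (simp add: U_def)
  define \<delta> where "\<delta> s t = (LINT x|lborel. \<bar>d s x - d t x\<bar>)" for s t
  have \<delta>0: "(\<lambda>n. \<delta> (s n) t) \<longlonglongrightarrow> 0" if st: "t \<in> ?J" "\<And>n. s n \<in> ?J" "s \<longlonglongrightarrow> t" for s t
  proof (rule tendsto_sandwich[where f = "\<lambda>_. 0"])
    show "(\<lambda>n. W11_W1p_norm p (\<lambda>x. v (s n) x - v t x)) \<longlonglongrightarrow> 0"
      by (rule C0_curveD[OF W st W11_W1p_norm_zero])
    have "\<delta> (s n) t \<le> W11_W1p_norm p (\<lambda>x. v (s n) x - v t x)" for n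
    proof -
      \<comment> \<open>The weak derivative of a difference is almost everywhere the difference of
        the weak derivatives, so \<open>\<delta>\<close> is one of the summands of the W
        norm.\<close>
      have "Lq_norm 1 (weak_deriv (\<lambda>x. v (s n) x - v t x)) = Lq_norm 1 (\<lambda>x. d (s n) x - d t x)"
        using di[OF st(1)] di[OF st(2)[of n]]
        by (intro weak_deriv_norm has_weak_deriv_diff vt(3) st) (auto dest!: borel_measurable_integrable)
      also have "\<dots> = \<delta> (s n) t" by (simp add: Lq_norm_def \<delta>_def)
      moreover have "0 \<le> Lq_norm q f" for q f by (simp add: Lq_norm_def)
      ultimately show ?thesis unfolding W11_W1p_norm_def W1_norm_def by (simp only: le_add_same_cancel1 le_add_same_cancel2 add_nonneg_nonneg add.assoc add.left_commute[of _ "\<delta> (s n) t"])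
    qed
    then show "\<forall>\<^sub>F n in sequentially. \<delta> (s n) t \<le> W11_W1p_norm p (\<lambda>x. v (s n) x - v t x)" by simp
  qed (auto simp: \<delta>_def)
  have U\<delta>: "\<bar>U s x - U t x\<bar> \<le> \<delta> s t" if "s \<in> ?J" "t \<in> ?J" for s t x
    unfolding U_def \<delta>_def by (rule prim_diff_le[OF di[OF that(1)] di[OF that(2)]])
  have Uc: "continuous_on UNIV (U t)" if "t \<in> ?J" for t
    unfolding U_def by (rule density_of_continuous[OF prim_density[OF di[OF that]]])
  have JS: "t \<in> ?J" if "t \<in> {0..S}" "ereal S < T" for t S
    using that by (auto intro: order_le_less_trans[of _ "ereal S"])
  have fcU: "fcont S U" if S: "ereal S < T" for S
    unfolding continuous_on_sequentially
  proof (intro allI ballI impI)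
    fix c :: "nat \<Rightarrow> real \<times> real" and a
    assume a: "a \<in> {0..S} \<times> (UNIV :: real set)" and c: "(\<forall>n. c n \<in> {0..S} \<times> UNIV) \<and> c \<longlonglongrightarrow> a"
    obtain t x where tx: "a = (t, x)" by (cases a)
    have tJ: "t \<in> ?J" using a tx by (intro JS[OF _ S]) auto
    have sJ: "fst (c n) \<in> ?J" for n using c by (intro JS[OF _ S]) (auto simp: mem_Times_iff)
    have l: "(\<lambda>n. fst (c n)) \<longlonglongrightarrow> t" "(\<lambda>n. snd (c n)) \<longlonglongrightarrow> x"
      using tendsto_fst[of c a sequentially] tendsto_snd[of c a sequentially] c tx by auto
    have "(\<lambda>n. U t (snd (c n))) \<longlonglongrightarrow> U t x"
      by (rule continuous_on_tendsto_compose[OF Uc[OF tJ] l(2)]) auto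
    then have "(\<lambda>n. \<bar>U t (snd (c n)) - U t x\<bar>) \<longlonglongrightarrow> 0" by (simp add: LIM_zero tendsto_rabs_zero)
    then have lim: "(\<lambda>n. \<delta> (fst (c n)) t + \<bar>U t (snd (c n)) - U t x\<bar>) \<longlonglongrightarrow> 0"
      using tendsto_add[OF \<delta>0[OF tJ sJ l(1)]] by simp
    have "(\<lambda>n. U (fst (c n)) (snd (c n)) - U t x) \<longlonglongrightarrow> 0"
    proof (rule Lim_null_comparison[OF _ lim], rule always_eventually, rule allI)
      fix n
      show "norm (U (fst (c n)) (snd (c n)) - U t x) \<le> \<delta> (fst (c n)) t + \<bar>U t (snd (c n)) - U t x\<bar>"
        using U\<delta>[OF sJ[of n] tJ, of "snd (c n)"] unfolding real_norm_def by linarith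
    qed
    then have "(\<lambda>n. U (fst (c n)) (snd (c n))) \<longlonglongrightarrow> U t x" by (rule LIM_zero_cancel)
    then show "((\<lambda>(t, x). U t x) \<circ> c) \<longlonglongrightarrow> (\<lambda>(t, x). U t x) a" by (simp add: comp_def split_beta tx)
  qed
  have bd: "\<exists>M. \<forall>t\<in>{0..S}. \<forall>x. \<bar>U t x\<bar> \<le> M" if S: "ereal S < T" for S
  proof -
    define \<mu> where "\<mu> t = (LINT x|lborel. \<bar>d t x\<bar>)" for t
    have md: "\<bar>\<mu> s - \<mu> t\<bar> \<le> \<delta> s t" if "s \<in> ?J" "t \<in> ?J" for s t
    proof -
      have "\<mu> s - \<mu> t = (LINT x|lborel. \<bar>d s x\<bar> - \<bar>d t x\<bar>)"
        unfolding \<mu>_def using di that by (intro Bochner_Integration.integral_diff[symmetric] integrable_abs) auto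
      also have "\<bar>\<dots>\<bar> \<le> (LINT x|lborel. \<bar>\<bar>d s x\<bar> - \<bar>d t x\<bar>\<bar>)" by (rule integral_abs_bound)
      also have "\<dots> \<le> \<delta> s t"
        unfolding \<delta>_def using di[OF that(1)] di[OF that(2)] by (intro integral_mono') auto
      finally show ?thesis .
    qed
    have "continuous_on {0..S} \<mu>"
      unfolding continuous_on_sequentially
    proof (intro allI ballI impI)
      fix s t assume t: "t \<in> {0..S}" and s: "(\<forall>n. s n \<in> {0..S}) \<and> s \<longlonglongrightarrow> t"
      have J: "t \<in> ?J" "\<And>n. s n \<in> ?J" using JS[OF _ S] t s by blast+
      have "(\<lambda>n. \<mu> (s n) - \<mu> t) \<longlonglongrightarrow> 0"
        by (rule Lim_null_comparison[OF _ \<delta>0[OF J(1,2)]])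
          (use md J s in \<open>auto intro!: always_eventually\<close>)
      then show "(\<mu> \<circ> s) \<longlonglongrightarrow> \<mu> t" unfolding comp_def by (rule LIM_zero_cancel)
    qed
    then have "bounded (\<mu> ` {0..S})" by (intro compact_imp_bounded compact_continuous_image) auto
    then obtain M where M: "\<And>t. t \<in> {0..S} \<Longrightarrow> \<bar>\<mu> t\<bar> \<le> M" unfolding bounded_iff real_norm_def by blast
    have "\<bar>U t x\<bar> \<le> M" if "t \<in> {0..S}" for t x
      using prim_abs_le[OF di[OF JS[OF that S]], of x] M[OF that] unfolding U_def \<mu>_def by linarith
    then show ?thesis by blast
  qed
  have eq: "U t x = ulin g t x + duh (src p U) t x" if t: "t \<in> ?J" for t x
  proof -
    have t': "0 \<le> t" "ereal t < T" using t by auto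
    have F: "fcont t (src p U)" using p by (intro fcont_src fcU t') auto
    have tt: "t \<in> {0..t}" using t' by simp
    have "U t = (\<lambda>x. ulin g t x + duh (src p U) t x)"
    proof (rule AE_eq_continuous[OF Uc[OF t]])
      show "continuous_on UNIV (\<lambda>x. ulin g t x + duh (src p U) t x)"
        by (intro continuous_on_add fcont_slice[OF fcont_ulin tt] fcont_slice[OF duh_continuous[OF F] tt])
      have "AE x in lborel. v t x = propagator t (\<lambda>y. u0 y + u1 y) x + dt_propagator t u0 x
             + (LINT \<tau>:{0..t}|lborel. propagator (t - \<tau>) (\<lambda>y. \<bar>v \<tau> y\<bar> powr p) x)"
        using v t' by (simp add: regular_mild_solution_def mild_solution_def)
      moreover have "AE x in lborel. dt_propagator t u0 x = dt_propagator t g x"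
        using t' m by (intro dt_propagator_cong_AE) auto
      moreover have "(LINT \<tau>:{0..t}|lborel. propagator (t - \<tau>) (\<lambda>y. \<bar>v \<tau> y\<bar> powr p) x) = duh (src p U) t x" for x
      proof (rule duh_eq_LINT[OF F t'(1) order_refl])
        fix \<tau> assume "\<tau> \<in> {0..t}"
        then have J: "\<tau> \<in> ?J" using t' by (intro JS) auto
        show "(\<lambda>y. \<bar>v \<tau> y\<bar> powr p) \<in> borel_measurable borel"
          using borel_measurable_integrable[OF vt(1)[OF J]] by simp
        show "AE x in lborel. \<bar>v \<tau> x\<bar> powr p = src p U \<tau> x"
          using ae[OF J] by eventually_elim (simp add: src_def)
      qed
      moreover have "propagator t (\<lambda>y. u0 y + u1 y) x = 0" for x
        by (simp add: m(3) propagator_def set_lebesgue_integral_def)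
      moreover have "dt_propagator t g x = ulin g t x" for x
        unfolding ulin_def by (rule dt_propagator_conv[OF g_cont t'(1)])
      ultimately show "AE x in lborel. U t x = ulin g t x + duh (src p U) t x"
        using ae[OF t] by (auto elim!: eventually_elim2)
    qed
    then show ?thesis by (rule fun_cong)
  qed
  show ?thesis
  proof (rule that[of U])
    show "csol p g S U" if "0 \<le> S" "ereal S < T" for S
      unfolding csol_def using fcU[OF that(2)] bd[OF that(2)] eq JS[OF _ that(2)] by blast
  qed (use ae in auto)
qed

lemma csol_mild:
  assumes m: "u0 \<in> borel_measurable borel" "AE x in lborel. u0 x = g x" "\<And>x. u0 x + u1 x = 0"
    and cs: "\<And>S. 0 \<le> S \<Longrightarrow> ereal S < T \<Longrightarrow> csol p g S U"
  shows "regular_mild_solution p u0 u1 T U"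
proof -
  interpret regular_curve p T g h
    "\<lambda>t x. conv k1 t g x + duh (src p U) t x"
    "\<lambda>t x. bdry_x k1 k1y t g x + timeconv (\<lambda>s \<tau> x. bdry_x k0 k0y s (src p U \<tau>) x) t x"
    "\<lambda>t x. bdry_t k1 k1t t g x + timeconv (\<lambda>s \<tau> x. bdry_t k0 k1 s (src p U \<tau>) x) t x" U
    by (rule csol_regular[OF cs])
  have eq: "AE x in lborel. U t x = propagator t (\<lambda>y. u0 y + u1 y) x + dt_propagator t u0 x
             + (LINT \<tau>:{0..t}|lborel. propagator (t - \<tau>) (\<lambda>y. \<bar>U \<tau> y\<bar> powr p) x)"
    if t: "0 \<le> t" "ereal t < T" for t
  proof -
    have F: "fcont t (src p U)" 
    proof (rule fcont_src)
      show "fcont t U" using cs[OF t] unfolding csol_def by blast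
    qed (use p in simp)
    have "(LINT \<tau>:{0..t}|lborel. propagator (t - \<tau>) (\<lambda>y. \<bar>U \<tau> y\<bar> powr p) x) = duh (src p U) t x" for x
    proof (rule duh_eq_LINT[OF F t(1) order_refl])
      fix \<tau> assume \<tau>: "\<tau> \<in> {0..t}"
      show "(\<lambda>y. \<bar>U \<tau> y\<bar> powr p) \<in> borel_measurable borel"
        using borel_measurable_continuous_onI[OF fcont_slice[OF F \<tau>]] by (simp add: src_def[abs_def])
    qed (simp add: src_def)
    moreover have "propagator t (\<lambda>y. u0 y + u1 y) x = 0" for x
      by (simp add: m(3) propagator_def set_lebesgue_integral_def)
    moreover have "dt_propagator t g x = ulin g t x" for x
      unfolding ulin_def by (rule dt_propagator_conv[OF g_cont t(1)])
    moreover have "AE x in lborel. dt_propagator t u0 x = dt_propagator t g x"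
      using t m by (intro dt_propagator_cong_AE) auto
    moreover have "U t x = ulin g t x + duh (src p U) t x" for x
      using cs[OF t] t unfolding csol_def by auto
    ultimately show ?thesis by auto
  qed
  show ?thesis
    unfolding regular_mild_solution_def mild_solution_def using C0_Lq C0_W C1_Lq eq by blast
qed

end

section \<open>The upper bound\<close>

lemma sym_integral_reflect: "sym_integral s (\<lambda>y. \<phi> (- y)) = sym_integral s \<phi>"
  using Henstock_Kurzweil_Integration.integral_reflect_real[of 1 "-1" "\<lambda>z. \<phi> (s * z)"] by (simp add: sym_integral_def)

lemma k0_even: "k0 s (- y) = k0 s y"
  by (simp add: k0_def)

lemma box_shift:
  fixes G :: "real \<Rightarrow> real"
  assumes G: "continuous_on UNIV G" "\<And>x. 0 \<le> G x" and y: "0 \<le> y" "y \<le> b"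
  shows "integral {-b..b} G \<le> integral {-b..b} (\<lambda>x. G (x - y)) + integral {-b..b} (\<lambda>x. G (x + y))"
proof -
  have i: "G integrable_on {a..c}" for a c
    by (intro integrable_continuous_real continuous_on_subset[OF G(1)]) simp
  have s: "integral {-b..b} (\<lambda>x. G (x + z)) = integral {-b + z..b + z} G" for z
    using integral_shift_real_ivl[of "-b + z" z "b + z" G] by simp
  have "integral {-b..b} G = integral {-b..b - y} G + integral {b - y..b} G"
    using y by (intro Henstock_Kurzweil_Integration.integral_combine[symmetric] i) auto
  also have "integral {-b..b - y} G \<le> integral {-b - y..b - y} G"
    using y G(2) by (intro integral_subset_le i) auto
  also have "integral {b - y..b} G \<le> integral {-b + y..b + y} G"
    using y G(2) by (intro integral_subset_le i) auto
  finally show ?thesis using s[of y] s[of "-y"] by simp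
qed

text \<open>Since the kernel is even, the translates of \<open>G\<close> by \<open>y\<close> and \<open>-y\<close> can be averaged, and for
  \<open>\<bar>y\<bar> \<le> b\<close> the two translates of the box cover it.\<close>

lemma conv_box:
  assumes G: "continuous_on UNIV G" "\<And>x. 0 \<le> G x" and s: "0 \<le> s" and b: "0 < b"
  shows "(1 - exp (- s) - 2 * s / b\<^sup>2) / 2 * integral {-b..b} G \<le> integral {-b..b} (conv k0 s G)"
proof -
  define I where "I y = integral {-b..b} (\<lambda>x. G (x - y))" for y
  have cG: "continuous_on A (\<lambda>c. G (f c))" if "continuous_on A f" for A :: "'a::topological_space set" and f
    by (rule continuous_on_compose2[OF G(1) that]) simp
  have ck: "continuous_on A (\<lambda>y. k0 s (f y))" if "continuous_on A f" for A :: "'a::topological_space set" and f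
    by (intro continuous_intros that)
  have "continuous_on UNIV (\<lambda>y. integral (cbox (-b) b) (\<lambda>x. G (x - y)))"
    by (rule integral_continuous_on_param) (auto simp: split_beta intro!: cG continuous_intros)
  then have cI': "continuous_on UNIV I" by (simp add: I_def[abs_def])
  have cI: "continuous_on A (\<lambda>c. I (f c))" if "continuous_on A f" for A :: "'a::topological_space set" and f
    by (rule continuous_on_compose2[OF cI' that]) simp
  have I0: "0 \<le> I y" for y unfolding I_def using G by (intro integral_nonneg integrable_continuous_real cG continuous_intros) auto
  have I00: "I 0 = integral {-b..b} G" by (simp add: I_def)
  have "integral {-b..b} (conv k0 s G) =
      s * integral (cbox (-b) b) (\<lambda>x. integral (cbox (-1) 1) (\<lambda>z. k0 s (s * z) * G (x - s * z)))"
    by (simp add: conv_def[abs_def] sym_integral_def)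
  also have "\<dots> = s * integral (cbox (-1) 1) (\<lambda>z. integral (cbox (-b) b) (\<lambda>x. k0 s (s * z) * G (x - s * z)))"
    by (subst integral_swap_continuous) (auto simp: split_beta intro!: continuous_on_mult cG ck continuous_intros)
  also have "\<dots> = sym_integral s (\<lambda>y. k0 s y * I y)"
    by (simp add: I_def sym_integral_def)
  finally have e1: "integral {-b..b} (conv k0 s G) = sym_integral s (\<lambda>y. k0 s y * I y)" .
  have "sym_integral s (\<lambda>y. k0 s y * I (- y)) = sym_integral s (\<lambda>y. k0 s y * I y)"
    using sym_integral_reflect[of s "\<lambda>y. k0 s y * I y"] by (simp add: k0_even)
  then have e2: "2 * integral {-b..b} (conv k0 s G) = sym_integral s (\<lambda>y. k0 s y * I y + k0 s y * I (- y))"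
    by (subst sym_integral_add; (intro continuous_on_mult ck cI continuous_intros)?)
      (auto simp: e1)
  have "(1 - exp (- s) - 2 * s / b\<^sup>2) * I 0 \<le> (1 - exp (- s) - sym_integral s (\<lambda>y. y\<^sup>2 * k0 s y) / b\<^sup>2) * I 0"
    using k0_second_moment[OF s] b I0 by (intro mult_right_mono diff_left_mono divide_right_mono) auto
  also have "\<dots> = (sym_integral s (k0 s) - sym_integral s (\<lambda>y. y\<^sup>2 * k0 s y / b\<^sup>2)) * I 0"
    by (simp add: k0_mass)
  also have "\<dots> = sym_integral s (\<lambda>y. (k0 s y - y\<^sup>2 * k0 s y / b\<^sup>2) * I 0)"
    using b by (subst sym_integral_add[symmetric]) (auto intro!: continuous_intros ck)
  also have "\<dots> \<le> sym_integral s (\<lambda>y. k0 s y * I y + k0 s y * I (- y))"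
  proof (rule sym_integral_mono[OF s])
    fix y assume y: "\<bar>y\<bar> \<le> s"
    \<comment> \<open>As in Chebyshev's inequality, 1 - y^2 / b^2 lies below the indicator of |y|
      \<le> b, and the cost of the replacement is the second moment of the kernel.\<close>
    have "(1 - y\<^sup>2 / b\<^sup>2) * I 0 \<le> I y + I (- y)"
    proof (cases "\<bar>y\<bar> \<le> b")
      case True
      have "I 0 \<le> I \<bar>y\<bar> + I (- \<bar>y\<bar>)"
        using box_shift[OF G abs_ge_zero True] by (simp add: I_def)
      then have "I 0 \<le> I y + I (- y)" by (auto simp: abs_if split: if_splits)
      moreover have "(1 - y\<^sup>2 / b\<^sup>2) * I 0 \<le> 1 * I 0" using I0 by (intro mult_right_mono) auto
      ultimately show ?thesis by simp
    next
      case False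
      then have "b\<^sup>2 \<le> y\<^sup>2" using b abs_le_square_iff[of b y] by simp
      then have "1 \<le> y\<^sup>2 / b\<^sup>2" using b by simp
      then have "(1 - y\<^sup>2 / b\<^sup>2) * I 0 \<le> 0" using I0 by (intro mult_nonpos_nonneg) auto
      then show ?thesis using I0[of y] I0[of "-y"] by linarith
    qed
    then have "k0 s y * ((1 - y\<^sup>2 / b\<^sup>2) * I 0) \<le> k0 s y * (I y + I (- y))"
      by (rule mult_left_mono[OF _ k0_nonneg[OF y]])
    then show "(k0 s y - y\<^sup>2 * k0 s y / b\<^sup>2) * I 0 \<le> k0 s y * I y + k0 s y * I (- y)"
      by (simp add: algebra_simps)
  qed (use b in \<open>auto intro!: continuous_intros ck cI\<close>)
  finally show ?thesis unfolding I00 e2[symmetric] by simp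
qed

lemma box_jensen:
  fixes f :: "real \<Rightarrow> real"
  assumes f: "continuous_on {-b..b} f" and p: "1 \<le> p" and b: "0 < b"
  shows "\<bar>integral {-b..b} f\<bar> powr p \<le> (2 * b) powr (p - 1) * integral {-b..b} (\<lambda>x. \<bar>f x\<bar> powr p)"
proof -
  define a where "a = integral {-b..b} f / (2 * b)"
  have "integral {-b..b} (\<lambda>x. \<bar>a\<bar> powr p + p * \<bar>a\<bar> powr (p - 1) * sgn a * (f x - a)) \<le> integral {-b..b} (\<lambda>x. \<bar>f x\<bar> powr p)"
    using p by (intro Henstock_Kurzweil_Integration.integral_le integrable_continuous_real continuous_on_add continuous_on_mult
        continuous_on_diff continuous_on_const f powr_tangent continuous_on_powr' continuous_on_rabs) auto
  moreover have "integral {-b..b} (\<lambda>x. \<bar>a\<bar> powr p + p * \<bar>a\<bar> powr (p - 1) * sgn a * (f x - a)) = 2 * b * \<bar>a\<bar> powr p"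
  proof -
    have i: "f integrable_on {-b..b}" by (rule integrable_continuous_real[OF f])
    have c: "(\<lambda>x. z) integrable_on {-b..b}" for z :: real by (rule integrable_const_ivl)
    have "integral {-b..b} (\<lambda>x. f x - a) = 0"
      using b by (subst Henstock_Kurzweil_Integration.integral_diff[OF i c]) (simp add: a_def)
    then have "integral {-b..b} (\<lambda>x. p * \<bar>a\<bar> powr (p - 1) * sgn a * (f x - a)) = 0"
      by (simp only: Henstock_Kurzweil_Integration.integral_mult_right mult_zero_right)
    then show ?thesis
      using b by (subst Henstock_Kurzweil_Integration.integral_add)
        (auto intro!: c integrable_continuous_real continuous_intros f)
  qed
  moreover have "\<bar>integral {-b..b} f\<bar> powr p = (2 * b) powr (p - 1) * (2 * b * \<bar>a\<bar> powr p)"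
  proof -
    have "\<bar>integral {-b..b} f\<bar> = 2 * b * \<bar>a\<bar>" using b by (simp add: a_def abs_mult)
    then have "\<bar>integral {-b..b} f\<bar> powr p = (2 * b) powr p * \<bar>a\<bar> powr p" using b by (simp add: powr_mult)
    also have "(2 * b) powr p = (2 * b) powr (p - 1) * (2 * b)" using b powr_add[of "2 * b" "p - 1" 1] by simp
    finally show ?thesis by simp
  qed
  ultimately show ?thesis by (simp add: mult_left_mono)
qed

section \<open>The weighted test function estimate\<close>

text \<open>Either the first term on the right already suffices, or z is below the crossing point
  \<mu>^(-p/(p-1)) and its p-th root is below the second term.\<close>

lemma powr_young:
  fixes z \<mu> p :: real
  assumes p: "1 < p" and z: "0 \<le> z" and \<mu>: "0 < \<mu>"
  shows "z powr (1 / p) \<le> \<mu> * z + \<mu> powr (- 1 / (p - 1))"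
proof (cases "z powr (1 / p) \<le> \<mu> * z")
  case False
  then have z: "0 < z" using z by (cases "z = 0") auto
  have "\<mu> * z < z powr (1 / p)" using False by simp
  then have "ln (\<mu> * z) < ln (z powr (1 / p))" using \<mu> z by (subst ln_less_cancel_iff) auto
  then have l: "ln \<mu> + ln z < ln z / p" using \<mu> z by (simp add: ln_mult ln_powr)
  then have "p * (ln \<mu> + ln z) < p * (ln z / p)" using p by (intro mult_strict_left_mono) auto
  then have "ln z * (p - 1) < - p * ln \<mu>" using p by (simp add: algebra_simps)
  then have "ln z * (p - 1) / (p - 1) < - p * ln \<mu> / (p - 1)" using p by (intro divide_strict_right_mono) auto
  then have "ln z < - p * ln \<mu> / (p - 1)" using p by simp
  then have "ln z / p < (- p * ln \<mu> / (p - 1)) / p" using p by (intro divide_strict_right_mono) auto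
  also have "(- p * ln \<mu> / (p - 1)) / p = - 1 / (p - 1) * ln \<mu>" using p by (simp add: field_simps)
  finally have "z powr (1 / p) \<le> \<mu> powr (- 1 / (p - 1))" using z \<mu> by (simp add: powr_def)
  moreover have "0 \<le> \<mu> * z" using z \<mu> by simp
  ultimately show ?thesis by linarith
qed (smt (verit) powr_ge_zero)


text \<open>With the weight W = (1 - t/r)^(k+2), two integrations by parts replace \<phi> by its
  double primitive, the integral of (t - \<tau>) \<phi>(\<tau>), and W by W'', a multiple of (1 -
  t/r)^k / r^2. The parameter \<mu> of Young's inequality is left free.\<close>

lemma test_function_bound:
  fixes \<phi> :: "real \<Rightarrow> real" and p r L N K \<mu> :: real
  assumes p: "1 < p" and k: "2 / (p - 1) \<le> real k" and r: "0 < r" and pos: "0 < c" "0 \<le> K" "0 \<le> N" "0 < \<mu>"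
    and \<phi>: "continuous_on {0..r} \<phi>" "\<And>t. t \<in> {0..r} \<Longrightarrow> 0 \<le> \<phi> t"
    and le: "\<And>t. t \<in> {0..r} \<Longrightarrow>
      c / r * integral {0..t} (\<lambda>\<tau>. (t - \<tau>) * \<phi> \<tau>) \<le> K * \<phi> t powr (1 / p) + N / (1 + t)"
  defines "I \<equiv> integral {0..r} (\<lambda>t. (1 - t / r) ^ (k + 2) * \<phi> t)" and "M \<equiv> (real k + 2) * (real k + 1)"
  shows "c * I \<le> M / r * (K * (\<mu> * I + \<mu> powr (- 1 / (p - 1)) * r) + N * ln (1 + r))"
proof -
  define W where "W t = (1 - t / r) ^ (k + 2)" for t
  define V where "V t = - (real k + 2) / r * (1 - t / r) ^ (k + 1)" for t
  define V' where "V' t = M / r\<^sup>2 * (1 - t / r) ^ k" for t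
  define P where "P t = integral {0..t} \<phi>" for t
  define \<Phi> where "\<Phi> t = t * P t - integral {0..t} (\<lambda>\<tau>. \<tau> * \<phi> \<tau>)" for t
  have c\<phi>: "continuous_on {0..r} (\<lambda>\<tau>. \<tau> * \<phi> \<tau>)" by (intro continuous_intros \<phi>)
  have dP: "(P has_real_derivative \<phi> t) (at t within {0..r})" if "t \<in> {0..r}" for t
    unfolding P_def by (rule integral_has_real_derivative[OF \<phi>(1) that])
  have dQ: "((\<lambda>t. integral {0..t} (\<lambda>\<tau>. \<tau> * \<phi> \<tau>)) has_real_derivative t * \<phi> t) (at t within {0..r})" if "t \<in> {0..r}" for t
    by (rule integral_has_real_derivative[OF c\<phi> that])
  have d\<Phi>: "(\<Phi> has_real_derivative P t) (at t within {0..r})" if "t \<in> {0..r}" for t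
    unfolding \<Phi>_def[abs_def] by (auto intro!: derivative_eq_intros dP[OF that] dQ[OF that])
  have dpow: "((\<lambda>t. (1 - t / r) ^ (n + 1)) has_real_derivative - (real n + 1) / r * (1 - t / r) ^ n) (at t within {0..r})" for n t
  proof -
    have "((\<lambda>t. 1 - t / r) has_real_derivative - 1 / r) (at t within {0..r})"
      using r by (auto intro!: derivative_eq_intros)
    moreover have "(1 + real n) * (- 1 / r * z) = - (real n + 1) / r * z" for z
      by (simp add: divide_inverse algebra_simps)
    ultimately show ?thesis using DERIV_power_Suc[of "\<lambda>t. 1 - t / r" "- 1 / r" t "{0..r}" n] by (simp only: Suc_eq_plus1)
  qed
  have dW: "(W has_real_derivative V t) (at t within {0..r})" for t
    using dpow[of "k + 1" t] unfolding W_def[abs_def] V_def by (simp add: add.commute)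
  have dV: "(V has_real_derivative V' t) (at t within {0..r})" for t
  proof -
    have "(- x / r) * (- y / r * z) = x * y / r\<^sup>2 * z" for x y z by (simp add: power2_eq_square)
    from DERIV_cmult[OF dpow[of k], of "- (real k + 2) / r" t, unfolded this] show ?thesis
      unfolding V_def[abs_def] V'_def M_def by (simp only:)
  qed
  have cP: "continuous_on {0..r} P" by (rule DERIV_continuous_on[OF dP])
  have c\<Phi>: "continuous_on {0..r} \<Phi>" by (rule DERIV_continuous_on[OF d\<Phi>])
  have cW: "continuous_on {0..r} W" "continuous_on {0..r} V'"
    unfolding W_def[abs_def] V'_def[abs_def] using r by (intro continuous_intros; simp)+
  \<comment> \<open>W P - W' \<Phi> is a primitive of the integrand. Its boundary values vanish: at
    r through W and W', at 0 through P and \<Phi>.\<close>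
  have "((\<lambda>t. W t * \<phi> t - V' t * \<Phi> t) has_integral (W r * P r - V r * \<Phi> r) - (W 0 * P 0 - V 0 * \<Phi> 0)) {0..r}"
  proof (rule fundamental_theorem_of_calculus)
    fix t assume t: "t \<in> {0..r}"
    have "((\<lambda>t. W t * P t - V t * \<Phi> t) has_real_derivative W t * \<phi> t - V' t * \<Phi> t) (at t within {0..r})"
      by (auto intro!: derivative_eq_intros dP[OF t] d\<Phi>[OF t] dW dV)
    then show "((\<lambda>t. W t * P t - V t * \<Phi> t) has_vector_derivative W t * \<phi> t - V' t * \<Phi> t) (at t within {0..r})"
      by (simp add: has_real_derivative_iff_has_vector_derivative)
  qed (use r in simp)
  moreover have "(W r * P r - V r * \<Phi> r) - (W 0 * P 0 - V 0 * \<Phi> 0) = 0"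
    using r by (simp add: W_def V_def P_def \<Phi>_def)
  ultimately have "integral {0..r} (\<lambda>t. W t * \<phi> t - V' t * \<Phi> t) = 0" by (simp add: integral_unique)
  then have "I = integral {0..r} (\<lambda>t. V' t * \<Phi> t)"
    unfolding I_def W_def[symmetric]
    by (subst (asm) Henstock_Kurzweil_Integration.integral_diff)
      (auto intro!: integrable_continuous_real continuous_on_mult \<phi> c\<Phi> cW)
  then have "c * I = integral {0..r} (\<lambda>t. c * (V' t * \<Phi> t))"
    by (simp only: Henstock_Kurzweil_Integration.integral_mult_right)
  also have "\<dots> \<le> integral {0..r} (\<lambda>t. M / r * (K * (\<mu> * (W t * \<phi> t) + \<mu> powr (- 1 / (p - 1))) + N * (1 / (1 + t))))"
  proof (intro Henstock_Kurzweil_Integration.integral_le integrable_continuous_real)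
    fix t assume t: "t \<in> {0..r}"
    define z where "z = 1 - t / r"
    have z: "0 \<le> z" "z \<le> 1" using t r by (auto simp: z_def divide_simps)
    have "\<Phi> t = integral {0..t} (\<lambda>\<tau>. (t - \<tau>) * \<phi> \<tau>)"
    proof -
      have c: "continuous_on {0..t} \<phi>" using t by (intro continuous_on_subset[OF \<phi>(1)]) auto
      have "integral {0..t} (\<lambda>\<tau>. t * \<phi> \<tau> - \<tau> * \<phi> \<tau>) = \<Phi> t"
        unfolding \<Phi>_def P_def
        by (subst Henstock_Kurzweil_Integration.integral_diff)
          (auto intro!: integrable_continuous_real continuous_intros c)
      then show ?thesis by (simp add: left_diff_distrib)
    qed
    then have "c * (V' t * \<Phi> t) = M / r * z ^ k * (c / r * integral {0..t} (\<lambda>\<tau>. (t - \<tau>) * \<phi> \<tau>))"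
      using r unfolding V'_def z_def by (simp add: power2_eq_square)
    also have "\<dots> \<le> M / r * z ^ k * (K * \<phi> t powr (1 / p) + N / (1 + t))"
      using r z by (intro mult_left_mono le t mult_nonneg_nonneg) (auto simp: M_def)
    also have "\<dots> = M / r * (K * (z ^ k * \<phi> t powr (1 / p)) + z ^ k * (N / (1 + t)))"
      by (simp add: algebra_simps)
    also have "\<dots> \<le> M / r * (K * (\<mu> * (W t * \<phi> t) + \<mu> powr (- 1 / (p - 1))) + N * (1 / (1 + t)))"
    proof (intro mult_left_mono add_mono)
      \<comment> \<open>The condition k \<ge> 2 / (p - 1) means k \<ge> (k + 2) / p. Hence the
        weight left after two derivatives is still below the p-th root of the full weight, and
        Young's inequality returns the weighted integral itself.\<close>
      have "z ^ k \<le> z powr (real (k + 2) / p)"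
      proof (cases "z = 0")
        case True
        have "0 < real k" using k p by (meson divide_pos_pos less_le_trans zero_less_numeral diff_gt_0_iff_gt)
        then show ?thesis using True by (simp add: zero_power)
      next
        case False
        have "2 \<le> real k * (p - 1)" using k p by (simp add: divide_le_eq)
        then have "real (k + 2) / p \<le> real k" using p by (simp add: divide_le_eq algebra_simps)
        then have "z powr real k \<le> z powr (real (k + 2) / p)" using z False by (intro powr_mono') auto
        then show ?thesis using False z by (simp add: powr_realpow)
      qed
      then have "z ^ k * \<phi> t powr (1 / p) \<le> z powr (real (k + 2) / p) * \<phi> t powr (1 / p)"
        by (rule mult_right_mono) simp
      also have "z powr (real (k + 2) / p) = (z powr real (k + 2)) powr (1 / p)" by (simp add: powr_powr)
      also have "z powr real (k + 2) = W t"
        using z by (subst powr_realpow') (auto simp: W_def z_def)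
      also have "W t powr (1 / p) * \<phi> t powr (1 / p) = (W t * \<phi> t) powr (1 / p)"
        using z \<phi>(2)[OF t] by (intro powr_mult[symmetric])
      also have "\<dots> \<le> \<mu> * (W t * \<phi> t) + \<mu> powr (- 1 / (p - 1))"
        using z \<phi>(2)[OF t] pos p by (intro powr_young) (auto simp: W_def z_def)
      finally show "z ^ k * \<phi> t powr (1 / p) \<le> \<mu> * (W t * \<phi> t) + \<mu> powr (- 1 / (p - 1))" .
      have "z ^ k * (N / (1 + t)) \<le> 1 * (N / (1 + t))"
        using z t pos by (intro mult_right_mono power_le_one) auto
      then show "z ^ k * (N / (1 + t)) \<le> N * (1 / (1 + t))" by simp
    qed (use r pos in \<open>auto simp: M_def\<close>)
    finally show "c * (V' t * \<Phi> t) \<le> M / r * (K * (\<mu> * (W t * \<phi> t) + \<mu> powr (- 1 / (p - 1))) + N * (1 / (1 + t)))" .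
  qed (use r in \<open>auto intro!: continuous_intros cW \<phi> c\<Phi>\<close>)
  also have "\<dots> = M / r * (K * (\<mu> * I + \<mu> powr (- 1 / (p - 1)) * r) + N * ln (1 + r))"
  proof (rule integral_unique)
    have "((\<lambda>t. 1 / (1 + t)) has_integral ln (1 + r) - ln (1 + 0)) {0..r}"
      using r by (intro fundamental_theorem_of_calculus)
        (auto simp: has_real_derivative_iff_has_vector_derivative[symmetric] intro!: derivative_eq_intros)
    then have l: "((\<lambda>t. 1 / (1 + t)) has_integral ln (1 + r)) {0..r}" by simp
    have i: "((\<lambda>t. W t * \<phi> t) has_integral I) {0..r}"
      unfolding I_def W_def[symmetric] by (intro integrable_integral integrable_continuous_real continuous_on_mult cW \<phi>)
    have "((\<lambda>t. \<mu> powr (- 1 / (p - 1))) has_integral \<mu> powr (- 1 / (p - 1)) * r) {0..r}"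
      using has_integral_const_real[of "\<mu> powr (- 1 / (p - 1))" 0 r] r by (simp add: mult.commute)
    from has_integral_mult_right[OF has_integral_add[OF has_integral_mult_right[OF has_integral_add[OF
        has_integral_mult_right[OF i] this]] has_integral_mult_right[OF l]]]
    show "((\<lambda>t. M / r * (K * (\<mu> * (W t * \<phi> t) + \<mu> powr (- 1 / (p - 1))) + N * (1 / (1 + t)))) has_integral
        M / r * (K * (\<mu> * I + \<mu> powr (- 1 / (p - 1)) * r) + N * ln (1 + r))) {0..r}" .
  qed
  finally show ?thesis .
qed

text \<open>The constant is fixed before r, N and \<phi>, which is what lets it be used for all
  \<epsilon> and all boxes at once.\<close>

lemma test_function_cap:
  fixes p c :: real
  assumes p: "1 < p" and k: "2 / (p - 1) \<le> real k" and c: "0 < c"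
  obtains A where "0 < A" "\<And>r N \<phi>. 1 \<le> r \<Longrightarrow> 0 \<le> N \<Longrightarrow> continuous_on {0..r} \<phi> \<Longrightarrow> (\<And>t. t \<in> {0..r} \<Longrightarrow> 0 \<le> \<phi> t) \<Longrightarrow>
    (\<And>t. t \<in> {0..r} \<Longrightarrow> c / r * integral {0..t} (\<lambda>\<tau>. (t - \<tau>) * \<phi> \<tau>)
        \<le> (8 * sqrt r) powr ((p - 1) / p) * \<phi> t powr (1 / p) + N / (1 + t)) \<Longrightarrow>
    integral {0..r} (\<lambda>t. (1 - t / r) ^ (k + 2) * \<phi> t) \<le> A * (r powr (- ((3 - p) / (2 * (p - 1)))) + N * ln (1 + r) / r)"
proof -
  define L where "L = (real k + 2) * (real k + 1) / c"
  have L: "0 < L" using c by (simp add: L_def)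
  define A1 where "A1 = 2 * L * (8 * (2 * L) powr (1 / (p - 1)))"
  have A1: "0 < A1" using L by (simp add: A1_def)
  show ?thesis
  proof (rule that[of "A1 + 2 * L"])
    show "0 < A1 + 2 * L" using A1 L by simp
    fix r N :: real and \<phi> :: "real \<Rightarrow> real"
    assume r: "1 \<le> r" and N: "0 \<le> N" and \<phi>: "continuous_on {0..r} \<phi>" "\<And>t. t \<in> {0..r} \<Longrightarrow> 0 \<le> \<phi> t"
      and le: "\<And>t. t \<in> {0..r} \<Longrightarrow> c / r * integral {0..t} (\<lambda>\<tau>. (t - \<tau>) * \<phi> \<tau>)
        \<le> (8 * sqrt r) powr ((p - 1) / p) * \<phi> t powr (1 / p) + N / (1 + t)"
    define I where "I = integral {0..r} (\<lambda>t. (1 - t / r) ^ (k + 2) * \<phi> t)"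
    define K where "K = (8 * sqrt r) powr ((p - 1) / p)"
    have K: "0 < K" using r by (simp add: K_def)
    \<comment> \<open>Chosen so that the Young term containing \<open>I\<close> is exactly
      \<open>I / 2\<close> and can be absorbed on the left.\<close>
    define \<mu> where "\<mu> = r / (2 * L * K)"
    have \<mu>: "0 < \<mu>" using r L K by (simp add: \<mu>_def)
    define l where "l = N * ln (1 + r) / r"
    have l: "0 \<le> l" using r N by (simp add: l_def)
    have "c * I \<le> (real k + 2) * (real k + 1) / r * (K * (\<mu> * I + \<mu> powr (- 1 / (p - 1)) * r) + N * ln (1 + r))"
      unfolding I_def using r K by (intro test_function_bound p k c N \<mu> \<phi> le[folded K_def]) auto
    also have "(real k + 2) * (real k + 1) = c * L" using c by (simp add: L_def)
    also have "c * L / r * (K * (\<mu> * I + \<mu> powr (- 1 / (p - 1)) * r) + N * ln (1 + r)) =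
        c * (I / 2 + L * (K * \<mu> powr (- 1 / (p - 1))) + L * l)"
    proof -
      have "c * L / r * (K * (r / (2 * L * K) * I + v * r) + n) = c * (I / 2 + L * (K * v) + L * (n / r))" for v n
        using r L K by (simp add: field_simps)
      then show ?thesis unfolding \<mu>_def l_def .
    qed
    finally have "I \<le> I / 2 + L * (K * \<mu> powr (- 1 / (p - 1))) + L * l" using c by simp
    then have "I \<le> 2 * L * (K * \<mu> powr (- 1 / (p - 1))) + 2 * L * l" by simp
    also have "K * \<mu> powr (- 1 / (p - 1)) = 8 * (2 * L) powr (1 / (p - 1)) * r powr (- ((3 - p) / (2 * (p - 1))))"
    proof -
      have "\<mu> powr (- 1 / (p - 1)) = (2 * L) powr (1 / (p - 1)) * K powr (1 / (p - 1)) * r powr (- 1 / (p - 1))"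
        unfolding \<mu>_def using r L K by (simp add: powr_divide powr_mult powr_minus_divide)
      \<comment> \<open>The exponents (p - 1) / p and 1 + 1 / (p - 1) are reciprocal, so the box
        width reappears. Combined with r^(-1/(p-1)) its square root of r leaves the exponent -(3 -
        p) / (2 (p - 1)).\<close>
      moreover have "K * K powr (1 / (p - 1)) = 8 * sqrt r"
      proof -
        have "K * K powr (1 / (p - 1)) = K powr (1 + 1 / (p - 1))" using K by (simp add: powr_add)
        also have "\<dots> = (8 * sqrt r) powr ((p - 1) / p * (1 + 1 / (p - 1)))" by (simp add: K_def powr_powr)
        also have "(p - 1) / p * (1 + 1 / (p - 1)) = 1" using p by (simp add: field_simps)
        finally show ?thesis using r by simp
      qed
      moreover have "sqrt r * r powr (- 1 / (p - 1)) = r powr (- ((3 - p) / (2 * (p - 1))))"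
      proof -
        have "sqrt r * r powr (- 1 / (p - 1)) = r powr (1 / 2 + - 1 / (p - 1))"
          using r by (subst powr_add) (simp add: powr_half_sqrt)
        also have "1 / 2 + - 1 / (p - 1) = - ((3 - p) / (2 * (p - 1)))" using p by (simp add: field_simps)
        finally show ?thesis .
      qed
      ultimately show ?thesis by (metis (no_types, lifting) mult.assoc mult.left_commute)
    qed
    finally have "I \<le> A1 * r powr (- ((3 - p) / (2 * (p - 1)))) + 2 * L * l" by (simp add: A1_def mult.assoc)
    also have "\<dots> \<le> (A1 + 2 * L) * (r powr (- ((3 - p) / (2 * (p - 1)))) + l)"
      using A1 L l by (simp add: algebra_simps)
    finally show "integral {0..r} (\<lambda>t. (1 - t / r) ^ (k + 2) * \<phi> t) \<le> (A1 + 2 * L) * (r powr (- ((3 - p) / (2 * (p - 1)))) + N * ln (1 + r) / r)"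
      unfolding I_def l_def .
  qed
qed

section \<open>The integral of the source over a diffusive box\<close>

text \<open>The half-width 4 sqrt r is matched to \<open>k0_second_moment\<close>: up to time r at
  most s / (8 r) of the kernel is lost, less than the lower bound s / (2 r) for its mass 1 - exp
  (-s).\<close>

definition boxmass :: "real \<Rightarrow> real \<Rightarrow> (real \<Rightarrow> real \<Rightarrow> real) \<Rightarrow> real \<Rightarrow> real" where
  "boxmass p r U t = integral {- (4 * sqrt r)..4 * sqrt r} (src p U t)"

lemma integral_le_mass:
  assumes f: "continuous_on UNIV f" and m: "mass f \<le> ennreal c" "0 \<le> c"
  shows "\<bar>integral {a..b} f\<bar> \<le> c"
proof -
  have ci: "continuous_on {a..b} f" "continuous_on {a..b} (\<lambda>x. \<bar>f x\<bar>)"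
    by (intro continuous_on_subset[OF f] continuous_on_rabs; simp)+
  have si: "set_integrable lborel {a..b} (\<lambda>x. \<bar>f x\<bar>)" by (rule borel_integrable_atLeastAtMost'[OF ci(2)])
  have "\<bar>integral {a..b} f\<bar> \<le> integral {a..b} (\<lambda>x. \<bar>f x\<bar>)"
    using integral_norm_bound_integral[of f "{a..b}" "\<lambda>x. \<bar>f x\<bar>"] ci by (simp add: integrable_continuous_real)
  also have "ennreal (integral {a..b} (\<lambda>x. \<bar>f x\<bar>)) = (\<integral>\<^sup>+x. ennreal (indicator {a..b} x * \<bar>f x\<bar>) \<partial>lborel)"
    using si unfolding set_borel_integral_eq_integral(2)[OF si, symmetric] set_lebesgue_integral_def set_integrable_def real_scaleR_def
    by (intro nn_integral_eq_integral[symmetric]) auto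
  then have "ennreal (integral {a..b} (\<lambda>x. \<bar>f x\<bar>)) \<le> mass f"
    unfolding mass_def by (auto intro!: nn_integral_mono simp: indicator_def)
  then have "integral {a..b} (\<lambda>x. \<bar>f x\<bar>) \<le> c"
    using m by (metis ennreal_le_iff order_trans)
  finally show ?thesis .
qed

text \<open>3/16 is (1/2 - 1/8) / 2: the mass minus the leakage, halved by the averaging in
  \<open>conv_box\<close>.\<close>

lemma box_weight:
  assumes r: "1 \<le> r" and s: "0 \<le> s" "s \<le> r"
  shows "3 / 16 / r * s \<le> (1 - exp (- s) - 2 * s / (4 * sqrt r)\<^sup>2) / 2"
proof -
  have "exp (- s) \<le> 1 / (1 + s)"
    using exp_ge_add_one_self[of s] s by (simp add: exp_minus inverse_eq_divide frac_le)
  moreover have "s / (2 * r) \<le> s / (1 + s)" using r s by (intro divide_left_mono) auto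
  moreover have "1 - 1 / (1 + s) = s / (1 + s)" using s by (simp add: field_simps)
  moreover have "2 * s / (4 * sqrt r)\<^sup>2 = s / (8 * r)" using r by (simp add: power_mult_distrib)
  ultimately have "s / (2 * r) - s / (8 * r) \<le> 1 - exp (- s) - 2 * s / (4 * sqrt r)\<^sup>2" by linarith
  moreover have "(s / (2 * r) - s / (8 * r)) / 2 = 3 / 16 / r * s" using r by (simp add: field_simps)
  ultimately show ?thesis by (metis divide_right_mono zero_le_numeral)
qed

lemma boxmass_continuous:
  assumes "fcont S (src p U)" shows "continuous_on {0..S} (boxmass p r U)"
proof -
  have "continuous_on {0..S} (\<lambda>t. integral (cbox (- (4 * sqrt r)) (4 * sqrt r)) (src p U t))"
    by (rule integral_continuous_on_param) (rule continuous_on_subset[OF assms], auto)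
  then show ?thesis by (simp add: boxmass_def[abs_def])
qed

lemma boxmass_nonneg:
  assumes "fcont S (src p U)" "t \<in> {0..S}" shows "0 \<le> boxmass p r U t"
  unfolding boxmass_def
  by (intro integral_nonneg integrable_continuous_real continuous_on_subset[OF fcont_slice[OF assms]]) (auto simp: src_def)

lemma boxmass_mono:
  assumes "fcont S (src p U)" "t \<in> {0..S}" "r \<le> r'" shows "boxmass p r U t \<le> boxmass p r' U t"
  unfolding boxmass_def using assms(3)
  by (intro integral_subset_le integrable_continuous_real continuous_on_subset[OF fcont_slice[OF assms(1,2)]])
    (auto simp: src_def intro: order_trans[of _ "4 * sqrt r"] order_trans[of "- (4 * sqrt r')" "- (4 * sqrt r)"])

lemma box_upper:
  assumes p: "1 < p" and U: "fcont S U" "t \<in> {0..S}" and r: "1 \<le> r"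
  shows "\<bar>integral {- (4 * sqrt r)..4 * sqrt r} (U t)\<bar> powr p \<le> (8 * sqrt r) powr (p - 1) * boxmass p r U t"
proof -
  have "continuous_on {- (4 * sqrt r)..4 * sqrt r} (U t)"
    by (intro continuous_on_subset[OF fcont_slice[OF U]]) simp
  from box_jensen[OF this, of p] show ?thesis
    using p r by (simp add: boxmass_def src_def[abs_def])
qed

context datum
begin

lemma csol_fcont: "csol p g S U \<Longrightarrow> fcont S U" "csol p g S U \<Longrightarrow> fcont S (src p U)"
  using fcont_src[of p S U] p by (auto simp: csol_def)

lemma box_lower:
  assumes U: "csol p g S U" and r: "1 \<le> r" and t: "t \<in> {0..S}" "t \<le> r"
  shows "3 / 16 / r * integral {0..t} (\<lambda>\<tau>. (t - \<tau>) * boxmass p r U \<tau>)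
    \<le> \<bar>integral {- (4 * sqrt r)..4 * sqrt r} (U t)\<bar> + N / (1 + t)"
proof -
  define b where "b = 4 * sqrt r"
  have b: "0 < b" using r by (simp add: b_def)
  have t0: "0 \<le> t" "t \<le> S" using t by auto
  have F: "fcont t (src p U)" by (rule fcont_mono[OF csol_fcont(2)[OF U] t0(2)])
  let ?G = "\<lambda>\<tau> x. conv k0 (t - \<tau>) (src p U \<tau>) x"
  have gc: "continuous_on ({0..t} \<times> A) (\<lambda>c. ?G (fst c) (snd c))" for A
    by (rule tcontD[OF tcont_conv[OF jcont_k(1) F], of _ "\<lambda>c. t - fst c" fst snd]) (auto intro!: continuous_intros)
  have gc': "continuous_on (A \<times> {0..t}) (\<lambda>c. ?G (snd c) (fst c))" for A
    by (rule tcontD[OF tcont_conv[OF jcont_k(1) F], of _ "\<lambda>c. t - snd c" snd fst]) (auto intro!: continuous_intros)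
  have cu: "continuous_on UNIV (ulin g t)" using t0 by (intro fcont_slice[OF fcont_ulin[of t]]) auto
  have cd: "continuous_on UNIV (duh (src p U) t)" using t0 by (intro fcont_slice[OF duh_continuous[OF F]]) auto
  have "3 / 16 / r * integral {0..t} (\<lambda>\<tau>. (t - \<tau>) * boxmass p r U \<tau>) =
      integral {0..t} (\<lambda>\<tau>. 3 / 16 / r * ((t - \<tau>) * boxmass p r U \<tau>))"
    by (simp only: Henstock_Kurzweil_Integration.integral_mult_right)
  also have "\<dots> \<le> integral {0..t} (\<lambda>\<tau>. integral {-b..b} (?G \<tau>))"
  proof (intro Henstock_Kurzweil_Integration.integral_le integrable_continuous_real)
    show "continuous_on {0..t} (\<lambda>\<tau>. 3 / 16 / r * ((t - \<tau>) * boxmass p r U \<tau>))"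
      using r by (intro continuous_intros boxmass_continuous[OF F])
    have "continuous_on {0..t} (\<lambda>\<tau>. integral (cbox (-b) b) (?G \<tau>))"
      by (rule integral_continuous_on_param) (use gc in \<open>simp add: split_beta\<close>)
    then show "continuous_on {0..t} (\<lambda>\<tau>. integral {-b..b} (?G \<tau>))" by simp
    fix \<tau> assume \<tau>: "\<tau> \<in> {0..t}"
    have "3 / 16 / r * (t - \<tau>) * boxmass p r U \<tau> \<le> (1 - exp (- (t - \<tau>)) - 2 * (t - \<tau>) / b\<^sup>2) / 2 * boxmass p r U \<tau>"
      using \<tau> t0 t r boxmass_nonneg[OF F \<tau>] unfolding b_def by (intro mult_right_mono box_weight) auto
    also have "\<dots> \<le> integral {-b..b} (?G \<tau>)"
      unfolding boxmass_def b_def[symmetric]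
      using \<tau> by (intro conv_box fcont_slice[OF F] b) (auto simp: src_def)
    finally show "3 / 16 / r * ((t - \<tau>) * boxmass p r U \<tau>) \<le> integral {-b..b} (?G \<tau>)" by (simp only: mult.assoc)
  qed
  also have "\<dots> = integral {-b..b} (duh (src p U) t)"
    using integral_swap_continuous[of 0 "-b" t b ?G] gc
    by (simp add: duh_def timeconv_def[abs_def] split_beta cbox_Pair_eq)
  also have "\<dots> = integral {-b..b} (U t) - integral {-b..b} (ulin g t)"
  proof -
    have "integral {-b..b} (U t) = integral {-b..b} (\<lambda>x. ulin g t x + duh (src p U) t x)"
      using U t unfolding csol_def by (intro Henstock_Kurzweil_Integration.integral_cong) auto
    also have "\<dots> = integral {-b..b} (ulin g t) + integral {-b..b} (duh (src p U) t)"
      by (intro Henstock_Kurzweil_Integration.integral_add integrable_continuous_real continuous_on_subset[OF cu] continuous_on_subset[OF cd]) auto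
    finally show ?thesis by simp
  qed
  also have "\<dots> \<le> \<bar>integral {-b..b} (U t)\<bar> + N / (1 + t)"
  proof -
    have "0 \<le> N / (1 + t)" using N_nonneg t0 by simp
    from integral_le_mass[OF cu ulin_mass[OF t0(1)] this, of "-b" b] show ?thesis by linarith
  qed
  finally show ?thesis unfolding b_def .
qed

lemma csol_test_function:
  assumes U: "csol p g r U" and r: "1 \<le> r" and t: "t \<in> {0..r}"
  shows "3 / 16 / r * integral {0..t} (\<lambda>\<tau>. (t - \<tau>) * boxmass p r U \<tau>)
        \<le> (8 * sqrt r) powr ((p - 1) / p) * boxmass p r U t powr (1 / p) + N / (1 + t)"
proof -
  let ?y = "\<bar>integral {- (4 * sqrt r)..4 * sqrt r} (U t)\<bar>"
  have "?y = (?y powr p) powr (1 / p)" using p by (simp add: powr_powr)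
  also have "\<dots> \<le> ((8 * sqrt r) powr (p - 1) * boxmass p r U t) powr (1 / p)"
    using p by (intro powr_mono2 box_upper[OF p csol_fcont(1)[OF U] t r]) auto
  also have "\<dots> = (8 * sqrt r) powr ((p - 1) / p) * boxmass p r U t powr (1 / p)"
    using boxmass_nonneg[OF csol_fcont(2)[OF U] t, of r] by (simp add: powr_mult powr_powr)
  finally show ?thesis using box_lower[OF U r t] t by simp
qed

text \<open>Let r = 2 \<rho>. For t in the last quarter of [0, r] the source deposited before \<rho>
  has acted for a time at least r / 4, so the integral of U(t) over the box is at least 3/64 P minus
  the linear error, hence at least 3/128 P. Jensen's inequality with exponent 3 bounds the source at
  time t below by a multiple of P^3 / r. Integration over a time of length r / 4 cancels r, which is
  the scale invariance of the critical case.\<close>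

lemma critical_growth:
  assumes p3: "p = 3" and U: "csol p g (2 * \<rho>) U" and \<rho>: "1 \<le> \<rho>"
    and small: "N / \<rho> \<le> 3 / 128 * integral {0..\<rho>} (boxmass p \<rho> U)"
  defines "P \<equiv> integral {0..\<rho>} (boxmass p \<rho> U)"
  shows "P + (3 / 128) ^ 3 / 256 * P ^ 3 \<le> integral {0..2 * \<rho>} (boxmass p (2 * \<rho>) U)"
proof -
  define r where "r = 2 * \<rho>"
  have r: "1 \<le> r" "0 < r" using \<rho> by (auto simp: r_def)
  note F = csol_fcont(2)[OF U, folded r_def] and U' = U[folded r_def]
  let ?\<phi> = "boxmass p r U"
  have c\<phi>: "continuous_on {a..b} ?\<phi>" if "0 \<le> a" "b \<le> r" for a b
    using that by (intro continuous_on_subset[OF boxmass_continuous[OF F]]) auto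
  have i\<phi>: "?\<phi> integrable_on {a..b}" if "0 \<le> a" "b \<le> r" for a b
    by (rule integrable_continuous_real[OF c\<phi>[OF that]])
  have nn: "0 \<le> ?\<phi> t" if "t \<in> {0..r}" for t by (rule boxmass_nonneg[OF F that])
  have P0: "0 \<le> P" unfolding P_def
    using \<rho> by (intro integral_nonneg integrable_continuous_real continuous_on_subset[OF boxmass_continuous[OF F]] boxmass_nonneg[OF F])
      (auto simp: r_def)
  have PP: "P \<le> integral {0..\<rho>} ?\<phi>"
    unfolding P_def using \<rho>
    by (intro Henstock_Kurzweil_Integration.integral_le integrable_continuous_real continuous_on_subset[OF boxmass_continuous[OF F]]
        boxmass_mono[OF F]) (auto simp: r_def)
  have ptw: "(3 / 128) ^ 3 / 64 * P ^ 3 / r \<le> ?\<phi> t" if t: "t \<in> {3 / 4 * r..r}" for t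
  proof -
    let ?y = "\<bar>integral {- (4 * sqrt r)..4 * sqrt r} (U t)\<bar>"
    have t': "t \<in> {0..r}" "t \<le> r" "\<rho> \<le> t" using t \<rho> by (auto simp: r_def)
    have cc: "continuous_on {a..t} (\<lambda>\<tau>. (t - \<tau>) * ?\<phi> \<tau>)" if "0 \<le> a" for a
      using t' that by (intro continuous_intros c\<phi>) auto
    have "r / 4 * P \<le> r / 4 * integral {0..\<rho>} ?\<phi>" using PP r by simp
    also have "\<dots> = integral {0..\<rho>} (\<lambda>\<tau>. r / 4 * ?\<phi> \<tau>)" by (simp only: Henstock_Kurzweil_Integration.integral_mult_right)
    also have "\<dots> \<le> integral {0..\<rho>} (\<lambda>\<tau>. (t - \<tau>) * ?\<phi> \<tau>)"
      using t \<rho> t' by (intro Henstock_Kurzweil_Integration.integral_le integrable_continuous_real continuous_intros c\<phi> mult_right_mono nn)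
        (auto simp: r_def)
    also have "\<dots> \<le> integral {0..t} (\<lambda>\<tau>. (t - \<tau>) * ?\<phi> \<tau>)"
      using t' \<rho> nn by (intro integral_subset_le integrable_continuous_real cc continuous_intros c\<phi>) (auto simp: r_def)
    finally have "3 / 16 / r * (r / 4 * P) \<le> 3 / 16 / r * integral {0..t} (\<lambda>\<tau>. (t - \<tau>) * ?\<phi> \<tau>)"
      using r by (intro mult_left_mono) auto
    also have "\<dots> \<le> ?y + N / (1 + t)" by (rule box_lower[OF U' r(1) t'(1,2)])
    also have "N / (1 + t) \<le> N / \<rho>" using t' \<rho> N_nonneg by (intro divide_left_mono) auto
    also have "\<dots> \<le> 3 / 128 * P" using small by (simp add: P_def)
    also have "3 / 16 / r * (r / 4 * P) = 3 / 64 * P" using r by simp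
    finally have "3 / 128 * P \<le> ?y" by simp
    then have "(3 / 128 * P) ^ 3 \<le> ?y ^ 3" using P0 by (intro power_mono) auto
    also have "?y ^ 3 = ?y powr p" using p3 by (simp add: powr_numeral)
    also have "\<dots> \<le> (8 * sqrt r) powr (p - 1) * ?\<phi> t" by (rule box_upper[OF p csol_fcont(1)[OF U'] t'(1) r(1)])
    also have "(8 * sqrt r) powr (p - 1) = 64 * r" using p3 r by (simp add: power_mult_distrib powr_numeral)
    finally show ?thesis using r by (simp add: field_simps)
  qed
  have "(3 / 128) ^ 3 / 256 * P ^ 3 = integral {3 / 4 * r..r} (\<lambda>t. (3 / 128) ^ 3 / 64 * P ^ 3 / r)"
    using r by simp
  also have "\<dots> \<le> integral {3 / 4 * r..r} ?\<phi>"
    using r by (intro Henstock_Kurzweil_Integration.integral_le i\<phi> ptw integrable_const_ivl) auto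
  also have "\<dots> \<le> integral {\<rho>..r} ?\<phi>"
    using \<rho> nn by (intro integral_subset_le i\<phi>) (auto simp: r_def)
  finally have "P + (3 / 128) ^ 3 / 256 * P ^ 3 \<le> integral {0..\<rho>} ?\<phi> + integral {\<rho>..r} ?\<phi>"
    using PP by simp
  also have "\<dots> = integral {0..r} ?\<phi>"
    using \<rho> by (intro Henstock_Kurzweil_Integration.integral_combine i\<phi>) (auto simp: r_def)
  finally show ?thesis unfolding r_def .
qed

end

section \<open>Counting growth steps, scaling in \<epsilon> and smallness\<close>

text \<open>Discrete version of P' = c P^3, for which 1 / P^2 decreases at a constant rate. Each
  step lowers 1 / P^2 by at least c / (1 + c P^2), and the cap \<open>K\<close> bounds this from
  below.\<close>

lemma cubic_growth_steps:
  fixes P :: "nat \<Rightarrow> real"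
  assumes c: "0 < c" and P0: "0 < P 0" and step: "\<And>j. j < n \<Longrightarrow> P 0 \<le> P j \<Longrightarrow> P j + c * P j ^ 3 \<le> P (Suc j)"
    and K: "\<And>j. j \<le> n \<Longrightarrow> P j \<le> K"
  shows "real n * (c / (1 + c * K\<^sup>2)) \<le> 1 / (P 0)\<^sup>2"
proof -
  define d where "d = c / (1 + c * K\<^sup>2)"
  have "P 0 \<le> P j \<and> 1 / (P j)\<^sup>2 + real j * d \<le> 1 / (P 0)\<^sup>2" if "j \<le> n" for j
    using that
  proof (induction j)
    case (Suc j)
    then have IH: "P 0 \<le> P j" "1 / (P j)\<^sup>2 + real j * d \<le> 1 / (P 0)\<^sup>2" by auto
    have Pj: "0 < P j" using IH P0 by simp
    define x where "x = c * (P j)\<^sup>2"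
    have x: "0 < x" using c Pj by (simp add: x_def)
    have "P j * (1 + x) = P j + c * P j ^ 3" by (simp add: x_def power2_eq_square power3_eq_cube algebra_simps)
    also have "\<dots> \<le> P (Suc j)" using Suc.prems IH by (intro step) auto
    finally have le: "P j * (1 + x) \<le> P (Suc j)" .
    have "P j * 1 \<le> P j * (1 + x)" using Pj x by (intro mult_left_mono) auto
    then have mono: "P j \<le> P (Suc j)" using le by simp
    have pos: "0 < P j * (1 + x)" using Pj x by simp
    have "1 / (P (Suc j))\<^sup>2 \<le> 1 / (P j * (1 + x))\<^sup>2"
      using le pos Pj mono x by (intro divide_left_mono power_mono mult_pos_pos zero_less_power) auto
    also have "\<dots> = (1 / (1 + x)) * (1 / ((P j)\<^sup>2 * (1 + x)))" by (simp add: power2_eq_square)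
    also have "\<dots> \<le> 1 * (1 / ((P j)\<^sup>2 * (1 + x)))" using x by (intro mult_right_mono) auto
    also have "\<dots> = 1 / (P j)\<^sup>2 - c / (1 + x)"
    proof -
      have "1 / (Q * (1 + c * Q)) = 1 / Q - c / (1 + c * Q)" if "0 < Q" for Q
      proof -
        have "0 < 1 + c * Q" using c that by (simp add: add_pos_pos)
        then show ?thesis using that by (simp add: divide_simps)
      qed
      from this[of "(P j)\<^sup>2"] show ?thesis using Pj by (simp add: x_def)
    qed
    also have "d \<le> c / (1 + x)"
    proof -
      have "(P j)\<^sup>2 \<le> K\<^sup>2" using K[of j] Suc.prems Pj by (intro power_mono) auto
      then show ?thesis unfolding d_def x_def using c by (intro divide_left_mono) (auto intro!: mult_pos_pos add_pos_nonneg)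
    qed
    then have "1 / (P j)\<^sup>2 - c / (1 + x) \<le> 1 / (P j)\<^sup>2 - d" by simp
    finally show ?case using IH mono by (auto simp: algebra_simps)
  qed simp
  from this[of n] have "1 / (P n)\<^sup>2 + real n * d \<le> 1 / (P 0)\<^sup>2" by simp
  moreover have "0 \<le> 1 / (P n)\<^sup>2" by simp
  ultimately show ?thesis unfolding d_def by linarith
qed

lemma ulin_cmult: "ulin (\<lambda>x. c * g x) t x = c * ulin g t x"
proof -
  have "conv k1 t (\<lambda>x. c * g x) x = c * conv k1 t g x"
    unfolding conv_def mult.left_commute[of _ c] by (rule sym_integral_cmult(1))
  then show ?thesis by (simp add: ulin_def wave_def algebra_simps)
qed

lemma datum_cmult:
  assumes D: "datum p g h" shows "datum p (\<lambda>x. c * g x) (\<lambda>x. c * h x)"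
proof -
  interpret datum p g h by (rule D)
  show ?thesis
  proof
    show "(\<lambda>x. c * g x) = prim (\<lambda>x. c * h x)"
      by (simp add: g prim_def[abs_def] set_integral_mult_right)
  qed (intro p hL g1 Lq_cmult)+
qed

lemma N_cmult:
  assumes D: "datum p g h" and c: "0 \<le> c"
  shows "datum.N (\<lambda>x. c * g x) (\<lambda>x. c * h x) = c * datum.N g h"
proof -
  interpret datum p g h by (rule D)
  interpret C: datum p "\<lambda>x. c * g x" "\<lambda>x. c * h x" by (rule datum_cmult[OF D])
  show ?thesis unfolding C.N_def C.H_def N_def H_def using c by (simp add: abs_mult algebra_simps)
qed

lemma small_powr:
  fixes B s c :: real
  assumes s: "0 < s" and c: "0 < c"
  obtains e where "0 < e" "\<And>x. 0 < x \<Longrightarrow> x < e \<Longrightarrow> B * x powr s \<le> c"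
proof (rule that[of "(c / (\<bar>B\<bar> + 1)) powr (1 / s)"])
  show "0 < (c / (\<bar>B\<bar> + 1)) powr (1 / s)" using c by (simp add: divide_eq_0_iff)
  fix x assume x: "0 < x" "x < (c / (\<bar>B\<bar> + 1)) powr (1 / s)"
  have "x powr s \<le> ((c / (\<bar>B\<bar> + 1)) powr (1 / s)) powr s" using x s by (intro powr_mono2) auto
  also have "\<dots> = c / (\<bar>B\<bar> + 1)" using s c by (simp add: powr_powr)
  finally have "(\<bar>B\<bar> + 1) * x powr s \<le> c" by (simp add: pos_le_divide_eq mult.commute)
  moreover have "B * x powr s \<le> (\<bar>B\<bar> + 1) * x powr s" by (intro mult_right_mono) auto
  ultimately show "B * x powr s \<le> c" by linarith
qed

text \<open>For p = 3 the exponential exceeds its exponent, so in both cases \<open>T1\<close> is at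
  least a negative power of its argument.\<close>

lemma T1_large:
  assumes p: "1 < p" "p \<le> 3" and C: "0 < C"
  obtains e where "0 < e" "\<And>\<epsilon>. 0 < \<epsilon> \<Longrightarrow> \<epsilon> < e \<Longrightarrow> R \<le> T1 p (C * \<epsilon> powr p)"
proof -
  define \<gamma> where "\<gamma> = (if p < 3 then 2 * (p - 1) / (3 - p) else 2)"
  have \<gamma>: "0 < \<gamma>" using p by (simp add: \<gamma>_def)
  have T: "\<delta> powr (- \<gamma>) \<le> T1 p \<delta>" for \<delta>
    unfolding T1_def \<gamma>_def using exp_ge_add_one_self[of "\<delta> powr - 2"] by (auto intro: order_trans[of _ "1 + \<delta> powr - 2"])
  obtain e where e: "0 < e" "\<And>x. 0 < x \<Longrightarrow> x < e \<Longrightarrow> C powr \<gamma> * x powr (p * \<gamma>) \<le> 1 / (\<bar>R\<bar> + 1)"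
    using small_powr[of "p * \<gamma>" "1 / (\<bar>R\<bar> + 1)" "C powr \<gamma>"] p \<gamma> by (auto simp: add_nonneg_pos)
  show ?thesis
  proof (rule that[OF e(1)])
    fix \<epsilon> assume \<epsilon>: "0 < \<epsilon>" "\<epsilon> < e"
    let ?z = "(C * \<epsilon> powr p) powr \<gamma>"
    have "?z = C powr \<gamma> * \<epsilon> powr (p * \<gamma>)" using C \<epsilon> by (simp add: powr_mult powr_powr)
    then have "?z \<le> 1 / (\<bar>R\<bar> + 1)" using e(2)[OF \<epsilon>] by simp
    moreover have "0 < ?z" using C \<epsilon> by simp
    ultimately have "\<bar>R\<bar> + 1 \<le> 1 / ?z" by (simp add: pos_le_divide_eq mult.commute)
    also have "\<dots> = (C * \<epsilon> powr p) powr (- \<gamma>)" by (simp add: powr_minus_divide)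
    also have "\<dots> \<le> T1 p (C * \<epsilon> powr p)" by (rule T)
    finally show "R \<le> T1 p (C * \<epsilon> powr p)" by linarith
  qed
qed

context datum
begin

text \<open>\<open>a\<close> is twice the contribution of the linear source, which leaves a / 2 for
  the nonlinear one; 12 is twice the factor 6 of \<open>src_integrals\<close>.\<close>

lemma bootstrap:
  assumes a: "a = 2 * 2 powr p * Kp p * N powr p" and le: "12 * 2 powr p * a powr (p - 1) * Lam p S \<le> 1"
  shows "0 \<le> a" "2 powr p * (Kp p * N powr p + 6 * a powr p * Lam p S) \<le> a"
proof -
  have "0 \<le> Kp p" using p by (simp add: Kp_def)
  then show a0: "0 \<le> a" using a by simp
  have e: "a powr p = a powr (p - 1) * a" using a0 powr_add[of a "p - 1" 1] by simp
  have "2 powr p * (Kp p * N powr p + 6 * a powr p * Lam p S) = a / 2 + (12 * 2 powr p * a powr (p - 1) * Lam p S) * (a / 2)"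
    unfolding e by (simp add: a algebra_simps)
  also have "\<dots> \<le> a / 2 + 1 * (a / 2)" using a0 le by (intro add_left_mono mult_right_mono) auto
  finally show "2 powr p * (Kp p * N powr p + 6 * a powr p * Lam p S) \<le> a" by simp
qed

lemma ulin_0: "ulin g 0 x = g x"
  by (simp add: ulin_def wave_def conv_def sym_integral_def)

end

section \<open>The source during the first unit of time\<close>

lemma existence_cmult:
  assumes D: "datum p g h" and p3: "p \<le> 3" and \<epsilon>: "0 < \<epsilon>" and S: "0 \<le> S"
  defines "A \<equiv> 2 * 2 powr p * Kp p * datum.N g h powr p"
  assumes le: "12 * 2 powr p * (A * \<epsilon> powr p) powr (p - 1) * Lam p S \<le> 1"
  obtains U where "csol p (\<lambda>x. \<epsilon> * g x) S U"
    "\<And>t x. 0 \<le> t \<Longrightarrow> t \<le> S \<Longrightarrow> \<bar>U t x - \<epsilon> * ulin g t x\<bar> \<le> A * \<epsilon> powr p"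
proof -
  interpret datum p g h by (rule D)
  interpret E: datum p "\<lambda>x. \<epsilon> * g x" "\<lambda>x. \<epsilon> * h x" by (rule datum_cmult[OF D])
  have "A * \<epsilon> powr p = 2 * 2 powr p * Kp p * E.N powr p"
    using \<epsilon> N_nonneg by (simp add: A_def N_cmult[OF D] powr_mult)
  note b = E.bootstrap[OF this le]
  show ?thesis
    using E.existence[OF p3 b S] that unfolding ulin_cmult by blast
qed

text \<open>The arbitrary solution U is compared with the one constructed on [0, 1], for which
  closeness to the linear part is known. The linear part is near g(x0) \<noteq> 0 around the point
  (0, x0).\<close>

lemma source_start:
  assumes D: "datum p g h" and p3: "p \<le> 3" and x0: "g x0 \<noteq> 0"
  obtains e \<kappa> R where "0 < e" "0 < \<kappa>" "1 \<le> R"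
    "\<And>\<epsilon> r U. 0 < \<epsilon> \<Longrightarrow> \<epsilon> < e \<Longrightarrow> R \<le> r \<Longrightarrow> csol p (\<lambda>x. \<epsilon> * g x) r U \<Longrightarrow>
      \<kappa> * \<epsilon> powr p \<le> integral {0..1} (boxmass p r U)"
proof -
  interpret datum p g h by (rule D)
  \<comment> \<open>Continuity costs at most half of |g(x0)|, which leaves 2 \<eta>; the nonlinear
    correction may take another \<eta>.\<close>
  define \<eta> where "\<eta> = \<bar>g x0\<bar> / 4"
  have \<eta>: "0 < \<eta>" using x0 by (simp add: \<eta>_def)
  obtain d where d: "0 < d" "\<And>c. c \<in> {0..1} \<times> UNIV \<Longrightarrow> dist c (0, x0) < d \<Longrightarrow>
      dist ((\<lambda>(t, x). ulin g t x) c) (ulin g 0 x0) < 2 * \<eta>"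
  proof -
    have "(0, x0) \<in> {0..1 :: real} \<times> (UNIV :: real set)" by simp
    then show ?thesis
      using fcont_ulin[of 1] \<eta> that unfolding continuous_on_iff by (metis (no_types, lifting) case_prod_conv mult_pos_pos zero_less_numeral)
  qed
  \<comment> \<open>Time and space deviations of at most \<rho> each stay within distance 2 d / 3 <
    d.\<close>
  define \<rho> where "\<rho> = min 1 (d / 3)"
  have \<rho>: "0 < \<rho>" "\<rho> \<le> 1" using d by (auto simp: \<rho>_def)
  have low: "2 * \<eta> \<le> \<bar>ulin g t x\<bar>" if t: "0 \<le> t" "t \<le> \<rho>" and x: "\<bar>x - x0\<bar> \<le> \<rho>" for t x
  proof -
    have "dist (t, x) (0, x0) \<le> \<bar>t\<bar> + \<bar>x - x0\<bar>"
      unfolding dist_Pair_Pair dist_real_def using sqrt_sum_squares_le_sum_abs[of "\<bar>t - 0\<bar>" "\<bar>x - x0\<bar>"] by simp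
    also have "\<dots> < d" using t x d \<rho> by (simp add: \<rho>_def min_def split: if_splits)
    finally have "\<bar>ulin g t x - g x0\<bar> < 2 * \<eta>"
      using d(2)[of "(t, x)"] t \<rho> by (simp add: ulin_0 dist_real_def)
    then show ?thesis unfolding \<eta>_def by linarith
  qed
  define A where "A = 2 * 2 powr p * Kp p * N powr p"
  have A0: "0 \<le> A" using p by (simp add: A_def Kp_def)
  obtain e1 where e1: "0 < e1" "\<And>x. 0 < x \<Longrightarrow> x < e1 \<Longrightarrow> A * x powr (p - 1) \<le> \<eta>"
    using small_powr[of "p - 1" \<eta> A] p \<eta> by auto
  obtain e2 where e2: "0 < e2" "\<And>x. 0 < x \<Longrightarrow> x < e2 \<Longrightarrow> (12 * 2 powr p * A powr (p - 1) * Lam p 1) * x powr (p * (p - 1)) \<le> 1"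
    using small_powr[of "p * (p - 1)" 1 "12 * 2 powr p * A powr (p - 1) * Lam p 1"] p by auto
  \<comment> \<open>For r \<ge> R the box of half-width 4 sqrt r contains the interval of radius
    \<rho> \<le> 1 around x0.\<close>
  define R where "R = (\<bar>x0\<bar> + 1)\<^sup>2"
  have R1: "1 \<le> R" unfolding R_def by (rule one_le_power) simp
  show ?thesis
  proof (rule that[of "min e1 e2" "2 * \<rho>\<^sup>2 * \<eta> powr p" R])
    show "0 < min e1 e2" "0 < 2 * \<rho>\<^sup>2 * \<eta> powr p" using e1 e2 \<rho> \<eta> by auto
    show "1 \<le> R" by (rule R1)
    fix \<epsilon> r U assume \<epsilon>: "0 < \<epsilon>" "\<epsilon> < min e1 e2" and r: "R \<le> r" and U: "csol p (\<lambda>x. \<epsilon> * g x) r U"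
    interpret E: datum p "\<lambda>x. \<epsilon> * g x" "\<lambda>x. \<epsilon> * h x" by (rule datum_cmult[OF D])
    have r1: "1 \<le> r" using r R1 by simp
    have "(A * \<epsilon> powr p) powr (p - 1) = A powr (p - 1) * \<epsilon> powr (p * (p - 1))"
      using A0 by (simp add: powr_mult powr_powr)
    then have "12 * 2 powr p * (A * \<epsilon> powr p) powr (p - 1) * Lam p 1 \<le> 1"
      using e2(2)[of \<epsilon>] \<epsilon> by (simp add: ac_simps)
    then obtain V where V: "csol p (\<lambda>x. \<epsilon> * g x) 1 V"
        "\<And>t x. 0 \<le> t \<Longrightarrow> t \<le> 1 \<Longrightarrow> \<bar>V t x - \<epsilon> * ulin g t x\<bar> \<le> A * \<epsilon> powr p"
      using existence_cmult[OF D p3 \<epsilon>(1), of 1] unfolding A_def by auto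
    have ptw: "(\<epsilon> * \<eta>) powr p \<le> src p U t x" if t: "0 \<le> t" "t \<le> \<rho>" and x: "\<bar>x - x0\<bar> \<le> \<rho>" for t x
    proof -
      have "U t x = V t x" using t \<rho> by (intro csol_unique[OF p csol_mono[OF U r1] V(1)]) auto
      then have "\<bar>U t x - \<epsilon> * ulin g t x\<bar> \<le> A * \<epsilon> powr p" using V(2)[of t x] t \<rho> by simp
      moreover have "A * \<epsilon> powr p \<le> \<epsilon> * \<eta>"
      proof -
        have "A * \<epsilon> powr p = \<epsilon> * (A * \<epsilon> powr (p - 1))" using \<epsilon> powr_add[of \<epsilon> "p - 1" 1] by simp
        also have "\<dots> \<le> \<epsilon> * \<eta>" using e1(2)[of \<epsilon>] \<epsilon> by (intro mult_left_mono) auto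
        finally show ?thesis .
      qed
      moreover have "\<epsilon> * (2 * \<eta>) \<le> \<bar>\<epsilon> * ulin g t x\<bar>"
        using low[OF t x] \<epsilon> by (simp add: abs_mult mult_left_mono)
      ultimately have "\<epsilon> * \<eta> \<le> \<bar>U t x\<bar>" by linarith
      then show ?thesis unfolding src_def using \<epsilon> \<eta> p by (intro powr_mono2) auto
    qed
    note F = E.csol_fcont(2)[OF U]
    have bm: "2 * \<rho> * (\<epsilon> * \<eta>) powr p \<le> boxmass p r U t" if t: "0 \<le> t" "t \<le> \<rho>" for t
    proof -
      have tr: "t \<in> {0..r}" using t \<rho> r1 by auto
      have c: "src p U t integrable_on {a..b}" for a b
        by (intro integrable_continuous_real continuous_on_subset[OF fcont_slice[OF F tr]]) simp
      have "sqrt R \<le> sqrt r" using r by simp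
      then have sr: "\<bar>x0\<bar> + 1 \<le> sqrt r" by (simp add: R_def)
      have "2 * \<rho> * (\<epsilon> * \<eta>) powr p = integral {x0 - \<rho>..x0 + \<rho>} (\<lambda>x. (\<epsilon> * \<eta>) powr p)" using \<rho> by simp
      also have "\<dots> \<le> integral {x0 - \<rho>..x0 + \<rho>} (src p U t)"
        using t by (intro Henstock_Kurzweil_Integration.integral_le c integrable_const_ivl ptw) auto
      also have "\<dots> \<le> boxmass p r U t"
        unfolding boxmass_def using sr \<rho> by (intro integral_subset_le c) (auto simp: src_def)
      finally show ?thesis .
    qed
    have cb: "boxmass p r U integrable_on {a..b}" if "0 \<le> a" "b \<le> r" for a b
      using that by (intro integrable_continuous_real continuous_on_subset[OF boxmass_continuous[OF F]]) auto
    have "2 * \<rho>\<^sup>2 * \<eta> powr p * \<epsilon> powr p = integral {0..\<rho>} (\<lambda>t. 2 * \<rho> * (\<epsilon> * \<eta>) powr p)"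
      using \<rho> \<epsilon> \<eta> by (simp add: powr_mult power2_eq_square)
    also have "\<dots> \<le> integral {0..\<rho>} (boxmass p r U)"
      using \<rho> r1 by (intro Henstock_Kurzweil_Integration.integral_le cb integrable_const_ivl bm) auto
    also have "\<dots> \<le> integral {0..1} (boxmass p r U)"
      using \<rho> r1 boxmass_nonneg[OF F] by (intro integral_subset_le cb) auto
    finally show "2 * \<rho>\<^sup>2 * \<eta> powr p * \<epsilon> powr p \<le> integral {0..1} (boxmass p r U)" .
  qed
qed

section \<open>Upper bounds for the lifespan\<close>

text \<open>Up to half of the time r the weight is at least 2^(-m).\<close>

lemma weighted_boxmass:
  assumes F: "fcont r (src p U)" and s: "0 \<le> s" "2 * s \<le> r" "0 < r"
  shows "integral {0..s} (boxmass p r U) / 2 ^ m \<le> integral {0..r} (\<lambda>t. (1 - t / r) ^ m * boxmass p r U t)"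
proof -
  have cb: "continuous_on {a..b} (boxmass p r U)" if "0 \<le> a" "b \<le> r" for a b
    using that by (intro continuous_on_subset[OF boxmass_continuous[OF F]]) auto
  have "integral {0..s} (boxmass p r U) / 2 ^ m = integral {0..s} (\<lambda>t. (1 / 2 ^ m) * boxmass p r U t)"
    by (simp only: Henstock_Kurzweil_Integration.integral_mult_right) simp
  also have "\<dots> \<le> integral {0..s} (\<lambda>t. (1 - t / r) ^ m * boxmass p r U t)"
  proof (intro Henstock_Kurzweil_Integration.integral_le integrable_continuous_real mult_right_mono)
    fix t assume t: "t \<in> {0..s}"
    have "(1 / 2) ^ m \<le> (1 - t / r) ^ m" using t s by (intro power_mono) (auto simp: field_simps)
    then show "1 / 2 ^ m \<le> (1 - t / r) ^ m" by (simp add: power_divide)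
    show "0 \<le> boxmass p r U t" using t s by (intro boxmass_nonneg[OF F]) auto
  qed (use s in \<open>auto intro!: continuous_intros cb\<close>)
  also have "\<dots> \<le> integral {0..r} (\<lambda>t. (1 - t / r) ^ m * boxmass p r U t)"
    using s by (intro integral_subset_le integrable_continuous_real continuous_on_mult cb continuous_intros)
      (auto intro!: mult_nonneg_nonneg boxmass_nonneg[OF F] zero_le_power simp: divide_le_eq)
  finally show ?thesis .
qed

text \<open>At r = T1(C \<epsilon>^p) the main term of the cap is exactly C \<epsilon>^p, and the
  logarithmic error is also of order \<epsilon>^p with a positive power of C in front. For small C
  the two together stay below the mass of order \<epsilon>^p that the start provides.\<close>

lemma subcritical_upper:
  assumes D: "datum p g h" and p3: "p < 3" and x0: "g x0 \<noteq> 0"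
  obtains e C where "0 < e" "0 < C"
    "\<And>\<epsilon> U. 0 < \<epsilon> \<Longrightarrow> \<epsilon> < e \<Longrightarrow> \<not> csol p (\<lambda>x. \<epsilon> * g x) (T1 p (C * \<epsilon> powr p)) U"
proof -
  interpret datum p g h by (rule D)
  obtain e0 \<kappa> R where st: "0 < e0" "0 < \<kappa>" "1 \<le> R"
    "\<And>\<epsilon> r U. 0 < \<epsilon> \<Longrightarrow> \<epsilon> < e0 \<Longrightarrow> R \<le> r \<Longrightarrow> csol p (\<lambda>x. \<epsilon> * g x) r U \<Longrightarrow>
      \<kappa> * \<epsilon> powr p \<le> integral {0..1} (boxmass p r U)"
    using source_start[OF D less_imp_le[OF p3] x0] by blast
  define k where "k = nat \<lceil>2 / (p - 1)\<rceil>"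
  have k: "2 / (p - 1) \<le> real k" unfolding k_def by linarith
  obtain A where A: "0 < A" "\<And>r N \<phi>. 1 \<le> r \<Longrightarrow> 0 \<le> N \<Longrightarrow> continuous_on {0..r} \<phi> \<Longrightarrow> (\<And>t. t \<in> {0..r} \<Longrightarrow> 0 \<le> \<phi> t) \<Longrightarrow>
    (\<And>t. t \<in> {0..r} \<Longrightarrow> 3 / 16 / r * integral {0..t} (\<lambda>\<tau>. (t - \<tau>) * \<phi> \<tau>)
        \<le> (8 * sqrt r) powr ((p - 1) / p) * \<phi> t powr (1 / p) + N / (1 + t)) \<Longrightarrow>
    integral {0..r} (\<lambda>t. (1 - t / r) ^ (k + 2) * \<phi> t) \<le> A * (r powr (- ((3 - p) / (2 * (p - 1)))) + N * ln (1 + r) / r)"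
    using test_function_cap[OF p k, of "3 / 16"] by auto
  \<comment> \<open>With this exponent r^(-\<theta>) = (C \<epsilon>^p)^((p-1)/p), of order
    \<epsilon>^(p-1). The factor \<epsilon> in the linear error then completes \<epsilon>^p, and ln
    (1 + r) / r is bounded by a multiple of r^(-\<theta>).\<close>
  define \<theta> where "\<theta> = (3 - p) / (2 * p)"
  have \<theta>: "0 < \<theta>" "\<theta> < 1" using p p3 by (auto simp: \<theta>_def divide_simps)
  define B where "B = 2 / (1 - \<theta>)"
  have B: "0 < B" using \<theta> by (simp add: B_def)
  define q where "q = \<kappa> / 2 ^ (k + 2)"
  have q: "0 < q" using st by (simp add: q_def)
  obtain c1 where c1: "0 < c1" "\<And>x. 0 < x \<Longrightarrow> x < c1 \<Longrightarrow> A * x powr 1 \<le> q / 3"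
    using small_powr[of 1 "q / 3" A] q by auto
  obtain c2 where c2: "0 < c2" "\<And>x. 0 < x \<Longrightarrow> x < c2 \<Longrightarrow> (A * N * B) * x powr ((p - 1) / p) \<le> q / 3"
    using small_powr[of "(p - 1) / p" "q / 3" "A * N * B"] q p by auto
  \<comment> \<open>Each of the two terms of the cap then takes at most a third of \<open>q\<close>,
    the weighted share of the deposited mass.\<close>
  define C where "C = min c1 c2 / 2"
  have C: "0 < C" "C < c1" "C < c2" using c1(1) c2(1) by (auto simp: C_def min_def)
  obtain e1 where e1: "0 < e1" "\<And>\<epsilon>. 0 < \<epsilon> \<Longrightarrow> \<epsilon> < e1 \<Longrightarrow> R + 2 \<le> T1 p (C * \<epsilon> powr p)"
    using T1_large[OF p less_imp_le[OF p3] C(1), of "R + 2"] by blast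
  show ?thesis
  proof (rule that[of "min e0 e1" C])
    show "0 < min e0 e1" "0 < C" using st e1 C by auto
    fix \<epsilon> U assume \<epsilon>: "0 < \<epsilon>" "\<epsilon> < min e0 e1"
    show "\<not> csol p (\<lambda>x. \<epsilon> * g x) (T1 p (C * \<epsilon> powr p)) U"
    proof
      define r where "r = T1 p (C * \<epsilon> powr p)"
      assume "csol p (\<lambda>x. \<epsilon> * g x) (T1 p (C * \<epsilon> powr p)) U"
      then have U: "csol p (\<lambda>x. \<epsilon> * g x) r U" by (simp add: r_def)
      have r: "R \<le> r" "2 \<le> r" "1 \<le> r" using e1(2)[of \<epsilon>] \<epsilon> st(3) by (auto simp: r_def)
      interpret E: datum p "\<lambda>x. \<epsilon> * g x" "\<lambda>x. \<epsilon> * h x" by (rule datum_cmult[OF D])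
      note F = E.csol_fcont(2)[OF U]
      have "\<kappa> * \<epsilon> powr p / 2 ^ (k + 2) \<le> integral {0..1} (boxmass p r U) / 2 ^ (k + 2)"
        using st(4)[OF \<epsilon>(1) _ r(1) U] \<epsilon> by (intro divide_right_mono) auto
      also have "\<dots> \<le> integral {0..r} (\<lambda>t. (1 - t / r) ^ (k + 2) * boxmass p r U t)"
        using r by (intro weighted_boxmass F) auto
      also have "\<dots> \<le> A * (r powr (- ((3 - p) / (2 * (p - 1)))) + E.N * ln (1 + r) / r)"
        by (rule A(2)[OF r(3) E.N_nonneg boxmass_continuous[OF F] boxmass_nonneg[OF F] E.csol_test_function[OF U r(3)]])
      also have "\<dots> \<le> A * (C * \<epsilon> powr p + \<epsilon> * N * (B * (C powr ((p - 1) / p) * \<epsilon> powr (p - 1))))"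
      proof (intro mult_left_mono add_mono)
        have r_eq: "r = (C * \<epsilon> powr p) powr (- (2 * (p - 1) / (3 - p)))" using p3 by (simp add: r_def T1_def)
        have pw: "r powr (- x) = (C * \<epsilon> powr p) powr (2 * (p - 1) / (3 - p) * x)" for x
          unfolding r_eq by (simp add: powr_powr)
        have "2 * (p - 1) / (3 - p) * ((3 - p) / (2 * (p - 1))) = 1" using p p3 by simp
        then show "r powr (- ((3 - p) / (2 * (p - 1)))) \<le> C * \<epsilon> powr p" unfolding pw using C by simp
        have "ln (1 + r) \<le> ln (2 * r)" using r by simp
        also have "\<dots> \<le> (2 * r) powr (1 - \<theta>) / (1 - \<theta>)" using r \<theta> by (intro ln_powr_bound) auto
        also have "\<dots> \<le> (2 * r powr (1 - \<theta>)) / (1 - \<theta>)"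
        proof (intro divide_right_mono)
          have "2 powr (1 - \<theta>) \<le> 2 powr (1::real)" using \<theta> by (intro powr_mono) auto
          then show "(2 * r) powr (1 - \<theta>) \<le> 2 * r powr (1 - \<theta>)"
            using r by (simp add: powr_mult mult_right_mono)
        qed (use \<theta> in simp)
        finally have l: "ln (1 + r) \<le> B * r powr (1 - \<theta>)" by (simp add: B_def)
        have "ln (1 + r) / r \<le> B * (r powr (1 - \<theta>) / r)"
          using divide_right_mono[OF l, of r] r by simp
        also have "r powr (1 - \<theta>) / r = r powr (- \<theta>)" using r powr_diff[of r 1 \<theta>] by (simp add: powr_minus_divide)
        also have "\<dots> = (C * \<epsilon> powr p) powr ((p - 1) / p)"
        proof -
          have "2 * (p - 1) / (3 - p) * \<theta> = (p - 1) / p" using p p3 by (simp add: \<theta>_def field_simps)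
          then show ?thesis unfolding pw by simp
        qed
        also have "\<dots> = C powr ((p - 1) / p) * \<epsilon> powr (p - 1)" using C \<epsilon> p by (simp add: powr_mult powr_powr)
        finally have "E.N * (ln (1 + r) / r) \<le> E.N * (B * (C powr ((p - 1) / p) * \<epsilon> powr (p - 1)))"
          by (rule mult_left_mono[OF _ E.N_nonneg])
        then show "E.N * ln (1 + r) / r \<le> \<epsilon> * N * (B * (C powr ((p - 1) / p) * \<epsilon> powr (p - 1)))"
          using N_cmult[OF D less_imp_le[OF \<epsilon>(1)]] by simp
      qed (use A in simp)
      also have "\<dots> = (A * C powr 1 + (A * N * B) * C powr ((p - 1) / p)) * \<epsilon> powr p"
      proof -
        have "\<epsilon> powr p = \<epsilon> * \<epsilon> powr (p - 1)" using \<epsilon> powr_add[of \<epsilon> 1 "p - 1"] by simp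
        then show ?thesis using C by (simp add: algebra_simps)
      qed
      also have "\<dots> \<le> (q / 3 + q / 3) * \<epsilon> powr p"
        by (intro mult_right_mono add_mono c1(2) c2(2) C) simp
      finally have "q * \<epsilon> powr p \<le> (q / 3 + q / 3) * \<epsilon> powr p" by (simp add: q_def)
      then show False using q \<epsilon> by simp
    qed
  qed
qed

text \<open>The weighted estimate only caps the integral of the source in the critical case; the lifespan
  is controlled by the number of dyadic steps that the cubic growth needs to reach the cap.\<close>

lemma critical_upper:
  assumes D: "datum p g h" and p3: "p = 3" and x0: "g x0 \<noteq> 0"
  obtains e C where "0 < e" "0 < C"
    "\<And>\<epsilon> U. 0 < \<epsilon> \<Longrightarrow> \<epsilon> < e \<Longrightarrow> \<not> csol p (\<lambda>x. \<epsilon> * g x) (T1 p (C * \<epsilon> powr p)) U"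
proof -
  interpret datum p g h by (rule D)
  obtain e0 \<kappa> R where st: "0 < e0" "0 < \<kappa>" "1 \<le> R"
    "\<And>\<epsilon> r U. 0 < \<epsilon> \<Longrightarrow> \<epsilon> < e0 \<Longrightarrow> R \<le> r \<Longrightarrow> csol p (\<lambda>x. \<epsilon> * g x) r U \<Longrightarrow>
      \<kappa> * \<epsilon> powr p \<le> integral {0..1} (boxmass p r U)"
    using source_start[OF D eq_refl[OF p3] x0] by blast
  have k: "2 / (p - 1) \<le> real 1" using p3 by simp
  obtain A where A: "0 < A" "\<And>r N \<phi>. 1 \<le> r \<Longrightarrow> 0 \<le> N \<Longrightarrow> continuous_on {0..r} \<phi> \<Longrightarrow> (\<And>t. t \<in> {0..r} \<Longrightarrow> 0 \<le> \<phi> t) \<Longrightarrow>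
    (\<And>t. t \<in> {0..r} \<Longrightarrow> 3 / 16 / r * integral {0..t} (\<lambda>\<tau>. (t - \<tau>) * \<phi> \<tau>)
        \<le> (8 * sqrt r) powr ((p - 1) / p) * \<phi> t powr (1 / p) + N / (1 + t)) \<Longrightarrow>
    integral {0..r} (\<lambda>t. (1 - t / r) ^ (1 + 2) * \<phi> t) \<le> A * (r powr (- ((3 - p) / (2 * (p - 1)))) + N * ln (1 + r) / r)"
    using test_function_cap[OF p k, of "3 / 16"] by auto
  define c where "c = (3 / 128 :: real) ^ 3 / 256"
  have c: "0 < c" by (simp add: c_def)
  \<comment> \<open>8 = 2^3 undoes the weight of exponent 1 + 2 at half time. At p = 3 the power of
    r in the cap is 1, and for \<epsilon> < 1 the logarithmic error is at most N.\<close>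
  define K where "K = 8 * (A * (1 + N))"
  define d where "d = c / (1 + c * K\<^sup>2)"
  have d: "0 < d" using c by (simp add: d_def add_pos_nonneg)
  \<comment> \<open>Chosen so that the linear error \<epsilon> N / \<rho>, at scales \<rho> \<ge> B
    / \<epsilon>^2, is at most 3/128 \<kappa> \<epsilon>^3, hence at most 3/128 of the initial mass,
    as \<open>critical_growth\<close> requires.\<close>
  define B where "B = R + 128 * N / (3 * \<kappa>)"
  have "0 \<le> 128 * N / (3 * \<kappa>)" using st N_nonneg by simp
  then have B: "1 \<le> B" "R \<le> B" using st(3) unfolding B_def by linarith+
  \<comment> \<open>More than E / \<epsilon>^6 steps contradict \<open>cubic_growth_steps\<close>,
    since the initial mass is at least \<kappa> \<epsilon>^3.\<close>
  define E where "E = 1 / (d * \<kappa>\<^sup>2)"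
  have E: "0 < E" using d st by (simp add: E_def)
  \<comment> \<open>Makes (C \<epsilon>^3)^(-2) equal to (E + 3 + B) / \<epsilon>^6, the logarithmic
    size that suffices for the last dyadic scale.\<close>
  define C where "C = 1 / sqrt (E + 3 + B)"
  have C: "0 < C" using E B by (simp add: C_def)
  show ?thesis
  proof (rule that[of "min e0 1" C])
    show "0 < min e0 1" "0 < C" using st C by auto
    fix \<epsilon> U assume \<epsilon>': "0 < \<epsilon>" "\<epsilon> < min e0 1"
    then have \<epsilon>: "0 < \<epsilon>" "\<epsilon> < e0" "\<epsilon> < 1" by auto
    interpret e: datum p "\<lambda>x. \<epsilon> * g x" "\<lambda>x. \<epsilon> * h x" by (rule datum_cmult[OF D])
    have eN: "e.N = \<epsilon> * N" using \<epsilon> by (simp add: N_cmult[OF D])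
    have ep: "\<epsilon> powr p = \<epsilon> ^ 3" using \<epsilon> p3 by (simp add: powr_numeral)
    \<comment> \<open>The dyadic scales start at order \<epsilon>^(-2): only then has the linear
      error of order \<epsilon> / t dropped to the size \<epsilon>^3 of the deposited mass.\<close>
    define \<rho> where "\<rho> j = 2 ^ j * (B / \<epsilon>\<^sup>2)" for j :: nat
    define P where "P j = integral {0..\<rho> j} (boxmass p (\<rho> j) U)" for j
    define n where "n = nat \<lceil>E / \<epsilon> ^ 6\<rceil> + 1"
    have e2: "1 \<le> 1 / \<epsilon>\<^sup>2" "1 / \<epsilon>\<^sup>2 \<le> 1 / \<epsilon> ^ 6" "1 \<le> 1 / \<epsilon> ^ 6"
      using \<epsilon> power_decreasing[of 2 6 \<epsilon>] by (auto intro!: divide_left_mono power_le_one simp: le_divide_eq)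
    have \<rho>B: "B / \<epsilon>\<^sup>2 \<le> \<rho> j" for j
      using mult_right_mono[of 1 "2 ^ j" "B / \<epsilon>\<^sup>2"] B \<epsilon> by (simp add: \<rho>_def)
    have B\<epsilon>: "B \<le> B / \<epsilon>\<^sup>2" using mult_left_mono[OF e2(1), of B] B by simp
    have \<rho>: "1 \<le> \<rho> j" "R \<le> \<rho> j" for j using \<rho>B[of j] B\<epsilon> B by auto
    have \<rho>S: "\<rho> (Suc j) = 2 * \<rho> j" for j by (simp add: \<rho>_def)
    have \<rho>m: "\<rho> i \<le> \<rho> j" if "i \<le> j" for i j
      unfolding \<rho>_def using that B \<epsilon> by (intro mult_right_mono power_increasing) auto
    have n1: "E / \<epsilon> ^ 6 < real n" "real n \<le> E / \<epsilon> ^ 6 + 2"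
      unfolding n_def using E \<epsilon> by (auto simp: le_of_int_ceiling intro: less_le_trans[of _ "of_int \<lceil>E / \<epsilon> ^ 6\<rceil> + 1"]) linarith+
    have big: "\<rho> (Suc n) \<le> T1 p (C * \<epsilon> powr p)"
    proof -
      have "(2::real) ^ Suc n \<le> exp 1 ^ Suc n" using exp_ge_add_one_self[of 1] by (intro power_mono) auto
      also have "\<dots> = exp (real (Suc n))" by (metis exp_of_nat_mult mult.right_neutral)
      finally have "\<rho> (Suc n) \<le> exp (real (Suc n)) * exp (B / \<epsilon>\<^sup>2)"
        unfolding \<rho>_def
      proof (intro mult_mono)
        show "B / \<epsilon>\<^sup>2 \<le> exp (B / \<epsilon>\<^sup>2)" using exp_ge_add_one_self[of "B / \<epsilon>\<^sup>2"] by linarith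
      qed (use B \<epsilon> in auto)
      also have "\<dots> = exp (real (Suc n) + B / \<epsilon>\<^sup>2)" by (simp add: exp_add)
      also have "\<dots> \<le> exp ((E + 3 + B) * (1 / \<epsilon> ^ 6))"
      proof -
        have "B / \<epsilon>\<^sup>2 \<le> B * (1 / \<epsilon> ^ 6)" using mult_left_mono[OF e2(2), of B] B by simp
        moreover have "real (Suc n) \<le> E * (1 / \<epsilon> ^ 6) + 3 * (1 / \<epsilon> ^ 6)" using n1(2) e2(3) by simp
        ultimately show ?thesis unfolding exp_le_cancel_iff distrib_right by linarith
      qed
      also have "(E + 3 + B) * (1 / \<epsilon> ^ 6) = (C * \<epsilon> powr p) powr (- 2)"
      proof -
        have "(C * \<epsilon> powr p) powr (- 2) = 1 / (C * \<epsilon> ^ 3)\<^sup>2"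
          unfolding ep using C \<epsilon> by (simp add: powr_minus_divide powr_numeral)
        also have "(C * \<epsilon> ^ 3)\<^sup>2 = C\<^sup>2 * \<epsilon> ^ 6" by (simp add: power_mult_distrib flip: power_mult)
        also have "C\<^sup>2 = 1 / (E + 3 + B)" using E B by (simp add: C_def power_divide)
        finally show ?thesis by simp
      qed
      also have "exp \<dots> = T1 p (C * \<epsilon> powr p)" using p3 by (simp add: T1_def)
      finally show ?thesis .
    qed
    show "\<not> csol p (\<lambda>x. \<epsilon> * g x) (T1 p (C * \<epsilon> powr p)) U"
    proof
      assume "csol p (\<lambda>x. \<epsilon> * g x) (T1 p (C * \<epsilon> powr p)) U"
      from csol_mono[OF this big] have Un: "csol p (\<lambda>x. \<epsilon> * g x) (\<rho> (Suc n)) U" .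
      have U: "csol p (\<lambda>x. \<epsilon> * g x) (\<rho> j) U" if "j \<le> Suc n" for j
        by (rule csol_mono[OF Un \<rho>m[OF that]])
      note F = e.csol_fcont(2)[OF U]
      have ci: "boxmass p r U integrable_on {a..b}" if "j \<le> Suc n" "0 \<le> a" "b \<le> \<rho> j" for a b r j
        using that(2,3) by (intro integrable_continuous_real continuous_on_subset[OF boxmass_continuous[OF F[OF that(1)]]]) auto
      have P0: "\<kappa> * \<epsilon> ^ 3 \<le> P 0"
      proof -
        have "\<kappa> * \<epsilon> ^ 3 \<le> integral {0..1} (boxmass p (\<rho> 0) U)"
          using st(4)[OF \<epsilon>(1,2) \<rho>(2) U[of 0]] by (simp add: ep)
        also have "\<dots> \<le> P 0"
          unfolding P_def using \<rho>(1)[of 0] boxmass_nonneg[OF F[of 0]] ci[of 0]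
          by (intro integral_subset_le) auto
        finally show ?thesis .
      qed
      have \<kappa>\<epsilon>: "0 < \<kappa> * \<epsilon> ^ 3" using st \<epsilon> by simp
      have step: "P j + c * P j ^ 3 \<le> P (Suc j)" if j: "j < n" "P 0 \<le> P j" for j
      proof -
        have "e.N / \<rho> j \<le> e.N / (B / \<epsilon>\<^sup>2)"
          using \<rho>B[of j] B \<epsilon> \<rho>(1)[of j] e.N_nonneg by (intro divide_left_mono mult_pos_pos) auto
        also have "\<dots> = \<epsilon> ^ 3 * (N / B)" using \<epsilon> B by (simp add: eN power2_eq_square power3_eq_cube)
        also have "\<dots> \<le> \<epsilon> ^ 3 * (3 / 128 * \<kappa>)"
        proof (rule mult_left_mono)
          have "N \<le> 3 / 128 * \<kappa> * B" using st by (simp add: B_def distrib_left)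
          then show "N / B \<le> 3 / 128 * \<kappa>" using B by (simp add: pos_divide_le_eq)
        qed (use \<epsilon> in simp)
        also have "\<dots> \<le> 3 / 128 * P j" using P0 j(2) by simp
        finally have "e.N / \<rho> j \<le> 3 / 128 * integral {0..\<rho> j} (boxmass p (\<rho> j) U)" by (simp add: P_def)
        from e.critical_growth[OF p3 _ \<rho>(1) this] U[of "Suc j"] j(1) show ?thesis
          unfolding P_def c_def \<rho>S by simp
      qed
      have cap: "P j \<le> K" if j: "j \<le> n" for j
      proof -
        \<comment> \<open>The weighted estimate controls the integral up to half of its time, so a
          cap at scale j uses the solution up to scale j + 1. This is why existence up to
          \<open>\<rho> (Suc n)\<close> is assumed.\<close>
        define r where "r = \<rho> (Suc j)"
        have r: "r = 2 * \<rho> j" "1 \<le> r" using \<rho>(1)[of j] by (auto simp: r_def \<rho>S)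
        have Ur: "csol p (\<lambda>x. \<epsilon> * g x) r U" unfolding r_def using j by (intro U) simp
        note Fr = e.csol_fcont(2)[OF Ur]
        have "P j \<le> integral {0..\<rho> j} (boxmass p r U)"
          unfolding P_def
        proof (intro Henstock_Kurzweil_Integration.integral_le)
          show "boxmass p (\<rho> j) U integrable_on {0..\<rho> j}" "boxmass p r U integrable_on {0..\<rho> j}"
            using ci[of j 0 "\<rho> j"] j by auto
          fix t assume "t \<in> {0..\<rho> j}"
          then show "boxmass p (\<rho> j) U t \<le> boxmass p r U t"
            using r \<rho>(1)[of j] by (intro boxmass_mono[OF Fr]) auto
        qed
        then have "P j / 2 ^ (1 + 2) \<le> integral {0..\<rho> j} (boxmass p r U) / 2 ^ (1 + 2)"
          by (rule divide_right_mono) simp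
        also have "\<dots> \<le> integral {0..r} (\<lambda>t. (1 - t / r) ^ (1 + 2) * boxmass p r U t)"
          using r \<rho>(1)[of j] by (intro weighted_boxmass Fr) auto
        also have "\<dots> \<le> A * (r powr (- ((3 - p) / (2 * (p - 1)))) + e.N * ln (1 + r) / r)"
          by (rule A(2)[OF r(2) e.N_nonneg boxmass_continuous[OF Fr] boxmass_nonneg[OF Fr] e.csol_test_function[OF Ur r(2)]])
        also have "\<dots> \<le> A * (1 + N)"
        proof (intro mult_left_mono add_mono)
          show "r powr (- ((3 - p) / (2 * (p - 1)))) \<le> 1" using p3 r by simp
          have "ln (1 + r) / r \<le> 1" using ln_add_one_self_le_self[of r] r by simp
          then have "e.N * (ln (1 + r) / r) \<le> N * 1"
            unfolding eN using \<epsilon> N_nonneg r by (intro mult_mono mult_left_le_one_le) auto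
          then show "e.N * ln (1 + r) / r \<le> N" by simp
        qed (use A in simp)
        finally show ?thesis by (simp add: K_def)
      qed
      have "real n * d \<le> 1 / (P 0)\<^sup>2"
        unfolding d_def by (intro cubic_growth_steps c less_le_trans[OF \<kappa>\<epsilon> P0] step cap)
      also have "\<dots> \<le> 1 / (\<kappa> * \<epsilon> ^ 3)\<^sup>2"
        using P0 less_le_trans[OF \<kappa>\<epsilon> P0] st(2) \<epsilon>(1) by (intro divide_left_mono power_mono mult_pos_pos zero_less_power) auto
      also have "\<dots> = E / \<epsilon> ^ 6 * d"
        using d st \<epsilon> by (simp add: E_def power_mult_distrib field_simps flip: power_mult)
      finally show False using mult_strict_right_mono[OF n1(1) d] by linarith
    qed
  qed
qed

section \<open>Lower bound for the lifespan\<close>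

text \<open>Up to constants \<open>T1\<close> inverts the growth of \<open>Lam\<close>: the
  condition of \<open>bootstrap\<close>, in which \<epsilon>^(p(p-1)) multiplies \<open>Lam\<close>,
  becomes a lower bound on \<delta> / \<epsilon>^p.\<close>

lemma Lam_le_T1:
  fixes p \<delta> S :: real
  assumes p: "1 < p" "p \<le> 3" and \<delta>: "0 < \<delta>" "\<delta> \<le> 1" and S: "0 \<le> S" "S \<le> T1 p \<delta>"
  shows "Lam p S \<le> (if p < 3 then 2 / (3 - p) * 2 powr ((3 - p) / 2) else 3) * \<delta> powr (- (p - 1))"
proof (cases "p < 3")
  case True
  define T where "T = T1 p \<delta>"
  have T: "T = \<delta> powr (- (2 * (p - 1) / (3 - p)))" using True by (simp add: T_def T1_def)
  have "\<delta> powr 0 \<le> T" unfolding T using \<delta> p True by (intro powr_mono') (auto simp: divide_nonneg_pos)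
  then have "1 \<le> T" using \<delta> by simp
  then have "(1 + S) powr ((3 - p) / 2) \<le> (2 * T) powr ((3 - p) / 2)"
    using S True by (intro powr_mono2) (auto simp: T_def)
  also have "\<dots> = 2 powr ((3 - p) / 2) * T powr ((3 - p) / 2)"
    using T by (simp add: powr_mult)
  also have "T powr ((3 - p) / 2) = \<delta> powr (- (p - 1))"
  proof -
    have "- (2 * (p - 1) / (3 - p)) * ((3 - p) / 2) = - (p - 1)" using True by (simp add: field_simps)
    then show ?thesis unfolding T powr_powr by simp
  qed
  finally show ?thesis unfolding Lam_def using True
    by (simp add: mult.assoc divide_right_mono)
next
  case False
  then have p3: "p = 3" using p by simp
  have z: "1 \<le> \<delta> powr (- 2)" using \<delta> powr_mono'[of "-2" 0 \<delta>] by simp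
  have "S \<le> exp (\<delta> powr (- 2))" using S p3 by (simp add: T1_def)
  then have "1 + S \<le> exp 1 * exp (\<delta> powr (- 2))"
  proof -
    have *: "1 + S \<le> a * b" if "2 \<le> a" "1 \<le> b" "S \<le> b" for a b :: real
      using mult_right_mono[of 2 a b] that by linarith
    show ?thesis using exp_ge_add_one_self[of 1] \<open>S \<le> exp (\<delta> powr (- 2))\<close> by (intro *) auto
  qed
  then have "ln (1 + S) \<le> ln (exp (1 + \<delta> powr (- 2)))"
    using S by (subst ln_le_cancel_iff) (auto simp: exp_add)
  then have "1 + ln (1 + S) \<le> 3 * \<delta> powr (- 2)" using z by simp
  then show ?thesis using p3 by (simp add: Lam_def)
qed

lemma lifespan_lower:
  assumes D: "datum p g h" and p3: "p \<le> 3"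
  obtains e c where "0 < e" "0 < c"
    "\<And>\<epsilon>. 0 < \<epsilon> \<Longrightarrow> \<epsilon> < e \<Longrightarrow> \<exists>U. csol p (\<lambda>x. \<epsilon> * g x) (T1 p (c * \<epsilon> powr p)) U"
proof -
  interpret datum p g h by (rule D)
  define A where "A = 2 * 2 powr p * Kp p * N powr p"
  have A0: "0 \<le> A" using p by (simp add: A_def Kp_def)
  define L where "L = (if p < 3 then 2 / (3 - p) * 2 powr ((3 - p) / 2) else 3)"
  have L: "0 < L" by (simp add: L_def)
  define B where "B = 12 * 2 powr p * A powr (p - 1) * L"
  have B: "0 \<le> B" using L by (simp add: B_def)
  \<comment> \<open>The smallness condition then reads B / (B + 1) \<le> 1. The summand 1 keeps c
    positive.\<close>
  define c where "c = (B + 1) powr (1 / (p - 1))"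
  have c: "0 < c" "c powr (p - 1) = B + 1" using B p by (auto simp: c_def powr_powr)
  obtain e where e: "0 < e" "\<And>x. 0 < x \<Longrightarrow> x < e \<Longrightarrow> c * x powr p \<le> 1"
    using small_powr[of p 1 c] p by auto
  show ?thesis
  proof (rule that[OF e(1) c(1)])
    fix \<epsilon> assume \<epsilon>: "0 < \<epsilon>" "\<epsilon> < e"
    define \<delta> where "\<delta> = c * \<epsilon> powr p"
    have \<delta>: "0 < \<delta>" "\<delta> \<le> 1" using e(2)[OF \<epsilon>] c \<epsilon> by (auto simp: \<delta>_def)
    have T: "0 \<le> T1 p \<delta>" by (simp add: T1_def)
    have "12 * 2 powr p * (A * \<epsilon> powr p) powr (p - 1) * Lam p (T1 p \<delta>) \<le>
        12 * 2 powr p * (A * \<epsilon> powr p) powr (p - 1) * (L * \<delta> powr (- (p - 1)))"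
      unfolding L_def by (intro mult_left_mono Lam_le_T1 p p3 \<delta> T) auto
    also have "\<dots> = B * (\<epsilon> powr p) powr (p - 1) * \<delta> powr (- (p - 1))"
      using A0 by (simp add: B_def powr_mult)
    also have "\<delta> powr (- (p - 1)) = 1 / ((B + 1) * (\<epsilon> powr p) powr (p - 1))"
      unfolding powr_minus_divide \<delta>_def using c by (simp add: powr_mult)
    also have "B * (\<epsilon> powr p) powr (p - 1) * (1 / ((B + 1) * (\<epsilon> powr p) powr (p - 1))) = B / (B + 1)"
      using \<epsilon> B by simp
    also have "\<dots> \<le> 1" using B by simp
    finally show "\<exists>U. csol p (\<lambda>x. \<epsilon> * g x) (T1 p (c * \<epsilon> powr p)) U"
      using existence_cmult[OF D p3 \<epsilon>(1) T] unfolding A_def \<delta>_def by blast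
  qed
qed

section \<open>The lifespan\<close>

lemma csol_cong:
  assumes V: "csol p g S V" and eq: "\<And>t x. 0 \<le> t \<Longrightarrow> t \<le> S \<Longrightarrow> U t x = V t x"
  shows "csol p g S U"
proof -
  have fc: "fcont S U \<longleftrightarrow> fcont S V"
    by (rule continuous_on_cong) (auto simp: eq)
  have "duh (src p U) t x = duh (src p V) t x" if "t \<in> {0..S}" for t x
    unfolding duh_def timeconv_def
  proof (rule Henstock_Kurzweil_Integration.integral_cong)
    fix \<tau> assume "\<tau> \<in> {0..t}"
    then have "src p U \<tau> = src p V \<tau>" using that by (auto simp: src_def eq)
    then show "conv k0 (t - \<tau>) (src p U \<tau>) x = conv k0 (t - \<tau>) (src p V \<tau>) x" by simp
  qed
  moreover have "(\<forall>t\<in>{0..S}. \<forall>x. \<bar>U t x\<bar> \<le> M) \<longleftrightarrow> (\<forall>t\<in>{0..S}. \<forall>x. \<bar>V t x\<bar> \<le> M)" for M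
    by (auto simp: eq)
  ultimately show ?thesis using V fc eq unfolding csol_def by (metis atLeastAtMost_iff)
qed

lemma Lq_cong_AE:
  assumes "f \<in> Lq q" "g \<in> borel_measurable borel" "AE x in lborel. f x = g x"
  shows "g \<in> Lq q"
proof -
  have "integrable lborel (\<lambda>x. \<bar>f x\<bar> powr q) \<longleftrightarrow> integrable lborel (\<lambda>x. \<bar>g x\<bar> powr q)"
    using assms by (intro integrable_cong_AE) (auto simp: Lq_iff)
  then show ?thesis using assms by (simp add: Lq_iff)
qed

text \<open>The weak derivatives supplied for the exponents 1 and p may be different functions. Both
  agree almost everywhere with \<open>weak_deriv f\<close>, which therefore lies in both
  spaces.\<close>

lemma W1_datum:
  assumes p: "1 < p" and f: "f \<in> W1 1 \<inter> W1 p"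
  obtains g h where "datum p g h" "AE x in lborel. f x = g x"
proof -
  define h where "h = weak_deriv f"
  note w = W1_weak_deriv[of f, folded h_def]
  have f1: "f \<in> W1 1" using f by simp
  have hm: "h \<in> borel_measurable borel" using w(2)[OF f1] by (auto dest: borel_measurable_integrable)
  have hL: "h \<in> Lq q" if fq: "f \<in> W1 q" for q
  proof -
    obtain h' where h': "h' \<in> Lq q" "has_weak_deriv f h'" using fq by (auto simp: W1_def)
    show ?thesis using weak_deriv_props(2)[OF h'(2)] by (intro Lq_cong_AE[OF h'(1) hm]) (auto simp: h_def)
  qed
  have "continuous_on UNIV (prim h)" by (rule density_of_continuous[OF prim_density[OF w(2)[OF f1]]])
  then have gm: "prim h \<in> borel_measurable borel" by (rule borel_measurable_continuous_onI)
  have "f \<in> Lq 1" using f1 by (simp add: W1_def)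
  then have "prim h \<in> Lq 1" by (rule Lq_cong_AE[OF _ gm w(4)[OF f1]])
  moreover have "h \<in> Lq 1" "h \<in> Lq p" using f by (auto intro: hL)
  ultimately have "datum p (prim h) h" using p by (intro datum.intro) auto
  with w(4)[OF f1] show ?thesis using that by blast
qed

lemma lifespan_upper:
  assumes D: "datum p g h" and p3: "p \<le> 3" and x0: "g x0 \<noteq> 0"
  obtains e C where "0 < e" "0 < C"
    "\<And>\<epsilon> U. 0 < \<epsilon> \<Longrightarrow> \<epsilon> < e \<Longrightarrow> \<not> csol p (\<lambda>x. \<epsilon> * g x) (T1 p (C * \<epsilon> powr p)) U"
proof (cases "p < 3")
  case True
  from subcritical_upper[OF D this x0] show ?thesis using that by blast
next
  case False
  then have "p = 3" using p3 by simp
  from critical_upper[OF D this x0] show ?thesis using that by blast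
qed

context datum
begin

text \<open>Regular mild solutions on [0, T) yield classical ones on each closed interval [0, S]
  with S < T, and uniqueness glues these together. In particular the supremum that defines the
  lifespan is attained by a solution on the whole half-open interval.\<close>

theorem lifespan_bounds:
  assumes u0: "u0 \<in> borel_measurable borel" "AE x in lborel. u0 x = g x" "\<And>x. u0 x + u1 x = 0"
    and low: "csol p g Sl V" "0 < Sl" and up: "\<And>U. \<not> csol p g Su U" "0 \<le> Su"
  shows "\<exists>u. regular_mild_solution p u0 u1 (lifespan p u0 u1) u \<and>
        (\<forall>T v. 0 < T \<and> T \<le> lifespan p u0 u1 \<and> regular_mild_solution p u0 u1 T v \<longrightarrow>
          (\<forall>t. 0 \<le> t \<and> ereal t < T \<longrightarrow> (AE x in lborel. v t x = u t x)))"
    "ereal Sl \<le> lifespan p u0 u1" "lifespan p u0 u1 \<le> ereal Su"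
proof -
  define T0 where "T0 = lifespan p u0 u1"
  define \<T> where "\<T> = {T. 0 < T \<and> (\<exists>u. regular_mild_solution p u0 u1 T u)}"
  have T0: "T0 = Sup \<T>" by (simp add: T0_def \<T>_def lifespan_def)
  have rep: "\<exists>U. csol p g S U" if "T \<in> \<T>" "0 \<le> S" "ereal S < T" for T S
    using that mild_representative[OF u0] unfolding \<T>_def by blast
  have "regular_mild_solution p u0 u1 (ereal Sl) V"
    by (rule csol_mild[OF u0 csol_mono[OF low(1)]]) auto
  then have "ereal Sl \<in> \<T>" using low(2) by (auto simp: \<T>_def)
  then show "ereal Sl \<le> lifespan p u0 u1" unfolding T0_def[symmetric] T0 by (rule Sup_upper)
  show "lifespan p u0 u1 \<le> ereal Su"
    unfolding T0_def[symmetric] T0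
  proof (rule Sup_least)
    fix T assume "T \<in> \<T>"
    then show "T \<le> ereal Su" using rep[of T Su] up by (meson not_le)
  qed
  have ex: "\<exists>U. csol p g S U" if S: "0 \<le> S" "ereal S < T0" for S
    using S rep unfolding T0 less_Sup_iff by blast
  define sol where "sol S = (SOME U. csol p g S U)" for S
  have sol: "csol p g S (sol S)" if "0 \<le> S" "ereal S < T0" for S
    unfolding sol_def by (rule someI_ex[OF ex[OF that]])
  \<comment> \<open>A diagonal choice: at time t use the solution chosen for [0, t]. By uniqueness
    it agrees with every longer one.\<close>
  define U where "U t x = sol t t x" for t x
  have U: "csol p g S U" if S: "0 \<le> S" "ereal S < T0" for S
  proof (rule csol_cong[OF sol[OF S]])
    fix t x assume t: "0 \<le> t" "t \<le> S"
    then have "ereal t < T0" using S by (meson ereal_less_eq(3) order_le_less_trans)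
    then show "U t x = sol S t x"
      unfolding U_def using t by (intro csol_unique[OF p sol csol_mono[OF sol[OF S] t(2)]]) auto
  qed
  have "regular_mild_solution p u0 u1 T0 U" by (rule csol_mild[OF u0 U])
  moreover have "AE x in lborel. v t x = U t x"
    if T: "0 < T" "T \<le> T0" "regular_mild_solution p u0 u1 T v" and t: "0 \<le> t" "ereal t < T" for T v t
  proof -
    obtain V where V: "\<And>S. 0 \<le> S \<Longrightarrow> ereal S < T \<Longrightarrow> csol p g S V"
      "\<And>t. 0 \<le> t \<Longrightarrow> ereal t < T \<Longrightarrow> AE x in lborel. v t x = V t x"
      using mild_representative[OF u0 T(3)] by blast
    have "V t x = U t x" for x
      using t T by (intro csol_unique[OF p V(1)[OF t] U]) (auto intro: less_le_trans)
    then show ?thesis using V(2)[OF t] by simp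
  qed
  ultimately show "\<exists>u. regular_mild_solution p u0 u1 (lifespan p u0 u1) u \<and>
        (\<forall>T v. 0 < T \<and> T \<le> lifespan p u0 u1 \<and> regular_mild_solution p u0 u1 T v \<longrightarrow>
          (\<forall>t. 0 \<le> t \<and> ereal t < T \<longrightarrow> (AE x in lborel. v t x = u t x)))"
    unfolding T0_def by blast
qed

end

theorem theorem1p1:
  fixes p :: real and f :: "real \<Rightarrow> real"
  assumes "1 < p" and "p \<le> 3"
    and "f \<in> W1 1 \<inter> W1 p"
    and "\<not> (AE x in lborel. f x = 0)"
  shows "\<exists>\<epsilon>\<^sub>f>0. \<exists>c\<^sub>f>0. \<exists>C\<^sub>f>0. \<forall>\<epsilon> u0 u1 T0.
    0 < \<epsilon> \<and> \<epsilon> < \<epsilon>\<^sub>f \<and> u0 = (\<lambda>x. \<epsilon> * f x) \<and> u1 = (\<lambda>x. - \<epsilon> * f x) \<and> T0 = lifespan p u0 u1 \<longrightarrow>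
      (\<exists>u. regular_mild_solution p u0 u1 T0 u \<and>
        (\<forall>T v. 0 < T \<and> T \<le> T0 \<and> regular_mild_solution p u0 u1 T v \<longrightarrow>
          (\<forall>t. 0 \<le> t \<and> ereal t < T \<longrightarrow> (AE x in lborel. v t x = u t x)))) \<and>
      ereal (T1 p (c\<^sub>f * \<epsilon> powr p)) \<le> T0 \<and> T0 \<le> ereal (T1 p (C\<^sub>f * \<epsilon> powr p))"
proof -
  obtain g h where D: "datum p g h" and fg: "AE x in lborel. f x = g x" by (rule W1_datum[OF assms(1,3)])
  have "\<exists>x0. g x0 \<noteq> 0"
  proof (rule ccontr)
    assume "\<nexists>x0. g x0 \<noteq> 0"
    then have "AE x in lborel. f x = 0" using fg by simp
    then show False using assms(4) by contradiction
  qed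
  then obtain x0 where x0: "g x0 \<noteq> 0" ..
  obtain e1 c where l: "0 < e1" "0 < c"
    "\<And>\<epsilon>. 0 < \<epsilon> \<Longrightarrow> \<epsilon> < e1 \<Longrightarrow> \<exists>U. csol p (\<lambda>x. \<epsilon> * g x) (T1 p (c * \<epsilon> powr p)) U"
    using lifespan_lower[OF D assms(2)] by blast
  obtain e2 C where u: "0 < e2" "0 < C"
    "\<And>\<epsilon> U. 0 < \<epsilon> \<Longrightarrow> \<epsilon> < e2 \<Longrightarrow> \<not> csol p (\<lambda>x. \<epsilon> * g x) (T1 p (C * \<epsilon> powr p)) U"
    using lifespan_upper[OF D assms(2) x0] by blast
  have fm: "f \<in> borel_measurable borel" using assms(3) by (auto simp: W1_def Lq_iff)
  have main: "(\<exists>u. regular_mild_solution p u0 u1 (lifespan p u0 u1) u \<and>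
        (\<forall>T v. 0 < T \<and> T \<le> lifespan p u0 u1 \<and> regular_mild_solution p u0 u1 T v \<longrightarrow>
          (\<forall>t. 0 \<le> t \<and> ereal t < T \<longrightarrow> (AE x in lborel. v t x = u t x)))) \<and>
      ereal (T1 p (c * \<epsilon> powr p)) \<le> lifespan p u0 u1 \<and> lifespan p u0 u1 \<le> ereal (T1 p (C * \<epsilon> powr p))"
    if \<epsilon>: "0 < \<epsilon>" "\<epsilon> < min e1 e2" and u01: "u0 = (\<lambda>x. \<epsilon> * f x)" "u1 = (\<lambda>x. - \<epsilon> * f x)" for \<epsilon> u0 u1
  proof -
    interpret E: datum p "\<lambda>x. \<epsilon> * g x" "\<lambda>x. \<epsilon> * h x" by (rule datum_cmult[OF D])
    obtain V where V: "csol p (\<lambda>x. \<epsilon> * g x) (T1 p (c * \<epsilon> powr p)) V" using l(3)[OF \<epsilon>(1)] \<epsilon> by auto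
    have T: "0 < T1 p (a * \<epsilon> powr p)" if "0 < a" for a using that \<epsilon> by (simp add: T1_def)
    have "u0 \<in> borel_measurable borel" "AE x in lborel. u0 x = \<epsilon> * g x" "\<And>x. u0 x + u1 x = 0"
      using fm fg by (auto simp: u01)
    note lb = E.lifespan_bounds[OF this V T[OF l(2)], of "T1 p (C * \<epsilon> powr p)"]
    have "\<not> csol p (\<lambda>x. \<epsilon> * g x) (T1 p (C * \<epsilon> powr p)) U" for U using u(3)[OF \<epsilon>(1)] \<epsilon> by simp
    from lb[OF this less_imp_le[OF T[OF u(2)]]] show ?thesis by blast
  qed
  have "0 < min e1 e2" using l u by simp
  with main l(2) u(2) show ?thesis by blast
qed

end
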